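(* Let $b\ge1$ and let $p_1,p_2\in\mathbb{S}^2$ be the points with $\phi(p_1)=ib$, $\phi(p_2)=-ib$. Let $a>0$ be arbitrary, let $\sigma=a\delta_{p_1}+a\delta_{p_2}$, and let $D=\operatorname{supp}(\mu_\sigma)$ be the droplet. There is a positive measure $\sigma^*$ supported on $\phi^{-1}(\mathbb{R}\cup\{\infty\})$ with total mass $\frac{1}{2a}$ such that for some constant $m$, $$U^{\lambda_D}(x)=U^{\frac{2a}{1+2a}\sigma^*}(x)+m\quad\text{if }x\in\mathbb{S}^2\setminus D,$$ $$U^{\lambda_D}(x)\le U^{\frac{2a}{1+2a}\sigma^*}(x)+m\quad\text{if }x\in D.$$ The measure $\sigma^*$ is given by $$\sigma^*=\frac{1}{2a}(\phi^{-1})_*(\mu_V),$$ where $\mu_V$ is the equilibrium measure on $\mathbb{R}$ in the external field $V(x)=\frac{1+a}{2}\log(x^2+b^{-2})-\frac a2\log(x^2+b^2)$.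
   Context: $\mathbb{S}^2=\{x\in\mathbb{R}^3:\|x\|=1\}$; $\lambda$ is Lebesgue (surface) measure on $\mathbb{S}^2$ normalized so that $\lambda(\mathbb{S}^2)=1$, and $\lambda_D$ is the restriction of $\lambda$ to $D$. The stereographic projection $\phi:\mathbb{S}^2\to\mathbb{C}\cup\{\infty\}$ is $\phi(x_1,x_2,x_3)=\frac{x_1+ix_2}{1-x_3}$ for $x_3\ne1$, and $\phi(0,0,1)=\infty$. $(\phi^{-1})_*$ denotes pushforward by $\phi^{-1}$. For a positive measure $\tau$ on $\mathbb{S}^2$, $U^\tau(x)=\int\log\frac{1}{\|x-y\|}d\tau(y)$. For a charge distribution $\sigma$ on $\mathbb{S}^2$, $\mu_\sigma$ denotes the equilibrium measure in the external field $Q=U^\sigma$, i.e. the unique probability measure on $\mathbb{S}^2$ minimizing $$I_Q[\mu]=\iint\log\frac{1}{\|x-y\|}\,d\mu(x)d\mu(y)+2\int Q\,d\mu .$$ The equilibrium measure $\mu_V$ in the external field $V$ on $\mathbb{R}$ is the unique minimizer of $I_V[\mu]=\iint\log\frac1{|x-y|}d\mu(x)d\mu(y)+2\int V\,d\mu$ among probability measures $\mu$ on $\mathbb{R}$, where $I_V[\mu]$ is understood as $\iint\left[\log\frac1{|x-y|}+V(x)+V(y)\right]d\mu(x)d\mu(y)$ when the integrals are not separately defined. *)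

theory Defs
  imports "HOL-Probability.Probability"
begin

abbreviation S2 :: "(real ^ 3) set" where
  "S2 \<equiv> sphere 0 1"

text \<open>
  A measure on the sphere is a measure with the space and the sigma-algebra of \<open>sphere_borel\<close>;
  a measure on the line is a measure with the sigma-algebra of \<open>borel\<close>.
\<close>

definition sphere_borel :: "(real ^ 3) measure" where
  "sphere_borel = restrict_space borel S2"

text \<open>
  Normalized surface measure, in polar coordinates: the measure of a set is the proportion of the
  volume of the unit ball taken up by the cone over that set. Here \<open>sgn x\<close> is \<open>x\<close> divided by its
  norm, and the origin, which \<open>sgn\<close> sends to itself and not into the sphere, is a null set.
\<close>

definition surface_measure :: "(real ^ 3) measure" where
  "surface_measure =
     restrict_space (distr (uniform_measure lborel (cball 0 1)) borel sgn) S2"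

definition restrict_measure :: "'a measure \<Rightarrow> 'a set \<Rightarrow> 'a measure" where
  "restrict_measure M D = density M (indicator D)"

definition add_measure :: "'a measure \<Rightarrow> 'a measure \<Rightarrow> 'a measure" where
  "add_measure M N = measure_of (space M) (sets M) (\<lambda>A. emeasure M A + emeasure N A)"

definition measure_support :: "'a::topological_space measure \<Rightarrow> 'a set" where
  "measure_support M =
     {x \<in> space M. \<forall>U. open U \<longrightarrow> x \<in> U \<longrightarrow> emeasure M (U \<inter> space M) > 0}"

text \<open>The point at infinity of the extended complex plane is \<open>None\<close>.\<close>

definition stereographic :: "real ^ 3 \<Rightarrow> complex option" where
  "stereographic x =
     (if x $ 3 = 1 then None
      else Some ((of_real (x $ 1) + \<i> * of_real (x $ 2)) / of_real (1 - x $ 3)))"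

definition stereographic_inv :: "complex option \<Rightarrow> real ^ 3" where
  "stereographic_inv = inv_into S2 stereographic"

text \<open>
  Energies and potentials may be infinite, so integrals are taken in the extended reals as the
  integral of the positive part minus that of the negative part. Every use below has an integrand
  that is bounded below (for the energy on the line, in the external field of the theorem) and a
  finite measure, so the negative part has finite integral.
\<close>

definition ereal_integral :: "'a measure \<Rightarrow> ('a \<Rightarrow> ereal) \<Rightarrow> ereal" where
  "ereal_integral M f =
     enn2ereal (\<integral>\<^sup>+ x. e2ennreal (f x) \<partial>M) - enn2ereal (\<integral>\<^sup>+ x. e2ennreal (- f x) \<partial>M)"

definition log_kernel :: "'a::real_normed_vector \<Rightarrow> 'a \<Rightarrow> ereal" where
  "log_kernel x y = (if x = y then \<infinity> else ereal (ln (1 / norm (x - y))))"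

definition log_potential :: "(real ^ 3) measure \<Rightarrow> real ^ 3 \<Rightarrow> ereal" where
  "log_potential \<tau> x = ereal_integral \<tau> (\<lambda>y. log_kernel x y)"

definition sphere_energy :: "(real ^ 3 \<Rightarrow> ereal) \<Rightarrow> (real ^ 3) measure \<Rightarrow> ereal" where
  "sphere_energy Q \<mu> =
     ereal_integral (\<mu> \<Otimes>\<^sub>M \<mu>) (\<lambda>(x, y). log_kernel x y) + 2 * ereal_integral \<mu> Q"

definition sphere_equilibrium :: "(real ^ 3) measure \<Rightarrow> (real ^ 3) measure" where
  "sphere_equilibrium \<sigma> =
     (THE \<mu>. is_arg_min (sphere_energy (log_potential \<sigma>))
               (\<lambda>\<nu>. sets \<nu> = sets sphere_borel \<and> prob_space \<nu>) \<mu>)"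

text \<open>
  The two parts of the weighted energy on the line are combined under one integral, since the
  logarithmic energy need not be defined for a measure with unbounded support. Whenever the parts
  have a meaningful sum, this agrees with the sum.
\<close>

definition line_energy :: "(real \<Rightarrow> real) \<Rightarrow> real measure \<Rightarrow> ereal" where
  "line_energy V \<mu> =
     ereal_integral (\<mu> \<Otimes>\<^sub>M \<mu>) (\<lambda>(x, y). log_kernel x y + ereal (V x) + ereal (V y))"

definition line_equilibrium :: "(real \<Rightarrow> real) \<Rightarrow> real measure" where
  "line_equilibrium V =
     (THE \<mu>. is_arg_min (line_energy V)
               (\<lambda>\<nu>. sets \<nu> = sets borel \<and> prob_space \<nu>) \<mu>)"

end

theory Submission
  imports Defs "HOL-Complex_Analysis.Cauchy_Integral_Formula"
begin

text \<open>
  Let \<open>skern\<close> be the logarithmic kernel of the sphere up to a constant. Both equilibrium measures are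
  identified by Frostman conditions: the power series of the kernel in \<open>x \<bullet> y\<close> has nonnegative coefficients, so
  the energy of a difference of probability measures is nonnegative and vanishes only if all moments agree.

  The equilibrium measure on the line is explicit. Its density on the unit circle is
  \<open>(1 + a) * poiss q1 t - a * poiss q2 t\<close>, transported to the line by \<open>cot (t / 2)\<close> if \<open>a * b\<^sup>2 \<le> 1 + a\<close>, and to an
  interval by a multiple of \<open>cos (t / 2)\<close> otherwise; the Poisson integral of \<open>ln (norm (cis t - \<zeta>))\<close> gives the
  potential \<open>u\<close> of its image on the sphere in closed form.

  Let \<open>U\<close> be the potential of \<open>\<sigma>\<close>. For a suitable constant \<open>c0\<close>, the function \<open>u + U - c0\<close> is nonnegative on the
  sphere and vanishes on the boundary of a region \<open>D\<close>, which is the complement of two caps or an ellipse. Hence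
  the function equal to \<open>U\<close> on \<open>D\<close> and to \<open>c0 - u\<close> outside is continuously differentiable, and its Laplacian is
  \<open>a\<close> on \<open>D\<close> and \<open>- 1 / 2\<close> outside. Green's formula, which follows from the fundamental theorem of calculus along
  the orbits of the three coordinate rotations, turns this into the potential of the surface measure on \<open>D\<close>:
  it is a constant minus the glued function, up to the factor \<open>1 + 2 * a\<close>. Inside \<open>D\<close> this is the Frostman
  condition showing that \<open>D\<close> is the droplet, and outside it is the mother body identity.
\<close>

section \<open>Positive definiteness of the logarithmic kernel\<close>

text \<open>The energy on the line need not split into finite parts, so the line problem is moved to
  the sphere: the conformal factor of stereographic projection replaces the external field by the
  bounded function \<open>ext_field a b x - ln (1 + x^2) / 2\<close>, and one uniqueness argument
  serves both minimisation problems. Explicit candidates with bounded potential replace any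
  existence theory for minimisers. Rotations replace charts: the Laplacian is the sum of the squares
  of the three rotation derivatives, the surface measure is invariant, and closed orbits leave no
  boundary terms. Of the boundary of the droplet only one thing is used: almost every orbit meets it
  finitely often. The threshold a * b^2 = 1 + a is the tangency of the two caps. Up to it the
  equilibrium measure charges the whole line, and two problems with one charge each are superposed.
  Beyond it the support is the segment between the foci of the ellipse, and the coordinate with an
  explicit potential determines a point of the plane only up to sign, which the symmetry of the
  measure compensates.\<close>

definition wmon :: "3 list \<Rightarrow> real ^ 3 \<Rightarrow> real" where
  "wmon w x = (\<Prod>i\<leftarrow>w. x $ i)"

lemma wmon_measurable [measurable]: "wmon w \<in> borel_measurable borel"
  unfolding wmon_def by (induction w) auto

lemma abs_wmon_le: "x \<in> S2 \<Longrightarrow> \<bar>wmon w x\<bar> \<le> 1"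
proof (induction w)
  case (Cons i w)
  then have "\<bar>x $ i\<bar> \<le> 1" using component_le_norm_cart[of x i] by simp
  with Cons show ?case by (auto simp: wmon_def abs_mult intro!: mult_le_one)
qed (simp add: wmon_def)

text \<open>Words repeat each monomial as often as its multinomial coefficient says, so every
  coefficient is 1 and the kernel is visibly positive definite.\<close>

lemma inner_power_wmon: "(x \<bullet> y) ^ k = (\<Sum>w | length w = k. wmon w x * wmon w y)"
proof (induction k)
  case 0
  have "{w :: 3 list. length w = 0} = {[]}" by auto
  then show ?case by (simp add: wmon_def)
next
  case (Suc k)
  have *: "{w :: 3 list. length w = Suc k} = (\<lambda>(i, w). i # w) ` (UNIV \<times> {w. length w = k})"
    by (force simp: length_Suc_conv)
  have inj: "inj_on (\<lambda>(i, w). i # w) (UNIV \<times> {w :: 3 list. length w = k})"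
    by (auto simp: inj_on_def)
  have "(\<Sum>w | length w = Suc k. wmon w x * wmon w y) =
     (\<Sum>(i, w)\<in>UNIV \<times> {w. length w = k}. wmon (i # w) x * wmon (i # w) y)"
    unfolding * by (subst sum.reindex[OF inj]) (simp add: case_prod_beta)
  also have "\<dots> = (\<Sum>i\<in>UNIV. \<Sum>w | length w = k. (x $ i * y $ i) * (wmon w x * wmon w y))"
    by (subst sum.cartesian_product[symmetric]) (simp add: wmon_def mult_ac)
  also have "\<dots> = (\<Sum>i\<in>UNIV. x $ i * y $ i) * (\<Sum>w | length w = k. wmon w x * wmon w y)"
    by (rule sum_product[symmetric])
  also have "\<dots> = (x \<bullet> y) * (x \<bullet> y) ^ k"
    using Suc by (simp add: inner_vec_def)
  finally show ?case by simp
qed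

lemma finite_words: "finite {w :: 3 list. length w = k}"
  using finite_lists_length_eq[OF finite_class.finite_UNIV, of k] by (simp only: subset_UNIV simp_thms)

lemma wmon_append: "wmon (u @ v) x = wmon u x * wmon v x"
  by (simp add: wmon_def)

definition wval :: "(real \<times> 3 list) list \<Rightarrow> real ^ 3 \<Rightarrow> real" where
  "wval L x = (\<Sum>p\<leftarrow>L. fst p * wmon (snd p) x)"

lemma wval_simps: "wval [] x = 0" "wval (p # L) x = fst p * wmon (snd p) x + wval L x"
  "wval (L @ M) x = wval L x + wval M x"
  by (simp_all add: wval_def)

lemma wval_mult: "\<exists>N. \<forall>x. wval L x * wval M x = wval N x"
proof (induction L)
  case Nil
  have "\<forall>x. wval [] x * wval M x = wval [] x" by (simp add: wval_simps)
  then show ?case by blast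
next
  case (Cons p L)
  then obtain N where N: "\<forall>x. wval L x * wval M x = wval N x" by blast
  have 1: "wval (map (\<lambda>r. (fst p * fst r, snd p @ snd r)) M') x = fst p * wmon (snd p) x * wval M' x" for M' x
    by (induction M') (auto simp: wval_simps wmon_append distrib_left)
  have "\<forall>x. wval (p # L) x * wval M x = wval (map (\<lambda>r. (fst p * fst r, snd p @ snd r)) M @ N) x"
    by (simp add: wval_simps 1 N distrib_right)
  then show ?case by blast
qed

text \<open>Moments along words thus determine the integrals of all polynomials. The class
  \<open>real_polynomial_function\<close> is generated by linear maps, constants, sums and products,
  so only a linear map has to be expanded in coordinates.\<close>

lemma polynomial_wmon:
  fixes p :: "real ^ 3 \<Rightarrow> real"
  assumes "real_polynomial_function p"
  shows "\<exists>L. \<forall>x. p x = wval L x"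
  using assms
proof (induction rule: real_polynomial_function.induct)
  case (linear f)
  interpret bounded_linear f by fact
  have *: "f x = (\<Sum>i\<in>UNIV. x $ i * f (axis i 1))" for x
  proof -
    have "f x = f (\<Sum>i\<in>UNIV. x $ i *s axis i 1)" by (simp only: basis_expansion)
    also have "\<dots> = (\<Sum>i\<in>UNIV. f (x $ i *s axis i 1))" by (rule sum)
    finally show ?thesis by (simp only: scalar_mult_eq_scaleR scale real_scaleR_def)
  qed
  have "f x = wval [(f (axis 1 1), [1]), (f (axis 2 1), [2]), (f (axis 3 1), [3])] x" for x
    by (subst *) (simp add: sum_3 wmon_def wval_def mult.commute)
  then show ?case by blast
next
  case (const c)
  have "\<forall>x. c = wval [(c, [])] x" by (simp add: wmon_def wval_def)
  then show ?case by blast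
next
  case (add f g)
  then obtain L M where "\<forall>x. f x = wval L x" "\<forall>x. g x = wval M x" by blast
  then have "\<forall>x. f x + g x = wval (L @ M) x" by (simp add: wval_simps)
  then show ?case by blast
next
  case (mult f g)
  then show ?case using wval_mult by metis
qed

text \<open>Closed sets form an intersection-stable generator, and the indicator of a nonempty
  closed set is the pointwise limit of continuous cut-offs of the distance to it.\<close>

lemma measure_eq_if_continuous_integral_eq:
  fixes M N :: "'a :: metric_space measure"
  assumes "prob_space M" "prob_space N"
    and sM: "sets M = sets borel" and sN: "sets N = sets borel"
    and eq: "\<And>f. continuous_on UNIV f \<Longrightarrow> (\<And>x. 0 \<le> f x \<and> f x \<le> 1) \<Longrightarrow>
       (\<integral>x. f x \<partial>M) = (\<integral>x. (f x :: real) \<partial>N)"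
  shows "M = N"
proof -
  interpret M: prob_space M by fact
  interpret N: prob_space N by fact
  note [measurable_cong] = sM sN
  have cl: "emeasure M F = emeasure N F" if F: "closed F" for F
  \<comment> \<open>\<open>infdist\<close> to the empty set is 0 by convention, so the cut-offs
    \<open>f n\<close> would all be 1 in that case.\<close>
  proof (cases "F = {}")
    case False
    define f where "f n x = max 0 (1 - real n * infdist x F)" for n :: nat and x
    have cont: "continuous_on UNIV (f n)" for n
      unfolding f_def by (intro continuous_intros)
    have meas: "f n \<in> borel_measurable borel" for n
      using cont by (rule borel_measurable_continuous_onI)
    have bd: "0 \<le> f n x \<and> f n x \<le> 1" for n x
      by (simp add: f_def infdist_nonneg)
    have lim: "(\<lambda>n. f n x) \<longlonglongrightarrow> indicator F x" for x
    proof (cases "x \<in> F")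
      case True
      then show ?thesis by (simp add: f_def)
    next
      case nF: False
      then have pos: "infdist x F > 0"
        using False F by (metis in_closed_iff_infdist_zero infdist_nonneg order_le_less)
      then obtain n0 :: nat where n0: "1 < real n0 * infdist x F"
        using reals_Archimedean3 by blast
      have "f n x = 0" if "n \<ge> n0" for n
      proof -
        have "real n0 * infdist x F \<le> real n * infdist x F"
          using that pos by (intro mult_right_mono) auto
        with n0 show ?thesis by (simp add: f_def)
      qed
      then have "eventually (\<lambda>n. f n x = 0) sequentially"
        using eventually_sequentially by blast
      then show ?thesis using nF by (simp add: tendsto_eventually)
    qed
    have Fb: "F \<in> sets borel" using F by simp
    have "(\<lambda>n. \<integral>x. f n x \<partial>M) \<longlonglongrightarrow> (\<integral>x. indicator F x \<partial>M)"
      by (rule integral_dominated_convergence[where w = "\<lambda>_. 1"])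
         (use meas bd lim Fb in \<open>auto simp: measurable_cong_sets[OF sM refl]\<close>)
    moreover have "(\<lambda>n. \<integral>x. f n x \<partial>N) \<longlonglongrightarrow> (\<integral>x. indicator F x \<partial>N)"
      by (rule integral_dominated_convergence[where w = "\<lambda>_. 1"])
         (use meas bd lim Fb in \<open>auto simp: measurable_cong_sets[OF sN refl]\<close>)
    ultimately have "(\<integral>x. indicator F x \<partial>M) = (\<integral>x. (indicator F x :: real) \<partial>N)"
      using eq[OF cont bd] LIMSEQ_unique by simp
    then show ?thesis
      using sets_eq_imp_space_eq[OF sM] sets_eq_imp_space_eq[OF sN]
      by (simp add: M.emeasure_eq_measure N.emeasure_eq_measure)
  qed simp
  show ?thesis
  proof (rule measure_eqI_generator_eq[where E = "Collect closed" and \<Omega> = UNIV and A = "\<lambda>_. UNIV"])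
    show "Int_stable (Collect closed :: 'a set set)" by (auto simp: Int_stable_def)
    show "sets M = sigma_sets UNIV (Collect closed)" "sets N = sigma_sets UNIV (Collect closed)"
      using sM sN by (simp_all add: borel_eq_closed)
  qed (use cl in auto)
qed

text \<open>Stone-Weierstrass approximates a continuous function uniformly on the sphere by
  combinations of the \<open>wmon w\<close>. The measures live on the whole space and are only
  concentrated on the sphere, hence the conditions almost everywhere.\<close>

lemma sphere_measure_eqI:
  fixes M N :: "(real ^ 3) measure"
  assumes "prob_space M" "prob_space N"
    and sM: "sets M = sets borel" and sN: "sets N = sets borel"
    and aM: "AE x in M. x \<in> S2" and aN: "AE x in N. x \<in> S2"
    and eq: "\<And>w. (\<integral>x. wmon w x \<partial>M) = (\<integral>x. wmon w x \<partial>N)"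
  shows "M = N"
proof (rule measure_eq_if_continuous_integral_eq[OF assms(1-4)])
  interpret M: prob_space M by fact
  interpret N: prob_space N by fact
  note [measurable_cong] = sM sN
  fix f :: "real ^ 3 \<Rightarrow> real"
  assume f: "continuous_on UNIV f" "\<And>x. 0 \<le> f x \<and> f x \<le> 1"
  have [measurable]: "f \<in> borel_measurable borel"
    using f(1) by (rule borel_measurable_continuous_onI)
  have iM: "integrable M (wmon w)" for w
    by (rule M.integrable_const_bound[where B = 1]) (use aM abs_wmon_le in \<open>auto elim: eventually_mono\<close>)
  have iN: "integrable N (wmon w)" for w
    by (rule N.integrable_const_bound[where B = 1]) (use aN abs_wmon_le in \<open>auto elim: eventually_mono\<close>)
  have ifM: "integrable M f" and ifN: "integrable N f"
    by (rule M.integrable_const_bound[where B = 1] N.integrable_const_bound[where B = 1];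
        use f in \<open>auto\<close>)+
  have "\<bar>(\<integral>x. f x \<partial>M) - (\<integral>x. f x \<partial>N)\<bar> \<le> 2 * e" if "e > 0" for e
  proof -
    obtain p where p: "polynomial_function p" "\<And>x. x \<in> S2 \<Longrightarrow> norm (f x - p x) < e"
      using Stone_Weierstrass_polynomial_function[OF compact_sphere continuous_on_subset[OF f(1)] \<open>e > 0\<close>]
      by (metis subset_UNIV)
    then have rp: "real_polynomial_function p"
      by (simp add: real_polynomial_function_eq)
    obtain L where L: "\<And>x. p x = wval L x"
      using polynomial_wmon[OF rp] by blast
    have "integrable M (wval L) \<and> integrable N (wval L) \<and> (\<integral>x. wval L x \<partial>M) = (\<integral>x. wval L x \<partial>N)"
    proof (induction L)
      case (Cons c L)
      have *: "wval (c # L) = (\<lambda>x. fst c * wmon (snd c) x + wval L x)"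
        by (auto simp: wval_simps)
      show ?case unfolding * using Cons by (auto simp: eq iM iN)
    qed (simp add: wval_def)
    moreover have "p = wval L" using L by auto
    ultimately have ip: "integrable M p \<and> integrable N p \<and> (\<integral>x. p x \<partial>M) = (\<integral>x. p x \<partial>N)"
      by simp
    have "\<bar>(\<integral>x. f x \<partial>M) - (\<integral>x. p x \<partial>M)\<bar> \<le> (\<integral>x. e \<partial>M)"
      apply (subst Bochner_Integration.integral_diff[symmetric])
      using ip ifM apply (auto simp: )[2]
      apply (rule integral_abs_bound[THEN order_trans])
      apply (rule integral_mono_AE)
      using aM p(2) ip ifM by (auto elim!: eventually_mono simp: less_imp_le)
    moreover have "\<bar>(\<integral>x. f x \<partial>N) - (\<integral>x. p x \<partial>N)\<bar> \<le> (\<integral>x. e \<partial>N)"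
      apply (subst Bochner_Integration.integral_diff[symmetric])
      using ip ifN apply (auto simp: )[2]
      apply (rule integral_abs_bound[THEN order_trans])
      apply (rule integral_mono_AE)
      using aN p(2) ip ifN by (auto elim!: eventually_mono simp: less_imp_le)
    ultimately show ?thesis using ip by (simp add: M.prob_space N.prob_space)
  qed
  from this[of "e / 2" for e] have "\<bar>(\<integral>x. f x \<partial>M) - (\<integral>x. f x \<partial>N)\<bar> \<le> 0 + e" if "e > 0" for e
    using that by simp
  then have "\<bar>(\<integral>x. f x \<partial>M) - (\<integral>x. f x \<partial>N)\<bar> \<le> 0"
    by (rule field_le_epsilon)
  then show "(\<integral>x. f x \<partial>M) = (\<integral>x. f x \<partial>N)" by simp
qed

section \<open>Logarithmic energies as power series in the moments\<close>

lemma AE_pair_S2: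
  fixes M N :: "(real ^ 3) measure"
  assumes "prob_space M" "prob_space N"
    and sM: "sets M = sets borel" and sN: "sets N = sets borel"
    and aM: "AE x in M. x \<in> S2" and aN: "AE x in N. x \<in> S2"
  shows "AE p in M \<Otimes>\<^sub>M N. fst p \<in> S2 \<and> snd p \<in> S2"
proof -
  interpret M: prob_space M by fact
  interpret N: prob_space N by fact
  interpret P: pair_prob_space M N ..
  note [measurable_cong] = sM sN
  have "AE x in M. AE y in N. fst (x, y) \<in> S2 \<and> snd (x, y) \<in> S2"
    using aM aN by (auto elim!: eventually_mono)
  then show ?thesis
    by (rule P.AE_pair_measure[rotated]) (simp add: space_pair_measure, measurable)
qed

text \<open>Fubini splits the contribution of each word into a product of two moments. For
  \<open>M = N\<close> these are squares, which is the source of positivity.\<close>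

lemma integral_inner_power:
  fixes M N :: "(real ^ 3) measure"
  assumes "prob_space M" "prob_space N"
    and sM: "sets M = sets borel" and sN: "sets N = sets borel"
    and aM: "AE x in M. x \<in> S2" and aN: "AE x in N. x \<in> S2"
  shows "(\<integral>p. (fst p \<bullet> snd p) ^ k \<partial>(M \<Otimes>\<^sub>M N)) =
     (\<Sum>w | length w = k. (\<integral>x. wmon w x \<partial>M) * (\<integral>x. wmon w x \<partial>N))"
proof -
  interpret M: prob_space M by fact
  interpret N: prob_space N by fact
  interpret P: pair_prob_space M N ..
  note [measurable_cong] = sM sN
  have int: "integrable (M \<Otimes>\<^sub>M N) (\<lambda>p. wmon w (fst p) * wmon w (snd p))" for w
  proof (rule P.integrable_const_bound[where B = 1])
    show "AE p in M \<Otimes>\<^sub>M N. norm (wmon w (fst p) * wmon w (snd p)) \<le> 1"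
      using AE_pair_S2[OF assms]
      by eventually_elim (auto simp: abs_mult intro!: mult_le_one abs_wmon_le)
  qed measurable
  have "(\<integral>p. wmon w (fst p) * wmon w (snd p) \<partial>(M \<Otimes>\<^sub>M N)) =
      (\<integral>x. wmon w x \<partial>M) * (\<integral>x. wmon w x \<partial>N)" for w
    using P.integral_fst[of "\<lambda>x y. wmon w x * wmon w y"] int[of w]
    by (simp add: case_prod_beta')
  then show ?thesis
    by (simp add: inner_power_wmon Bochner_Integration.integral_sum int)
qed

text \<open>The summand for n = 0 is 1 / 0, that is 0, so the series has no constant term.\<close>

lemma neg_ln_series: "\<bar>u :: real\<bar> < 1 \<Longrightarrow> (\<lambda>n. u ^ n / real n) sums (- ln (1 - u))"
  using sums_minus[OF ln_series'[of "- u"]] by simp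

text \<open>The factor r < 1 keeps the argument of the logarithm away from 0: a geometric series
  dominates, and summation commutes with integration whatever mass lies near the diagonal.\<close>

lemma log_kernel_regularised_sums:
  fixes M N :: "(real ^ 3) measure"
  assumes "prob_space M" "prob_space N"
    and sM: "sets M = sets borel" and sN: "sets N = sets borel"
    and aM: "AE x in M. x \<in> S2" and aN: "AE x in N. x \<in> S2" and r: "0 < r" "r < 1"
  shows "(\<lambda>k. r ^ k / real k * (\<Sum>w | length w = k. (\<integral>x. wmon w x \<partial>M) * (\<integral>x. wmon w x \<partial>N)))
    sums (\<integral>p. - ln (1 - r * (fst p \<bullet> snd p)) \<partial>(M \<Otimes>\<^sub>M N))"
proof -
  interpret M: prob_space M by fact
  interpret N: prob_space N by fact
  interpret P: pair_prob_space M N ..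
  note [measurable_cong] = sM sN
  define f where "f k p = (r * (fst p \<bullet> snd p)) ^ k / real k" for k and p :: "(real ^ 3) \<times> (real ^ 3)"
  have [measurable]: "f k \<in> borel_measurable (M \<Otimes>\<^sub>M N)" for k
    unfolding f_def by measurable
  have le1: "\<bar>fst p \<bullet> snd p\<bar> \<le> 1" if "fst p \<in> S2 \<and> snd p \<in> S2" for p :: "(real ^ 3) \<times> (real ^ 3)"
    using that Cauchy_Schwarz_ineq2[of "fst p" "snd p"] by simp
  have bd: "norm (f k p) \<le> r ^ k" if "fst p \<in> S2 \<and> snd p \<in> S2" for k p
  proof (cases "k = 0")
    case False
    have "norm (f k p) = (r * \<bar>fst p \<bullet> snd p\<bar>) ^ k / real k"
      using r by (simp add: f_def power_abs abs_mult)
    also have "\<dots> \<le> (r * 1) ^ k / 1"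
      using False r le1[OF that] by (intro frac_le power_mono mult_left_mono) auto
    finally show ?thesis by simp
  qed (simp add: f_def)
  have AEbd: "AE p in M \<Otimes>\<^sub>M N. \<forall>k. norm (f k p) \<le> r ^ k"
    using AE_pair_S2[OF assms(1-6)] by eventually_elim (use bd in blast)
  have int: "integrable (M \<Otimes>\<^sub>M N) (f k)" for k
    by (rule P.integrable_const_bound[where B = "r ^ k"]) (use AEbd in \<open>auto elim: eventually_mono\<close>)
  have geo: "summable (\<lambda>k. r ^ k)" using r by (simp add: summable_geometric)
  have "(\<lambda>k. \<integral>p. f k p \<partial>(M \<Otimes>\<^sub>M N)) sums (\<integral>p. (\<Sum>k. f k p) \<partial>(M \<Otimes>\<^sub>M N))"
  proof (rule sums_integral[OF int])
    show "AE p in M \<Otimes>\<^sub>M N. summable (\<lambda>k. norm (f k p))"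
      using AEbd by eventually_elim (rule summable_comparison_test'[OF geo], simp)
    have "(\<integral>p. norm (f k p) \<partial>(M \<Otimes>\<^sub>M N)) \<le> r ^ k" for k
    proof -
      have "(\<integral>p. norm (f k p) \<partial>(M \<Otimes>\<^sub>M N)) \<le> (\<integral>p. r ^ k \<partial>(M \<Otimes>\<^sub>M N))"
        by (rule integral_mono_AE) (use AEbd int in \<open>auto elim: eventually_mono\<close>)
      then show ?thesis by (simp add: P.prob_space)
    qed
    then show "summable (\<lambda>k. \<integral>p. norm (f k p) \<partial>(M \<Otimes>\<^sub>M N))"
      by (intro summable_comparison_test'[OF geo]) simp
  qed
  moreover have "(\<integral>p. f k p \<partial>(M \<Otimes>\<^sub>M N)) =
      r ^ k / real k * (\<Sum>w | length w = k. (\<integral>x. wmon w x \<partial>M) * (\<integral>x. wmon w x \<partial>N))" for k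
    unfolding f_def using integral_inner_power[OF assms(1-6), of k] by (simp add: power_mult_distrib)
  moreover have "(\<integral>p. (\<Sum>k. f k p) \<partial>(M \<Otimes>\<^sub>M N)) =
      (\<integral>p. - ln (1 - r * (fst p \<bullet> snd p)) \<partial>(M \<Otimes>\<^sub>M N))"
  proof (rule integral_cong_AE)
    show "AE p in M \<Otimes>\<^sub>M N. (\<Sum>k. f k p) = - ln (1 - r * (fst p \<bullet> snd p))"
      using AE_pair_S2[OF assms(1-6)]
    proof eventually_elim
      case (elim p)
      have "\<bar>r * (fst p \<bullet> snd p)\<bar> \<le> r * 1"
        using r le1[OF elim] by (auto simp: abs_mult intro!: mult_left_mono)
      then have "\<bar>r * (fst p \<bullet> snd p)\<bar> < 1" using r by linarith
      from sums_unique[OF neg_ln_series[OF this]] show ?case by (simp add: f_def)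
    qed
  qed measurable
  ultimately show ?thesis by simp
qed

lemma log_kernel_regularised_lim:
  fixes P :: "((real ^ 3) \<times> (real ^ 3)) measure"
  assumes "prob_space P" and sP: "sets P = sets (borel \<Otimes>\<^sub>M borel)"
    and aP: "AE p in P. fst p \<in> S2 \<and> snd p \<in> S2" and dP: "AE p in P. fst p \<bullet> snd p \<noteq> 1"
    and int: "integrable P (\<lambda>p. ln (1 - fst p \<bullet> snd p))"
  shows "(\<lambda>n. \<integral>p. - ln (1 - (1 - 1 / real (n + 2)) * (fst p \<bullet> snd p)) \<partial>P)
    \<longlonglongrightarrow> (\<integral>p. - ln (1 - fst p \<bullet> snd p) \<partial>P)"
proof (rule integral_dominated_convergence[where w = "\<lambda>p. \<bar>ln (1 - fst p \<bullet> snd p)\<bar> + ln 2"])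
  interpret P: prob_space P by fact
  note [measurable_cong] = sP
  show "(\<lambda>p. - ln (1 - fst p \<bullet> snd p)) \<in> borel_measurable P" by measurable
  show "(\<lambda>p. - ln (1 - (1 - 1 / real (n + 2)) * (fst p \<bullet> snd p))) \<in> borel_measurable P" for n
    by measurable
  show "integrable P (\<lambda>p. \<bar>ln (1 - fst p \<bullet> snd p)\<bar> + ln 2)" using int by simp
  have rlim: "(\<lambda>n. 1 - 1 / real (n + 2)) \<longlonglongrightarrow> 1 - 0"
    by (intro tendsto_diff tendsto_const LIMSEQ_ignore_initial_segment[where f = "\<lambda>n. 1 / real n"] lim_1_over_n)
  show "AE p in P. (\<lambda>n. - ln (1 - (1 - 1 / real (n + 2)) * (fst p \<bullet> snd p))) \<longlonglongrightarrow> - ln (1 - fst p \<bullet> snd p)"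
    using dP
  proof eventually_elim
    case (elim p)
    have "(\<lambda>n. 1 - (1 - 1 / real (n + 2)) * (fst p \<bullet> snd p)) \<longlonglongrightarrow> 1 - (1 - 0) * (fst p \<bullet> snd p)"
      by (intro tendsto_diff tendsto_mult tendsto_const rlim)
    then show ?case using elim by (intro tendsto_minus tendsto_ln) auto
  qed
  fix n
  show "AE p in P. norm (- ln (1 - (1 - 1 / real (n + 2)) * (fst p \<bullet> snd p))) \<le> \<bar>ln (1 - fst p \<bullet> snd p)\<bar> + ln 2"
    using aP dP
  proof eventually_elim
    case (elim p)
    define t where "t = fst p \<bullet> snd p"
    define r where "r = 1 - 1 / real (n + 2)"
    have r: "0 < r" "r < 1" by (auto simp: r_def field_simps)
    have t: "\<bar>t\<bar> \<le> 1" "t \<noteq> 1"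
      using elim Cauchy_Schwarz_ineq2[of "fst p" "snd p"] by (auto simp: t_def)
    have b: "1 - r * t \<le> 2" "0 < 1 - r * t"
    proof -
      have "\<bar>r * t\<bar> \<le> r * 1" unfolding abs_mult using r t by (intro mult_mono) auto
      then show "1 - r * t \<le> 2" "0 < 1 - r * t" using r by linarith+
    qed
    show ?case
    \<comment> \<open>For nonnegative t the regularised argument lies between 1 - t and 1, so the
      limit itself dominates; for negative t it lies between 1 and 2, which costs the summand ln
      2.\<close>
    proof (cases "t \<ge> 0")
      case True
      then have "r * t \<le> 1 * t" using r by (intro mult_right_mono) auto
      then have "1 - t \<le> 1 - r * t" by simp
      moreover have "0 \<le> r * t" using True r by simp
      ultimately have "ln (1 - t) \<le> ln (1 - r * t)" "ln (1 - r * t) \<le> 0" using t b by auto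
      moreover have "0 \<le> ln (2 :: real)" by simp
      moreover note \<open>ln (1 - t) \<le> ln (1 - r * t)\<close> \<open>ln (1 - r * t) \<le> 0\<close>
      ultimately show ?thesis unfolding t_def[symmetric] r_def[symmetric] real_norm_def by linarith
    next
      case False
      then have "r * t \<le> 0" using r by (simp add: mult_nonneg_nonpos)
      then have "0 \<le> ln (1 - r * t)" "ln (1 - r * t) \<le> ln 2" using b by auto
      then show ?thesis unfolding t_def[symmetric] r_def[symmetric] by (simp add: abs_le_iff)
    qed
  qed
qed

text \<open>For r < 1 the regularised energy of M - N is a power series in r with nonnegative
  coefficients, so it exceeds each of its terms, and this survives the limit r = 1. For k = 0 the
  left side is 0 and the bound says that the energy is nonnegative.\<close>

lemma log_energy_lower_bound:
  fixes M N :: "(real ^ 3) measure"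
  assumes prM: "prob_space M" and prN: "prob_space N"
    and sM: "sets M = sets borel" and sN: "sets N = sets borel"
    and aM: "AE x in M. x \<in> S2" and aN: "AE x in N. x \<in> S2"
    and d: "AE p in M \<Otimes>\<^sub>M M. fst p \<bullet> snd p \<noteq> 1" "AE p in M \<Otimes>\<^sub>M N. fst p \<bullet> snd p \<noteq> 1"
      "AE p in N \<Otimes>\<^sub>M N. fst p \<bullet> snd p \<noteq> 1"
    and int: "integrable (M \<Otimes>\<^sub>M M) (\<lambda>p. ln (1 - fst p \<bullet> snd p))"
      "integrable (M \<Otimes>\<^sub>M N) (\<lambda>p. ln (1 - fst p \<bullet> snd p))"
      "integrable (N \<Otimes>\<^sub>M N) (\<lambda>p. ln (1 - fst p \<bullet> snd p))"
  shows "(\<Sum>w | length w = k. ((\<integral>x. wmon w x \<partial>M) - (\<integral>x. wmon w x \<partial>N))\<^sup>2) / real k \<le>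
     (\<integral>p. - ln (1 - fst p \<bullet> snd p) \<partial>(M \<Otimes>\<^sub>M M)) - 2 * (\<integral>p. - ln (1 - fst p \<bullet> snd p) \<partial>(M \<Otimes>\<^sub>M N))
       + (\<integral>p. - ln (1 - fst p \<bullet> snd p) \<partial>(N \<Otimes>\<^sub>M N))"
proof -
  interpret M: prob_space M by fact
  interpret N: prob_space N by fact
  interpret MM: pair_prob_space M M ..
  interpret MN: pair_prob_space M N ..
  interpret NN: pair_prob_space N N ..
  note [measurable_cong] = sM sN
  define m where "m k = (\<Sum>w | length w = k. ((\<integral>x. wmon w x \<partial>M) - (\<integral>x. wmon w x \<partial>N))\<^sup>2)" for k
  define F where "F r = (\<integral>p. - ln (1 - r * (fst p \<bullet> snd p)) \<partial>(M \<Otimes>\<^sub>M M))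
     - 2 * (\<integral>p. - ln (1 - r * (fst p \<bullet> snd p)) \<partial>(M \<Otimes>\<^sub>M N))
     + (\<integral>p. - ln (1 - r * (fst p \<bullet> snd p)) \<partial>(N \<Otimes>\<^sub>M N))" for r
  have sums: "(\<lambda>k. r ^ k / real k * m k) sums F r" if r: "0 < r" "r < 1" for r
  proof -
    have eq: "r ^ k / real k * m k =
        r ^ k / real k * (\<Sum>w | length w = k. (\<integral>x. wmon w x \<partial>M) * (\<integral>x. wmon w x \<partial>M))
        - 2 * (r ^ k / real k * (\<Sum>w | length w = k. (\<integral>x. wmon w x \<partial>M) * (\<integral>x. wmon w x \<partial>N)))
        + r ^ k / real k * (\<Sum>w | length w = k. (\<integral>x. wmon w x \<partial>N) * (\<integral>x. wmon w x \<partial>N))" for k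
    proof -
      have "m k = (\<Sum>w | length w = k. (\<integral>x. wmon w x \<partial>M) * (\<integral>x. wmon w x \<partial>M))
        - 2 * (\<Sum>w | length w = k. (\<integral>x. wmon w x \<partial>M) * (\<integral>x. wmon w x \<partial>N))
        + (\<Sum>w | length w = k. (\<integral>x. wmon w x \<partial>N) * (\<integral>x. wmon w x \<partial>N))"
        unfolding m_def sum_distrib_left sum_subtractf[symmetric] sum.distrib[symmetric]
        by (intro sum.cong) (auto simp: power2_eq_square algebra_simps)
      then show ?thesis by (simp only: ring_distribs mult.left_commute)
    qed
    show ?thesis unfolding eq F_def
      by (intro sums_add sums_diff sums_mult log_kernel_regularised_sums assms r)
  qed
  have m0: "m k \<ge> 0" for k unfolding m_def by (intro sum_nonneg) auto
  have le: "r ^ k / real k * m k \<le> F r" if r: "0 < r" "r < 1" for r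
  proof -
    have "sum (\<lambda>k. r ^ k / real k * m k) {k} \<le> (\<Sum>k. r ^ k / real k * m k)"
      by (rule sum_le_suminf) (use sums[OF r] m0 r in \<open>auto simp: sums_iff intro!: mult_nonneg_nonneg divide_nonneg_nonneg\<close>)
    then show ?thesis using sums[OF r] by (simp add: sums_iff)
  qed
  let ?r = "\<lambda>n. 1 - 1 / real (n + 2)"
  have rlim: "?r \<longlonglongrightarrow> 1 - 0"
    by (intro tendsto_diff tendsto_const LIMSEQ_ignore_initial_segment[where f = "\<lambda>n. 1 / real n"] lim_1_over_n)
  have Flim: "(\<lambda>n. F (?r n)) \<longlonglongrightarrow>
     (\<integral>p. - ln (1 - fst p \<bullet> snd p) \<partial>(M \<Otimes>\<^sub>M M)) - 2 * (\<integral>p. - ln (1 - fst p \<bullet> snd p) \<partial>(M \<Otimes>\<^sub>M N))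
       + (\<integral>p. - ln (1 - fst p \<bullet> snd p) \<partial>(N \<Otimes>\<^sub>M N))"
    unfolding F_def
    by (intro tendsto_add tendsto_diff tendsto_mult tendsto_const log_kernel_regularised_lim
         MM.prob_space_axioms MN.prob_space_axioms NN.prob_space_axioms AE_pair_S2 assms sets_pair_measure_cong)
  have "(\<lambda>n. ?r n ^ k * (1 / real k) * m k) \<longlonglongrightarrow> (1 - 0) ^ k * (1 / real k) * m k"
    by (intro tendsto_mult tendsto_power rlim tendsto_const)
  from LIMSEQ_le[OF this Flim] have "(1 - 0) ^ k * (1 / real k) * m k \<le>
     (\<integral>p. - ln (1 - fst p \<bullet> snd p) \<partial>(M \<Otimes>\<^sub>M M)) - 2 * (\<integral>p. - ln (1 - fst p \<bullet> snd p) \<partial>(M \<Otimes>\<^sub>M N))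
       + (\<integral>p. - ln (1 - fst p \<bullet> snd p) \<partial>(N \<Otimes>\<^sub>M N))"
    using le[of "?r n" for n] by (auto simp: field_simps)
  then show ?thesis by (simp add: m_def)
qed

lemma log_energy_unique:
  fixes M N :: "(real ^ 3) measure"
  assumes prM: "prob_space M" and prN: "prob_space N"
    and sM: "sets M = sets borel" and sN: "sets N = sets borel"
    and aM: "AE x in M. x \<in> S2" and aN: "AE x in N. x \<in> S2"
    and d: "AE p in M \<Otimes>\<^sub>M M. fst p \<bullet> snd p \<noteq> 1" "AE p in M \<Otimes>\<^sub>M N. fst p \<bullet> snd p \<noteq> 1"
      "AE p in N \<Otimes>\<^sub>M N. fst p \<bullet> snd p \<noteq> 1"
    and int: "integrable (M \<Otimes>\<^sub>M M) (\<lambda>p. ln (1 - fst p \<bullet> snd p))"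
      "integrable (M \<Otimes>\<^sub>M N) (\<lambda>p. ln (1 - fst p \<bullet> snd p))"
      "integrable (N \<Otimes>\<^sub>M N) (\<lambda>p. ln (1 - fst p \<bullet> snd p))"
    and le: "(\<integral>p. - ln (1 - fst p \<bullet> snd p) \<partial>(M \<Otimes>\<^sub>M M)) - 2 * (\<integral>p. - ln (1 - fst p \<bullet> snd p) \<partial>(M \<Otimes>\<^sub>M N))
       + (\<integral>p. - ln (1 - fst p \<bullet> snd p) \<partial>(N \<Otimes>\<^sub>M N)) \<le> 0"
  shows "M = N"
proof (rule sphere_measure_eqI[OF prM prN sM sN aM aN])
  fix w :: "3 list"
  show "(\<integral>x. wmon w x \<partial>M) = (\<integral>x. wmon w x \<partial>N)"
  \<comment> \<open>The logarithmic series has no term of degree 0, so the moment of the empty word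
    has to come from the total masses.\<close>
  proof (cases "w = []")
    case True
    then show ?thesis using prob_space.prob_space[OF prM] prob_space.prob_space[OF prN] by (simp add: wmon_def)
  next
    case False
    define S where "S = (\<Sum>v | length v = length w. ((\<integral>x. wmon v x \<partial>M) - (\<integral>x. wmon v x \<partial>N))\<^sup>2)"
    have "S / real (length w) \<le> 0"
      using log_energy_lower_bound[OF prM prN sM sN aM aN d int, of "length w"] le by (simp add: S_def)
    then have "S \<le> 0" using False by (simp add: divide_le_0_iff)
    moreover have "S \<ge> 0" unfolding S_def by (intro sum_nonneg) auto
    ultimately have "S = 0" by simp
    then show ?thesis unfolding S_def
      by (subst (asm) sum_nonneg_eq_0_iff) (auto simp: finite_words)
  qed
qed

section \<open>Frostman conditions\<close>

text \<open>In a linear order, if \<open>a\<close> is the only admissible point with value at most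
  \<open>f a\<close>, minimality and uniqueness follow at once.\<close>

lemma the_arg_min_eqI:
  fixes f :: "'a \<Rightarrow> 'b :: linorder"
  assumes "P a" "\<And>x. P x \<Longrightarrow> f x \<le> f a \<Longrightarrow> x = a"
  shows "(THE x. is_arg_min f P x) = a"
proof (rule the_equality)
  show "is_arg_min f P a"
    using assms by (auto simp: is_arg_min_def dest: less_imp_le)
  show "x = a" if "is_arg_min f P x" for x
    using assms that by (auto simp: is_arg_min_def not_less)
qed

text \<open>The squared chord length is \<open>2 * (1 - x \<bullet> y)\<close>, so off the diagonal
  this is \<open>log_kernel\<close> plus ln 2 / 2. On the diagonal it is 0, because ln 0 = 0, and
  not infinite; conditions such as \<open>x \<noteq> y\<close> almost everywhere keep track of
  this.\<close>

definition skern :: "real ^ 3 \<Rightarrow> real ^ 3 \<Rightarrow> real" where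
  "skern x y = - ln (1 - x \<bullet> y) / 2"

lemma skern_measurable [measurable]:
  assumes [measurable]: "f \<in> borel_measurable M" "g \<in> borel_measurable M"
  shows "(\<lambda>x. skern (f x) (g x)) \<in> borel_measurable M"
  unfolding skern_def by measurable

lemma abs_inner_S2: "x \<in> S2 \<Longrightarrow> y \<in> S2 \<Longrightarrow> \<bar>x \<bullet> y\<bar> \<le> 1"
  using Cauchy_Schwarz_ineq2[of x y] by simp

lemma skern_ge: "x \<in> S2 \<Longrightarrow> y \<in> S2 \<Longrightarrow> - ln 2 / 2 \<le> skern x y"
proof -
  assume "x \<in> S2" "y \<in> S2"
  then have "\<bar>x \<bullet> y\<bar> \<le> 1" by (rule abs_inner_S2)
  then have "0 \<le> 1 - x \<bullet> y" "1 - x \<bullet> y \<le> 2" by auto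
  then have "ln (1 - x \<bullet> y) \<le> ln 2"
    by (cases "1 - x \<bullet> y = 0") (simp, simp)
  then show ?thesis by (simp add: skern_def)
qed

lemma inner_eq_1_iff: "x \<in> S2 \<Longrightarrow> y \<in> S2 \<Longrightarrow> x \<bullet> y = 1 \<longleftrightarrow> x = y"
proof -
  assume *: "x \<in> S2" "y \<in> S2"
  have "(norm (x - y))\<^sup>2 = 2 - 2 * (x \<bullet> y)"
    using * by (simp add: power2_norm_eq_inner inner_diff inner_commute norm_eq_1)
  then show ?thesis by auto
qed

lemma log_kernel_eq_skern:
  assumes "x \<in> S2" "y \<in> S2" "x \<noteq> y"
  shows "log_kernel x y = ereal (skern x y - ln 2 / 2)"
proof -
  have n: "(norm (x - y))\<^sup>2 = 2 * (1 - x \<bullet> y)"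
    using assms by (simp add: power2_norm_eq_inner inner_diff inner_commute norm_eq_1)
  have p: "norm (x - y) > 0" using assms by simp
  have "1 - x \<bullet> y > 0" using n p by (metis zero_less_mult_pos zero_less_numeral zero_less_power)
  then have "2 * ln (norm (x - y)) = ln 2 + ln (1 - x \<bullet> y)"
    using ln_realpow[of "norm (x - y)" 2] ln_mult[of 2 "1 - x \<bullet> y"] unfolding n by (simp del: mult_eq_0_iff)
  then show ?thesis using assms p by (simp add: log_kernel_def skern_def ln_div field_simps)
qed

text \<open>Integrating the Frostman inequality against \<mu> and the equality against \<mu>0, and
  comparing the weighted energies, gives a nonpositive energy of \<mu> - \<mu>0, so the images under
  \<gamma> agree. The map \<gamma> is the inclusion of the sphere in one application and the
  embedding of the line in the other; \<open>sep\<close> pulls the equality of the images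
  back.\<close>

lemma log_frostman_unique:
  fixes \<gamma> :: "'a \<Rightarrow> real ^ 3" and \<mu> \<mu>0 :: "'a measure" and u Q :: "'a \<Rightarrow> real"
  assumes g[measurable]: "\<gamma> \<in> borel_measurable N" and gS: "\<And>x. x \<in> space N \<Longrightarrow> \<gamma> x \<in> S2"
    and sep: "\<And>A. A \<in> sets N \<Longrightarrow> \<exists>B\<in>sets borel. A = \<gamma> -` B \<inter> space N"
    and "prob_space \<mu>" "prob_space \<mu>0"
    and s: "sets \<mu> = sets N" and s0: "sets \<mu>0 = sets N"
    and k: "AE p in \<mu> \<Otimes>\<^sub>M \<mu>. \<gamma> (fst p) \<bullet> \<gamma> (snd p) \<noteq> 1"
      "integrable (\<mu> \<Otimes>\<^sub>M \<mu>) (\<lambda>p. skern (\<gamma> (fst p)) (\<gamma> (snd p)))"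
    and ku: "\<And>x. x \<in> space N \<Longrightarrow> AE y in \<mu>0. \<gamma> x \<bullet> \<gamma> y \<noteq> 1"
      "\<And>x. x \<in> space N \<Longrightarrow> integrable \<mu>0 (\<lambda>y. skern (\<gamma> x) (\<gamma> y))"
      "\<And>x. x \<in> space N \<Longrightarrow> (\<integral>y. skern (\<gamma> x) (\<gamma> y) \<partial>\<mu>0) = u x"
    and u: "u \<in> borel_measurable N" "\<And>x. x \<in> space N \<Longrightarrow> \<bar>u x\<bar> \<le> B"
    and Q: "integrable \<mu> Q" "integrable \<mu>0 Q"
    and F: "AE x in \<mu>. F \<le> u x + Q x" "AE x in \<mu>0. u x + Q x = F"
    and le: "(\<integral>p. skern (\<gamma> (fst p)) (\<gamma> (snd p)) \<partial>(\<mu> \<Otimes>\<^sub>M \<mu>)) + 2 * (\<integral>x. Q x \<partial>\<mu>)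
       \<le> (\<integral>p. skern (\<gamma> (fst p)) (\<gamma> (snd p)) \<partial>(\<mu>0 \<Otimes>\<^sub>M \<mu>0)) + 2 * (\<integral>x. Q x \<partial>\<mu>0)"
  shows "\<mu> = \<mu>0"
proof -
  interpret m: prob_space \<mu> by fact
  interpret m0: prob_space \<mu>0 by fact
  note [measurable_cong] = s s0
  have sp: "space \<mu> = space N" "space \<mu>0 = space N" using s s0 by (auto dest: sets_eq_imp_space_eq)
  have um[measurable]: "u \<in> borel_measurable N" by fact
  have cross: "integrable (\<nu> \<Otimes>\<^sub>M \<mu>0) (\<lambda>p. skern (\<gamma> (fst p)) (\<gamma> (snd p)))"
      "AE p in \<nu> \<Otimes>\<^sub>M \<mu>0. \<gamma> (fst p) \<bullet> \<gamma> (snd p) \<noteq> 1"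
      "(\<integral>p. skern (\<gamma> (fst p)) (\<gamma> (snd p)) \<partial>(\<nu> \<Otimes>\<^sub>M \<mu>0)) = (\<integral>x. u x \<partial>\<nu>)"
      "integrable \<nu> u"
    if nu: "prob_space \<nu>" and sn: "sets \<nu> = sets N" for \<nu>
  proof -
    interpret n: prob_space \<nu> by fact
    interpret P: pair_prob_space \<nu> \<mu>0 ..
    note [measurable_cong] = sn
    have spn: "space \<nu> = space N" using sn by (auto dest: sets_eq_imp_space_eq)
    show iu: "integrable \<nu> u"
      by (rule n.integrable_const_bound[where B = B]) (use u spn in auto)
    show int: "integrable (\<nu> \<Otimes>\<^sub>M \<mu>0) (\<lambda>p. skern (\<gamma> (fst p)) (\<gamma> (snd p)))"
    proof (rule P.Fubini_integrable)
      show "AE x in \<nu>. integrable \<mu>0 (\<lambda>y. skern (\<gamma> (fst (x, y))) (\<gamma> (snd (x, y))))"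
        using ku(2) spn by auto
      \<comment> \<open>Since \<open>skern\<close> is at least - ln 2 / 2, its absolute value is at
        most \<open>skern\<close> plus ln 2. The bounded potential u therefore controls the L1 norm
        in y uniformly in x.\<close>
      have "norm (\<integral>y. norm (skern (\<gamma> x) (\<gamma> y)) \<partial>\<mu>0) \<le> B + ln 2" if x: "x \<in> space N" for x
      proof -
        have "(\<integral>y. norm (skern (\<gamma> x) (\<gamma> y)) \<partial>\<mu>0) \<le> (\<integral>y. skern (\<gamma> x) (\<gamma> y) + ln 2 \<partial>\<mu>0)"
        proof (rule integral_mono)
          show "norm (skern (\<gamma> x) (\<gamma> y)) \<le> skern (\<gamma> x) (\<gamma> y) + ln 2" if "y \<in> space \<mu>0" for y
            using skern_ge[OF gS[OF x] gS, of y] that sp ln_gt_zero[of "2 :: real"]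
            unfolding real_norm_def by (simp add: abs_le_iff)
        qed (use ku(2)[OF x] in auto)
        also have "\<dots> = u x + ln 2" using ku(2,3)[OF x] by (simp add: m0.prob_space)
        finally show ?thesis using u(2)[OF x] by simp
      qed
      then show "integrable \<nu> (\<lambda>x. \<integral>y. norm (skern (\<gamma> (fst (x, y))) (\<gamma> (snd (x, y)))) \<partial>\<mu>0)"
        by (intro n.integrable_const_bound[where B = "B + ln 2"]) (use spn in auto)
    qed measurable
    show "AE p in \<nu> \<Otimes>\<^sub>M \<mu>0. \<gamma> (fst p) \<bullet> \<gamma> (snd p) \<noteq> 1"
    proof (rule P.AE_pair_measure)
      show "AE x in \<nu>. AE y in \<mu>0. \<gamma> (fst (x, y)) \<bullet> \<gamma> (snd (x, y)) \<noteq> 1"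
        using ku(1) spn by auto
    qed measurable
    have "(\<integral>p. skern (\<gamma> (fst p)) (\<gamma> (snd p)) \<partial>(\<nu> \<Otimes>\<^sub>M \<mu>0)) = (\<integral>x. \<integral>y. skern (\<gamma> x) (\<gamma> y) \<partial>\<mu>0 \<partial>\<nu>)"
      using P.integral_fst[of "\<lambda>x y. skern (\<gamma> x) (\<gamma> y)"] int by (simp add: case_prod_beta')
    also have "\<dots> = (\<integral>x. u x \<partial>\<nu>)"
      by (rule Bochner_Integration.integral_cong) (use ku(3) spn in auto)
    finally show "(\<integral>p. skern (\<gamma> (fst p)) (\<gamma> (snd p)) \<partial>(\<nu> \<Otimes>\<^sub>M \<mu>0)) = (\<integral>x. u x \<partial>\<nu>)" .
  qed
  note c = cross[OF m.prob_space_axioms s] and c0 = cross[OF m0.prob_space_axioms s0]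
  define E where "E \<mu> \<nu> = (\<integral>p. skern (\<gamma> (fst p)) (\<gamma> (snd p)) \<partial>(\<mu> \<Otimes>\<^sub>M \<nu>))" for \<mu> \<nu>
  have "(\<integral>x. F \<partial>\<mu>) \<le> (\<integral>x. u x + Q x \<partial>\<mu>)"
    by (rule integral_mono_AE) (use F Q c in auto)
  then have 1: "F \<le> E \<mu> \<mu>0 + (\<integral>x. Q x \<partial>\<mu>)"
    using Q c by (simp add: m.prob_space E_def)
  have "(\<integral>x. u x + Q x \<partial>\<mu>0) = (\<integral>x. F \<partial>\<mu>0)"
    by (rule integral_cong_AE) (use F Q c0 in auto)
  then have 2: "F = E \<mu>0 \<mu>0 + (\<integral>x. Q x \<partial>\<mu>0)"
    using Q c0 by (simp add: m0.prob_space E_def)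
  \<comment> \<open>Twice \<open>1\<close>, twice \<open>2\<close> and the comparison of energies
    are added; the integrals of Q and the constant F cancel.\<close>
  have E: "E \<mu> \<mu> - 2 * E \<mu> \<mu>0 + E \<mu>0 \<mu>0 \<le> 0"
    using 1 2 le by (simp add: E_def)
  let ?d = "\<lambda>\<mu>. distr \<mu> borel \<gamma>"
  have pr: "prob_space (?d \<mu>)" "prob_space (?d \<mu>0)"
    by (auto intro!: m.prob_space_distr m0.prob_space_distr)
  interpret d: prob_space "?d \<mu>" by fact
  interpret d0: prob_space "?d \<mu>0" by fact
  have pm: "?d \<mu> \<Otimes>\<^sub>M ?d \<nu> = distr (\<mu> \<Otimes>\<^sub>M \<nu>) (borel \<Otimes>\<^sub>M borel) (\<lambda>(x, y). (\<gamma> x, \<gamma> y))"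
    if "prob_space \<nu>" "sets \<nu> = sets N" "sets \<mu> = sets N" for \<mu> \<nu>
  proof (rule pair_measure_distr)
    interpret n: prob_space \<nu> by fact
    note [measurable_cong] = that(2,3)
    show "\<gamma> \<in> borel_measurable \<mu>" "\<gamma> \<in> borel_measurable \<nu>" by measurable
    interpret dn: prob_space "?d \<nu>" by (intro n.prob_space_distr) measurable
    show "sigma_finite_measure (?d \<nu>)" by unfold_locales
  qed
  have trI: "integrable (?d \<mu> \<Otimes>\<^sub>M ?d \<nu>) (\<lambda>p. ln (1 - fst p \<bullet> snd p))"
      if "prob_space \<nu>" "sets \<nu> = sets N" "sets \<mu> = sets N"
       "integrable (\<mu> \<Otimes>\<^sub>M \<nu>) (\<lambda>p. skern (\<gamma> (fst p)) (\<gamma> (snd p)))" for \<mu> \<nu>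
  proof -
    note [measurable_cong] = that(2,3)
    have "integrable (\<mu> \<Otimes>\<^sub>M \<nu>) (\<lambda>p. - 2 * skern (\<gamma> (fst p)) (\<gamma> (snd p)))"
      using that(4) by simp
    then show ?thesis unfolding pm[OF that(1-3)]
      by (subst integrable_distr_eq) (auto simp: skern_def case_prod_beta')
  qed
  have trE: "(\<integral>p. - ln (1 - fst p \<bullet> snd p) \<partial>(?d \<mu> \<Otimes>\<^sub>M ?d \<nu>)) = 2 * E \<mu> \<nu>"
      if "prob_space \<nu>" "sets \<nu> = sets N" "sets \<mu> = sets N" for \<mu> \<nu>
  proof -
    note [measurable_cong] = that(2,3)
    have "(\<integral>p. - ln (1 - fst p \<bullet> snd p) \<partial>(?d \<mu> \<Otimes>\<^sub>M ?d \<nu>)) =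
        (\<integral>p. 2 * skern (\<gamma> (fst p)) (\<gamma> (snd p)) \<partial>(\<mu> \<Otimes>\<^sub>M \<nu>))"
      unfolding pm[OF that(1-3)]
      by (subst integral_distr) (auto simp: skern_def case_prod_beta')
    then show ?thesis by (simp add: E_def)
  qed
  have trA: "AE p in ?d \<mu> \<Otimes>\<^sub>M ?d \<nu>. fst p \<bullet> snd p \<noteq> 1"
      if "prob_space \<nu>" "sets \<nu> = sets N" "sets \<mu> = sets N"
       "AE p in \<mu> \<Otimes>\<^sub>M \<nu>. \<gamma> (fst p) \<bullet> \<gamma> (snd p) \<noteq> 1" for \<mu> \<nu>
  proof -
    note [measurable_cong] = that(2,3)
    show ?thesis unfolding pm[OF that(1-3)]
      by (subst AE_distr_iff) (use that(4) in \<open>auto simp: case_prod_beta'\<close>)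
  qed
  have aS: "AE x in ?d \<mu>. x \<in> S2" "AE x in ?d \<mu>0. x \<in> S2"
    by (subst AE_distr_iff; use gS sp in \<open>auto\<close>)+
  have "?d \<mu> = ?d \<mu>0"
  proof (rule log_energy_unique[OF pr _ _ aS])
    show "(\<integral>p. - ln (1 - fst p \<bullet> snd p) \<partial>(?d \<mu> \<Otimes>\<^sub>M ?d \<mu>)) - 2 * (\<integral>p. - ln (1 - fst p \<bullet> snd p) \<partial>(?d \<mu> \<Otimes>\<^sub>M ?d \<mu>0))
       + (\<integral>p. - ln (1 - fst p \<bullet> snd p) \<partial>(?d \<mu>0 \<Otimes>\<^sub>M ?d \<mu>0)) \<le> 0"
      using E by (simp only: trE m.prob_space_axioms m0.prob_space_axioms s s0)
  qed (auto intro!: trI trA c c0 k s s0 m.prob_space_axioms m0.prob_space_axioms)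
  show "\<mu> = \<mu>0"
  proof (rule measure_eqI)
    fix A assume "A \<in> sets \<mu>"
    then obtain B where B: "B \<in> sets borel" "A = \<gamma> -` B \<inter> space N" using sep s by auto
    then have "emeasure \<mu> A = emeasure (?d \<mu>) B" "emeasure \<mu>0 A = emeasure (?d \<mu>0) B"
      by (simp_all add: emeasure_distr sp)
    with \<open>?d \<mu> = ?d \<mu>0\<close> show "emeasure \<mu> A = emeasure \<mu>0 A" by simp
  qed (simp add: s s0)
qed

section \<open>Integrals in the extended reals\<close>

lemma ereal_integral_real:
  assumes "AE x in M. f x = ereal (g x)" "integrable M g"
  shows "ereal_integral M f = ereal (\<integral>x. g x \<partial>M)"
proof -
  have 1: "(\<integral>\<^sup>+ x. e2ennreal (f x) \<partial>M) = (\<integral>\<^sup>+ x. ennreal (g x) \<partial>M)"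
    by (rule nn_integral_cong_AE) (use assms in \<open>auto elim!: eventually_mono simp: ennreal.rep_eq e2ennreal_ereal\<close>)
  have 2: "(\<integral>\<^sup>+ x. e2ennreal (- f x) \<partial>M) = (\<integral>\<^sup>+ x. ennreal (- g x) \<partial>M)"
    by (rule nn_integral_cong_AE) (use assms in \<open>auto elim!: eventually_mono simp: e2ennreal_ereal\<close>)
  have fin: "(\<integral>\<^sup>+ x. ennreal (g x) \<partial>M) < \<infinity>" "(\<integral>\<^sup>+ x. ennreal (- g x) \<partial>M) < \<infinity>"
    using assms(2) unfolding real_integrable_def by (auto simp: top.not_eq_extremum)
  obtain a b where "(\<integral>\<^sup>+ x. ennreal (g x) \<partial>M) = ennreal a" "a \<ge> 0"
      "(\<integral>\<^sup>+ x. ennreal (- g x) \<partial>M) = ennreal b" "b \<ge> 0"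
    using fin by (metis ennreal_cases infinity_ennreal_def order_less_irrefl)
  then show ?thesis
    unfolding ereal_integral_def 1 2 real_lebesgue_integral_def[OF assms(2)]
    by (simp add: enn2ereal_ennreal)
qed

text \<open>The negative part has integral at most \<bar>B\<bar> times the total mass, so the
  difference of the two parts is never undefined, and a value other than infinity forces
  integrability.\<close>

lemma ereal_integral_bounded_below:
  fixes f :: "'a \<Rightarrow> ereal"
  assumes fin: "finite_measure M" and f[measurable]: "f \<in> borel_measurable M" and B: "AE x in M. ereal (- B) \<le> f x"
  shows "ereal_integral M f \<noteq> - \<infinity>"
    and "ereal_integral M f \<noteq> \<infinity> \<Longrightarrow> AE x in M. f x \<noteq> \<infinity>"
    and "ereal_integral M f \<noteq> \<infinity> \<Longrightarrow> integrable M (\<lambda>x. real_of_ereal (f x))"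
    and "ereal_integral M f \<noteq> \<infinity> \<Longrightarrow> ereal_integral M f = ereal (\<integral>x. real_of_ereal (f x) \<partial>M)"
proof -
  interpret finite_measure M by fact
  have "(\<integral>\<^sup>+ x. e2ennreal (- f x) \<partial>M) \<le> (\<integral>\<^sup>+ x. ennreal \<bar>B\<bar> \<partial>M)"
  proof (rule nn_integral_mono_AE)
    show "AE x in M. e2ennreal (- f x) \<le> ennreal \<bar>B\<bar>"
      using B
    proof eventually_elim
      case (elim x)
      then have "- f x \<le> ereal \<bar>B\<bar>" by (cases "f x") auto
      then show ?case by (metis e2ennreal_ereal e2ennreal_mono)
    qed
  qed
  also have "\<dots> < \<infinity>" by (simp add: ennreal_mult_less_top emeasure_eq_measure)
  finally have neg: "(\<integral>\<^sup>+ x. e2ennreal (- f x) \<partial>M) < \<infinity>" .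
  then obtain b where b: "(\<integral>\<^sup>+ x. e2ennreal (- f x) \<partial>M) = ennreal b" "b \<ge> 0"
    by (metis ennreal_cases infinity_ennreal_def order_less_irrefl)
  show "ereal_integral M f \<noteq> - \<infinity>"
    unfolding ereal_integral_def b(1) using b(2)
    by (cases "enn2ereal (\<integral>\<^sup>+ x. e2ennreal (f x) \<partial>M)")
       (auto simp: enn2ereal_ennreal)
  assume ni: "ereal_integral M f \<noteq> \<infinity>"
  then have pos: "(\<integral>\<^sup>+ x. e2ennreal (f x) \<partial>M) < \<infinity>"
    unfolding ereal_integral_def b(1) using b(2)
    by (cases "(\<integral>\<^sup>+ x. e2ennreal (f x) \<partial>M)") (auto simp: enn2ereal_ennreal)
  have "AE x in M. e2ennreal (f x) \<noteq> \<infinity>"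
    by (rule nn_integral_noteq_infinite) (use pos in auto)
  then show fi: "AE x in M. f x \<noteq> \<infinity>"
    by eventually_elim auto
  then have ff: "AE x in M. f x = ereal (real_of_ereal (f x))"
    using B by eventually_elim (auto simp: ereal_real)
  have "(\<integral>\<^sup>+ x. ennreal (real_of_ereal (f x)) \<partial>M) = (\<integral>\<^sup>+ x. e2ennreal (f x) \<partial>M)"
  proof (rule nn_integral_cong_AE)
    show "AE x in M. ennreal (real_of_ereal (f x)) = e2ennreal (f x)"
      using ff by eventually_elim (metis e2ennreal_ereal)
  qed
  moreover have "(\<integral>\<^sup>+ x. ennreal (- real_of_ereal (f x)) \<partial>M) = (\<integral>\<^sup>+ x. e2ennreal (- f x) \<partial>M)"
  proof (rule nn_integral_cong_AE)
    show "AE x in M. ennreal (- real_of_ereal (f x)) = e2ennreal (- f x)"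
      using ff by eventually_elim (metis e2ennreal_ereal uminus_ereal.simps(1))
  qed
  ultimately show int: "integrable M (\<lambda>x. real_of_ereal (f x))"
    unfolding real_integrable_def using pos neg by auto
  show "ereal_integral M f = ereal (\<integral>x. real_of_ereal (f x) \<partial>M)"
    by (rule ereal_integral_real[OF ff int])
qed

lemma log_kernel_measurable [measurable]:
  fixes f g :: "'a \<Rightarrow> 'b :: euclidean_space"
  assumes [measurable]: "f \<in> borel_measurable M" "g \<in> borel_measurable M"
  shows "(\<lambda>x. log_kernel (f x) (g x)) \<in> borel_measurable M"
proof -
  have [measurable]: "Measurable.pred M (\<lambda>x. f x = g x)" by measurable
  show ?thesis unfolding log_kernel_def by measurable
qed

lemma space_sphere_borel [simp]: "space sphere_borel = S2"
  by (simp add: sphere_borel_def space_restrict_space)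

lemma measurable_sphere_borel [measurable (raw)]: "f \<in> borel_measurable borel \<Longrightarrow> f \<in> borel_measurable sphere_borel"
  unfolding sphere_borel_def by (rule measurable_restrict_space1)

lemma fst_snd_sphere_measurable:
  assumes "sets M = sets sphere_borel" "sets N = sets sphere_borel"
  shows "fst \<in> borel_measurable (M \<Otimes>\<^sub>M N)" "snd \<in> borel_measurable (M \<Otimes>\<^sub>M N)"
proof -
  note [measurable_cong] = assms
  have "(\<lambda>x. x) \<in> borel_measurable M" "(\<lambda>x. x) \<in> borel_measurable N" by measurable
  from measurable_compose[OF measurable_fst this(1), of N] measurable_compose[OF measurable_snd this(2), of M]
  show "fst \<in> borel_measurable (M \<Otimes>\<^sub>M N)" "snd \<in> borel_measurable (M \<Otimes>\<^sub>M N)"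
    by auto
qed

lemma log_kernel_ge: "x \<in> S2 \<Longrightarrow> y \<in> S2 \<Longrightarrow> ereal (- ln 2) \<le> log_kernel x y"
  using skern_ge[of x y] by (cases "x = y") (simp add: log_kernel_def, simp add: log_kernel_eq_skern)

lemma ereal_add_twice: "ereal a + 2 * ereal b = ereal (a + 2 * b)"
  by (metis numeral_eq_ereal plus_ereal.simps(1) times_ereal.simps(1))

text \<open>P is the set where the external field is infinite, and q is its real-valued version
  elsewhere. A competitor of finite energy does not charge P or the diagonal, so all integrals
  become real and \<open>log_frostman_unique\<close> applies.\<close>

lemma sphere_equilibrium_eqI:
  fixes u q :: "real ^ 3 \<Rightarrow> real"
  assumes s0: "sets \<mu>0 = sets sphere_borel" and p0: "prob_space \<mu>0"
    and ku: "\<And>x. x \<in> S2 \<Longrightarrow> AE y in \<mu>0. x \<noteq> y"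
      "\<And>x. x \<in> S2 \<Longrightarrow> integrable \<mu>0 (\<lambda>y. skern x y)"
      "\<And>x. x \<in> S2 \<Longrightarrow> (\<integral>y. skern x y \<partial>\<mu>0) = u x"
    and u: "u \<in> borel_measurable borel" "\<And>x. x \<in> S2 \<Longrightarrow> \<bar>u x\<bar> \<le> B"
    and P: "closed P"
    and q[measurable]: "q \<in> borel_measurable borel"
    and Q: "\<And>x. x \<in> S2 - P \<Longrightarrow> log_potential \<sigma> x = ereal (q x)"
      "\<And>x. x \<in> P \<Longrightarrow> log_potential \<sigma> x = \<infinity>"
    and F: "\<And>x. x \<in> S2 - P \<Longrightarrow> F \<le> u x + q x" "AE x in \<mu>0. x \<notin> P \<and> u x + q x = F"
  shows "sphere_equilibrium \<sigma> = \<mu>0"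
  unfolding sphere_equilibrium_def
proof (rule the_arg_min_eqI)
  interpret m0: prob_space \<mu>0 by fact
  note [measurable_cong] = s0
  have um[measurable]: "u \<in> borel_measurable borel" by fact
  have Pm[measurable]: "P \<in> sets borel" using P by simp
  show "sets \<mu>0 = sets sphere_borel \<and> prob_space \<mu>0" using s0 p0 by simp
  have sp0: "space \<mu>0 = S2" using sets_eq_imp_space_eq[OF s0] by simp
  define Qf where "Qf x = (if x \<in> P then \<infinity> else ereal (q x))" for x
  have Qfm[measurable]: "Qf \<in> borel_measurable borel" unfolding Qf_def by measurable
  \<comment> \<open>The lower bound of the field is read off from the Frostman inequality and the
    bound B of the potential.\<close>
  have Qf_ge: "ereal (- (B - F)) \<le> Qf x" if "x \<in> S2" for x
    using F(1)[of x] u(2)[OF that] that by (auto simp: Qf_def)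
  have Qf: "ereal_integral \<mu> (log_potential \<sigma>) = ereal_integral \<mu> Qf" if "space \<mu> = S2" for \<mu>
    using Q that unfolding ereal_integral_def Qf_def
    by (intro arg_cong2[where f = minus] arg_cong[where f = enn2ereal] nn_integral_cong) auto
  have fin: "AE p in \<mu> \<Otimes>\<^sub>M \<mu>. fst p \<bullet> snd p \<noteq> 1"
      "integrable (\<mu> \<Otimes>\<^sub>M \<mu>) (\<lambda>p. skern (fst p) (snd p))"
      "integrable \<mu> q" "AE x in \<mu>. x \<notin> P"
      "sphere_energy (log_potential \<sigma>) \<mu> =
        ereal ((\<integral>p. skern (fst p) (snd p) \<partial>(\<mu> \<Otimes>\<^sub>M \<mu>)) - ln 2 / 2 + 2 * (\<integral>x. q x \<partial>\<mu>))"
    if sm: "sets \<mu> = sets sphere_borel" and pm: "prob_space \<mu>"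
      and ne: "sphere_energy (log_potential \<sigma>) \<mu> \<noteq> \<infinity>" for \<mu>
  proof -
    interpret m: prob_space \<mu> by fact
    interpret mm: pair_prob_space \<mu> \<mu> ..
    note [measurable_cong] = sm
    have sp: "space \<mu> = S2" using sets_eq_imp_space_eq[OF sm] by simp
    note [measurable] = fst_snd_sphere_measurable[OF sm sm]
    let ?k = "\<lambda>(x, y). log_kernel x (y :: real ^ 3)"
    have km: "?k \<in> borel_measurable (\<mu> \<Otimes>\<^sub>M \<mu>)" unfolding case_prod_beta' by measurable
    have kb: "AE p in \<mu> \<Otimes>\<^sub>M \<mu>. ereal (- ln 2) \<le> ?k p"
      by (rule AE_I2) (auto simp: space_pair_measure sp intro!: log_kernel_ge)
    have qb: "AE x in \<mu>. ereal (- (B - F)) \<le> Qf x"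
      by (rule AE_I2) (use Qf_ge sp in auto)
    have Qm: "Qf \<in> borel_measurable \<mu>" by measurable
    note K = ereal_integral_bounded_below[OF mm.finite_measure_axioms km kb]
    note L = ereal_integral_bounded_below[OF m.finite_measure_axioms Qm qb]
    have E: "sphere_energy (log_potential \<sigma>) \<mu> = ereal_integral (\<mu> \<Otimes>\<^sub>M \<mu>) ?k + 2 * ereal_integral \<mu> Qf"
      unfolding sphere_energy_def Qf[OF sp] ..
    have nK: "ereal_integral (\<mu> \<Otimes>\<^sub>M \<mu>) ?k \<noteq> \<infinity>" and nL: "ereal_integral \<mu> Qf \<noteq> \<infinity>"
      using ne K(1) L(1) unfolding E
      by (cases "ereal_integral (\<mu> \<Otimes>\<^sub>M \<mu>) ?k"; cases "ereal_integral \<mu> Qf"; auto)+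
    have d: "AE p in \<mu> \<Otimes>\<^sub>M \<mu>. fst p \<noteq> snd p"
      using K(2)[OF nK] by eventually_elim (auto simp: log_kernel_def)
    have S: "AE p in \<mu> \<Otimes>\<^sub>M \<mu>. fst p \<in> S2 \<and> snd p \<in> S2"
      by (rule AE_I2) (auto simp: space_pair_measure sp)
    show "AE p in \<mu> \<Otimes>\<^sub>M \<mu>. fst p \<bullet> snd p \<noteq> 1"
      using d S by eventually_elim (use inner_eq_1_iff in blast)
    have eq: "AE p in \<mu> \<Otimes>\<^sub>M \<mu>. real_of_ereal (?k p) = skern (fst p) (snd p) - ln 2 / 2"
      using d S by eventually_elim (auto simp: case_prod_beta log_kernel_eq_skern)
    have "integrable (\<mu> \<Otimes>\<^sub>M \<mu>) (\<lambda>p. skern (fst p) (snd p) - ln 2 / 2)"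
      using K(3)[OF nK] by (rule integrable_cong_AE_imp) (use eq in \<open>auto elim: eventually_mono\<close>)
    from Bochner_Integration.integrable_add[OF this, of "\<lambda>_. ln 2 / 2"]
    show int: "integrable (\<mu> \<Otimes>\<^sub>M \<mu>) (\<lambda>p. skern (fst p) (snd p))" by simp
    have "(\<integral>p. real_of_ereal (?k p) \<partial>(\<mu> \<Otimes>\<^sub>M \<mu>)) = (\<integral>p. skern (fst p) (snd p) - ln 2 / 2 \<partial>(\<mu> \<Otimes>\<^sub>M \<mu>))"
      by (rule integral_cong_AE) (use eq in auto)
    also have "\<dots> = (\<integral>p. skern (fst p) (snd p) \<partial>(\<mu> \<Otimes>\<^sub>M \<mu>)) - ln 2 / 2"
      using int by (simp add: mm.prob_space)
    finally have 1: "ereal_integral (\<mu> \<Otimes>\<^sub>M \<mu>) ?k = ereal ((\<integral>p. skern (fst p) (snd p) \<partial>(\<mu> \<Otimes>\<^sub>M \<mu>)) - ln 2 / 2)"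
      using K(4)[OF nK] by simp
    show nP: "AE x in \<mu>. x \<notin> P"
      using L(2)[OF nL] by eventually_elim (auto simp: Qf_def)
    have eq': "AE x in \<mu>. real_of_ereal (Qf x) = q x"
      using nP by eventually_elim (auto simp: Qf_def)
    show "integrable \<mu> q"
      using L(3)[OF nL] by (rule integrable_cong_AE_imp) (use eq' in \<open>auto elim: eventually_mono\<close>)
    have "(\<integral>x. real_of_ereal (Qf x) \<partial>\<mu>) = (\<integral>x. q x \<partial>\<mu>)"
      by (rule integral_cong_AE) (use eq' in auto)
    then have 2: "ereal_integral \<mu> Qf = ereal (\<integral>x. q x \<partial>\<mu>)"
      using L(4)[OF nL] by simp
    show "sphere_energy (log_potential \<sigma>) \<mu> =
        ereal ((\<integral>p. skern (fst p) (snd p) \<partial>(\<mu> \<Otimes>\<^sub>M \<mu>)) - ln 2 / 2 + 2 * (\<integral>x. q x \<partial>\<mu>))"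
      unfolding E 1 2 ereal_add_twice ..
  qed
  \<comment> \<open>A candidate of infinite energy would make the comparison with a competitor
    vacuous, so its finiteness has to be established separately.\<close>
  have fin0: "sphere_energy (log_potential \<sigma>) \<mu>0 \<noteq> \<infinity>"
  proof -
    interpret mm: pair_prob_space \<mu>0 \<mu>0 ..
    note [measurable] = fst_snd_sphere_measurable[OF s0 s0]
    have int: "integrable (\<mu>0 \<Otimes>\<^sub>M \<mu>0) (\<lambda>p. skern (fst p) (snd p))"
    proof (rule mm.Fubini_integrable)
      show "AE x in \<mu>0. integrable \<mu>0 (\<lambda>y. skern (fst (x, y)) (snd (x, y)))"
        using ku(2) sp0 by auto
      have "norm (\<integral>y. norm (skern x y) \<partial>\<mu>0) \<le> B + ln 2" if x: "x \<in> S2" for x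
      proof -
        have "(\<integral>y. norm (skern x y) \<partial>\<mu>0) \<le> (\<integral>y. skern x y + ln 2 \<partial>\<mu>0)"
        proof (rule integral_mono)
          show "norm (skern x y) \<le> skern x y + ln 2" if "y \<in> space \<mu>0" for y
            using skern_ge[OF x, of y] that sp0 ln_gt_zero[of "2 :: real"]
            unfolding real_norm_def by (simp add: abs_le_iff)
        qed (use ku(2)[OF x] in auto)
        also have "\<dots> = u x + ln 2" using ku(2,3)[OF x] by (simp add: m0.prob_space)
        finally show ?thesis using u(2)[OF x] by simp
      qed
      then show "integrable \<mu>0 (\<lambda>x. \<integral>y. norm (skern (fst (x, y)) (snd (x, y))) \<partial>\<mu>0)"
        by (intro m0.integrable_const_bound[where B = "B + ln 2"]) (use sp0 in auto)
    qed measurable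
    have "AE p in \<mu>0 \<Otimes>\<^sub>M \<mu>0. fst p \<noteq> snd p"
    proof (rule mm.AE_pair_measure)
      show "AE x in \<mu>0. AE y in \<mu>0. fst (x, y) \<noteq> snd (x, y)"
        by (rule AE_I2) (simp add: sp0 ku(1))
    qed measurable
    moreover have "AE p in \<mu>0 \<Otimes>\<^sub>M \<mu>0. fst p \<in> S2 \<and> snd p \<in> S2"
      by (rule AE_I2) (auto simp: space_pair_measure sp0)
    ultimately have "AE p in \<mu>0 \<Otimes>\<^sub>M \<mu>0. (\<lambda>(x, y). log_kernel x y) p = ereal (skern (fst p) (snd p) - ln 2 / 2)"
      by eventually_elim (auto simp: case_prod_beta log_kernel_eq_skern)
    note 1 = ereal_integral_real[OF this Bochner_Integration.integrable_diff[OF int mm.integrable_const]]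
    have "integrable \<mu>0 (\<lambda>x. F - u x)"
    proof (rule Bochner_Integration.integrable_diff[OF m0.integrable_const])
      show "integrable \<mu>0 u"
      proof (rule m0.integrable_const_bound)
        show "AE x in \<mu>0. norm (u x) \<le> B"
          by (rule AE_I2) (simp only: sp0 u(2) real_norm_def)
      qed measurable
    qed
    \<comment> \<open>Almost everywhere for \<mu>0 the Frostman equality expresses the field by the
      bounded potential, which makes it integrable.\<close>
    moreover have "AE x in \<mu>0. Qf x = ereal (F - u x)"
      using F(2)
    proof eventually_elim
      case (elim x)
      then have "q x = F - u x" by linarith
      with elim show ?case by (simp only: Qf_def if_False simp_thms)
    qed
    ultimately have 2: "ereal_integral \<mu>0 Qf = ereal (\<integral>x. F - u x \<partial>\<mu>0)"
      by (metis ereal_integral_real)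
    show ?thesis unfolding sphere_energy_def Qf[OF sp0] 1 2 ereal_add_twice by (simp only: infinity_ereal_def ereal.distinct not_False_eq_True)
  qed
  fix \<mu> assume pr: "sets \<mu> = sets sphere_borel \<and> prob_space \<mu>"
    and le: "sphere_energy (log_potential \<sigma>) \<mu> \<le> sphere_energy (log_potential \<sigma>) \<mu>0"
  from pr have sm: "sets \<mu> = sets sphere_borel" and pm: "prob_space \<mu>" by (rule conjunct1, rule conjunct2)
  have ne: "sphere_energy (log_potential \<sigma>) \<mu> \<noteq> \<infinity>"
  proof (rule notI)
    assume h: "sphere_energy (log_potential \<sigma>) \<mu> = \<infinity>"
    have "sphere_energy (log_potential \<sigma>) \<mu>0 = \<infinity>"
      using le unfolding h by (rule ereal_infty_less_eq(1)[THEN iffD1])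
    with fin0 show False by (rule notE)
  qed
  note f = fin[OF sm pm ne] and f0 = fin[OF s0 p0 fin0]
  have sep: "\<exists>B\<in>sets borel. A = (\<lambda>x. x) -` B \<inter> space sphere_borel" if "A \<in> sets sphere_borel" for A
  proof -
    from that obtain B where "B \<in> sets borel" "A = S2 \<inter> B"
      unfolding sphere_borel_def sets_restrict_space by blast
    then have "A = (\<lambda>x. x) -` B \<inter> space sphere_borel" by (simp only: space_sphere_borel vimage_ident Int_commute)
    with \<open>B \<in> sets borel\<close> show ?thesis by (rule rev_bexI)
  qed
  have F1: "AE x in \<mu>. F \<le> u x + q x"
    using f(4) AE_space[of \<mu>]
  proof eventually_elim
    case (elim x)
    then have "x \<in> S2 - P" using sets_eq_imp_space_eq[OF sm] by simp
    then show ?case by (rule F(1))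
  qed
  have F2: "AE x in \<mu>0. u x + q x = F" using F(2) by eventually_elim simp
  have ku1: "AE y in \<mu>0. x \<bullet> y \<noteq> 1" if "x \<in> space sphere_borel" for x
    using ku(1)[of x, OF that[unfolded space_sphere_borel]] AE_space[of \<mu>0]
  proof eventually_elim
    case (elim y)
    then show ?case using inner_eq_1_iff[of x y] that by (simp only: space_sphere_borel sp0 simp_thms)
  qed
  have le': "(\<integral>p. skern (fst p) (snd p) \<partial>(\<mu> \<Otimes>\<^sub>M \<mu>)) + 2 * (\<integral>x. q x \<partial>\<mu>)
       \<le> (\<integral>p. skern (fst p) (snd p) \<partial>(\<mu>0 \<Otimes>\<^sub>M \<mu>0)) + 2 * (\<integral>x. q x \<partial>\<mu>0)"
    using le unfolding f(5) f0(5) by simp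
  have id: "(\<lambda>x :: real ^ 3. x) \<in> borel_measurable sphere_borel" "u \<in> borel_measurable sphere_borel"
    by measurable
  show "\<mu> = \<mu>0"
    by (rule log_frostman_unique[where \<gamma> = "\<lambda>x. x" and N = sphere_borel and u = u and Q = q and B = B and F = F,
          OF id(1) _ sep pm p0 sm s0 f(1,2) ku1 _ _ id(2) _ f(3) f0(3) F1 F2 le'])
       (simp_all only: space_sphere_borel ku u(2))
qed

section \<open>The line as a great circle without its north pole\<close>

definition line_to_sphere :: "real \<Rightarrow> real ^ 3" where
  "line_to_sphere x = vector [2 * x / (1 + x\<^sup>2), 0, (x\<^sup>2 - 1) / (1 + x\<^sup>2)]"

lemma one_plus_sq_pos [simp]: "0 < 1 + (x :: real)\<^sup>2" "1 + x\<^sup>2 \<noteq> 0"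
  using zero_le_power2[of x] by linarith+

lemma inner_3: "(x :: real ^ 3) \<bullet> y = x $ 1 * y $ 1 + x $ 2 * y $ 2 + x $ 3 * y $ 3"
  by (simp add: inner_vec_def sum_3)

lemma mem_S2_iff: "x \<in> S2 \<longleftrightarrow> (x $ 1)\<^sup>2 + (x $ 2)\<^sup>2 + (x $ 3)\<^sup>2 = 1"
  by (simp add: norm_eq_1 inner_3 power2_eq_square)

lemma line_to_sphere_inner: "1 - line_to_sphere x \<bullet> line_to_sphere y = 2 * (x - y)\<^sup>2 / ((1 + x\<^sup>2) * (1 + y\<^sup>2))"
  by (simp add: inner_3 line_to_sphere_def divide_simps) algebra

lemma line_to_sphere_S2: "line_to_sphere x \<in> S2"
  using line_to_sphere_inner[of x x] by (simp add: norm_eq_1)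

lemma line_to_sphere_nth:
  "line_to_sphere x $ 1 = 2 * x / (1 + x\<^sup>2)" "line_to_sphere x $ 2 = 0"
  "line_to_sphere x $ 3 = (x\<^sup>2 - 1) / (1 + x\<^sup>2)"
  by (simp_all add: line_to_sphere_def)

lemma continuous_on_vec3:
  fixes f :: "'a :: topological_space \<Rightarrow> real ^ 3"
  assumes "continuous_on S (\<lambda>x. f x $ 1)" "continuous_on S (\<lambda>x. f x $ 2)" "continuous_on S (\<lambda>x. f x $ 3)"
  shows "continuous_on S f"
proof -
  have "continuous_on S (\<lambda>x. (\<chi> i. f x $ i) :: real ^ 3)"
  proof (rule continuous_on_vec_lambda)
    fix i :: 3
    show "continuous_on S (\<lambda>x. f x $ i)"
      using exhaust_3[of i] assms by (elim disjE) (simp_all only:)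
  qed
  then show ?thesis by (simp only: vec_nth_inverse vec_lambda_eta)
qed

lemma continuous_on_line_to_sphere: "continuous_on UNIV line_to_sphere"
  by (intro continuous_on_vec3; unfold line_to_sphere_nth; intro continuous_intros; simp)

lemma line_to_sphere_measurable [measurable]: "line_to_sphere \<in> borel_measurable borel"
  using continuous_on_line_to_sphere by (rule borel_measurable_continuous_onI)

lemma sphere_to_line: "line_to_sphere x $ 1 / (1 - line_to_sphere x $ 3) = x"
proof -
  have "1 - (x\<^sup>2 - 1) / (1 + x\<^sup>2) = 2 / (1 + x\<^sup>2)" by (simp add: divide_simps)
  then show ?thesis by (simp add: line_to_sphere_def)
qed

lemma line_to_sphere_separates:
  assumes "A \<in> sets borel"
  shows "\<exists>B\<in>sets borel. A = line_to_sphere -` B \<inter> space borel"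
proof
  have [measurable]: "(\<lambda>v :: real ^ 3. v $ 1 / (1 - v $ 3)) \<in> borel_measurable borel"
    by measurable
  show "(\<lambda>v :: real ^ 3. v $ 1 / (1 - v $ 3)) -` A \<in> sets borel"
    using measurable_sets[OF \<open>(\<lambda>v :: real ^ 3. v $ 1 / (1 - v $ 3)) \<in> borel_measurable borel\<close> assms] by simp
  show "A = line_to_sphere -` ((\<lambda>v :: real ^ 3. v $ 1 / (1 - v $ 3)) -` A) \<inter> space borel"
    by (auto simp: sphere_to_line)
qed

text \<open>Each endpoint of a chord contributes half the logarithm of its conformal factor. In the
  energy these terms merge with V into \<open>V x - ln (1 + x^2) / 2\<close>, which is bounded for
  the field in question.\<close>

lemma log_kernel_line:
  assumes "x \<noteq> y"
  shows "log_kernel x y =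
    ereal (skern (line_to_sphere x) (line_to_sphere y) + ln 2 / 2 - ln (1 + x\<^sup>2) / 2 - ln (1 + y\<^sup>2) / 2)"
proof -
  have "ln (2 * (x - y)\<^sup>2 / ((1 + x\<^sup>2) * (1 + y\<^sup>2))) = ln 2 + 2 * ln \<bar>x - y\<bar> - (ln (1 + x\<^sup>2) + ln (1 + y\<^sup>2))"
    using assms ln_realpow[of "\<bar>x - y\<bar>" 2]
    by (simp add: ln_div ln_mult del: ln_realpow)
  then show ?thesis using assms
    by (simp add: log_kernel_def skern_def line_to_sphere_inner ln_div field_simps)
qed

text \<open>The weighted energy of a measure on the line is, up to the constant ln 2 / 2, the energy
  of its image on the sphere in the bounded field \<open>Vt\<close>. There the two parts of the
  energy can be separated even for unbounded support.\<close>

lemma line_equilibrium_eqI: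
  fixes u :: "real \<Rightarrow> real" and V :: "real \<Rightarrow> real"
  assumes s0: "sets \<mu>0 = sets borel" and p0: "prob_space \<mu>0"
    and ku: "\<And>x. AE y in \<mu>0. x \<noteq> y"
      "\<And>x. integrable \<mu>0 (\<lambda>y. skern (line_to_sphere x) (line_to_sphere y))"
      "\<And>x. (\<integral>y. skern (line_to_sphere x) (line_to_sphere y) \<partial>\<mu>0) = u x"
    and u: "u \<in> borel_measurable borel" "\<And>x. \<bar>u x\<bar> \<le> B"
    and V[measurable]: "V \<in> borel_measurable borel"
    and Vt: "\<And>x. \<bar>V x - ln (1 + x\<^sup>2) / 2\<bar> \<le> C"
    and F: "\<And>x. F \<le> u x + (V x - ln (1 + x\<^sup>2) / 2)" "AE x in \<mu>0. u x + (V x - ln (1 + x\<^sup>2) / 2) = F"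
  shows "line_equilibrium V = \<mu>0"
  unfolding line_equilibrium_def
proof (rule the_arg_min_eqI)
  interpret m0: prob_space \<mu>0 by fact
  note [measurable_cong] = s0
  have um[measurable]: "u \<in> borel_measurable borel" by fact
  show "sets \<mu>0 = sets borel \<and> prob_space \<mu>0" using s0 p0 by simp
  have sp0: "space \<mu>0 = UNIV" using sets_eq_imp_space_eq[OF s0] by simp
  define Vt where "Vt x = V x - ln (1 + x\<^sup>2) / 2" for x
  have Vtm[measurable]: "Vt \<in> borel_measurable borel" unfolding Vt_def by measurable
  define k where "k x y = skern (line_to_sphere x) (line_to_sphere y)" for x y
  have km[measurable]: "(\<lambda>p. k (f p) (g p)) \<in> borel_measurable M"
    if [measurable]: "f \<in> borel_measurable M" "g \<in> borel_measurable M" for f g and M :: "'z measure"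
    unfolding k_def by measurable
  have neq1: "x \<noteq> y \<longleftrightarrow> line_to_sphere x \<bullet> line_to_sphere y \<noteq> 1" for x y
    using line_to_sphere_inner[of x y] by auto
  let ?f = "\<lambda>(x, y). log_kernel x (y :: real) + ereal (V x) + ereal (V y)"
  have f_eq: "?f p = ereal (k (fst p) (snd p) + ln 2 / 2 + Vt (fst p) + Vt (snd p))" if "fst p \<noteq> snd p" for p
    using log_kernel_line[OF that] by (auto simp: case_prod_beta Vt_def k_def)
  \<comment> \<open>The constants cancel: - ln 2 / 2 is the lower bound of \<open>skern\<close>, and
    ln 2 / 2 its offset in \<open>log_kernel_line\<close>.\<close>
  have f_ge: "ereal (- 2 * C) \<le> ?f p" for p
  proof (cases "fst p = snd p")
    case True
    then show ?thesis by (auto simp: log_kernel_def case_prod_beta)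
  next
    case False
    have "- ln 2 / 2 \<le> k (fst p) (snd p)" unfolding k_def by (intro skern_ge line_to_sphere_S2)
    with Vt[of "fst p"] Vt[of "snd p"] show ?thesis unfolding f_eq[OF False]
      by (simp add: Vt_def abs_le_iff)
  qed
  have fin: "AE p in \<mu> \<Otimes>\<^sub>M \<mu>. line_to_sphere (fst p) \<bullet> line_to_sphere (snd p) \<noteq> 1"
      "integrable (\<mu> \<Otimes>\<^sub>M \<mu>) (\<lambda>p. k (fst p) (snd p))"
      "integrable \<mu> Vt"
      "line_energy V \<mu> = ereal ((\<integral>p. k (fst p) (snd p) \<partial>(\<mu> \<Otimes>\<^sub>M \<mu>)) + ln 2 / 2 + 2 * (\<integral>x. Vt x \<partial>\<mu>))"
    if sm: "sets \<mu> = sets borel" and pm: "prob_space \<mu>"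
      and ne: "line_energy V \<mu> \<noteq> \<infinity>" for \<mu>
  proof -
    interpret m: prob_space \<mu> by fact
    interpret mm: pair_prob_space \<mu> \<mu> ..
    note [measurable_cong] = sm
    have fm: "?f \<in> borel_measurable (\<mu> \<Otimes>\<^sub>M \<mu>)" unfolding case_prod_beta' by measurable
    have fb: "AE p in \<mu> \<Otimes>\<^sub>M \<mu>. ereal (- (2 * C)) \<le> ?f p"
      using f_ge by auto
    note K = ereal_integral_bounded_below[OF mm.finite_measure_axioms fm fb]
    have nK: "ereal_integral (\<mu> \<Otimes>\<^sub>M \<mu>) ?f \<noteq> \<infinity>" using ne by (simp add: line_energy_def)
    have d: "AE p in \<mu> \<Otimes>\<^sub>M \<mu>. fst p \<noteq> snd p"
      using K(2)[OF nK] by eventually_elim (auto simp: log_kernel_def)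
    then show "AE p in \<mu> \<Otimes>\<^sub>M \<mu>. line_to_sphere (fst p) \<bullet> line_to_sphere (snd p) \<noteq> 1"
      by eventually_elim (use neq1 in blast)
    show iV: "integrable \<mu> Vt"
      by (rule m.integrable_const_bound[where B = C]) (use Vt in \<open>auto simp: Vt_def\<close>)
    have iV1: "integrable (\<mu> \<Otimes>\<^sub>M \<mu>) (\<lambda>p. Vt (fst p))" "integrable (\<mu> \<Otimes>\<^sub>M \<mu>) (\<lambda>p. Vt (snd p))"
      by (rule mm.integrable_const_bound[where B = C]; use Vt in \<open>auto simp: Vt_def\<close>)+
    have eq: "AE p in \<mu> \<Otimes>\<^sub>M \<mu>. real_of_ereal (?f p) = k (fst p) (snd p) + ln 2 / 2 + Vt (fst p) + Vt (snd p)"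
      using d
    proof eventually_elim
      case (elim p)
      show ?case unfolding f_eq[OF elim] by simp
    qed
    have "integrable (\<mu> \<Otimes>\<^sub>M \<mu>) (\<lambda>p. k (fst p) (snd p) + ln 2 / 2 + Vt (fst p) + Vt (snd p))"
      using K(3)[OF nK] by (rule integrable_cong_AE_imp) (use eq in \<open>auto elim: eventually_mono\<close>)
    from Bochner_Integration.integrable_diff[OF Bochner_Integration.integrable_diff[OF this iV1(2)] iV1(1)]
      integrable_const[of "ln 2 / 2 :: real"]
    have "integrable (\<mu> \<Otimes>\<^sub>M \<mu>) (\<lambda>p. k (fst p) (snd p) + ln 2 / 2)" by simp
    from Bochner_Integration.integrable_diff[OF this mm.integrable_const[of "ln 2 / 2"]]
    show int: "integrable (\<mu> \<Otimes>\<^sub>M \<mu>) (\<lambda>p. k (fst p) (snd p))" by simp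
    have "(\<integral>p. real_of_ereal (?f p) \<partial>(\<mu> \<Otimes>\<^sub>M \<mu>)) =
        (\<integral>p. k (fst p) (snd p) + ln 2 / 2 + Vt (fst p) + Vt (snd p) \<partial>(\<mu> \<Otimes>\<^sub>M \<mu>))"
      by (rule integral_cong_AE) (use eq fm in \<open>auto\<close>)
    also have "\<dots> = (\<integral>p. k (fst p) (snd p) \<partial>(\<mu> \<Otimes>\<^sub>M \<mu>)) + ln 2 / 2
        + (\<integral>p. Vt (fst p) \<partial>(\<mu> \<Otimes>\<^sub>M \<mu>)) + (\<integral>p. Vt (snd p) \<partial>(\<mu> \<Otimes>\<^sub>M \<mu>))"
      using int iV1 by (simp add: mm.prob_space)
    also have "(\<integral>p. Vt (fst p) \<partial>(\<mu> \<Otimes>\<^sub>M \<mu>)) = (\<integral>x. Vt x \<partial>\<mu>)"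
      using mm.integral_fst[of "\<lambda>x y. Vt x"] iV1 by (simp add: case_prod_beta' m.prob_space)
    also have "(\<integral>p. Vt (snd p) \<partial>(\<mu> \<Otimes>\<^sub>M \<mu>)) = (\<integral>x. Vt x \<partial>\<mu>)"
      using mm.integral_fst[of "\<lambda>x y. Vt y"] iV1 by (simp add: case_prod_beta' m.prob_space)
    finally show "line_energy V \<mu> = ereal ((\<integral>p. k (fst p) (snd p) \<partial>(\<mu> \<Otimes>\<^sub>M \<mu>)) + ln 2 / 2 + 2 * (\<integral>x. Vt x \<partial>\<mu>))"
      unfolding line_energy_def K(4)[OF nK] by simp
  qed
  have fin0: "line_energy V \<mu>0 \<noteq> \<infinity>"
  proof -
    interpret mm: pair_prob_space \<mu>0 \<mu>0 ..
    have int: "integrable (\<mu>0 \<Otimes>\<^sub>M \<mu>0) (\<lambda>p. k (fst p) (snd p))"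
    proof (rule mm.Fubini_integrable)
      show "AE x in \<mu>0. integrable \<mu>0 (\<lambda>y. k (fst (x, y)) (snd (x, y)))"
        using ku(2) by (auto simp: k_def)
      have "norm (\<integral>y. norm (k x y) \<partial>\<mu>0) \<le> B + ln 2" for x
      proof -
        have "(\<integral>y. norm (k x y) \<partial>\<mu>0) \<le> (\<integral>y. k x y + ln 2 \<partial>\<mu>0)"
        proof (rule integral_mono)
          show "norm (k x y) \<le> k x y + ln 2" for y
            using skern_ge[OF line_to_sphere_S2 line_to_sphere_S2, of x y] ln_gt_zero[of "2 :: real"]
            unfolding real_norm_def k_def by (simp add: abs_le_iff)
        qed (use ku(2)[of x] in \<open>auto simp: k_def\<close>)
        also have "\<dots> = u x + ln 2" using ku(2,3)[of x] by (simp add: m0.prob_space k_def)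
        finally show ?thesis using u(2)[of x] by simp
      qed
      then show "integrable \<mu>0 (\<lambda>x. \<integral>y. norm (k (fst (x, y)) (snd (x, y))) \<partial>\<mu>0)"
        by (intro m0.integrable_const_bound[where B = "B + ln 2"]) auto
    qed measurable
    have "AE p in \<mu>0 \<Otimes>\<^sub>M \<mu>0. fst p \<noteq> snd p"
    proof (rule mm.AE_pair_measure)
      show "AE x in \<mu>0. AE y in \<mu>0. fst (x, y) \<noteq> snd (x, y)"
        by (rule AE_I2) (simp add: ku(1))
    qed measurable
    then have eq: "AE p in \<mu>0 \<Otimes>\<^sub>M \<mu>0. ?f p = ereal (k (fst p) (snd p) + ln 2 / 2 + Vt (fst p) + Vt (snd p))"
      by eventually_elim (rule f_eq)
    have iV1: "integrable (\<mu>0 \<Otimes>\<^sub>M \<mu>0) (\<lambda>p. Vt (fst p))" "integrable (\<mu>0 \<Otimes>\<^sub>M \<mu>0) (\<lambda>p. Vt (snd p))"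
      by (rule mm.integrable_const_bound[where B = C]; use Vt in \<open>auto simp: Vt_def\<close>)+
    have "integrable (\<mu>0 \<Otimes>\<^sub>M \<mu>0) (\<lambda>p. k (fst p) (snd p) + ln 2 / 2 + Vt (fst p) + Vt (snd p))"
      using int iV1 by (intro Bochner_Integration.integrable_add mm.integrable_const)
    from ereal_integral_real[OF eq this] show ?thesis by (simp add: line_energy_def)
  qed
  fix \<mu> assume pr: "sets \<mu> = sets borel \<and> prob_space \<mu>"
    and le: "line_energy V \<mu> \<le> line_energy V \<mu>0"
  from pr have sm: "sets \<mu> = sets borel" and pm: "prob_space \<mu>" by (rule conjunct1, rule conjunct2)
  have ne: "line_energy V \<mu> \<noteq> \<infinity>"
  proof (rule notI)
    assume h: "line_energy V \<mu> = \<infinity>"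
    have "line_energy V \<mu>0 = \<infinity>"
      using le unfolding h by (rule ereal_infty_less_eq(1)[THEN iffD1])
    with fin0 show False by (rule notE)
  qed
  note f = fin[OF sm pm ne] and f0 = fin[OF s0 p0 fin0]
  show "\<mu> = \<mu>0"
  proof (rule log_frostman_unique[where \<gamma> = line_to_sphere and N = borel and u = u and Q = Vt and B = B and F = F])
    show "AE y in \<mu>0. line_to_sphere x \<bullet> line_to_sphere y \<noteq> 1" for x
      using ku(1)[of x] neq1 by auto
    show "AE x in \<mu>. F \<le> u x + Vt x" using F(1) by (simp add: Vt_def)
    show "AE x in \<mu>0. u x + Vt x = F" using F(2) by (simp add: Vt_def)
    show "(\<integral>p. skern (line_to_sphere (fst p)) (line_to_sphere (snd p)) \<partial>(\<mu> \<Otimes>\<^sub>M \<mu>)) + 2 * (\<integral>x. Vt x \<partial>\<mu>)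
       \<le> (\<integral>p. skern (line_to_sphere (fst p)) (line_to_sphere (snd p)) \<partial>(\<mu>0 \<Otimes>\<^sub>M \<mu>0)) + 2 * (\<integral>x. Vt x \<partial>\<mu>0)"
      using le unfolding f(4) f0(4) by (simp add: k_def)
  qed (use f[unfolded k_def] f0 ku u s0 p0 sm pm line_to_sphere_S2 line_to_sphere_separates in \<open>auto\<close>)
qed

section \<open>Surface measure and rotations\<close>

lemma distr_lborel_orthogonal:
  fixes T :: "real ^ 3 \<Rightarrow> real ^ 3"
  assumes T: "orthogonal_transformation T"
  shows "distr lborel borel T = lborel"
proof (rule lborel_eqI[symmetric])
  have [measurable]: "T \<in> borel_measurable borel"
    using T by (intro borel_measurable_continuous_onI linear_continuous_on linear_linear[THEN iffD2])
      (simp add: orthogonal_transformation_linear)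
  fix l u :: "real ^ 3" assume lu: "\<And>b. b \<in> Basis \<Longrightarrow> l \<bullet> b \<le> u \<bullet> b"
  have bij: "bij T" using orthogonal_transformation_bij[OF T] .
  have inv: "orthogonal_transformation (inv T)" using orthogonal_transformation_inv[OF T] .
  have "T -` box l u = inv T ` box l u" using bij by (simp add: bij_vimage_eq_inv_image)
  moreover have "T -` box l u \<in> sets lborel"
    using measurable_sets_borel[OF \<open>T \<in> borel_measurable borel\<close>, of "box l u"] by simp
  ultimately have "emeasure (distr lborel borel T) (box l u) = emeasure lebesgue (inv T ` box l u)"
    by (simp add: emeasure_distr)
  also have "\<dots> = emeasure lebesgue (box l u)"
    using measurable_orthogonal_image[OF inv, of "box l u"] measure_orthogonal_image[OF inv, of "box l u"]
    by (simp add: emeasure_eq_measure2 fmeasurableD)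
  also have "\<dots> = (\<Prod>b\<in>Basis. (u - l) \<bullet> b)"
    using lu by (simp add: emeasure_lborel_box)
  finally show "emeasure (distr lborel borel T) (box l u) = (\<Prod>b\<in>Basis. (u - l) \<bullet> b)" .
qed simp

text \<open>This is \<open>surface_measure\<close> before the restriction to the sphere. Keeping all
  Borel sets of the space makes functions measurable without restricting them; membership in
  \<open>S2\<close> is then available almost everywhere.\<close>

definition sphere_prob :: "(real ^ 3) measure" where
  "sphere_prob = distr (uniform_measure lborel (cball 0 1)) borel sgn"

lemma sgn_measurable [measurable]: "(sgn :: real ^ 3 \<Rightarrow> real ^ 3) \<in> borel_measurable borel"
  unfolding sgn_div_norm[abs_def] by measurable

lemma open_lborel_pos:
  fixes U :: "(real ^ 3) set"
  assumes "open U" "x \<in> U"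
  shows "emeasure lborel U \<noteq> 0"
proof
  assume "emeasure lborel U = 0"
  then have "negligible U"
    using assms by (simp add: negligible_iff_emeasure0)
  with open_not_negligible[OF assms(1)] assms(2) show False by auto
qed

lemma cball_measure: "emeasure lborel (cball 0 1 :: (real ^ 3) set) \<noteq> 0" "emeasure lborel (cball 0 1 :: (real ^ 3) set) \<noteq> \<infinity>"
proof -
  have "emeasure lborel (ball 0 1 :: (real ^ 3) set) \<noteq> 0"
    by (rule open_lborel_pos[where x = 0]) auto
  moreover have "emeasure lborel (ball 0 1 :: (real ^ 3) set) \<le> emeasure lborel (cball 0 1 :: (real ^ 3) set)"
    by (intro emeasure_mono) auto
  ultimately show "emeasure lborel (cball 0 1 :: (real ^ 3) set) \<noteq> 0" by auto
  show "emeasure lborel (cball 0 1 :: (real ^ 3) set) \<noteq> \<infinity>"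
    using emeasure_bounded_finite[of "cball 0 1 :: (real ^ 3) set"] by auto
qed

lemma sets_sphere_prob [simp, measurable_cong]: "sets sphere_prob = sets borel"
  by (simp add: sphere_prob_def)

lemma space_sphere_prob [simp]: "space sphere_prob = UNIV"
  by (simp add: sphere_prob_def)

lemma emeasure_sphere_prob:
  assumes [measurable]: "A \<in> sets borel"
  shows "emeasure sphere_prob A =
    emeasure lborel (cball 0 1 \<inter> sgn -` A) / emeasure lborel (cball 0 1 :: (real ^ 3) set)"
proof -
  have *: "sgn -` A \<in> sets borel" using measurable_sets_borel[OF sgn_measurable assms] .
  show ?thesis
    unfolding sphere_prob_def using *
    by (subst emeasure_distr) (auto simp: )
qed

interpretation sphere_prob: prob_space sphere_prob
  unfolding sphere_prob_def
  by (intro prob_space.prob_space_distr prob_space_uniform_measure) (use cball_measure in \<open>auto\<close>)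

lemma AE_sphere_prob: "AE x in sphere_prob. x \<in> S2"
proof -
  have "AE x in lborel. (x :: real ^ 3) \<noteq> 0"
    by (rule AE_I[where N = "{0}"]) auto
  then have "AE x in uniform_measure lborel (cball 0 1). (x :: real ^ 3) \<noteq> 0"
    by (intro AE_uniform_measureI) (auto elim: eventually_mono)
  then have "AE x in uniform_measure lborel (cball 0 1). sgn (x :: real ^ 3) \<in> S2"
    by eventually_elim (auto simp: norm_sgn)
  then show ?thesis unfolding sphere_prob_def
    by (subst AE_distr_iff) auto
qed

lemma sphere_prob_orthogonal:
  assumes T: "orthogonal_transformation T"
  shows "distr sphere_prob borel T = sphere_prob"
proof -
  have Tm[measurable]: "T \<in> borel_measurable borel"
    using T by (intro borel_measurable_continuous_onI linear_continuous_on linear_linear[THEN iffD2])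
      (simp add: orthogonal_transformation_linear)
  have lin: "linear T" using T by (simp add: orthogonal_transformation_linear)
  have nT: "norm (T x) = norm x" for x using T by (simp add: orthogonal_transformation)
  have sgnT: "sgn (T x) = T (sgn x)" for x
    by (simp add: sgn_div_norm nT linear_cmul[OF lin])
  show ?thesis
  proof (rule measure_eqI)
    fix A assume "A \<in> sets (distr sphere_prob borel T)"
    then have [measurable]: "A \<in> sets borel" by simp
    have TA[measurable]: "T -` A \<in> sets borel" using measurable_sets_borel[OF Tm, of A] by simp
    have sA[measurable]: "sgn -` A \<in> sets borel" using measurable_sets_borel[OF sgn_measurable, of A] by simp
    have "cball 0 1 \<inter> sgn -` (T -` A) = T -` (cball 0 1 \<inter> sgn -` A)"
      by (auto simp: nT sgnT)
    moreover have "emeasure lborel (T -` (cball 0 1 \<inter> sgn -` A)) = emeasure (distr lborel borel T) (cball 0 1 \<inter> sgn -` A)"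
      by (subst emeasure_distr) auto
    ultimately show "emeasure (distr sphere_prob borel T) A = emeasure sphere_prob A"
      by (simp add: emeasure_distr emeasure_sphere_prob distr_lborel_orthogonal[OF T])
  qed simp
qed

text \<open>The cone over U contains a nonempty open subset of the ball: the point halfway between
  the origin and x has a neighbourhood in it.\<close>

lemma sphere_prob_open_pos:
  assumes U: "open U" and x: "x \<in> U" "x \<in> S2"
  shows "emeasure sphere_prob U > 0"
proof -
  have cont: "continuous_on (- {0}) (sgn :: real ^ 3 \<Rightarrow> real ^ 3)"
    unfolding sgn_div_norm[abs_def] by (intro continuous_intros) auto
  have "open (- {0} \<inter> sgn -` U)"
    using continuous_open_preimage[OF cont _ U] by auto
  then have op: "open (ball 0 1 \<inter> (- {0} \<inter> sgn -` U))" by auto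
  have "sgn ((1 / 2) *\<^sub>R x) = x" using x by (simp add: sgn_div_norm)
  then have "(1 / 2) *\<^sub>R x \<in> ball 0 1 \<inter> (- {0} \<inter> sgn -` U)" using x by auto
  then have "emeasure lborel (ball 0 1 \<inter> (- {0} \<inter> sgn -` U)) \<noteq> 0"
    by (rule open_lborel_pos[OF op])
  moreover have "emeasure lborel (ball 0 1 \<inter> (- {0} \<inter> sgn -` U)) \<le> emeasure lborel (cball 0 1 \<inter> sgn -` U)"
    by (intro emeasure_mono) (use measurable_sets_borel[OF sgn_measurable borel_open[OF U]] in auto)
  ultimately have "emeasure lborel (cball 0 1 \<inter> sgn -` U) \<noteq> 0" by auto
  then show ?thesis
    using cball_measure U by (subst emeasure_sphere_prob) (simp_all add: ennreal_zero_less_divide less_top[symmetric] zero_less_iff_neq_zero)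
qed

text \<open>The cone over a single point lies on a line, which has no volume.\<close>

lemma sphere_prob_point: "emeasure sphere_prob {p} = 0"
proof -
  have "emeasure lborel (cball 0 1 \<inter> sgn -` {p}) = 0"
  proof -
    have "cball 0 1 \<inter> sgn -` {p} \<subseteq> span {p}"
    proof
      fix x assume "x \<in> cball 0 1 \<inter> sgn -` {p}"
      then have "x = norm x *\<^sub>R p" by (cases "x = 0") (auto simp: sgn_div_norm)
      then show "x \<in> span {p}" by (metis insertI1 span_base span_scale)
    qed
    moreover have "negligible (span {p})"
      by (rule negligible_lowdim) (use dim_le_card'[of "{p}"] in \<open>simp add: dim_span\<close>)
    ultimately have "negligible (cball 0 1 \<inter> sgn -` {p})" by (rule negligible_subset[rotated])
    moreover have "cball 0 1 \<inter> sgn -` {p} \<in> sets lborel"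
      using measurable_sets_borel[OF sgn_measurable, of "{p}"] by auto
    ultimately show ?thesis
      by (simp add: negligible_iff_emeasure0)
  qed
  then show ?thesis by (simp add: emeasure_sphere_prob)
qed

lemma surface_measure_eq: "surface_measure = restrict_space sphere_prob S2"
  by (simp add: surface_measure_def sphere_prob_def)

section \<open>Coordinate rotations and their generators\<close>

definition vec3 :: "real \<Rightarrow> real \<Rightarrow> real \<Rightarrow> real ^ 3" where
  "vec3 a b c = vector [a, b, c]"

lemma vec3_nth [simp]: "vec3 a b c $ 1 = a" "vec3 a b c $ 2 = b" "vec3 a b c $ 3 = c"
  by (simp_all add: vec3_def)

definition rot_x :: "real \<Rightarrow> real ^ 3 \<Rightarrow> real ^ 3" where
  "rot_x t x = vec3 (x $ 1) (cos t * x $ 2 - sin t * x $ 3) (sin t * x $ 2 + cos t * x $ 3)"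

definition rot_y :: "real \<Rightarrow> real ^ 3 \<Rightarrow> real ^ 3" where
  "rot_y t x = vec3 (cos t * x $ 1 + sin t * x $ 3) (x $ 2) (cos t * x $ 3 - sin t * x $ 1)"

definition rot_z :: "real \<Rightarrow> real ^ 3 \<Rightarrow> real ^ 3" where
  "rot_z t x = vec3 (cos t * x $ 1 - sin t * x $ 2) (sin t * x $ 1 + cos t * x $ 2) (x $ 3)"

definition rot :: "3 \<Rightarrow> real \<Rightarrow> real ^ 3 \<Rightarrow> real ^ 3" where
  "rot i = (if i = 1 then rot_x else if i = 2 then rot_y else rot_z)"

lemmas rot_defs = rot_def rot_x_def rot_y_def rot_z_def

text \<open>The cross product of the i-th basis vector with x, which is the velocity of the orbit of
  x under \<open>rot i\<close>.\<close>

definition rotgen :: "3 \<Rightarrow> real ^ 3 \<Rightarrow> real ^ 3" where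
  "rotgen i = (if i = 1 then (\<lambda>x. vec3 0 (- x $ 3) (x $ 2))
     else if i = 2 then (\<lambda>x. vec3 (x $ 3) 0 (- x $ 1))
     else (\<lambda>x. vec3 (- x $ 2) (x $ 1) 0))"

lemma vec3_eq_iff: "(x :: real ^ 3) = y \<longleftrightarrow> x $ 1 = y $ 1 \<and> x $ 2 = y $ 2 \<and> x $ 3 = y $ 3"
  by (simp add: vec_eq_iff forall_3)

lemma rot_0 [simp]: "rot i 0 x = x"
  by (simp add: rot_defs vec3_eq_iff)

lemma rot_2pi [simp]: "rot i (2 * pi) x = x"
  by (simp add: rot_defs vec3_eq_iff)

lemma rot_add: "rot i (s + t) x = rot i s (rot i t x)"
  by (simp add: rot_defs vec3_eq_iff cos_add sin_add algebra_simps)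

lemma plane_rot_inner:
  fixes c :: real
  assumes "c\<^sup>2 + s\<^sup>2 = 1"
  shows "(c * a - s * b) * (c * d - s * e) + (s * a + c * b) * (s * d + c * e) = a * d + b * e"
proof -
  have "(c * a - s * b) * (c * d - s * e) + (s * a + c * b) * (s * d + c * e) = (c\<^sup>2 + s\<^sup>2) * (a * d + b * e)"
    by (simp add: power2_eq_square algebra_simps)
  then show ?thesis by (simp add: assms)
qed

lemma rot_inner: "rot i t x \<bullet> rot i t y = x \<bullet> y"
proof -
  have cs: "(cos t)\<^sup>2 + (sin t)\<^sup>2 = 1" by simp
  show ?thesis
    using plane_rot_inner[OF cs, of "x $ 2" "x $ 3" "y $ 2" "y $ 3"]
      plane_rot_inner[OF cs, of "x $ 3" "x $ 1" "y $ 3" "y $ 1"]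
      plane_rot_inner[OF cs, of "x $ 1" "x $ 2" "y $ 1" "y $ 2"]
    by (simp add: rot_defs inner_3 algebra_simps)
qed

lemma rot_orthogonal: "orthogonal_transformation (rot i t)"
proof -
  have "linear (rot i t)"
    by (rule linearI) (simp_all add: rot_defs vec3_eq_iff algebra_simps)
  then show ?thesis by (simp add: orthogonal_transformation_def rot_inner)
qed

lemma norm_rot [simp]: "norm (rot i t x) = norm x"
  by (simp add: norm_eq_sqrt_inner rot_inner)

lemma rot_inner_deriv:
  "((\<lambda>t. rot i t x \<bullet> y) has_real_derivative rotgen i (rot i t x) \<bullet> y) (at t)"
  unfolding rot_defs rotgen_def inner_3
  by (auto intro!: derivative_eq_intros simp: algebra_simps)

lemma rotgen_inner_deriv:
  "((\<lambda>t. rotgen i (rot i t x) \<bullet> y) has_real_derivative rotgen i (rotgen i (rot i t x)) \<bullet> y) (at t)"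
  unfolding rot_defs rotgen_def inner_3
  by (auto intro!: derivative_eq_intros simp: algebra_simps)

text \<open>Lagrange's identity: the i-th inner product is the i-th coordinate of the cross product
  of x and y.\<close>

lemma rotgen_sum_sq: "(\<Sum>i\<in>UNIV. (rotgen i x \<bullet> y)\<^sup>2) = (x \<bullet> x) * (y \<bullet> y) - (x \<bullet> y)\<^sup>2"
  by (simp add: sum_3 rotgen_def inner_3 power2_eq_square algebra_simps)

text \<open>Linear functions are eigenfunctions of the Laplacian on the sphere, with eigenvalue
  -2.\<close>

lemma rotgen_sum_twice: "(\<Sum>i\<in>UNIV. rotgen i (rotgen i x) \<bullet> y) = - 2 * (x \<bullet> y)"
  by (simp add: sum_3 rotgen_def inner_3 algebra_simps)

lemma continuous_on_rot: "continuous_on UNIV (\<lambda>p. rot i (fst p) (snd p))"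
  by (rule continuous_on_vec3) (auto simp: rot_defs intro!: continuous_intros)

lemma rot_measurable [measurable]:
  assumes [measurable]: "f \<in> borel_measurable M" "g \<in> borel_measurable M"
  shows "(\<lambda>x. rot i (f x) (g x)) \<in> borel_measurable M"
proof -
  have "(\<lambda>p. rot i (fst p) (snd p)) \<in> borel_measurable borel"
    using continuous_on_rot by (rule borel_measurable_continuous_onI)
  then have *: "(\<lambda>p. rot i (fst p) (snd p)) \<in> borel_measurable (borel \<Otimes>\<^sub>M borel)"
    by (simp only: borel_prod)
  have "(\<lambda>x. (f x, g x)) \<in> M \<rightarrow>\<^sub>M borel \<Otimes>\<^sub>M borel" by measurable
  from measurable_compose[OF this *] show ?thesis by simp
qed

lemma rotgen_measurable [measurable]:
  assumes [measurable]: "f \<in> borel_measurable M"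
  shows "(\<lambda>x. rotgen i (f x)) \<in> borel_measurable M"
proof -
  have "continuous_on UNIV (rotgen i)"
    by (rule continuous_on_vec3) (auto simp: rotgen_def intro!: continuous_intros)
  from measurable_compose[OF assms borel_measurable_continuous_onI[OF this]] show ?thesis .
qed

lemma integral_sphere_prob_rot:
  fixes g :: "real ^ 3 \<Rightarrow> real"
  assumes [measurable]: "g \<in> borel_measurable borel"
  shows "(\<integral>x. g (rot i t x) \<partial>sphere_prob) = (\<integral>x. g x \<partial>sphere_prob)"
proof -
  have "(\<integral>x. g x \<partial>sphere_prob) = (\<integral>x. g x \<partial>distr sphere_prob borel (rot i t))"
    by (simp add: sphere_prob_orthogonal[OF rot_orthogonal])
  also have "\<dots> = (\<integral>x. g (rot i t x) \<partial>sphere_prob)"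
    by (rule integral_distr) auto
  finally show ?thesis ..
qed

text \<open>By invariance the integral of g equals that of g composed with any rotation, hence, by
  Fubini, the integral of the averages of g over the orbits.\<close>

lemma rotation_average_zero:
  fixes g :: "real ^ 3 \<Rightarrow> real"
  assumes g[measurable]: "g \<in> borel_measurable borel" and bd: "\<And>x. x \<in> S2 \<Longrightarrow> \<bar>g x\<bar> \<le> B"
    and zero: "AE x in sphere_prob. ((\<lambda>t. g (rot i t x)) has_integral 0) {0..2 * pi}"
  shows "(\<integral>x. g x \<partial>sphere_prob) = 0"
proof -
  have bd': "\<bar>g x\<bar> \<le> B" if "norm x = 1" for x using bd that by simp
  let ?L = "restrict_space lborel {0..2 * pi} :: real measure"
  have L: "emeasure ?L (space ?L) = ennreal (2 * pi)"
    by (simp add: emeasure_restrict_space)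
  interpret L: finite_measure ?L by (rule finite_measureI) (simp only: L ennreal_neq_top infinity_ennreal_def not_False_eq_True)
  interpret P: pair_sigma_finite sphere_prob ?L ..
  interpret F: finite_measure "sphere_prob \<Otimes>\<^sub>M ?L"
    by (rule finite_measure_pair_measure) unfold_locales
  have fm: "(\<lambda>p. fst p) \<in> borel_measurable (sphere_prob \<Otimes>\<^sub>M ?L)" "(\<lambda>p. snd p) \<in> borel_measurable (sphere_prob \<Otimes>\<^sub>M ?L)"
  proof -
    have "(\<lambda>x. x) \<in> borel_measurable ?L" by (rule measurable_restrict_space1) simp
    from measurable_compose[OF measurable_snd this] show "(\<lambda>p. snd p) \<in> borel_measurable (sphere_prob \<Otimes>\<^sub>M ?L)" .
    show "(\<lambda>p. fst p) \<in> borel_measurable (sphere_prob \<Otimes>\<^sub>M ?L)"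
      using measurable_fst[of sphere_prob ?L] by (simp cong: measurable_cong_sets)
  qed
  note [measurable] = fm
  have int: "integrable (sphere_prob \<Otimes>\<^sub>M ?L) (\<lambda>p. g (rot i (snd p) (fst p)))"
  proof (rule F.integrable_const_bound[where B = B])
    have "AE x in sphere_prob. AE t in ?L. norm (g (rot i (snd (x, t)) (fst (x, t)))) \<le> B"
      using AE_sphere_prob by eventually_elim (auto simp: bd')
    then show "AE p in sphere_prob \<Otimes>\<^sub>M ?L. norm (g (rot i (snd p) (fst p))) \<le> B"
      by (rule P.AE_pair_measure[rotated]) measurable
  qed measurable
  have "(\<integral>x. \<integral>t. g (rot i t x) \<partial>?L \<partial>sphere_prob) = (\<integral>t. \<integral>x. g (rot i t x) \<partial>sphere_prob \<partial>?L)"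
    using P.Fubini_integral[of "\<lambda>x t. g (rot i t x)"] int by (simp add: case_prod_beta')
  also have "\<dots> = 2 * pi * (\<integral>x. g x \<partial>sphere_prob)"
    using L by (simp add: integral_sphere_prob_rot measure_def)
  also have "(\<integral>x. \<integral>t. g (rot i t x) \<partial>?L \<partial>sphere_prob) = (\<integral>x. 0 \<partial>sphere_prob)"
  proof (rule integral_cong_AE)
    show "AE x in sphere_prob. (\<integral>t. g (rot i t x) \<partial>?L) = 0"
      using zero AE_sphere_prob
    proof eventually_elim
      case (elim x)
      have set_int: "set_integrable lborel {0..2 * pi} (\<lambda>t. g (rot i t x))"
        unfolding set_integrable_def
      proof (rule integrableI_bounded_set_indicator[where B = B])
        show "AE t in lborel. t \<in> {0..2 * pi} \<longrightarrow> norm (g (rot i t x)) \<le> B"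
          using elim by (auto simp: bd')
      qed (auto simp: emeasure_lborel_Icc_eq)
      have "(\<integral>t. g (rot i t x) \<partial>?L) = (LINT t:{0..2 * pi}|lborel. g (rot i t x))"
        by (subst integral_restrict_space) (auto simp: set_lebesgue_integral_def)
      also have "\<dots> = integral {0..2 * pi} (\<lambda>t. g (rot i t x))"
        by (rule set_borel_integral_eq_integral(2)[OF set_int])
      also have "\<dots> = 0" using elim(1) by (rule integral_unique)
      finally show ?case .
    qed
    have "(\<lambda>p. g (rot i (snd p) (fst p))) \<in> borel_measurable (sphere_prob \<Otimes>\<^sub>M ?L)" by measurable
    then have "(\<lambda>(x, t). g (rot i t x)) \<in> borel_measurable (sphere_prob \<Otimes>\<^sub>M ?L)"
      by (simp add: case_prod_beta')
    then show "(\<lambda>x. \<integral>t. g (rot i t x) \<partial>?L) \<in> borel_measurable sphere_prob"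
      by (rule L.borel_measurable_lebesgue_integral)
  qed simp
  finally show ?thesis by simp
qed

definition trig2 :: "(real \<Rightarrow> real) \<Rightarrow> bool" where
  "trig2 F \<longleftrightarrow> (\<exists>a0 a1 a2 a3 a4. \<forall>t. F t = a0 + a1 * cos t + a2 * sin t + a3 * (cos t)\<^sup>2 + a4 * (cos t * sin t))"

text \<open>A trigonometric polynomial of degree two is, up to a factor without zeros, a polynomial
  of degree at most four in \<open>cis t\<close>, and \<open>cis\<close> is injective on a half-open
  period.\<close>

lemma trig2_zeros:
  assumes F: "trig2 F" and nz: "F t0 \<noteq> 0"
  shows "finite {t \<in> {0..2 * pi}. F t = 0}"
proof -
  obtain a0 a1 a2 a3 a4 where F: "\<And>t. F t = a0 + a1 * cos t + a2 * sin t + a3 * (cos t)\<^sup>2 + a4 * (cos t * sin t)"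
    using F unfolding trig2_def by blast
  \<comment> \<open>With c = cis t, insert (c + 1 / c) / 2 for the cosine and (c - 1 / c) / (2 * i)
    for the sine, and multiply by 4 * c^2.\<close>
  define p where "p = [: Complex a3 a4, Complex (2 * a1) (2 * a2), Complex (4 * a0 + 2 * a3) 0,
      Complex (2 * a1) (- 2 * a2), Complex a3 (- a4) :]"
  have p: "poly p (cis t) = 4 * (cis t)\<^sup>2 * of_real (F t)" for t
  proof -
    have "(sin t)\<^sup>2 = 1 - (cos t)\<^sup>2" by (simp add: sin_squared_eq)
    then show ?thesis
      unfolding p_def F
      by (simp add: complex_eq_iff power2_eq_square) algebra
  qed
  have "p \<noteq> 0"
  proof
    assume "p = 0"
    with p[of t0] nz show False by simp
  qed
  then have fin: "finite {z. poly p z = 0}" by (rule poly_roots_finite)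
  have "cis ` {t \<in> {0..<2 * pi}. F t = 0} \<subseteq> {z. poly p z = 0}"
    by (auto simp: p)
  then have "finite (cis ` {t \<in> {0..<2 * pi}. F t = 0})" using fin by (rule finite_subset)
  moreover have "inj_on cis {t \<in> {0..<2 * pi}. F t = 0}"
  proof (rule inj_onI)
    fix s t assume st: "s \<in> {t \<in> {0..<2 * pi}. F t = 0}" "t \<in> {t \<in> {0..<2 * pi}. F t = 0}" "cis s = cis t"
    then have "cos s = cos t" "sin s = sin t" by (auto simp: complex_eq_iff)
    then obtain n :: int where n: "s = t + 2 * pi * of_int n"
      using sin_cos_eq_iff[of s t] by blast
    have "\<bar>s - t\<bar> < 2 * pi" using st by auto
    then have "2 * pi * \<bar>of_int n :: real\<bar> < 2 * pi * 1" using n by (simp add: abs_mult)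
    then have "\<bar>of_int n :: real\<bar> < 1" by (simp only: mult_less_cancel_left_pos pi_gt_zero mult_pos_pos zero_less_numeral)
    then have "n = 0" by linarith
    with n show "s = t" by simp
  qed
  ultimately have "finite {t \<in> {0..<2 * pi}. F t = 0}" by (rule finite_imageD)
  then have "finite (insert (2 * pi) {t \<in> {0..<2 * pi}. F t = 0})" by simp
  moreover have "{t \<in> {0..2 * pi}. F t = 0} \<subseteq> insert (2 * pi) {t \<in> {0..<2 * pi}. F t = 0}" by auto
  ultimately show ?thesis by (rule finite_subset[rotated])
qed

section \<open>Green's formula on the sphere\<close>

text \<open>Only the pure second derivatives along the three rotations are recorded, because the
  Laplacian is their sum and no mixed derivative occurs in Green's formula.\<close>

definition rot_C2_at :: "(real ^ 3 \<Rightarrow> real) \<Rightarrow> (3 \<Rightarrow> real ^ 3 \<Rightarrow> real) \<Rightarrow> (3 \<Rightarrow> real ^ 3 \<Rightarrow> real) \<Rightarrow> real ^ 3 \<Rightarrow> bool" where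
  "rot_C2_at H H1 H2 x \<longleftrightarrow> (\<forall>i. ((\<lambda>t. H (rot i t x)) has_real_derivative H1 i x) (at 0) \<and>
     ((\<lambda>t. H1 i (rot i t x)) has_real_derivative H2 i x) (at 0))"

lemma rot_shift_deriv:
  assumes "((\<lambda>s. H (rot i s (rot i t x))) has_real_derivative D) (at 0)"
  shows "((\<lambda>s. H (rot i s x)) has_real_derivative D) (at t)"
proof -
  have "((\<lambda>s. H (rot i s x)) has_real_derivative D) (at (0 + t))"
    by (subst DERIV_shift) (use assms in \<open>simp add: rot_add\<close>)
  then show ?thesis by simp
qed

lemma rot_C2_atD:
  assumes "rot_C2_at H H1 H2 (rot i t x)"
  shows "((\<lambda>s. H (rot i s x)) has_real_derivative H1 i (rot i t x)) (at t)"
    and "((\<lambda>s. H1 i (rot i s x)) has_real_derivative H2 i (rot i t x)) (at t)"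
proof -
  have *: "((\<lambda>s. H (rot i s (rot i t x))) has_real_derivative H1 i (rot i t x)) (at 0)"
    "((\<lambda>s. H1 i (rot i s (rot i t x))) has_real_derivative H2 i (rot i t x)) (at 0)"
    using assms unfolding rot_C2_at_def by blast+
  show "((\<lambda>s. H (rot i s x)) has_real_derivative H1 i (rot i t x)) (at t)"
    by (rule rot_shift_deriv[of H i t x, OF *(1)])
  show "((\<lambda>s. H1 i (rot i s x)) has_real_derivative H2 i (rot i t x)) (at t)"
    by (rule rot_shift_deriv[of "H1 i" i t x, OF *(2)])
qed

lemma isCont_If:
  fixes f g :: "real \<Rightarrow> real"
  assumes "isCont f t" "isCont g t" "f t = g t"
  shows "isCont (\<lambda>s. if P s then f s else g s) t"
  unfolding isCont_def
proof (rule tendstoI)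
  fix e :: real assume e: "e > 0"
  have "\<forall>\<^sub>F s in at t. dist (f s) (f t) < e" "\<forall>\<^sub>F s in at t. dist (g s) (g t) < e"
    using assms(1,2) e by (auto simp: isCont_def tendsto_iff)
  then show "\<forall>\<^sub>F s in at t. dist (if P s then f s else g s) (if P t then f t else g t) < e"
    by eventually_elim (use assms(3) in auto)
qed

text \<open>Along an orbit the integrand is the derivative of the Wronskian of L and h. The
  Wronskian involves only h and its first derivative, so it is continuous across the interface
  \<open>q = 0\<close>, and it returns to its initial value after a full turn.\<close>

lemma rotational_green_component:
  fixes q :: "real ^ 3 \<Rightarrow> real" and i :: 3
  assumes qc: "continuous_on UNIV q" and qf: "AE x in sphere_prob. finite {t \<in> {0..2 * pi}. q (rot i t x) = 0}"
    and A: "\<And>x. x \<in> S2 \<Longrightarrow> q x \<le> 0 \<Longrightarrow> rot_C2_at HA HA1 HA2 x"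
    and B: "\<And>x. x \<in> S2 \<Longrightarrow> q x \<ge> 0 \<Longrightarrow> rot_C2_at HB HB1 HB2 x"
    and AB: "\<And>x. x \<in> S2 \<Longrightarrow> q x = 0 \<Longrightarrow> HA x = HB x \<and> HA1 i x = HB1 i x"
    and h: "\<And>x. h x = (if q x \<le> 0 then HA x else HB x)"
    and h2: "\<And>x. h2 x = (if q x \<le> 0 then HA2 i x else HB2 i x)"
    and hm[measurable]: "h \<in> borel_measurable borel" "h2 \<in> borel_measurable borel"
    and hb: "\<And>x. x \<in> S2 \<Longrightarrow> \<bar>h x\<bar> \<le> K" "\<And>x. x \<in> S2 \<Longrightarrow> \<bar>h2 x\<bar> \<le> K"
    and L: "\<And>x. x \<in> S2 \<Longrightarrow> rot_C2_at L L1 L2 x"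
    and Lm[measurable]: "L \<in> borel_measurable borel" "L2 i \<in> borel_measurable borel"
    and Lb: "\<And>x. x \<in> S2 \<Longrightarrow> \<bar>L x\<bar> \<le> M" "\<And>x. x \<in> S2 \<Longrightarrow> \<bar>L2 i x\<bar> \<le> M"
  shows "(\<integral>x. L x * h2 x - h x * L2 i x \<partial>sphere_prob) = 0"
proof (rule rotation_average_zero[where i = i and B = "M * K + K * M"])
  show "(\<lambda>x. L x * h2 x - h x * L2 i x) \<in> borel_measurable borel" by measurable
  show "\<bar>L x * h2 x - h x * L2 i x\<bar> \<le> M * K + K * M" if "x \<in> S2" for x
  proof -
    have "\<bar>L x * h2 x\<bar> \<le> M * K" "\<bar>h x * L2 i x\<bar> \<le> K * M"
      unfolding abs_mult using hb[OF that] Lb[OF that] by (intro mult_mono; linarith)+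
    then show ?thesis by linarith
  qed
  show "AE x in sphere_prob. ((\<lambda>t. L (rot i t x) * h2 (rot i t x) - h (rot i t x) * L2 i (rot i t x)) has_integral 0) {0..2 * pi}"
    using AE_sphere_prob qf
  proof eventually_elim
    case (elim x)
    have S: "rot i t x \<in> S2" for t using elim(1) by simp
    define F where "F P P1 t = L (rot i t x) * P1 i (rot i t x) - P (rot i t x) * L1 i (rot i t x)"
      for P :: "real ^ 3 \<Rightarrow> real" and P1 :: "3 \<Rightarrow> real ^ 3 \<Rightarrow> real" and t
    have Fd: "(F P P1 has_real_derivative L (rot i t x) * P2 i (rot i t x) - P (rot i t x) * L2 i (rot i t x)) (at t)"
      if "rot_C2_at P P1 P2 (rot i t x)" for P P1 P2 t
      unfolding F_def using rot_C2_atD[OF that] rot_C2_atD[OF L[OF S]]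
      by (auto intro!: derivative_eq_intros simp: algebra_simps)
    define f where "f t = (if q (rot i t x) \<le> 0 then F HA HA1 t else F HB HB1 t)" for t
    have qi: "continuous_on UNIV (\<lambda>t. q (rot i t x))"
    proof -
      have "continuous_on UNIV (\<lambda>t. (t, x))" by (intro continuous_intros)
      from continuous_on_compose2[OF continuous_on_rot[of i] this]
      have "continuous_on UNIV (\<lambda>t. rot i t x)" by simp
      from continuous_on_compose2[OF qc this] show ?thesis by simp
    qed
    have Z: "finite {t \<in> {0..2 * pi}. q (rot i t x) = 0}"
      by (rule elim(2))
    have d: "(f has_real_derivative L (rot i t x) * h2 (rot i t x) - h (rot i t x) * L2 i (rot i t x)) (at t)"
      if "q (rot i t x) \<noteq> 0" for t
    proof (cases "q (rot i t x) < 0")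
      case True
      have ev: "\<forall>\<^sub>F s in nhds t. q (rot i s x) < 0"
        using eventually_nhds_in_open[OF open_Collect_less[OF qi continuous_on_const], of t 0] True by simp
      have "(F HA HA1 has_real_derivative L (rot i t x) * HA2 i (rot i t x) - HA (rot i t x) * L2 i (rot i t x)) (at t)"
        by (rule Fd) (use A S True in auto)
      then show ?thesis
        unfolding h h2 using True
        by (subst DERIV_cong_ev[OF refl _ refl, of f "F HA HA1"])
           (use ev in \<open>auto elim!: eventually_mono simp: f_def\<close>)
    next
      case False
      then have pos: "q (rot i t x) > 0" using that by auto
      have ev: "\<forall>\<^sub>F s in nhds t. q (rot i s x) > 0"
        using eventually_nhds_in_open[OF open_Collect_less[OF continuous_on_const qi], of t 0] pos by simp
      have "(F HB HB1 has_real_derivative L (rot i t x) * HB2 i (rot i t x) - HB (rot i t x) * L2 i (rot i t x)) (at t)"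
        by (rule Fd) (use B S pos in auto)
      then show ?thesis
        unfolding h h2 using pos
        by (subst DERIV_cong_ev[OF refl _ refl, of f "F HB HB1"])
           (use ev in \<open>auto elim!: eventually_mono simp: f_def\<close>)
    qed
    have c: "isCont f t" for t
    proof (cases "q (rot i t x) = 0")
      case False
      then show ?thesis using DERIV_isCont d by blast
    next
      case True
      show ?thesis unfolding f_def
      proof (rule isCont_If)
        show "isCont (F HA HA1) t" "isCont (F HB HB1) t"
          using DERIV_isCont[OF Fd[OF A[OF S]]] DERIV_isCont[OF Fd[OF B[OF S]]] True by simp_all
        show "F HA HA1 t = F HB HB1 t" using AB[OF S True] by (simp add: F_def)
      qed
    qed
    \<comment> \<open>At crossings of the interface the Wronskian is continuous but perhaps not
      differentiable. There are finitely many, which this form of the fundamental theorem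
      tolerates.\<close>
    have "((\<lambda>t. L (rot i t x) * h2 (rot i t x) - h (rot i t x) * L2 i (rot i t x)) has_integral f (2 * pi) - f 0) {0..2 * pi}"
    proof (rule fundamental_theorem_of_calculus_interior_strong[OF Z])
      show "continuous_on {0..2 * pi} f" using c by (simp add: continuous_at_imp_continuous_on)
    qed (use d in \<open>auto simp: has_real_derivative_iff_has_vector_derivative[symmetric]\<close>)
    moreover have "f (2 * pi) = f 0" by (simp add: f_def F_def)
    ultimately show ?case by simp
  qed
qed

section \<open>Logarithmic kernels with the singularity moved off the sphere\<close>

definition kern :: "real \<Rightarrow> real ^ 3 \<Rightarrow> real ^ 3 \<Rightarrow> real" where
  "kern \<kappa> y x = - ln (\<kappa> - x \<bullet> y) / 2"

definition kern1 :: "real \<Rightarrow> real ^ 3 \<Rightarrow> 3 \<Rightarrow> real ^ 3 \<Rightarrow> real" where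
  "kern1 \<kappa> y i x = rotgen i x \<bullet> y / (\<kappa> - x \<bullet> y) / 2"

definition kern2 :: "real \<Rightarrow> real ^ 3 \<Rightarrow> 3 \<Rightarrow> real ^ 3 \<Rightarrow> real" where
  "kern2 \<kappa> y i x = (rotgen i (rotgen i x) \<bullet> y / (\<kappa> - x \<bullet> y) + (rotgen i x \<bullet> y)\<^sup>2 / (\<kappa> - x \<bullet> y)\<^sup>2) / 2"

lemma kern_1: "kern 1 y x = skern x y"
  by (simp add: kern_def skern_def)

lemma kern_C2:
  assumes "x \<bullet> y < \<kappa>"
  shows "rot_C2_at (kern \<kappa> y) (kern1 \<kappa> y) (kern2 \<kappa> y) x"
  unfolding rot_C2_at_def
proof (intro allI conjI)
  fix i
  have d: "((\<lambda>t. rot i t x \<bullet> y) has_real_derivative rotgen i x \<bullet> y) (at 0)"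
      "((\<lambda>t. rotgen i (rot i t x) \<bullet> y) has_real_derivative rotgen i (rotgen i x) \<bullet> y) (at 0)"
    using rot_inner_deriv[of i x y 0] rotgen_inner_deriv[of i x y 0] by simp_all
  show "((\<lambda>t. kern \<kappa> y (rot i t x)) has_real_derivative kern1 \<kappa> y i x) (at 0)"
    unfolding kern_def kern1_def using assms
    by (auto intro!: derivative_eq_intros d simp: field_simps)
  show "((\<lambda>t. kern1 \<kappa> y i (rot i t x)) has_real_derivative kern2 \<kappa> y i x) (at 0)"
  proof -
    define w where "w = \<kappa> - x \<bullet> y"
    have w: "w \<noteq> 0" using assms by (simp add: w_def)
    have "((\<lambda>t. rotgen i (rot i t x) \<bullet> y / (\<kappa> - rot i t x \<bullet> y) / 2) has_real_derivative
        ((rotgen i (rotgen i x) \<bullet> y) * w - (rotgen i x \<bullet> y) * (0 - rotgen i x \<bullet> y)) / (w * w) / 2) (at 0)"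
      unfolding w_def
      by (rule DERIV_cong[OF DERIV_cdivide[OF DERIV_divide[OF d(2) DERIV_diff[OF DERIV_const d(1)]]]])
         (use assms in auto)
    moreover have "((rotgen i (rotgen i x) \<bullet> y) * w - (rotgen i x \<bullet> y) * (0 - rotgen i x \<bullet> y)) / (w * w) / 2 = kern2 \<kappa> y i x"
      unfolding kern2_def w_def[symmetric] using w by (simp add: field_simps power2_eq_square)
    ultimately show ?thesis unfolding kern1_def by simp
  qed
qed

text \<open>Lagrange's identity and the eigenvalue -2 reduce the Laplacian to a function of the
  inner product. At \<kappa> = 1 it is the constant 1 / 2, which balances the point charge at y; for
  \<kappa> > 1 that charge is smeared out.\<close>

lemma kern2_sum:
  assumes "x \<in> S2" "y \<in> S2" "x \<bullet> y \<noteq> \<kappa>"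
  shows "(\<Sum>i\<in>UNIV. kern2 \<kappa> y i x) = 1 / 2 - (\<kappa>\<^sup>2 - 1) / (\<kappa> - x \<bullet> y)\<^sup>2 / 2"
proof -
  define s where "s = x \<bullet> y"
  have n: "x \<bullet> x = 1" "y \<bullet> y = 1" using assms by (auto simp: norm_eq_1)
  have "(\<Sum>i\<in>UNIV. kern2 \<kappa> y i x) =
      ((\<Sum>i\<in>UNIV. rotgen i (rotgen i x) \<bullet> y) / (\<kappa> - s) + (\<Sum>i\<in>UNIV. (rotgen i x \<bullet> y)\<^sup>2) / (\<kappa> - s)\<^sup>2) / 2"
    by (simp only: kern2_def s_def sum_divide_distrib sum.distrib[symmetric])
  also have "\<dots> = (- 2 * s / (\<kappa> - s) + (1 - s\<^sup>2) / (\<kappa> - s)\<^sup>2) / 2"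
    unfolding rotgen_sum_twice rotgen_sum_sq n by (simp add: s_def)
  also have "\<dots> = 1 / 2 - (\<kappa>\<^sup>2 - 1) / (\<kappa> - s)\<^sup>2 / 2"
  proof -
    define w where "w = \<kappa> - s"
    have w: "w \<noteq> 0" "s = \<kappa> - w" using assms(3) by (auto simp: w_def s_def)
    show ?thesis unfolding w_def[symmetric] using w(1) by (simp add: w(2) field_simps power2_eq_square)
  qed
  finally show ?thesis unfolding s_def .
qed

lemma norm_rotgen_le: "norm (rotgen i x) \<le> norm x"
proof -
  have "rotgen i x \<bullet> rotgen i x \<le> x \<bullet> x"
    by (auto simp: rotgen_def inner_3)
  then show ?thesis by (simp add: norm_le)
qed

lemma kern_bounds:
  assumes "x \<in> S2" "y \<in> S2" "0 < d" "d \<le> \<kappa> - x \<bullet> y" "1 \<le> \<kappa>" "\<kappa> \<le> 2"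
  shows "\<bar>kern \<kappa> y x\<bar> \<le> \<bar>ln d\<bar> + ln 3" "\<bar>kern2 \<kappa> y i x\<bar> \<le> 1 / d + 1 / d\<^sup>2"
proof -
  have s: "\<bar>x \<bullet> y\<bar> \<le> 1" using assms abs_inner_S2 by blast
  have "ln d \<le> ln (\<kappa> - x \<bullet> y)" "ln (\<kappa> - x \<bullet> y) \<le> ln 3"
    using assms s by auto
  moreover have "0 \<le> ln (3 :: real)" by simp
  ultimately show "\<bar>kern \<kappa> y x\<bar> \<le> \<bar>ln d\<bar> + ln 3" unfolding kern_def by linarith
  have n: "norm x = 1" "norm y = 1" using assms by auto
  have "\<bar>rotgen i x \<bullet> y\<bar> \<le> 1 * 1"
    using Cauchy_Schwarz_ineq2[of "rotgen i x" y] norm_rotgen_le[of i x] n by simp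
  then have 1: "(rotgen i x \<bullet> y)\<^sup>2 \<le> 1" by (simp add: abs_square_le_1)
  have "norm (rotgen i (rotgen i x)) \<le> 1"
    using norm_rotgen_le[of i "rotgen i x"] norm_rotgen_le[of i x] n by simp
  then have 2: "\<bar>rotgen i (rotgen i x) \<bullet> y\<bar> \<le> 1"
    using Cauchy_Schwarz_ineq2[of "rotgen i (rotgen i x)" y] n by simp
  have "\<bar>rotgen i (rotgen i x) \<bullet> y / (\<kappa> - x \<bullet> y)\<bar> \<le> 1 / d"
    unfolding abs_divide using assms 2 by (intro frac_le) auto
  have "\<bar>(rotgen i x \<bullet> y)\<^sup>2 / (\<kappa> - x \<bullet> y)\<^sup>2\<bar> \<le> 1 / d\<^sup>2"
    unfolding abs_divide using assms 1 by (intro frac_le) (auto intro!: power_mono)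
  show "\<bar>kern2 \<kappa> y i x\<bar> \<le> 1 / d + 1 / d\<^sup>2"
  proof -
    have half: "\<bar>(u + v) / 2\<bar> \<le> p + r" if "\<bar>u\<bar> \<le> p" "\<bar>v\<bar> \<le> r" for u v p r :: real
      using that by (simp add: abs_le_iff)
    show ?thesis unfolding kern2_def
      by (rule half) fact+
  qed
qed

lemma kern_measurable [measurable]: "kern \<kappa> y \<in> borel_measurable borel" "kern2 \<kappa> y i \<in> borel_measurable borel"
  unfolding kern_def[abs_def] kern2_def[abs_def] by measurable

text \<open>The smeared point charge in the Laplacian of \<open>kern \<kappa> y\<close>. With
  \<kappa> = (1 + r^2) / (2 * r) it is the Jacobian of a conformal automorphism of the sphere; as
  \<kappa> tends to 1 its mass concentrates at y.\<close>

definition poisson3 :: "real \<Rightarrow> real ^ 3 \<Rightarrow> real ^ 3 \<Rightarrow> real" where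
  "poisson3 \<kappa> y x = (\<kappa>\<^sup>2 - 1) / (\<kappa> - x \<bullet> y)\<^sup>2"

text \<open>A continuously differentiable function glued from HA on \<open>q \<le> 0\<close> and HB
  on \<open>q \<ge> 0\<close>; the suffixes 1 and 2 mark first and second rotation derivatives.
  Since the first derivatives match on \<open>q = 0\<close>, the Laplacian is a bounded function
  without a part carried by the interface.\<close>

locale piecewise_rot_C2 =
  fixes q :: "real ^ 3 \<Rightarrow> real" and HA HB :: "real ^ 3 \<Rightarrow> real"
    and HA1 HA2 HB1 HB2 :: "3 \<Rightarrow> real ^ 3 \<Rightarrow> real" and K :: real
  assumes qc: "continuous_on UNIV q" and qf: "\<And>i. AE x in sphere_prob. finite {t \<in> {0..2 * pi}. q (rot i t x) = 0}"
    and A: "\<And>x. x \<in> S2 \<Longrightarrow> q x \<le> 0 \<Longrightarrow> rot_C2_at HA HA1 HA2 x"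
    and B: "\<And>x. x \<in> S2 \<Longrightarrow> q x \<ge> 0 \<Longrightarrow> rot_C2_at HB HB1 HB2 x"
    and AB: "\<And>x i. x \<in> S2 \<Longrightarrow> q x = 0 \<Longrightarrow> HA x = HB x \<and> HA1 i x = HB1 i x"
    and meas[measurable]: "HA \<in> borel_measurable borel" "HB \<in> borel_measurable borel"
      "\<And>i. HA2 i \<in> borel_measurable borel" "\<And>i. HB2 i \<in> borel_measurable borel"
    and bdA: "\<And>x. x \<in> S2 \<Longrightarrow> q x \<le> 0 \<Longrightarrow> \<bar>HA x\<bar> \<le> K" "\<And>x i. x \<in> S2 \<Longrightarrow> q x \<le> 0 \<Longrightarrow> \<bar>HA2 i x\<bar> \<le> K"
    and bdB: "\<And>x. x \<in> S2 \<Longrightarrow> q x \<ge> 0 \<Longrightarrow> \<bar>HB x\<bar> \<le> K" "\<And>x i. x \<in> S2 \<Longrightarrow> q x \<ge> 0 \<Longrightarrow> \<bar>HB2 i x\<bar> \<le> K"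
begin

definition h :: "real ^ 3 \<Rightarrow> real" where
  "h x = (if q x \<le> 0 then HA x else HB x)"

definition lap :: "real ^ 3 \<Rightarrow> real" where
  "lap x = (if q x \<le> 0 then \<Sum>i\<in>UNIV. HA2 i x else \<Sum>i\<in>UNIV. HB2 i x)"

lemma q_measurable [measurable]: "q \<in> borel_measurable borel"
  using qc by (rule borel_measurable_continuous_onI)

lemma h_measurable [measurable]: "h \<in> borel_measurable borel"
  unfolding h_def[abs_def] by measurable

lemma lap_measurable [measurable]: "lap \<in> borel_measurable borel"
  unfolding lap_def[abs_def] by measurable

lemma h_bound: "x \<in> S2 \<Longrightarrow> \<bar>h x\<bar> \<le> K"
  using bdA(1)[of x] bdB(1)[of x] unfolding h_def by (cases "q x \<le> 0") auto

lemma lap_bound: "x \<in> S2 \<Longrightarrow> \<bar>lap x\<bar> \<le> 3 * K"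
  using bdA(2)[of x 1] bdA(2)[of x 2] bdA(2)[of x 3] bdB(2)[of x 1] bdB(2)[of x 2] bdB(2)[of x 3]
  unfolding lap_def sum_3 by (cases "q x \<le> 0") auto

lemma green:
  assumes L: "\<And>x. x \<in> S2 \<Longrightarrow> rot_C2_at L L1 L2 x"
    and Lm[measurable]: "L \<in> borel_measurable borel" "\<And>i. L2 i \<in> borel_measurable borel"
    and Lb: "\<And>x. x \<in> S2 \<Longrightarrow> \<bar>L x\<bar> \<le> M" "\<And>x i. x \<in> S2 \<Longrightarrow> \<bar>L2 i x\<bar> \<le> M"
  shows "(\<integral>x. L x * lap x \<partial>sphere_prob) = (\<integral>x. h x * (\<Sum>i\<in>UNIV. L2 i x) \<partial>sphere_prob)"
proof -
  define h2 where "h2 i x = (if q x \<le> 0 then HA2 i x else HB2 i x)" for i x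
  have [measurable]: "h2 i \<in> borel_measurable borel" for i unfolding h2_def[abs_def] by measurable
  have h2b: "\<bar>h2 i x\<bar> \<le> K" if "x \<in> S2" for i x
    using bdA(2)[OF that] bdB(2)[OF that] unfolding h2_def by (cases "q x \<le> 0") auto
  have int: "integrable sphere_prob (\<lambda>x. L x * h2 i x)" "integrable sphere_prob (\<lambda>x. h x * L2 i x)" for i
  proof -
    have "AE x in sphere_prob. norm (L x * h2 i x) \<le> M * K" "AE x in sphere_prob. norm (h x * L2 i x) \<le> K * M"
      using AE_sphere_prob unfolding real_norm_def abs_mult
      by (eventually_elim, intro mult_mono Lb h2b h_bound; fastforce intro: order_trans[OF abs_ge_zero] Lb(1) h_bound)+
    then show "integrable sphere_prob (\<lambda>x. L x * h2 i x)" "integrable sphere_prob (\<lambda>x. h x * L2 i x)"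
      by (intro sphere_prob.integrable_const_bound; measurable)+
  qed
  have 0: "(\<integral>x. L x * h2 i x \<partial>sphere_prob) = (\<integral>x. h x * L2 i x \<partial>sphere_prob)" for i
  proof -
    have "(\<integral>x. L x * h2 i x - h x * L2 i x \<partial>sphere_prob) = 0"
      by (rule rotational_green_component[OF qc qf A B AB h_def h2_def _ _ h_bound h2b L _ _ Lb]) simp_all
    then show ?thesis using int by simp
  qed
  have "(\<integral>x. L x * lap x \<partial>sphere_prob) = (\<integral>x. (\<Sum>i\<in>UNIV. L x * h2 i x) \<partial>sphere_prob)"
    by (rule Bochner_Integration.integral_cong) (auto simp: lap_def h2_def sum_distrib_left)
  also have "\<dots> = (\<Sum>i\<in>UNIV. \<integral>x. L x * h2 i x \<partial>sphere_prob)"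
    by (intro Bochner_Integration.integral_sum int)
  also have "\<dots> = (\<integral>x. (\<Sum>i\<in>UNIV. h x * L2 i x) \<partial>sphere_prob)"
    unfolding 0 by (intro Bochner_Integration.integral_sum[symmetric] int)
  finally show ?thesis by (simp add: sum_distrib_left)
qed

lemma green_kern:
  assumes y: "y \<in> S2" and k: "1 < \<kappa>" "\<kappa> \<le> 2"
  shows "(\<integral>x. kern \<kappa> y x * lap x \<partial>sphere_prob) = (\<integral>x. h x * (1 / 2 - poisson3 \<kappa> y x / 2) \<partial>sphere_prob)"
proof -
  define M where "M = max (\<bar>ln (\<kappa> - 1)\<bar> + ln 3) (1 / (\<kappa> - 1) + 1 / (\<kappa> - 1)\<^sup>2)"
  have d: "\<kappa> - 1 \<le> \<kappa> - x \<bullet> y" if "x \<in> S2" for x using abs_inner_S2[OF that y] by linarith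
  have "(\<integral>x. kern \<kappa> y x * lap x \<partial>sphere_prob) = (\<integral>x. h x * (\<Sum>i\<in>UNIV. kern2 \<kappa> y i x) \<partial>sphere_prob)"
  proof (rule green)
    fix x :: "real ^ 3" and i assume x: "x \<in> S2"
    show "\<bar>kern \<kappa> y x\<bar> \<le> M" "\<bar>kern2 \<kappa> y i x\<bar> \<le> M"
      using kern_bounds(1)[OF x y _ d[OF x]] kern_bounds(2)[OF x y _ d[OF x], of i] k unfolding M_def by auto
    show "rot_C2_at (kern \<kappa> y) (kern1 \<kappa> y) (kern2 \<kappa> y) x"
      by (rule kern_C2) (use d[OF x] k in linarith)
  qed auto
  also have "\<dots> = (\<integral>x. h x * (1 / 2 - poisson3 \<kappa> y x / 2) \<partial>sphere_prob)"
  proof (rule integral_cong_AE)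
    show "AE x in sphere_prob. h x * (\<Sum>i\<in>UNIV. kern2 \<kappa> y i x) = h x * (1 / 2 - poisson3 \<kappa> y x / 2)"
      using AE_sphere_prob
    proof eventually_elim
      case (elim x)
      have "x \<bullet> y \<noteq> \<kappa>" using d[OF elim] k by auto
      then show ?case by (simp add: kern2_sum[OF elim y] poisson3_def)
    qed
  qed (unfold poisson3_def, measurable)
  finally show ?thesis .
qed

end

lemma measure_sphere_prob_UNIV [simp]: "measure sphere_prob UNIV = 1"
  using sphere_prob.prob_space by simp

lemma trig2_const: "trig2 (\<lambda>t. c)"
  unfolding trig2_def by (rule exI[of _ c], rule exI[of _ 0], rule exI[of _ 0], rule exI[of _ 0], rule exI[of _ 0]) simp

text \<open>Green's formula for the constant function 1 gives the total mass of \<open>poisson3\<close>.\<close>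

interpretation one: piecewise_rot_C2 "\<lambda>_. - 1" "\<lambda>_. 1" "\<lambda>_. 1" "\<lambda>_ _. 0" "\<lambda>_ _. 0" "\<lambda>_ _. 0" "\<lambda>_ _. 0" 1
  by unfold_locales (auto simp: rot_C2_at_def)

lemma poisson3_measurable [measurable]: "poisson3 \<kappa> y \<in> borel_measurable borel"
  unfolding poisson3_def[abs_def] by measurable

lemma poisson3_nonneg: "1 < \<kappa> \<Longrightarrow> 0 \<le> poisson3 \<kappa> y x"
  unfolding poisson3_def by (simp add: one_le_power)

lemma poisson3_integrable:
  assumes "y \<in> S2" "1 < \<kappa>"
  shows "integrable sphere_prob (poisson3 \<kappa> y)"
proof (rule sphere_prob.integrable_const_bound[where B = "(\<kappa>\<^sup>2 - 1) / (\<kappa> - 1)\<^sup>2"])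
  show "AE x in sphere_prob. norm (poisson3 \<kappa> y x) \<le> (\<kappa>\<^sup>2 - 1) / (\<kappa> - 1)\<^sup>2"
    using AE_sphere_prob
  proof eventually_elim
    case (elim x)
    have "\<kappa> - 1 \<le> \<kappa> - x \<bullet> y" using abs_inner_S2[OF elim assms(1)] by linarith
    then have "(\<kappa> - 1)\<^sup>2 \<le> (\<kappa> - x \<bullet> y)\<^sup>2" using assms(2) by (intro power_mono) auto
    moreover have "1 \<le> \<kappa>\<^sup>2" using assms(2) by (simp add: one_le_power)
    moreover have "0 < (\<kappa> - 1)\<^sup>2" using assms(2) by simp
    ultimately have "poisson3 \<kappa> y x \<le> (\<kappa>\<^sup>2 - 1) / (\<kappa> - 1)\<^sup>2"
      unfolding poisson3_def by (intro frac_le) auto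
    then show ?case using poisson3_nonneg[OF assms(2), of y x] by simp
  qed
qed simp

lemma poisson3_integral:
  assumes "y \<in> S2" "1 < \<kappa>" "\<kappa> \<le> 2"
  shows "(\<integral>x. poisson3 \<kappa> y x \<partial>sphere_prob) = 1"
proof -
  have "(\<integral>x. (1 / 2 - poisson3 \<kappa> y x / 2) \<partial>sphere_prob) = 0"
    using one.green_kern[OF assms] by (simp add: one.lap_def one.h_def )
  then show ?thesis using poisson3_integrable[OF assms(1,2)] by (simp add: sphere_prob.prob_space)
qed

text \<open>The kernel is nonnegative with integral 1, and off any neighbourhood of y it tends to 0
  uniformly with \<kappa>^2 - 1.\<close>

lemma poisson3_approx_identity:
  fixes h :: "real ^ 3 \<Rightarrow> real"
  assumes y: "y \<in> S2" and hm[measurable]: "h \<in> borel_measurable borel"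
    and hb: "\<And>x. x \<in> S2 \<Longrightarrow> \<bar>h x\<bar> \<le> K" and hc: "continuous_on S2 h"
  shows "(\<lambda>n. \<integral>x. h x * poisson3 (1 + 1 / real (n + 1)) y x \<partial>sphere_prob) \<longlonglongrightarrow> h y"
proof (rule LIMSEQ_I)
  fix e :: real assume e: "e > 0"
  have K0: "0 \<le> K" using hb[OF y] by linarith
  obtain d where d: "d > 0" and hd: "\<And>x. x \<in> S2 \<Longrightarrow> dist x y < d \<Longrightarrow> dist (h x) (h y) < e / 2"
    using hc e y unfolding continuous_on_iff by (meson half_gt_zero)
  \<comment> \<open>At distance at least d from y, half the squared chord length is at least d^2 /
    2, so c bounds the denominator of the kernel from below for every \<kappa> > 1.\<close>
  define c where "c = (d\<^sup>2 / 2)\<^sup>2"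
  have c: "c > 0" using d by (simp add: c_def)
  define k where "k n = 1 + 1 / real (n + 1)" for n :: nat
  have k: "1 < k n" "k n \<le> 2" for n by (auto simp: k_def field_simps)
  have "(\<lambda>n. 1 + 1 / real (n + 1)) \<longlonglongrightarrow> 1 + 0"
    by (intro tendsto_add tendsto_const LIMSEQ_ignore_initial_segment[where f = "\<lambda>n. 1 / real n"] lim_1_over_n)
  then have "k \<longlonglongrightarrow> 1" by (simp add: k_def[abs_def])
  then have "(\<lambda>n. 2 * K * (((k n)\<^sup>2 - 1) / c)) \<longlonglongrightarrow> 2 * K * ((1\<^sup>2 - 1) / c)"
    using c by (intro tendsto_intros) auto
  then have "eventually (\<lambda>n. 2 * K * (((k n)\<^sup>2 - 1) / c) < e / 2) sequentially"
    using e by (intro order_tendstoD(2)) auto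
  then obtain N where N: "\<And>n. n \<ge> N \<Longrightarrow> 2 * K * (((k n)\<^sup>2 - 1) / c) < e / 2"
    unfolding eventually_sequentially by blast
  show "\<exists>no. \<forall>n\<ge>no. norm ((\<integral>x. h x * poisson3 (1 + 1 / real (n + 1)) y x \<partial>sphere_prob) - h y) < e"
  proof (intro exI[of _ N] allI impI)
    fix n assume n: "n \<ge> N"
    let ?P = "poisson3 (k n) y"
    note Pi = poisson3_integrable[OF y k(1)[of n]] and P1 = poisson3_integral[OF y k[of n]]
    have hPi: "integrable sphere_prob (\<lambda>x. h x * ?P x)"
    proof (rule Bochner_Integration.integrable_bound[OF integrable_mult_right[OF Pi, of K]])
      show "AE x in sphere_prob. norm (h x * ?P x) \<le> norm (K * ?P x)"
        using AE_sphere_prob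
      proof eventually_elim
        case (elim x)
        have "\<bar>h x\<bar> * \<bar>?P x\<bar> \<le> \<bar>K\<bar> * \<bar>?P x\<bar>" using hb[OF elim] by (intro mult_right_mono) auto
        then show ?case by (simp add: abs_mult)
      qed
    qed simp
    have "(\<integral>x. h x * ?P x \<partial>sphere_prob) - h y = (\<integral>x. h x * ?P x - h y * ?P x \<partial>sphere_prob)"
      using hPi Pi P1 by simp
    also have "\<bar>\<dots>\<bar> \<le> (\<integral>x. e / 2 * ?P x + 2 * K * (((k n)\<^sup>2 - 1) / c) \<partial>sphere_prob)"
    proof (rule integral_abs_bound[THEN order_trans], rule integral_mono_AE)
      show "integrable sphere_prob (\<lambda>x. \<bar>h x * ?P x - h y * ?P x\<bar>)" using hPi Pi by simp
      show "integrable sphere_prob (\<lambda>x. e / 2 * ?P x + 2 * K * (((k n)\<^sup>2 - 1) / c))" using Pi by simp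
      show "AE x in sphere_prob. \<bar>h x * ?P x - h y * ?P x\<bar> \<le> e / 2 * ?P x + 2 * K * (((k n)\<^sup>2 - 1) / c)"
        using AE_sphere_prob
      proof eventually_elim
        case (elim x)
        have P0: "0 \<le> ?P x" by (rule poisson3_nonneg[OF k(1)])
        have k2: "0 \<le> (k n)\<^sup>2 - 1" using k(1)[of n] by (simp add: one_le_power)
        have eq: "\<bar>h x * ?P x - h y * ?P x\<bar> = \<bar>h x - h y\<bar> * ?P x"
          using P0 by (simp add: left_diff_distrib[symmetric] abs_mult)
        show ?case
        proof (cases "dist x y < d")
          case True
          have "\<bar>h x - h y\<bar> * ?P x \<le> e / 2 * ?P x"
            using hd[OF elim True] P0 by (intro mult_right_mono) (auto simp: dist_real_def)
          moreover have "0 \<le> 2 * K * (((k n)\<^sup>2 - 1) / c)" using K0 k2 c by simp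
          ultimately show ?thesis unfolding eq by linarith
        next
          case False
          have "(norm (x - y))\<^sup>2 = 2 * (1 - x \<bullet> y)"
            using elim y by (simp add: power2_norm_eq_inner inner_diff inner_commute norm_eq_1)
          moreover have "d\<^sup>2 \<le> (norm (x - y))\<^sup>2" using False d by (intro power_mono) (auto simp: dist_norm)
          ultimately have "d\<^sup>2 \<le> 2 * (1 - x \<bullet> y)" by simp
          then have "d\<^sup>2 / 2 \<le> 1 - x \<bullet> y" by simp
          then have "d\<^sup>2 / 2 \<le> k n - x \<bullet> y" using k(1)[of n] by simp
          then have "c \<le> (k n - x \<bullet> y)\<^sup>2" unfolding c_def using d by (intro power_mono) auto
          then have Pc: "?P x \<le> ((k n)\<^sup>2 - 1) / c"
            unfolding poisson3_def using k2 c by (intro frac_le) auto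
          have "\<bar>h x - h y\<bar> * ?P x \<le> 2 * K * (((k n)\<^sup>2 - 1) / c)"
            using hb[OF elim] hb[OF y] P0 Pc by (intro mult_mono) auto
          moreover have "0 \<le> e / 2 * ?P x" using e P0 by simp
          ultimately show ?thesis unfolding eq by linarith
        qed
      qed
    qed
    also have "\<dots> = e / 2 + 2 * K * (((k n)\<^sup>2 - 1) / c)" using Pi P1 by (simp add: sphere_prob.prob_space)
    also have "\<dots> < e" using N[OF n] by linarith
    finally show "norm ((\<integral>x. h x * poisson3 (1 + 1 / real (n + 1)) y x \<partial>sphere_prob) - h y) < e"
      by (simp add: k_def)
  qed
qed

section \<open>Letting the regularisation tend to the logarithmic kernel\<close>

definition kap :: "nat \<Rightarrow> real" where
  "kap n = 1 + 1 / real (n + 1)"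

lemma kap: "1 < kap n" "kap n \<le> 2"
  by (auto simp: kap_def field_simps)

lemma kap_lim: "kap \<longlonglongrightarrow> 1"
proof -
  have "(\<lambda>n. 1 + 1 / real (n + 1)) \<longlonglongrightarrow> 1 + 0"
    by (intro tendsto_add tendsto_const LIMSEQ_ignore_initial_segment[where f = "\<lambda>n. 1 / real n"] lim_1_over_n)
  then show ?thesis by (simp add: kap_def[abs_def])
qed

lemma kern_lim: "x \<bullet> y \<noteq> 1 \<Longrightarrow> (\<lambda>n. kern (kap n) y x) \<longlonglongrightarrow> skern x y"
  unfolding kern_def skern_def
  by (intro tendsto_intros kap_lim) auto

lemma AE_sphere_prob_ne: "y \<in> S2 \<Longrightarrow> AE x in sphere_prob. x \<bullet> y \<noteq> 1"
proof -
  assume y: "y \<in> S2"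
  have "AE x in sphere_prob. x \<noteq> y"
    by (rule AE_I[where N = "{y}"]) (auto simp: sphere_prob_point)
  with AE_sphere_prob show ?thesis
    by eventually_elim (use inner_eq_1_iff[OF _ y] in blast)
qed

lemma linear_rot_C2: "rot_C2_at (\<lambda>x. x \<bullet> y) (\<lambda>i x. rotgen i x \<bullet> y) (\<lambda>i x. rotgen i (rotgen i x) \<bullet> y) x"
  unfolding rot_C2_at_def
proof (intro allI conjI)
  fix i
  show "((\<lambda>t. rot i t x \<bullet> y) has_real_derivative rotgen i x \<bullet> y) (at 0)"
      "((\<lambda>t. rotgen i (rot i t x) \<bullet> y) has_real_derivative rotgen i (rotgen i x) \<bullet> y) (at 0)"
    using rot_inner_deriv[of i x y 0] rotgen_inner_deriv[of i x y 0] by simp_all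
qed

lemma abs_rotgen_inner: "x \<in> S2 \<Longrightarrow> y \<in> S2 \<Longrightarrow> \<bar>rotgen i (rotgen i x) \<bullet> y\<bar> \<le> 1"
proof -
  assume *: "x \<in> S2" "y \<in> S2"
  have "norm (rotgen i (rotgen i x)) \<le> 1"
    using norm_rotgen_le[of i "rotgen i x"] norm_rotgen_le[of i x] * by simp
  then show ?thesis
    using Cauchy_Schwarz_ineq2[of "rotgen i (rotgen i x)" y] * by simp
qed

lemma kern_integrable:
  assumes y: "y \<in> S2" and k: "1 < \<kappa>" "\<kappa> \<le> 2"
  shows "integrable sphere_prob (kern \<kappa> y)"
proof (rule sphere_prob.integrable_const_bound[where B = "\<bar>ln (\<kappa> - 1)\<bar> + ln 3"])
  show "AE x in sphere_prob. norm (kern \<kappa> y x) \<le> \<bar>ln (\<kappa> - 1)\<bar> + ln 3"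
    using AE_sphere_prob
  proof eventually_elim
    case (elim x)
    have "\<kappa> - 1 \<le> \<kappa> - x \<bullet> y" using abs_inner_S2[OF elim y] by linarith
    then show ?case unfolding real_norm_def
      by (intro kern_bounds(1)[OF elim y]) (use k in auto)
  qed
qed simp

text \<open>A bound uniform in \<kappa>, obtained without computing the integral. Write the kernel
  as its product with \<open>x \<bullet> y\<close> plus its product with
  \<open>1 - x \<bullet> y\<close>: Green's formula for a linear function bounds the former integral
  by 1 / 2, and the latter product is at most 1 pointwise.\<close>

lemma integral_kern_le:
  assumes y: "y \<in> S2" and k: "1 < \<kappa>" "\<kappa> \<le> 2"
  shows "(\<integral>x. kern \<kappa> y x \<partial>sphere_prob) \<le> 3 / 2"
proof -
  \<comment> \<open>The constant q = -1 leaves a single piece, so a smooth function can be treated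
    without an interface.\<close>
  interpret lin: piecewise_rot_C2 "\<lambda>_. - 1" "\<lambda>x. x \<bullet> y" "\<lambda>x. x \<bullet> y" "\<lambda>i x. rotgen i x \<bullet> y"
      "\<lambda>i x. rotgen i (rotgen i x) \<bullet> y" "\<lambda>i x. rotgen i x \<bullet> y" "\<lambda>i x. rotgen i (rotgen i x) \<bullet> y" 1
  proof unfold_locales
    show "\<bar>x \<bullet> y\<bar> \<le> 1" if "x \<in> S2" for x using abs_inner_S2[OF that y] .
    then show "\<bar>x \<bullet> y\<bar> \<le> 1" if "x \<in> S2" for x using that .
  qed (auto simp: trig2_const linear_rot_C2 abs_rotgen_inner[simplified] y[simplified])
  have lap: "lin.lap x = - 2 * (x \<bullet> y)" for x
    by (simp only: lin.lap_def rotgen_sum_twice if_cancel)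
  have s_int: "integrable sphere_prob (\<lambda>x. x \<bullet> y)"
    by (rule sphere_prob.integrable_const_bound[where B = 1])
       (use AE_sphere_prob in eventually_elim, use abs_inner_S2 y in auto)
  have k_int: "integrable sphere_prob (kern \<kappa> y)" by (rule kern_integrable[OF assms])
  have bd: "AE x in sphere_prob. \<bar>(x \<bullet> y) * f x\<bar> \<le> \<bar>f x\<bar>" for f :: "real ^ 3 \<Rightarrow> real"
    using AE_sphere_prob
  proof eventually_elim
    case (elim x)
    show ?case unfolding abs_mult using mult_right_mono[OF abs_inner_S2[OF elim y], of "\<bar>f x\<bar>"] by simp
  qed
  have sk_int: "integrable sphere_prob (\<lambda>x. (x \<bullet> y) * kern \<kappa> y x)"
    by (rule Bochner_Integration.integrable_bound[OF k_int]) (use bd in \<open>auto\<close>)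
  note P_int = poisson3_integrable[OF y k(1)]
  have sP_int: "integrable sphere_prob (\<lambda>x. (x \<bullet> y) * poisson3 \<kappa> y x)"
    by (rule Bochner_Integration.integrable_bound[OF P_int]) (use bd in \<open>auto\<close>)
  have "- 2 * (\<integral>x. (x \<bullet> y) * kern \<kappa> y x \<partial>sphere_prob) = (\<integral>x. kern \<kappa> y x * lin.lap x \<partial>sphere_prob)"
    unfolding lap by (subst integral_mult_right_zero[symmetric]) (simp add: algebra_simps)
  also have "\<dots> = (\<integral>x. (x \<bullet> y) / 2 - (x \<bullet> y) * poisson3 \<kappa> y x / 2 \<partial>sphere_prob)"
    unfolding lin.green_kern[OF assms] lin.h_def by (simp add: algebra_simps)
  also have "\<dots> = (\<integral>x. x \<bullet> y \<partial>sphere_prob) / 2 - (\<integral>x. (x \<bullet> y) * poisson3 \<kappa> y x \<partial>sphere_prob) / 2"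
    using s_int sP_int by simp
  also have "\<dots> \<ge> - 1"
  proof -
    have "(\<integral>x. - 1 \<partial>sphere_prob) \<le> (\<integral>x. x \<bullet> y \<partial>sphere_prob)"
      by (rule integral_mono_AE) (use s_int AE_sphere_prob in \<open>auto elim!: eventually_mono dest!: abs_inner_S2[OF _ y, simplified] \<close>)
    moreover have "(\<integral>x. (x \<bullet> y) * poisson3 \<kappa> y x \<partial>sphere_prob) \<le> (\<integral>x. poisson3 \<kappa> y x \<partial>sphere_prob)"
    proof (rule integral_mono_AE[OF sP_int P_int])
      show "AE x in sphere_prob. (x \<bullet> y) * poisson3 \<kappa> y x \<le> poisson3 \<kappa> y x"
        using bd[of "poisson3 \<kappa> y"] by eventually_elim (use poisson3_nonneg[OF k(1)] in \<open>auto simp: abs_le_iff\<close>)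
    qed
    ultimately show ?thesis unfolding poisson3_integral[OF assms] by simp
  qed
  finally have 1: "(\<integral>x. (x \<bullet> y) * kern \<kappa> y x \<partial>sphere_prob) \<le> 1 / 2" by simp
  \<comment> \<open>With u = 1 - x \<bullet> y the integrand is at most - u * ln u / 2, which stays
    bounded up to the singularity.\<close>
  have "(\<integral>x. (1 - x \<bullet> y) * kern \<kappa> y x \<partial>sphere_prob) \<le> (\<integral>x. 1 \<partial>sphere_prob)"
  proof (rule integral_mono_AE)
    show "integrable sphere_prob (\<lambda>x. (1 - x \<bullet> y) * kern \<kappa> y x)"
      using Bochner_Integration.integrable_diff[OF k_int sk_int] by (simp add: algebra_simps)
    show "AE x in sphere_prob. (1 - x \<bullet> y) * kern \<kappa> y x \<le> 1"
      using AE_sphere_prob AE_sphere_prob_ne[OF y]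
    proof eventually_elim
      case (elim x)
      define u where "u = 1 - x \<bullet> y"
      have u: "0 < u" using abs_inner_S2[OF elim(1) y] elim(2) by (auto simp: u_def abs_le_iff)
      have "ln u \<le> ln (\<kappa> - x \<bullet> y)" using u k by (simp add: u_def)
      then have "kern \<kappa> y x \<le> - ln u / 2" by (simp add: kern_def)
      then have "u * kern \<kappa> y x \<le> u * (- ln u / 2)" using u by (intro mult_left_mono) auto
      also have "- ln u \<le> 1 / u - 1"
        using ln_le_minus_one[of "1 / u"] u by (simp add: ln_div)
      then have "u * (- ln u / 2) \<le> u * ((1 / u - 1) / 2)" using u by (intro mult_left_mono) auto
      also have "\<dots> = (1 - u) / 2" using u by (simp add: field_simps)
      also have "\<dots> \<le> 1" using u by simp
      finally show ?case by (simp add: u_def)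
    qed
  qed simp
  then have "(\<integral>x. kern \<kappa> y x \<partial>sphere_prob) - (\<integral>x. (x \<bullet> y) * kern \<kappa> y x \<partial>sphere_prob) \<le> 1"
    using k_int sk_int by (simp add: left_diff_distrib)
  with 1 show ?thesis by simp
qed

text \<open>Fatou's lemma along \<open>kap n\<close>, using the uniform bound on the integrals. The
  shift by ln 3 makes all functions nonnegative, as the arguments of the logarithms do not exceed
  3.\<close>

lemma skern_sphere_integrable:
  assumes y: "y \<in> S2"
  shows "integrable sphere_prob (\<lambda>x. skern x y)"
proof -
  have "(\<integral>\<^sup>+x. ennreal (skern x y + ln 3) \<partial>sphere_prob) \<le> liminf (\<lambda>n. \<integral>\<^sup>+x. ennreal (kern (kap n) y x + ln 3) \<partial>sphere_prob)"
  proof (rule order_trans[OF nn_integral_mono_AE nn_integral_liminf])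
    show "AE x in sphere_prob. ennreal (skern x y + ln 3) \<le> liminf (\<lambda>n. ennreal (kern (kap n) y x + ln 3))"
      using AE_sphere_prob_ne[OF y]
    proof eventually_elim
      case (elim x)
      have "(\<lambda>n. ennreal (kern (kap n) y x + ln 3)) \<longlonglongrightarrow> ennreal (skern x y + ln 3)"
        by (intro tendsto_ennrealI tendsto_intros kern_lim elim)
      then show ?case by (simp add: lim_imp_Liminf)
    qed
  qed measurable
  also have "\<dots> \<le> liminf (\<lambda>n. ennreal (3 / 2 + ln 3))"
  proof (rule Liminf_mono, rule always_eventually, rule allI)
    fix n
    have nonneg: "AE x in sphere_prob. 0 \<le> kern (kap n) y x + ln 3"
      using AE_sphere_prob
    proof eventually_elim
      case (elim x)
      have s: "\<bar>x \<bullet> y\<bar> \<le> 1" by (rule abs_inner_S2[OF elim y])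
      have "0 < kap n - x \<bullet> y" "kap n - x \<bullet> y \<le> 3" using s kap[of n] by linarith+
      then have "ln (kap n - x \<bullet> y) \<le> ln 3" by simp
      moreover have "0 \<le> ln (3 :: real)" by simp
      ultimately show ?case unfolding kern_def by linarith
    qed
    have int: "integrable sphere_prob (\<lambda>x. kern (kap n) y x + ln 3)"
      using kern_integrable[OF y kap] by simp
    have "(\<integral>\<^sup>+x. ennreal (kern (kap n) y x + ln 3) \<partial>sphere_prob) = ennreal (\<integral>x. kern (kap n) y x + ln 3 \<partial>sphere_prob)"
      by (rule nn_integral_eq_integral[OF int nonneg])
    also have "\<dots> \<le> ennreal (3 / 2 + ln 3)"
      using integral_kern_le[OF y kap, of n] kern_integrable[OF y kap, of n] by (intro ennreal_leI) simp
    finally show "(\<integral>\<^sup>+x. ennreal (kern (kap n) y x + ln 3) \<partial>sphere_prob) \<le> ennreal (3 / 2 + ln 3)" .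
  qed
  finally have fin: "(\<integral>\<^sup>+x. ennreal (skern x y + ln 3) \<partial>sphere_prob) < \<infinity>"
    by (simp add: Liminf_const less_le_trans order_le_less_trans)
  have nn: "AE x in sphere_prob. 0 \<le> skern x y + ln 3"
    using AE_sphere_prob
  proof eventually_elim
    case (elim x)
    have "ln 2 \<le> ln (3 :: real)" "0 \<le> ln (2 :: real)" by simp_all
    then show ?case using skern_ge[OF elim y] by linarith
  qed
  have "integrable sphere_prob (\<lambda>x. skern x y + ln 3)"
    by (rule integrableI_nonneg) (use nn fin in auto)
  from Bochner_Integration.integrable_diff[OF this sphere_prob.integrable_const[of "ln 3"]]
  show ?thesis by simp
qed

lemma kern_dominated:
  assumes "x \<in> S2" "y \<in> S2" "x \<bullet> y \<noteq> 1"
  shows "\<bar>kern (kap n) y x\<bar> \<le> \<bar>skern x y\<bar> + ln 3"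
proof -
  have s: "\<bar>x \<bullet> y\<bar> \<le> 1" using assms abs_inner_S2 by blast
  have u: "0 < 1 - x \<bullet> y" "1 - x \<bullet> y \<le> kap n - x \<bullet> y" "kap n - x \<bullet> y \<le> 3"
    using s assms(3) kap[of n] by (auto simp: abs_le_iff)
  have "ln (1 - x \<bullet> y) \<le> ln (kap n - x \<bullet> y)" "ln (kap n - x \<bullet> y) \<le> ln 3" using u by auto
  moreover have "0 \<le> ln (3 :: real)" by simp
  ultimately show ?thesis unfolding kern_def skern_def by linarith
qed

text \<open>Some orthogonal map carries y to z and preserves both the measure and the kernel. The
  full sphere therefore changes potentials only by a constant.\<close>

lemma surface_potential_const:
  assumes "y \<in> S2" "z \<in> S2"
  shows "(\<integral>x. skern x y \<partial>sphere_prob) = (\<integral>x. skern x z \<partial>sphere_prob)"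
proof -
  obtain T where T: "orthogonal_transformation T" "T y = z"
    using orthogonal_transformation_exists[of y z] assms by auto
  have [measurable]: "T \<in> borel_measurable borel"
    using T by (intro borel_measurable_continuous_onI linear_continuous_on linear_linear[THEN iffD2])
      (simp add: orthogonal_transformation_linear)
  have "(\<integral>x. skern x z \<partial>sphere_prob) = (\<integral>x. skern x z \<partial>distr sphere_prob borel T)"
    by (simp only: sphere_prob_orthogonal[OF T(1)])
  also have "\<dots> = (\<integral>x. skern (T x) (T y) \<partial>sphere_prob)"
    by (subst integral_distr) (auto simp: T(2))
  also have "\<dots> = (\<integral>x. skern x y \<partial>sphere_prob)"
    using T(1) by (simp add: skern_def orthogonal_transformation_def)
  finally show ?thesis ..
qed

context piecewise_rot_C2
begin

text \<open>The limit \<kappa> = 1 of \<open>green_kern\<close>: the left side converges by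
  domination, and \<open>poisson3\<close> evaluates h at y. Thus h is recovered from the potential
  of its Laplacian.\<close>

lemma green_potential:
  assumes y: "y \<in> S2" and hc: "continuous_on S2 h"
  shows "(\<integral>x. skern x y * lap x \<partial>sphere_prob) = (\<integral>x. h x \<partial>sphere_prob) / 2 - h y / 2"
proof -
  have "(\<lambda>n. \<integral>x. kern (kap n) y x * lap x \<partial>sphere_prob) \<longlonglongrightarrow> (\<integral>x. skern x y * lap x \<partial>sphere_prob)"
  proof (rule integral_dominated_convergence[where w = "\<lambda>x. (\<bar>skern x y\<bar> + ln 3) * (3 * K)"])
    show "integrable sphere_prob (\<lambda>x. (\<bar>skern x y\<bar> + ln 3) * (3 * K))"
      using skern_sphere_integrable[OF y] by simp
    show "AE x in sphere_prob. (\<lambda>n. kern (kap n) y x * lap x) \<longlonglongrightarrow> skern x y * lap x"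
      using AE_sphere_prob_ne[OF y] by eventually_elim (intro tendsto_intros kern_lim)
    show "AE x in sphere_prob. norm (kern (kap n) y x * lap x) \<le> (\<bar>skern x y\<bar> + ln 3) * (3 * K)" for n
      using AE_sphere_prob AE_sphere_prob_ne[OF y]
    proof eventually_elim
      case (elim x)
      show ?case unfolding real_norm_def abs_mult
        by (intro mult_mono kern_dominated lap_bound elim y) auto
    qed
  qed measurable
  moreover have "(\<integral>x. kern (kap n) y x * lap x \<partial>sphere_prob) =
      (\<integral>x. h x \<partial>sphere_prob) / 2 - (\<integral>x. h x * poisson3 (kap n) y x \<partial>sphere_prob) / 2" for n
  proof -
    have hi: "integrable sphere_prob h"
      by (rule sphere_prob.integrable_const_bound[where B = K])
         (use AE_sphere_prob h_bound in \<open>auto elim!: eventually_mono\<close>)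
    have hPi: "integrable sphere_prob (\<lambda>x. h x * poisson3 (kap n) y x)"
    proof (rule Bochner_Integration.integrable_bound[OF integrable_mult_right[OF poisson3_integrable[OF y kap(1)[of n]], of K]])
      show "AE x in sphere_prob. norm (h x * poisson3 (kap n) y x) \<le> norm (K * poisson3 (kap n) y x)"
        using AE_sphere_prob
      proof eventually_elim
        case (elim x)
        have "\<bar>h x\<bar> * \<bar>poisson3 (kap n) y x\<bar> \<le> \<bar>K\<bar> * \<bar>poisson3 (kap n) y x\<bar>"
          using h_bound[OF elim] by (intro mult_right_mono) auto
        then show ?case by (simp add: abs_mult)
      qed
    qed measurable
    have "(\<integral>x. kern (kap n) y x * lap x \<partial>sphere_prob) = (\<integral>x. h x / 2 - h x * poisson3 (kap n) y x / 2 \<partial>sphere_prob)"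
      unfolding green_kern[OF y kap] by (simp add: algebra_simps)
    then show ?thesis using hi hPi by simp
  qed
  moreover have "(\<lambda>n. (\<integral>x. h x \<partial>sphere_prob) / 2 - (\<integral>x. h x * poisson3 (kap n) y x \<partial>sphere_prob) / 2)
      \<longlonglongrightarrow> (\<integral>x. h x \<partial>sphere_prob) / 2 - h y / 2"
    using poisson3_approx_identity[OF y h_measurable h_bound hc]
    by (intro tendsto_intros) (simp_all add: kap_def)
  ultimately show ?thesis using LIMSEQ_unique by simp
qed

text \<open>Testing with the constant function 1. For the glued function of the droplet this
  determines the area of the droplet.\<close>

lemma green_mass: "(\<integral>x. lap x \<partial>sphere_prob) = 0"
  using green[of "\<lambda>_. 1" "\<lambda>_ _. 0" "\<lambda>_ _. 0" 1] by (simp add: rot_C2_at_def)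

end

section \<open>Logarithmic potentials of Poisson kernels\<close>

definition circ :: "real measure" where
  "circ = uniform_measure lborel {0..2 * pi}"

lemma sets_circ [simp, measurable_cong]: "sets circ = sets borel" and space_circ [simp]: "space circ = UNIV"
  by (simp_all add: circ_def)

interpretation circ: prob_space circ
  unfolding circ_def by (rule prob_space_uniform_measure) auto

lemma circ_eq_density: "circ = density lborel (\<lambda>t. ennreal (indicator {0..2 * pi} t / (2 * pi)))"
proof -
  have "emeasure lborel {0..2 * pi} = ennreal (2 * pi)" by simp
  moreover have "indicator {0..2 * pi} t / ennreal (2 * pi) = ennreal (indicator {0..2 * pi} t / (2 * pi))" for t
    by (auto simp: indicator_def divide_ennreal[symmetric])
  ultimately show ?thesis unfolding circ_def uniform_measure_def by simp
qed

lemma AE_circ_finite: "finite {t \<in> {0..2 * pi}. \<not> P t} \<Longrightarrow> AE t in circ. P t"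
proof -
  assume fin: "finite {t \<in> {0..2 * pi}. \<not> P t}"
  have "AE t in lborel. t \<notin> {t \<in> {0..2 * pi}. \<not> P t}"
    by (rule AE_not_in) (use fin in \<open>simp add: finite_imp_null_set_lborel\<close>)
  then show ?thesis unfolding circ_def by (intro AE_uniform_measureI) (auto elim!: eventually_mono)
qed

lemma circ_integral:
  assumes "continuous_on {0..2 * pi} f" and fm: "f \<in> borel_measurable borel"
    and "(f has_integral I) {0..2 * pi}"
  shows "integrable circ f" "(\<integral>t. f t \<partial>circ) = I / (2 * pi :: real)"
proof -
  have si: "set_integrable lborel {0..2 * pi} f"
    using assms(1) by (rule borel_integrable_atLeastAtMost')
  then have i: "integrable lborel (\<lambda>t. indicator {0..2 * pi} t *\<^sub>R f t)" by (simp add: set_integrable_def)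
  have eq: "(indicator {0..2 * pi} t / (2 * pi)) *\<^sub>R f t = (indicator {0..2 * pi} t *\<^sub>R f t) / (2 * pi)" for t by simp
  show "integrable circ f" unfolding circ_eq_density
    by (subst integrable_density) (use i fm in \<open>auto simp only: eq intro!: integrable_divide\<close>, auto)
  have "(\<integral>t. f t \<partial>circ) = (\<integral>t. (indicator {0..2 * pi} t *\<^sub>R f t) / (2 * pi) \<partial>lborel)"
    unfolding circ_eq_density by (subst integral_density) (use fm in \<open>auto simp only: eq\<close>, auto)
  also have "\<dots> = (LINT t:{0..2 * pi}|lborel. f t) / (2 * pi)"
    by (simp add: set_lebesgue_integral_def)
  also have "\<dots> = I / (2 * pi)"
    using set_borel_integral_eq_integral(2)[OF si] assms(3) by (simp add: integral_unique)
  finally show "(\<integral>t. f t \<partial>circ) = I / (2 * pi)" .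
qed

text \<open>The Poisson kernel of the unit disc at the point - q; hence the plus sign in front of
  the cosine and the values at \<open>- of_real q\<close> below.\<close>

definition poiss :: "real \<Rightarrow> real \<Rightarrow> real" where
  "poiss q t = (1 - q\<^sup>2) / (1 + q\<^sup>2 + 2 * q * cos t)"

lemma poiss_denom:
  fixes q t :: real
  assumes "\<bar>q\<bar> < 1"
  shows "(1 - \<bar>q\<bar>)\<^sup>2 \<le> 1 + q\<^sup>2 + 2 * q * cos t" "0 < 1 + q\<^sup>2 + 2 * q * cos t"
proof -
  have "\<bar>q * cos t\<bar> \<le> \<bar>q\<bar> * 1" unfolding abs_mult by (intro mult_left_mono) auto
  then have "- \<bar>q\<bar> \<le> q * cos t" by linarith
  then show "(1 - \<bar>q\<bar>)\<^sup>2 \<le> 1 + q\<^sup>2 + 2 * q * cos t" by (simp add: power2_diff)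
  moreover have "0 < (1 - \<bar>q\<bar>)\<^sup>2" using assms by simp
  ultimately show "0 < 1 + q\<^sup>2 + 2 * q * cos t" by linarith
qed

lemma poiss_pos: "\<bar>q\<bar> < 1 \<Longrightarrow> 0 < poiss q t"
  unfolding poiss_def using poiss_denom[of q t] by (simp add: abs_square_less_1)

lemma continuous_poiss: "\<bar>q\<bar> < 1 \<Longrightarrow> continuous_on S (poiss q)"
  unfolding poiss_def[abs_def] using poiss_denom by (intro continuous_intros) (metis less_irrefl)

lemma poiss_measurable [measurable]: "poiss q \<in> borel_measurable borel"
  unfolding poiss_def[abs_def] by measurable

lemma poiss_even: "poiss q (2 * pi - t) = poiss q t"
  by (simp add: poiss_def cos_diff)

lemma poisson_integral_formula:
  fixes F :: "complex \<Rightarrow> complex"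
  assumes F: "F holomorphic_on ball 0 R" and R: "1 < R" and q: "\<bar>q\<bar> < 1"
  shows "((\<lambda>t. F (cis t) * of_real (poiss q t)) has_integral 2 * pi * F (- of_real q)) {0..2 * pi}"
proof -
  define Q where "Q = (of_real q :: complex)"
  have Qn: "norm Q < 1" using q by (simp add: Q_def)
  have nz: "1 + Q * u \<noteq> 0" if "norm u \<le> 1" for u
  proof
    assume "1 + Q * u = 0"
    then have "Q * u = - 1" by (simp add: add_eq_0_iff)
    then have "norm Q * norm u = 1" by (metis norm_minus_cancel norm_mult norm_one)
    moreover have "norm Q * norm u \<le> norm Q * 1" using that by (intro mult_left_mono) auto
    ultimately show False using Qn by simp
  qed
  \<comment> \<open>The subtracted term vanishes at - Q, so Cauchy's formula still returns the value
    of F there. It adds to the Cauchy kernel the pole mirrored in the circle, and on the circle the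
    two together are the Poisson kernel.\<close>
  define f where "f u = F u - (u + Q) * Q * F u / (1 + Q * u)" for u
  have hol: "f holomorphic_on ball 0 1" "continuous_on (cball 0 1) f"
  proof -
    have sub: "cball 0 1 \<subseteq> ball (0 :: complex) R" using R by auto
    have Fc: "continuous_on (cball 0 1) F"
      using holomorphic_on_imp_continuous_on[OF F] sub by (rule continuous_on_subset)
    show "f holomorphic_on ball 0 1" unfolding f_def[abs_def]
      by (intro holomorphic_intros holomorphic_on_subset[OF F]) (use R nz in auto)
    show "continuous_on (cball 0 1) f" unfolding f_def[abs_def]
      by (intro continuous_intros Fc) (use nz in auto)
  qed
  have "((\<lambda>u. f u / (u - - Q)) has_contour_integral 2 * of_real pi * \<i> * f (- Q)) (circlepath 0 1)"
    by (rule Cauchy_integral_circlepath[OF hol(2,1)]) (use Qn in auto)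
  then have "((\<lambda>t. f (cis t) / (cis t + Q) * \<i> * cis t) has_integral 2 * of_real pi * \<i> * f (- Q)) {0..2 * pi}"
    unfolding circlepath_def by (subst (asm) has_contour_integral_part_circlepath_iff) auto
  then have I1: "((\<lambda>t. f (cis t) / (cis t + Q) * \<i> * cis t * (- \<i>)) has_integral 2 * of_real pi * \<i> * f (- Q) * (- \<i>)) {0..2 * pi}"
    by (rule has_integral_mult_left)
  have eqt: "f (cis t) / (cis t + Q) * \<i> * cis t * (- \<i>) = F (cis t) * of_real (poiss q t)" for t
  proof -
    define c where "c = cis t"
    define d where "d = cnj c"
    have cd: "c * d = 1" by (simp add: c_def d_def cis_cnj cis_mult)
    have nc: "norm c = 1" by (simp add: c_def)
    have c1: "1 + Q * c \<noteq> 0" using nz nc by simp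
    have c2: "c + Q \<noteq> 0"
    proof
      assume "c + Q = 0"
      then have "c = - Q" by (simp add: add_eq_0_iff2)
      then show False using nc Qn by simp
    qed
    have P: "of_real (poiss q t) = (1 - Q\<^sup>2) / (1 + Q\<^sup>2 + Q * (c + d))"
    proof -
      have "c + d = of_real (2 * cos t)" by (simp add: c_def d_def complex_eq_iff)
      then show ?thesis by (simp add: poiss_def Q_def)
    qed
    have den: "1 + Q\<^sup>2 + Q * (c + d) = (1 + Q * c) * (c + Q) * d"
      using cd by algebra
    have dn: "d \<noteq> 0" using cd by auto
    have "f c / (c + Q) * \<i> * c * (- \<i>) = F c * (c * (1 / (c + Q) - Q / (1 + Q * c)))"
      unfolding f_def using c1 c2 by (simp add: divide_simps) (simp add: algebra_simps)
    also have "c * (1 / (c + Q) - Q / (1 + Q * c)) = (1 - Q\<^sup>2) / ((1 + Q * c) * (c + Q) * d)"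
    proof -
      have "(1 / (c + Q) - Q / (1 + Q * c)) = (1 - Q\<^sup>2) / ((1 + Q * c) * (c + Q))"
        using c1 c2 by (simp add: divide_simps power2_eq_square algebra_simps)
      then have "c * (1 / (c + Q) - Q / (1 + Q * c)) = (c * d) * (1 - Q\<^sup>2) / ((1 + Q * c) * (c + Q) * d)"
        using dn by simp
      then show ?thesis unfolding cd by simp
    qed
    finally have "f c / (c + Q) * \<i> * c * (- \<i>) = F c * of_real (poiss q t)"
      unfolding P den .
    then show ?thesis by (simp only: c_def)
  qed
  have eqv: "2 * of_real pi * \<i> * f (- Q) * (- \<i>) = 2 * pi * F (- Q)"
    by (simp add: f_def)
  show ?thesis using I1 unfolding eqt eqv unfolding Q_def .
qed

text \<open>On the unit circle the zero at \<zeta> can be reflected to the outside without changing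
  the modulus, which makes the logarithm holomorphic in the disc.\<close>

lemma norm_cis_diff: "norm (1 - cnj \<zeta> * cis t) = norm (cis t - \<zeta>)"
proof -
  have "norm (1 - cnj \<zeta> * cis t) = norm (cnj (1 - cnj \<zeta> * cis t))" by (simp only: complex_mod_cnj)
  also have "cnj (1 - cnj \<zeta> * cis t) = cis (- t) * (cis t - \<zeta>)"
  proof -
    have "cis (- t) * cis t = 1" by (simp only: cis_mult) simp
    then show ?thesis
      by (simp only: complex_cnj_diff complex_cnj_mult complex_cnj_cnj complex_cnj_one cis_cnj right_diff_distrib mult.commute[of \<zeta>])
  qed
  finally show ?thesis by (simp only: norm_mult norm_cis mult_1)
qed

text \<open>The logarithm of \<open>1 - cnj \<zeta> * u\<close> is holomorphic in a disc of radius
  greater than 1. Its real part on the circle is the integrand, and its value at - q is the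
  result.\<close>

lemma log_poisson_interior:
  assumes z: "norm \<zeta> < 1" and q: "\<bar>q\<bar> < 1"
  shows "integrable circ (\<lambda>t. poiss q t * ln (norm (cis t - \<zeta>)))"
    "(\<integral>t. poiss q t * ln (norm (cis t - \<zeta>)) \<partial>circ) = ln (norm (1 + of_real q * \<zeta>))"
proof -
  define R where "R = (if \<zeta> = 0 then 2 else 1 / norm \<zeta>)"
  have R: "1 < R" using z by (auto simp: R_def)
  have rez: "1 - cnj \<zeta> * u \<notin> \<real>\<^sub>\<le>\<^sub>0" if "norm u < R" for u
  proof -
    have "norm (cnj \<zeta> * u) < 1"
      using that by (cases "\<zeta> = 0") (auto simp: R_def norm_mult field_simps)
    then have "Re (cnj \<zeta> * u) < 1" using complex_Re_le_cmod[of "cnj \<zeta> * u"] by linarith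
    then show ?thesis by (auto simp: complex_nonpos_Reals_iff)
  qed
  have hol: "(\<lambda>u. Ln (1 - cnj \<zeta> * u)) holomorphic_on ball 0 R"
    by (intro holomorphic_intros) (use rez in auto)
  have I0: "((\<lambda>t. Re (Ln (1 - cnj \<zeta> * cis t) * of_real (poiss q t))) has_integral Re (2 * pi * Ln (1 - cnj \<zeta> * - of_real q))) {0..2 * pi}"
    using has_integral_linear[OF poisson_integral_formula[OF hol R q] bounded_linear_Re] by (simp add: o_def)
  have eqt: "Re (Ln (1 - cnj \<zeta> * cis t) * of_real (poiss q t)) = poiss q t * ln (norm (cis t - \<zeta>))" for t
  proof -
    have "1 - cnj \<zeta> * cis t \<noteq> 0" using rez[of "cis t"] R by auto
    then show ?thesis by (simp add: norm_cis_diff)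
  qed
  have eqv: "Re (2 * pi * Ln (1 - cnj \<zeta> * - of_real q)) = 2 * pi * ln (norm (1 + of_real q * \<zeta>))"
  proof -
    define w where "w = 1 - cnj \<zeta> * - of_real q"
    have "w \<noteq> 0" using rez[of "- of_real q"] R q by (auto simp: w_def)
    moreover have "w = cnj (1 + of_real q * \<zeta>)" by (simp add: w_def mult.commute)
    then have "norm w = norm (1 + of_real q * \<zeta>)" by (simp only: complex_mod_cnj)
    ultimately show ?thesis unfolding w_def[symmetric] by simp
  qed
  have I: "((\<lambda>t. poiss q t * ln (norm (cis t - \<zeta>))) has_integral 2 * pi * ln (norm (1 + of_real q * \<zeta>))) {0..2 * pi}"
    using I0 unfolding eqt eqv .
  have cne: "cis t \<noteq> \<zeta>" for t using z by auto
  have cont: "continuous_on S (\<lambda>t. poiss q t * ln (norm (cis t - \<zeta>)))" for S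
    by (intro continuous_intros continuous_poiss[OF q]) (use cne in auto)
  show "integrable circ (\<lambda>t. poiss q t * ln (norm (cis t - \<zeta>)))"
    "(\<integral>t. poiss q t * ln (norm (cis t - \<zeta>)) \<partial>circ) = ln (norm (1 + of_real q * \<zeta>))"
    using circ_integral[OF cont borel_measurable_continuous_onI[OF cont] I] by simp_all
qed

lemma poiss_integral:
  assumes q: "\<bar>q\<bar> < 1"
  shows "integrable circ (poiss q)" "(\<integral>t. poiss q t \<partial>circ) = 1"
proof -
  have "((\<lambda>t. Re (1 * of_real (poiss q t))) has_integral Re (2 * pi * 1)) {0..2 * pi}"
    using has_integral_linear[OF poisson_integral_formula[of "\<lambda>_. 1" 2 q] bounded_linear_Re] q by (simp add: o_def)
  then have I: "(poiss q has_integral 2 * pi) {0..2 * pi}" by simp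
  show "integrable circ (poiss q)" "(\<integral>t. poiss q t \<partial>circ) = 1"
    using circ_integral[OF continuous_poiss[OF q] poiss_measurable I] by simp_all
qed


text \<open>Approach \<zeta> radially from inside. The integrals stay bounded because
  \<open>1 + q * r * \<zeta>\<close> has modulus at least 1 - \<bar>q\<bar>, so Fatou's lemma yields
  integrability and dominated convergence the value.\<close>

lemma log_poisson_boundary_integrable:
  assumes z: "norm \<zeta> = 1" and q: "\<bar>q\<bar> < 1"
  shows "AE t in circ. cis t \<noteq> \<zeta>" "integrable circ (\<lambda>t. poiss q t * ln (norm (cis t - \<zeta>)))"
    "(\<integral>t. poiss q t * ln (norm (cis t - \<zeta>)) \<partial>circ) = ln (norm (1 + of_real q * \<zeta>))"
proof -
  \<comment> \<open>If cis t = \<zeta>, then the real part of cis t * cnj \<zeta> is 1, a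
    trigonometric equation with finitely many solutions in a period.\<close>
  have F: "trig2 (\<lambda>t. - 1 + Re \<zeta> * cos t + Im \<zeta> * sin t)"
    unfolding trig2_def
    by (rule exI[of _ "- 1"], rule exI[of _ "Re \<zeta>"], rule exI[of _ "Im \<zeta>"], rule exI[of _ 0], rule exI[of _ 0]) simp
  have "\<exists>t0. - 1 + Re \<zeta> * cos t0 + Im \<zeta> * sin t0 \<noteq> 0"
  proof (rule ccontr)
    assume "\<not> ?thesis"
    then have "- 1 + Re \<zeta> * cos 0 + Im \<zeta> * sin 0 = 0" "- 1 + Re \<zeta> * cos pi + Im \<zeta> * sin pi = 0" by blast+
    then show False by simp
  qed
  then have fin: "finite {t \<in> {0..2 * pi}. - 1 + Re \<zeta> * cos t + Im \<zeta> * sin t = 0}"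
    using trig2_zeros[OF F] by blast
  show ne: "AE t in circ. cis t \<noteq> \<zeta>"
  proof (rule AE_circ_finite, rule finite_subset[OF _ fin])
    show "{t \<in> {0..2 * pi}. \<not> cis t \<noteq> \<zeta>} \<subseteq> {t \<in> {0..2 * pi}. - 1 + Re \<zeta> * cos t + Im \<zeta> * sin t = 0}"
      by (auto simp: power2_eq_square[symmetric] sin_squared_eq)
  qed
  define r where "r n = 1 - 1 / real (n + 2)" for n :: nat
  have r: "0 < r n" "r n < 1" for n by (auto simp: r_def field_simps)
  have "(\<lambda>n. 1 - 1 / real (n + 2)) \<longlonglongrightarrow> 1 - 0"
    by (intro tendsto_diff tendsto_const LIMSEQ_ignore_initial_segment[where f = "\<lambda>n. 1 / real n"] lim_1_over_n)
  then have rl: "r \<longlonglongrightarrow> 1" by (simp add: r_def[abs_def])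
  have zr: "norm (of_real (r n) * \<zeta>) < 1" for n using r[of n] z by (simp add: norm_mult)
  note I = log_poisson_interior[OF zr q]
  have le2: "norm (cis t - of_real (r n) * \<zeta>) \<le> 2" for t n
    using norm_triangle_ineq4[of "cis t" "of_real (r n) * \<zeta>"] zr[of n] by simp
  have pos: "0 < norm (cis t - of_real (r n) * \<zeta>)" for t n
  proof -
    have "cis t \<noteq> of_real (r n) * \<zeta>" using zr[of n] by (metis norm_cis less_irrefl)
    then show ?thesis by simp
  qed
  \<comment> \<open>The radial shift from \<zeta> has length 1 - r n, and no point of the circle is
    closer to the shifted point than that. So the shift changes the distance by at most a factor 2,
    and the logarithm by ln 2.\<close>
  have half: "norm (cis t - \<zeta>) \<le> 2 * norm (cis t - of_real (r n) * \<zeta>)" for t n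
  proof -
    have "norm (cis t - \<zeta>) \<le> norm (cis t - of_real (r n) * \<zeta>) + norm (of_real (r n) * \<zeta> - \<zeta>)"
      by (rule norm_diff_triangle_ineq[of "cis t" "of_real (r n) * \<zeta>" "of_real (r n) * \<zeta>" \<zeta>, simplified, THEN order_trans]) simp
    also have "norm (of_real (r n) * \<zeta> - \<zeta>) = 1 - r n"
    proof -
      have "of_real (r n) * \<zeta> - \<zeta> = of_real (r n - 1) * \<zeta>" by (simp add: algebra_simps)
      then show ?thesis using r[of n] z by (simp only: norm_mult norm_of_real) simp
    qed
    also have "1 - r n \<le> norm (cis t - of_real (r n) * \<zeta>)"
      using norm_triangle_ineq2[of "cis t" "of_real (r n) * \<zeta>"] r[of n] z by (simp add: norm_mult)
    finally show ?thesis by simp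
  qed
  have lim: "(\<lambda>n. ln (norm (cis t - of_real (r n) * \<zeta>))) \<longlonglongrightarrow> ln (norm (cis t - \<zeta>))" if "cis t \<noteq> \<zeta>" for t
  proof -
    have "(\<lambda>n. norm (cis t - of_real (r n) * \<zeta>)) \<longlonglongrightarrow> norm (cis t - of_real 1 * \<zeta>)"
      by (intro tendsto_intros rl)
    then show ?thesis using that by (intro tendsto_ln) auto
  qed
  define g where "g t = poiss q t * (ln 2 - ln (norm (cis t - \<zeta>)))" for t
  define gn where "gn n t = poiss q t * (ln 2 - ln (norm (cis t - of_real (r n) * \<zeta>)))" for n t
  have cism[measurable]: "cis \<in> borel_measurable borel"
    by (intro borel_measurable_continuous_onI continuous_intros)
  have gm: "g \<in> borel_measurable borel" "gn n \<in> borel_measurable borel" for n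
    unfolding g_def[abs_def] gn_def[abs_def] by measurable
  have gn0: "0 \<le> gn n t" for n t
    using poiss_pos[OF q, of t] le2[of t n] pos[of t n] by (simp add: gn_def)
  have gni: "integrable circ (gn n)" "(\<integral>t. gn n t \<partial>circ) = ln 2 - ln (norm (1 + of_real q * (of_real (r n) * \<zeta>)))" for n
    using I[of n] poiss_integral[OF q] by (simp_all add: gn_def[abs_def] right_diff_distrib)
  define M where "M = ln 2 - ln (1 - \<bar>q\<bar>)"
  have gnM: "(\<integral>t. gn n t \<partial>circ) \<le> M" for n
  proof -
    have "1 - \<bar>q\<bar> \<le> norm (1 + of_real q * (of_real (r n) * \<zeta>))"
    proof -
      have "norm (of_real q * (of_real (r n) * \<zeta>)) \<le> \<bar>q\<bar> * 1"
        unfolding norm_mult[of "of_real q"] norm_of_real using zr[of n] by (intro mult_left_mono) auto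
      then show ?thesis using norm_diff_ineq[of 1 "of_real q * (of_real (r n) * \<zeta>)"] by simp
    qed
    then have "ln (1 - \<bar>q\<bar>) \<le> ln (norm (1 + of_real q * (of_real (r n) * \<zeta>)))" using q by (intro ln_mono) auto
    then show ?thesis by (simp add: gni M_def)
  qed
  have "(\<integral>\<^sup>+t. ennreal (g t) \<partial>circ) \<le> liminf (\<lambda>n. \<integral>\<^sup>+t. ennreal (gn n t) \<partial>circ)"
  proof (rule order_trans[OF nn_integral_mono_AE nn_integral_liminf])
    show "AE t in circ. ennreal (g t) \<le> liminf (\<lambda>n. ennreal (gn n t))"
      using ne
    proof eventually_elim
      case (elim t)
      have "(\<lambda>n. ennreal (gn n t)) \<longlonglongrightarrow> ennreal (g t)"
        unfolding g_def gn_def by (intro tendsto_ennrealI tendsto_intros lim elim)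
      then show ?case by (simp add: lim_imp_Liminf)
    qed
  qed (use gm in \<open>simp add: measurable_cong_sets[OF sets_circ refl]\<close>)
  also have "\<dots> \<le> liminf (\<lambda>n. ennreal M)"
  proof (rule Liminf_mono, rule always_eventually, rule allI)
    fix n
    have "(\<integral>\<^sup>+t. ennreal (gn n t) \<partial>circ) = ennreal (\<integral>t. gn n t \<partial>circ)"
      by (rule nn_integral_eq_integral[OF gni(1)]) (simp add: gn0)
    also have "\<dots> \<le> ennreal M" using gnM by (rule ennreal_leI)
    finally show "(\<integral>\<^sup>+t. ennreal (gn n t) \<partial>circ) \<le> ennreal M" .
  qed
  finally have fin: "(\<integral>\<^sup>+t. ennreal (g t) \<partial>circ) < \<infinity>"
    by (simp add: Liminf_const order_le_less_trans)
  have g0: "0 \<le> g t" for t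
  proof (cases "cis t = \<zeta>")
    case True
    then show ?thesis using poiss_pos[OF q, of t] by (simp add: g_def)
  next
    case False
    have "norm (cis t - \<zeta>) \<le> 2" using norm_triangle_ineq4[of "cis t" \<zeta>] z by simp
    then show ?thesis using poiss_pos[OF q, of t] False by (simp add: g_def)
  qed
  have gi: "integrable circ g"
    by (rule integrableI_nonneg) (use fin g0 gm in \<open>auto simp: measurable_cong_sets[OF sets_circ refl]\<close>)
  have geq: "poiss q t * ln (norm (cis t - \<zeta>)) = ln 2 * poiss q t - g t" for t
    by (simp add: g_def algebra_simps)
  show int: "integrable circ (\<lambda>t. poiss q t * ln (norm (cis t - \<zeta>)))"
    unfolding geq using gi poiss_integral(1)[OF q] by simp
  have "(\<lambda>n. \<integral>t. poiss q t * ln (norm (cis t - of_real (r n) * \<zeta>)) \<partial>circ) \<longlonglongrightarrow>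
      (\<integral>t. poiss q t * ln (norm (cis t - \<zeta>)) \<partial>circ)"
  proof (rule integral_dominated_convergence[where w = "\<lambda>t. \<bar>poiss q t * ln (norm (cis t - \<zeta>))\<bar> + ln 2 * poiss q t"])
    show "integrable circ (\<lambda>t. \<bar>poiss q t * ln (norm (cis t - \<zeta>))\<bar> + ln 2 * poiss q t)"
      using int poiss_integral(1)[OF q] by simp
    show "AE t in circ. (\<lambda>n. poiss q t * ln (norm (cis t - of_real (r n) * \<zeta>))) \<longlonglongrightarrow> poiss q t * ln (norm (cis t - \<zeta>))"
      using ne by eventually_elim (intro tendsto_intros lim)
    show "AE t in circ. norm (poiss q t * ln (norm (cis t - of_real (r n) * \<zeta>))) \<le> \<bar>poiss q t * ln (norm (cis t - \<zeta>))\<bar> + ln 2 * poiss q t" for n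
      using ne
    proof eventually_elim
      case (elim t)
      have "ln (norm (cis t - \<zeta>)) \<le> ln (2 * norm (cis t - of_real (r n) * \<zeta>))"
        using half[of t n] elim pos[of t n] by simp
      also have "\<dots> = ln 2 + ln (norm (cis t - of_real (r n) * \<zeta>))" using pos[of t n] by (simp add: ln_mult)
      finally have l: "ln (norm (cis t - \<zeta>)) \<le> ln 2 + ln (norm (cis t - of_real (r n) * \<zeta>))" .
      have u: "ln (norm (cis t - of_real (r n) * \<zeta>)) \<le> ln 2" using le2[of t n] pos[of t n] by simp
      have "\<bar>ln (norm (cis t - of_real (r n) * \<zeta>))\<bar> \<le> \<bar>ln (norm (cis t - \<zeta>))\<bar> + ln 2"
        using l u by linarith
      then have "poiss q t * \<bar>ln (norm (cis t - of_real (r n) * \<zeta>))\<bar> \<le> poiss q t * (\<bar>ln (norm (cis t - \<zeta>))\<bar> + ln 2)"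
        using poiss_pos[OF q, of t] by (intro mult_left_mono) auto
      then show ?case using poiss_pos[OF q, of t] by (simp add: abs_mult algebra_simps)
    qed
  qed measurable
  moreover have "(\<lambda>n. \<integral>t. poiss q t * ln (norm (cis t - of_real (r n) * \<zeta>)) \<partial>circ) \<longlonglongrightarrow> ln (norm (1 + of_real q * \<zeta>))"
  proof -
    have "1 + of_real q * \<zeta> \<noteq> 0"
    proof
      assume "1 + of_real q * \<zeta> = 0"
      then have "norm (of_real q * \<zeta>) = 1" by (metis add_eq_0_iff norm_minus_cancel norm_one)
      then show False using q z by (simp add: norm_mult)
    qed
    moreover have "(\<lambda>n. norm (1 + of_real q * (of_real (r n) * \<zeta>))) \<longlonglongrightarrow> norm (1 + of_real q * (of_real 1 * \<zeta>))"
      by (intro tendsto_intros rl)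
    ultimately show ?thesis unfolding I(2) by (intro tendsto_ln) auto
  qed
  ultimately show "(\<integral>t. poiss q t * ln (norm (cis t - \<zeta>)) \<partial>circ) = ln (norm (1 + of_real q * \<zeta>))"
    by (rule LIMSEQ_unique)
qed

lemma log_poisson:
  assumes z: "norm \<zeta> \<le> 1" and q: "\<bar>q\<bar> < 1"
  shows "AE t in circ. cis t \<noteq> \<zeta>" "integrable circ (\<lambda>t. poiss q t * ln (norm (cis t - \<zeta>)))"
    "(\<integral>t. poiss q t * ln (norm (cis t - \<zeta>)) \<partial>circ) = ln (norm (1 + of_real q * \<zeta>))"
proof -
  have "AE t in circ. cis t \<noteq> \<zeta>" if "norm \<zeta> < 1"
    using that by (intro always_eventually allI) auto
  then show "AE t in circ. cis t \<noteq> \<zeta>"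
    using log_poisson_boundary_integrable(1)[of \<zeta>] z q by (cases "norm \<zeta> = 1") auto
  show "integrable circ (\<lambda>t. poiss q t * ln (norm (cis t - \<zeta>)))"
    using log_poisson_boundary_integrable(2)[of \<zeta>] log_poisson_interior(1)[of \<zeta>] z q by (cases "norm \<zeta> = 1") auto
  show "(\<integral>t. poiss q t * ln (norm (cis t - \<zeta>)) \<partial>circ) = ln (norm (1 + of_real q * \<zeta>))"
    using log_poisson_boundary_integrable(3)[of \<zeta>] log_poisson_interior(2)[of \<zeta>] z q by (cases "norm \<zeta> = 1") auto
qed

section \<open>Mother bodies from an obstacle function\<close>

lemma scale_measure_eq_density: "scale_measure r M = density M (\<lambda>_. r)"
  by (rule measure_eqI) (simp_all add: emeasure_density_const)

lemma skern_commute: "skern x y = skern y x"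
  by (simp add: skern_def inner_commute)

lemma log_potential_eq:
  assumes s: "sets \<tau> = sets sphere_borel" and fin: "finite_measure \<tau>" and x: "x \<in> S2"
    and ne: "AE y in \<tau>. x \<noteq> y" and int: "integrable \<tau> (\<lambda>y. skern x y)"
  shows "log_potential \<tau> x = ereal ((\<integral>y. skern x y \<partial>\<tau>) - ln 2 / 2 * measure \<tau> S2)"
proof -
  interpret finite_measure \<tau> by fact
  have sp: "space \<tau> = S2" using sets_eq_imp_space_eq[OF s] by simp
  have eq: "AE y in \<tau>. log_kernel x y = ereal (skern x y - ln 2 / 2)"
    using ne AE_space[of \<tau>] by eventually_elim (use x sp in \<open>simp add: log_kernel_eq_skern\<close>)
  have i: "integrable \<tau> (\<lambda>y. skern x y - ln 2 / 2)" using int by simp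
  show ?thesis unfolding log_potential_def ereal_integral_real[OF eq i]
    using int by (simp add: sp)
qed

text \<open>\<open>add_measure\<close> is given by \<open>measure_of\<close>, for which no
  integration rules are at hand. As the image of a multiple of counting measure on two points it can
  be integrated by \<open>nn_integral_distr\<close>.\<close>

lemma add_measure_points:
  assumes p: "p1 \<in> S2" "p2 \<in> S2"
  shows "add_measure (scale_measure r (return sphere_borel p1)) (scale_measure r (return sphere_borel p2)) =
    distr (scale_measure r (count_space (UNIV :: bool set))) sphere_borel (\<lambda>t. if t then p1 else p2)" (is "_ = ?N")
proof -
  have pm: "(\<lambda>t. if t then p1 else p2) \<in> scale_measure r (count_space (UNIV :: bool set)) \<rightarrow>\<^sub>M sphere_borel"
    using p by (simp add: measurable_def space_scale_measure)
  have emN: "emeasure ?N A = r * indicator A p1 + r * indicator A p2" if "A \<in> sets sphere_borel" for A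
  proof -
    have "emeasure ?N A = r * emeasure (count_space UNIV) ((\<lambda>t. if t then p1 else p2) -` A)"
      using pm that by (simp add: emeasure_distr space_scale_measure)
    also have "(\<lambda>t. if t then p1 else p2) -` A = (if p1 \<in> A then {True} else {}) \<union> (if p2 \<in> A then {False} else {})"
      by (auto split: if_splits)
    also have "r * emeasure (count_space UNIV) \<dots> = r * indicator A p1 + r * indicator A p2"
      by (auto simp: emeasure_count_space_finite mult_2_right[symmetric] mult.commute)
    finally show ?thesis .
  qed
  have sub: "sets sphere_borel \<subseteq> Pow S2"
    using sets.sets_into_space[of _ sphere_borel] by (auto simp only: space_sphere_borel)
  have ss: "sigma_sets S2 (sets sphere_borel) = sets sphere_borel"
    using sets.sigma_sets_eq[of sphere_borel] by (simp only: space_sphere_borel)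
  have "add_measure (scale_measure r (return sphere_borel p1)) (scale_measure r (return sphere_borel p2)) =
      measure_of S2 (sets sphere_borel) (\<lambda>A. emeasure (scale_measure r (return sphere_borel p1)) A + emeasure (scale_measure r (return sphere_borel p2)) A)"
    unfolding add_measure_def by (simp only: space_scale_measure space_return space_sphere_borel sets_scale_measure sets_return)
  also have "\<dots> = measure_of S2 (sets sphere_borel) (emeasure ?N)"
    by (rule measure_of_eq[OF sub]) (simp only: ss emN, simp add: emeasure_return)
  also have "\<dots> = measure_of (space ?N) (sets ?N) (emeasure ?N)"
    by (simp only: space_distr sets_distr space_sphere_borel)
  also have "\<dots> = ?N" by (rule measure_of_of_measure)
  finally show ?thesis .
qed

lemma log_potential_points:
  assumes p: "p1 \<in> S2" "p2 \<in> S2" and a: "0 < a" and x: "x \<in> S2"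
  defines "\<sigma> \<equiv> add_measure (scale_measure (ennreal a) (return sphere_borel p1)) (scale_measure (ennreal a) (return sphere_borel p2))"
  shows "x \<noteq> p1 \<Longrightarrow> x \<noteq> p2 \<Longrightarrow> log_potential \<sigma> x = ereal (a * skern x p1 + a * skern x p2 - a * ln 2)"
    and "x = p1 \<or> x = p2 \<Longrightarrow> log_potential \<sigma> x = \<infinity>"
proof -
  have pm: "(\<lambda>t. if t then p1 else p2) \<in> scale_measure r (count_space (UNIV :: bool set)) \<rightarrow>\<^sub>M sphere_borel" for r
    using p by (simp add: measurable_def space_scale_measure)
  have nn: "(\<integral>\<^sup>+y. f y \<partial>\<sigma>) = ennreal a * f p1 + ennreal a * f p2"
    if [measurable]: "f \<in> borel_measurable borel" for f
  proof -
    have "(\<integral>\<^sup>+y. f y \<partial>\<sigma>) = ennreal a * (\<Sum>t\<in>UNIV. f (if t then p1 else p2))"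
      unfolding \<sigma>_def add_measure_points[OF p]
      by (subst nn_integral_distr[OF pm]) (simp_all add: nn_integral_scale_measure nn_integral_count_space_finite)
    then show ?thesis by (simp add: UNIV_bool distrib_left add.commute)
  qed
  have L: "log_potential \<sigma> x =
      enn2ereal (ennreal a * e2ennreal (log_kernel x p1) + ennreal a * e2ennreal (log_kernel x p2)) -
      enn2ereal (ennreal a * e2ennreal (- log_kernel x p1) + ennreal a * e2ennreal (- log_kernel x p2))"
    unfolding log_potential_def ereal_integral_def by (subst (1 2) nn) auto
  have e: "e2ennreal (ereal r) = ennreal r" for r by (rule e2ennreal_ereal)
  show "log_potential \<sigma> x = ereal (a * skern x p1 + a * skern x p2 - a * ln 2)" if "x \<noteq> p1" "x \<noteq> p2"
  proof -
    define r s where "r = skern x p1 - ln 2 / 2" and "s = skern x p2 - ln 2 / 2"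
    have k: "log_kernel x p1 = ereal r" "log_kernel x p2 = ereal s"
      unfolding r_def s_def using that x p by (simp_all add: log_kernel_eq_skern)
    have "ennreal a * ennreal r + ennreal a * ennreal s = ennreal (a * max 0 r + a * max 0 s)" for r s
      using a by (simp add: ennreal_mult ennreal_max_0)
    then have mm: "enn2ereal (ennreal a * ennreal r + ennreal a * ennreal s) = ereal (a * max 0 r + a * max 0 s)" for r s
      using a by (simp only:) (rule enn2ereal_ennreal, simp)
    have "log_potential \<sigma> x = ereal (a * max 0 r + a * max 0 s) - ereal (a * max 0 (- r) + a * max 0 (- s))"
      unfolding L k uminus_ereal.simps(1) e mm ..
    also have "\<dots> = ereal (a * (max 0 r - max 0 (- r)) + a * (max 0 s - max 0 (- s)))" by (simp add: algebra_simps)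
    also have "\<dots> = ereal (a * r + a * s)" by (simp add: max_def)
    finally show ?thesis by (simp add: r_def s_def algebra_simps)
  qed
  show "log_potential \<sigma> x = \<infinity>" if "x = p1 \<or> x = p2"
  proof -
    have "ennreal a * e2ennreal (- log_kernel x y) < \<infinity>" if "y \<in> S2" for y
    proof (cases "x = y")
      case False
      have "- log_kernel x y = ereal (- (skern x y - ln 2 / 2))"
        using log_kernel_eq_skern[OF x that False] by simp
      then show ?thesis by (simp add: e ennreal_mult_less_top)
    qed (simp add: log_kernel_def e2ennreal_neg)
    then have neg: "ennreal a * e2ennreal (- log_kernel x p1) + ennreal a * e2ennreal (- log_kernel x p2) < \<infinity>"
      using p by simp
    have "ennreal a * e2ennreal (log_kernel x p1) + ennreal a * e2ennreal (log_kernel x p2) = \<infinity>"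
      using that a by (auto simp: log_kernel_def ennreal_mult_top)
    then show ?thesis unfolding L using neg
      by (cases "ennreal a * e2ennreal (- log_kernel x p1) + ennreal a * e2ennreal (- log_kernel x p2)")
         (auto simp: enn2ereal_ennreal)
  qed
qed

section \<open>Stereographic coordinates and densities on the sphere\<close>

lemma stereographic_eq_Some:
  "x \<in> S2 \<Longrightarrow> stereographic x = Some (of_real s) \<longleftrightarrow> x = line_to_sphere s"
proof -
  assume x: "x \<in> S2"
  show ?thesis
  proof
    assume st: "stereographic x = Some (of_real s)"
    then have n: "x $ 3 \<noteq> 1" by (auto simp: stereographic_def)
    define d where "d = 1 - x $ 3"
    have d: "d \<noteq> 0" "x $ 3 = 1 - d" using n by (auto simp: d_def)
    have "(of_real (x $ 1) + \<i> * of_real (x $ 2)) / of_real (1 - x $ 3) = (of_real s :: complex)"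
      using st n by (simp add: stereographic_def)
    then have "of_real (x $ 1) + \<i> * of_real (x $ 2) = (of_real (s * d) :: complex)"
      using d by (simp add: d_def[symmetric] field_simps)
    then have 12: "x $ 1 = s * d" "x $ 2 = 0" by (simp_all add: complex_eq_iff)
    have "(s * d)\<^sup>2 + (1 - d)\<^sup>2 = 1" using x unfolding mem_S2_iff 12 d(2) by simp
    then have "d * ((1 + s\<^sup>2) * d - 2) = 0" by (simp add: power2_eq_square algebra_simps)
    then have "(1 + s\<^sup>2) * d = 2" using d(1) by simp
    then have "d = 2 / (1 + s\<^sup>2)" by (simp add: field_simps)
    moreover have "1 - 2 / (1 + s\<^sup>2) = (s\<^sup>2 - 1) / (1 + s\<^sup>2)" by (simp add: field_simps)
    ultimately show "x = line_to_sphere s"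
      unfolding vec3_eq_iff line_to_sphere_nth 12 d(2) by simp
  next
    assume xs: "x = line_to_sphere s"
    have d: "1 - (s\<^sup>2 - 1) / (1 + s\<^sup>2) = 2 / (1 + s\<^sup>2)" by (simp add: field_simps)
    have n: "(s\<^sup>2 - 1) / (1 + s\<^sup>2) \<noteq> 1" by (simp add: field_simps)
    have "(of_real (2 * s / (1 + s\<^sup>2)) + \<i> * of_real 0) / of_real (2 / (1 + s\<^sup>2)) =
        (of_real (2 * s / (1 + s\<^sup>2) / (2 / (1 + s\<^sup>2))) :: complex)"
      by (simp only: of_real_divide of_real_0 mult_zero_right add_0_right)
    also have "2 * s / (1 + s\<^sup>2) / (2 / (1 + s\<^sup>2)) = s" by simp
    finally show "stereographic x = Some (of_real s)"
      unfolding stereographic_def xs line_to_sphere_nth d using n by (simp only: if_False)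
  qed
qed

lemma stereographic_inv_real: "stereographic_inv (Some (of_real s)) = line_to_sphere s"
proof -
  have "stereographic (line_to_sphere s) = Some (of_real s)"
    using stereographic_eq_Some[OF line_to_sphere_S2] by blast
  then have m: "Some (of_real s) \<in> stereographic ` S2"
    using line_to_sphere_S2 by (metis image_eqI)
  have "stereographic_inv (Some (of_real s)) \<in> S2" "stereographic (stereographic_inv (Some (of_real s))) = Some (of_real s)"
    unfolding stereographic_inv_def using inv_into_into[OF m] f_inv_into_f[OF m] by auto
  then show ?thesis using stereographic_eq_Some by blast
qed

lemma stereographic_real_iff:
  assumes "x \<in> S2" "x $ 2 = 0"
  shows "stereographic x \<in> insert None (Some ` \<real>)"
proof (cases "x $ 3 = 1")
  case False
  then have "stereographic x = Some (of_real (x $ 1 / (1 - x $ 3)))"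
    using assms by (simp add: stereographic_def)
  then show ?thesis using Reals_of_real by blast
qed (simp add: stereographic_def)

lemma line_to_sphere_sphere_measurable [measurable]: "line_to_sphere \<in> borel \<rightarrow>\<^sub>M sphere_borel"
  unfolding sphere_borel_def
  by (rule measurable_restrict_space2[OF Pi_I[OF line_to_sphere_S2] line_to_sphere_measurable])

lemma open_sphere_borel: "open U \<Longrightarrow> U \<inter> S2 \<in> sets sphere_borel"
proof -
  assume "open U"
  from imageI[OF borel_open[OF this], of "(\<inter>) S2"]
  show ?thesis unfolding sphere_borel_def sets_restrict_space by (simp only: Int_commute)
qed

lemma space_surface [simp]: "space surface_measure = S2" and sets_surface [simp]: "sets surface_measure = sets sphere_borel"
  by (simp add: surface_measure_eq space_restrict_space,
      unfold surface_measure_eq sphere_borel_def, rule sets_restrict_space_cong, rule sets_sphere_prob)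

lemma surface_density_integral:
  fixes f w :: "real ^ 3 \<Rightarrow> real"
  assumes [measurable]: "f \<in> borel_measurable borel" "w \<in> borel_measurable borel" and w: "\<And>x. 0 \<le> w x"
  shows "integrable (density surface_measure (\<lambda>x. ennreal (w x))) f \<longleftrightarrow> integrable sphere_prob (\<lambda>x. w x * f x)"
    "(\<integral>x. f x \<partial>density surface_measure (\<lambda>x. ennreal (w x))) = (\<integral>x. w x * f x \<partial>sphere_prob)"
    "(AE x in density surface_measure (\<lambda>x. ennreal (w x)). P x) \<longleftrightarrow> (AE x in sphere_prob. 0 < w x \<longrightarrow> P x)"
proof -
  have S[measurable]: "S2 \<in> sets (borel :: (real ^ 3) measure)" by simp
  have [measurable]: "f \<in> borel_measurable surface_measure" "w \<in> borel_measurable surface_measure"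
    unfolding surface_measure_eq by (auto intro!: measurable_restrict_space1)
  have ae: "AE x in sphere_prob. indicator S2 x *\<^sub>R (w x * f x) = w x * f x"
    using AE_sphere_prob by eventually_elim simp
  have "integrable (density surface_measure (\<lambda>x. ennreal (w x))) f \<longleftrightarrow> integrable surface_measure (\<lambda>x. w x * f x)"
    using w by (subst integrable_density) auto
  also have "\<dots> \<longleftrightarrow> integrable sphere_prob (\<lambda>x. indicator S2 x *\<^sub>R (w x * f x))"
    unfolding surface_measure_eq by (rule integrable_restrict_space) simp
  also have "\<dots> \<longleftrightarrow> integrable sphere_prob (\<lambda>x. w x * f x)"
    by (rule integrable_cong_AE) (use ae in auto)
  finally show "integrable (density surface_measure (\<lambda>x. ennreal (w x))) f \<longleftrightarrow> integrable sphere_prob (\<lambda>x. w x * f x)" .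
  have "(\<integral>x. f x \<partial>density surface_measure (\<lambda>x. ennreal (w x))) = (\<integral>x. w x * f x \<partial>surface_measure)"
    using w by (subst integral_density) auto
  also have "\<dots> = (\<integral>x. indicator S2 x *\<^sub>R (w x * f x) \<partial>sphere_prob)"
    unfolding surface_measure_eq by (rule integral_restrict_space) simp
  also have "\<dots> = (\<integral>x. w x * f x \<partial>sphere_prob)"
    by (rule integral_cong_AE) (use ae in auto)
  finally show "(\<integral>x. f x \<partial>density surface_measure (\<lambda>x. ennreal (w x))) = (\<integral>x. w x * f x \<partial>sphere_prob)" .
  have "(AE x in density surface_measure (\<lambda>x. ennreal (w x)). P x) \<longleftrightarrow> (AE x in surface_measure. 0 < w x \<longrightarrow> P x)"
    by (subst AE_density) auto
  also have "\<dots> \<longleftrightarrow> (AE x in sphere_prob. x \<in> S2 \<longrightarrow> 0 < w x \<longrightarrow> P x)"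
    unfolding surface_measure_eq by (rule AE_restrict_space_iff) simp
  also have "\<dots> \<longleftrightarrow> (AE x in sphere_prob. 0 < w x \<longrightarrow> P x)"
    using AE_sphere_prob by (auto elim: eventually_elim2)
  finally show "(AE x in density surface_measure (\<lambda>x. ennreal (w x)). P x) \<longleftrightarrow> (AE x in sphere_prob. 0 < w x \<longrightarrow> P x)" .
qed

lemma emeasure_surface: "A \<in> sets sphere_borel \<Longrightarrow> emeasure surface_measure A = emeasure sphere_prob A"
  unfolding surface_measure_eq sphere_borel_def
  by (subst emeasure_restrict_space) (auto simp: sets_restrict_space)

text \<open>The common goal of the case of two caps and the elliptic case, with the field and the
  droplet as parameters.\<close>

definition has_motherbody :: "real \<Rightarrow> (real \<Rightarrow> real) \<Rightarrow> (real ^ 3) set \<Rightarrow> bool" where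
  "has_motherbody a V D \<longleftrightarrow> (\<exists>\<sigma>'. sets \<sigma>' = sets sphere_borel \<and>
           measure_support \<sigma>' \<subseteq> {x \<in> S2. stereographic x \<in> insert None (Some ` \<real>)} \<and>
           emeasure \<sigma>' (space \<sigma>') = ennreal (1 / (2 * a)) \<and>
           (\<exists>m :: real.
              (\<forall>x \<in> S2 - D. log_potential (restrict_measure surface_measure D) x =
                 log_potential (scale_measure (ennreal (2 * a / (1 + 2 * a))) \<sigma>') x + ereal m) \<and>
              (\<forall>x \<in> D. log_potential (restrict_measure surface_measure D) x \<le>
                 log_potential (scale_measure (ennreal (2 * a / (1 + 2 * a))) \<sigma>') x + ereal m)) \<and>
           \<sigma>' = scale_measure (ennreal (1 / (2 * a)))
                  (distr (line_equilibrium V) sphere_borel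
                     (\<lambda>x. stereographic_inv (Some (complex_of_real x)))))"

text \<open>The interface between the potential theory and the two kinds of droplet
  \<open>q \<le> 0\<close>. The function h is the glued one, u the potential of the image of \<mu>0
  on the sphere, and H half the mean of h. The weight in \<open>green\<close> is the Laplacian of h:
  a on the droplet, - 1 / 2 elsewhere. By \<open>dense\<close> every point of the droplet is a limit
  of points with \<open>q < 0\<close>, hence lies in the support.\<close>

locale motherbody =
  fixes q h :: "real ^ 3 \<Rightarrow> real" and a c0 H K :: real and p1 p2 :: "real ^ 3"
    and \<mu>0 :: "real measure" and u :: "real ^ 3 \<Rightarrow> real"
  assumes qc: "continuous_on UNIV q"
    and h_measurable [measurable]: "h \<in> borel_measurable borel"
    and h_bound: "\<And>x. x \<in> S2 \<Longrightarrow> \<bar>h x\<bar> \<le> K"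
    and a: "0 < a" and p: "p1 \<in> S2" "p2 \<in> S2" and qp: "0 < q p1" "0 < q p2"
    and h_in: "\<And>x. x \<in> S2 \<Longrightarrow> q x \<le> 0 \<Longrightarrow> h x = a * skern x p1 + a * skern x p2"
    and h_out: "\<And>x. x \<in> S2 \<Longrightarrow> q x > 0 \<Longrightarrow> h x = c0 - u x"
    and green: "\<And>y. y \<in> S2 \<Longrightarrow>
      (\<integral>x. skern x y * (- 1 / 2 + (1 / 2 + a) * indicator (S2 \<inter> {x. q x \<le> 0}) x) \<partial>sphere_prob) = H - h y / 2"
    and green_mass: "(\<integral>x. - 1 / 2 + (1 / 2 + a) * indicator (S2 \<inter> {x. q x \<le> 0}) x \<partial>sphere_prob) = 0"
    and W: "\<And>x. x \<in> S2 \<Longrightarrow> x \<noteq> p1 \<Longrightarrow> x \<noteq> p2 \<Longrightarrow> c0 \<le> u x + a * skern x p1 + a * skern x p2"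
    and dense: "\<And>x U. x \<in> S2 \<Longrightarrow> q x \<le> 0 \<Longrightarrow> open U \<Longrightarrow> x \<in> U \<Longrightarrow> \<exists>y\<in>U \<inter> S2. q y < 0"
    and s0: "sets \<mu>0 = sets borel" and p0: "prob_space \<mu>0"
    and nu: "\<And>x. x \<in> S2 \<Longrightarrow> AE s in \<mu>0. x \<noteq> line_to_sphere s"
      "\<And>x. x \<in> S2 \<Longrightarrow> integrable \<mu>0 (\<lambda>s. skern x (line_to_sphere s))"
      "\<And>x. x \<in> S2 \<Longrightarrow> (\<integral>s. skern x (line_to_sphere s) \<partial>\<mu>0) = u x"
begin

definition droplet :: "(real ^ 3) set" where
  "droplet = S2 \<inter> {x. q x \<le> 0}"

lemma closed_q: "closed {x. q x \<le> 0}"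
  by (rule closed_Collect_le[OF qc continuous_on_const])

lemma open_q: "open {x. q x < 0}" "open {x. q x > 0}"
  by (rule open_Collect_less[OF qc continuous_on_const], rule open_Collect_less[OF continuous_on_const qc])

lemma droplet_borel [measurable]: "droplet \<in> sets borel"
  unfolding droplet_def by (rule borel_closed[OF closed_Int[OF closed_sphere closed_q]])

lemma droplet_sphere: "droplet \<in> sets sphere_borel"
proof -
  have "S2 \<inter> droplet = droplet" unfolding droplet_def by blast
  then show ?thesis
    using imageI[OF droplet_borel, of "(\<inter>) S2"] unfolding sphere_borel_def sets_restrict_space by simp
qed

abbreviation dind :: "real ^ 3 \<Rightarrow> real" where
  "dind \<equiv> indicator droplet"

lemma dind_skern_integrable: "x \<in> S2 \<Longrightarrow> integrable sphere_prob (\<lambda>y. dind y * skern x y)"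
proof -
  assume x: "x \<in> S2"
  have "integrable sphere_prob (\<lambda>y. skern x y)"
    using skern_sphere_integrable[OF x] by (simp add: skern_commute)
  then have "integrable sphere_prob (\<lambda>y. indicator droplet y *\<^sub>R skern x y)"
    by (intro integrable_mult_indicator) auto
  then show ?thesis by simp
qed

lemma droplet_measure: "measure sphere_prob droplet = 1 / (1 + 2 * a)"
proof -
  have "0 = (\<integral>x. - 1 / 2 + (1 / 2 + a) * dind x \<partial>sphere_prob)"
    unfolding droplet_def by (rule green_mass[symmetric])
  also have "\<dots> = - 1 / 2 + (1 / 2 + a) * measure sphere_prob droplet"
  proof -
    have i: "integrable sphere_prob dind" by (simp add: less_top[symmetric])
    then have "integrable sphere_prob (\<lambda>x. (1 / 2 + a) * dind x)" by simp
    from Bochner_Integration.integral_add[OF sphere_prob.integrable_const[of "- 1 / 2"] this]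
    show ?thesis by simp
  qed
  finally have "(1 + 2 * a) * measure sphere_prob droplet = 1" by (simp add: algebra_simps)
  then show ?thesis using a by (simp add: field_simps)
qed

definition dpot :: "real ^ 3 \<Rightarrow> real" where
  "dpot x = (\<integral>y. dind y * skern x y \<partial>sphere_prob)"

text \<open>In \<open>green\<close> the constant part - 1 / 2 of the weight contributes the
  potential of the full sphere, which does not depend on the point. What remains is the potential of
  the droplet.\<close>

lemma droplet_potential: "\<exists>C. \<forall>x\<in>S2. (1 + 2 * a) * dpot x = C - h x"
proof -
  define e :: "real ^ 3" where "e = vec3 1 0 0"
  have e: "e \<in> S2" by (simp only: mem_S2_iff e_def vec3_nth) simp
  have "(1 + 2 * a) * dpot x = (\<integral>y. skern y e \<partial>sphere_prob) + 2 * H - h x" if x: "x \<in> S2" for x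
  proof -
    have i: "integrable sphere_prob (\<lambda>y. skern y x)" by (rule skern_sphere_integrable[OF x])
    have i2: "integrable sphere_prob (\<lambda>y. dind y * skern y x)"
      using dind_skern_integrable[OF x] by (simp add: skern_commute)
    have "H - h x / 2 = (\<integral>y. skern y x * (- 1 / 2 + (1 / 2 + a) * dind y) \<partial>sphere_prob)"
      unfolding droplet_def by (rule green[OF x, symmetric])
    also have "\<dots> = (\<integral>y. - 1 / 2 * skern y x + (1 / 2 + a) * (dind y * skern y x) \<partial>sphere_prob)"
      by (rule Bochner_Integration.integral_cong) (auto simp: algebra_simps)
    also have "\<dots> = (\<integral>y. - 1 / 2 * skern y x \<partial>sphere_prob) + (\<integral>y. (1 / 2 + a) * (dind y * skern y x) \<partial>sphere_prob)"
      by (rule Bochner_Integration.integral_add[OF integrable_mult_right[OF i] integrable_mult_right[OF i2]])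
    also have "\<dots> = - 1 / 2 * (\<integral>y. skern y x \<partial>sphere_prob) + (1 / 2 + a) * dpot x"
      by (simp only: integral_mult_right_zero dpot_def skern_commute[of x])
    finally show ?thesis
      unfolding surface_potential_const[OF e x] by (simp add: algebra_simps)
  qed
  then show ?thesis by (intro exI[of _ "(\<integral>y. skern y e \<partial>sphere_prob) + 2 * H"]) simp
qed

lemma log_potential_droplet:
  assumes x: "x \<in> S2"
  shows "log_potential (restrict_measure surface_measure droplet) x = ereal (dpot x - ln 2 / 2 / (1 + 2 * a))"
proof -
  have eq: "restrict_measure surface_measure droplet = density surface_measure (\<lambda>x. ennreal (dind x))"
    by (simp add: restrict_measure_def ennreal_indicator)
  have fin: "emeasure (restrict_measure surface_measure droplet) S2 = emeasure sphere_prob droplet"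
  proof -
    have "emeasure (restrict_measure surface_measure droplet) S2 = emeasure surface_measure (droplet \<inter> S2)"
      unfolding restrict_measure_def
      by (rule emeasure_restricted) (use droplet_sphere sets.top[of surface_measure] in simp_all)
    also have "droplet \<inter> S2 = droplet" by (auto simp: droplet_def)
    also have "emeasure surface_measure droplet = emeasure sphere_prob droplet"
      by (rule emeasure_surface[OF droplet_sphere])
    finally show ?thesis .
  qed
  have "log_potential (restrict_measure surface_measure droplet) x =
      ereal ((\<integral>y. skern x y \<partial>restrict_measure surface_measure droplet) - ln 2 / 2 * measure (restrict_measure surface_measure droplet) S2)"
  proof (rule log_potential_eq[OF _ _ x])
    show "sets (restrict_measure surface_measure droplet) = sets sphere_borel"
      by (simp add: restrict_measure_def)
    show "finite_measure (restrict_measure surface_measure droplet)"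
    proof (rule finite_measureI)
      show "emeasure (restrict_measure surface_measure droplet) (space (restrict_measure surface_measure droplet)) \<noteq> \<infinity>"
        using fin by (simp add: restrict_measure_def)
    qed
    have "AE y in sphere_prob. y \<noteq> x" by (rule AE_I[where N = "{x}"]) (auto simp: sphere_prob_point)
    then show "AE y in restrict_measure surface_measure droplet. x \<noteq> y"
      unfolding eq by (subst surface_density_integral(3)[where f = "\<lambda>_. 0"]) (auto elim: eventually_mono)
    show "integrable (restrict_measure surface_measure droplet) (\<lambda>y. skern x y)"
      unfolding eq by (subst surface_density_integral(1)) (use dind_skern_integrable[OF x] in auto)
  qed
  moreover have "(\<integral>y. skern x y \<partial>restrict_measure surface_measure droplet) = dpot x"
    unfolding eq dpot_def by (subst surface_density_integral(2)) auto
  moreover have "measure (restrict_measure surface_measure droplet) S2 = 1 / (1 + 2 * a)"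
    using fin droplet_measure by (simp add: measure_def)
  ultimately show ?thesis by simp
qed

text \<open>The candidate for the equilibrium measure; 1 + 2 * a is the reciprocal of the area of
  the droplet.\<close>

definition equil :: "(real ^ 3) measure" where
  "equil = density surface_measure (\<lambda>x. ennreal ((1 + 2 * a) * dind x))"

lemma sets_equil: "sets equil = sets sphere_borel" and space_equil: "space equil = S2"
  by (simp_all add: equil_def)

lemma weight_measurable: "(\<lambda>x. (1 + 2 * a) * dind x) \<in> borel_measurable borel"
  and weight_nonneg: "0 \<le> (1 + 2 * a) * dind x"
  using a by auto

lemma emeasure_equil:
  assumes "A \<in> sets sphere_borel"
  shows "emeasure equil A = ennreal (1 + 2 * a) * emeasure sphere_prob (droplet \<inter> A)"
proof -
  have eq: "equil = density (density surface_measure (indicator droplet)) (\<lambda>_. ennreal (1 + 2 * a))"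
  proof -
    have [measurable]: "droplet \<in> sets surface_measure" using droplet_sphere by simp
    show ?thesis unfolding equil_def
      by (subst density_density_eq) (auto intro!: density_cong simp: indicator_def)
  qed
  have "emeasure equil A = ennreal (1 + 2 * a) * emeasure (density surface_measure (indicator droplet)) A"
    unfolding eq using assms by (subst emeasure_density_const) auto
  also have "emeasure (density surface_measure (indicator droplet)) A = emeasure surface_measure (droplet \<inter> A)"
    by (rule emeasure_restricted) (use assms droplet_sphere in simp_all)
  also have "\<dots> = emeasure sphere_prob (droplet \<inter> A)"
    by (rule emeasure_surface) (use assms droplet_sphere in auto)
  finally show ?thesis .
qed

lemma prob_space_equil: "prob_space equil"
proof (rule prob_spaceI)
  have "emeasure equil (space equil) = ennreal (1 + 2 * a) * emeasure sphere_prob (droplet \<inter> S2)"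
    unfolding space_equil using sets.top[of sphere_borel] by (intro emeasure_equil) simp
  also have "droplet \<inter> S2 = droplet" by (auto simp: droplet_def)
  also have "emeasure sphere_prob droplet = ennreal (1 / (1 + 2 * a))"
    using droplet_measure by (simp add: sphere_prob.emeasure_eq_measure)
  also have "ennreal (1 + 2 * a) * \<dots> = ennreal ((1 + 2 * a) * (1 / (1 + 2 * a)))"
    using a by (intro ennreal_mult[symmetric]) auto
  also have "(1 + 2 * a) * (1 / (1 + 2 * a)) = 1" using a by simp
  also have "ennreal 1 = 1" by simp
  finally show "emeasure equil (space equil) = 1" .
qed

lemma AE_equil: "AE x in equil. x \<in> droplet"
  unfolding equil_def
  by (subst surface_density_integral(3)[where f = "\<lambda>_. 0"])
     (use weight_measurable weight_nonneg in \<open>auto simp: indicator_def\<close>)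

text \<open>The set \<open>q > 0\<close> is open and not charged. Conversely each neighbourhood of a
  droplet point meets the open set \<open>q < 0\<close>, and nonempty open parts of the sphere have
  positive area.\<close>

lemma support_equil: "measure_support equil = droplet"
proof (intro set_eqI iffI)
  fix x assume x: "x \<in> measure_support equil"
  then have S: "x \<in> S2" and pos: "\<And>U. open U \<Longrightarrow> x \<in> U \<Longrightarrow> emeasure equil (U \<inter> S2) > 0"
    by (auto simp: measure_support_def space_equil)
  have m: "{x. q x > 0} \<inter> S2 \<in> sets sphere_borel"
    by (rule open_sphere_borel[OF open_q(2)])
  have e: "droplet \<inter> ({x. q x > 0} \<inter> S2) = {}"
    unfolding droplet_def using not_le by blast
  have "emeasure equil ({x. q x > 0} \<inter> S2) = 0"
    unfolding emeasure_equil[OF m] e by simp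
  then have "\<not> q x > 0" using pos[OF open_q(2)] by force
  then show "x \<in> droplet" using S by (simp add: droplet_def)
next
  fix x assume "x \<in> droplet"
  then have x: "x \<in> S2" "q x \<le> 0" by (auto simp: droplet_def)
  have "emeasure equil (U \<inter> S2) > 0" if U: "open U" "x \<in> U" for U
  proof -
    obtain y where y: "y \<in> U" "y \<in> S2" "q y < 0" using dense[OF x U] by auto
    have o: "open (U \<inter> {x. q x < 0})" using U open_q by auto
    have mU: "U \<inter> S2 \<in> sets sphere_borel"
      by (rule open_sphere_borel) (rule U)
    have "0 < emeasure sphere_prob (U \<inter> {x. q x < 0})"
      by (rule sphere_prob_open_pos[OF o]) (use y in auto)
    also have "\<dots> \<le> emeasure sphere_prob (droplet \<inter> (U \<inter> S2))"
    proof (rule emeasure_mono_AE)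
      show "AE x in sphere_prob. x \<in> U \<inter> {x. q x < 0} \<longrightarrow> x \<in> droplet \<inter> (U \<inter> S2)"
        using AE_sphere_prob by eventually_elim (auto simp: droplet_def)
      show "droplet \<inter> (U \<inter> S2) \<in> sets sphere_prob" using U by (auto intro: borel_open)
    qed
    finally show ?thesis unfolding emeasure_equil[OF mU] using a
      by (simp add: ennreal_zero_less_mult_iff del: ennreal_plus)
  qed
  then show "x \<in> measure_support equil" using x by (simp add: measure_support_def space_equil)
qed

text \<open>The potential of \<open>equil\<close> is C - h. On the droplet h is the potential of the
  two charges, so the Frostman sum is constant; off the droplet h = c0 - u, and the obstacle
  inequality \<open>W\<close> is the Frostman inequality.\<close>

lemma sphere_equilibrium_eq:
  "sphere_equilibrium (add_measure (scale_measure (ennreal a) (return sphere_borel p1))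
     (scale_measure (ennreal a) (return sphere_borel p2))) = equil" (is "sphere_equilibrium ?\<sigma> = _")
proof -
  obtain C where C: "\<And>x. x \<in> S2 \<Longrightarrow> (1 + 2 * a) * dpot x = C - h x" using droplet_potential by blast
  have K: "\<bar>C - h x\<bar> \<le> \<bar>C\<bar> + K" if "x \<in> S2" for x using h_bound[OF that] by linarith
  show ?thesis
  proof (rule sphere_equilibrium_eqI[where u = "\<lambda>x. C - h x" and B = "\<bar>C\<bar> + K" and P = "{p1, p2}"
        and q = "\<lambda>x. a * skern x p1 + a * skern x p2 - a * ln 2" and F = "C - a * ln 2"])
    show "sets equil = sets sphere_borel" by (rule sets_equil)
    show "prob_space equil" by (rule prob_space_equil)
    fix x :: "real ^ 3" assume x: "x \<in> S2"
    have "AE y in sphere_prob. y \<noteq> x" by (rule AE_I[where N = "{x}"]) (auto simp: sphere_prob_point)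
    then show "AE y in equil. x \<noteq> y"
      unfolding equil_def
      by (subst surface_density_integral(3)[where f = "\<lambda>_. 0"])
         (use weight_measurable weight_nonneg in \<open>auto elim: eventually_mono\<close>)
    have eqm: "(\<lambda>y. (1 + 2 * a) * dind y * skern x y) = (\<lambda>y. (1 + 2 * a) * (dind y * skern x y))"
      by (simp add: mult.assoc)
    show "integrable equil (\<lambda>y. skern x y)"
      unfolding equil_def
      by (subst surface_density_integral(1)[OF _ weight_measurable weight_nonneg])
         (simp, unfold eqm, rule integrable_mult_right[OF dind_skern_integrable[OF x]])
    show "(\<integral>y. skern x y \<partial>equil) = C - h x"
      unfolding equil_def C[OF x, symmetric] dpot_def
      by (subst surface_density_integral(2)[OF _ weight_measurable weight_nonneg])
         (simp, unfold eqm, rule integral_mult_right_zero)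
    show "\<bar>C - h x\<bar> \<le> \<bar>C\<bar> + K" by (rule K[OF x])
  next
    show "(\<lambda>x. C - h x) \<in> borel_measurable borel" by measurable
    show "closed {p1, p2}" by simp
    show "(\<lambda>x. a * skern x p1 + a * skern x p2 - a * ln 2) \<in> borel_measurable borel" by measurable
    fix x assume x: "x \<in> S2 - {p1, p2}"
    then show "log_potential ?\<sigma> x = ereal (a * skern x p1 + a * skern x p2 - a * ln 2)"
      by (intro log_potential_points(1)[OF p a]) auto
    show "C - a * ln 2 \<le> C - h x + (a * skern x p1 + a * skern x p2 - a * ln 2)"
      using h_in[of x] h_out[of x] W[of x] x by (cases "q x \<le> 0") auto
  next
    fix x assume x: "x \<in> {p1, p2}"
    then have "x \<in> S2" using p by auto
    then show "log_potential ?\<sigma> x = \<infinity>"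
      by (rule log_potential_points(2)[OF p a]) (use x in auto)
  next
    show "AE x in equil. x \<notin> {p1, p2} \<and> C - h x + (a * skern x p1 + a * skern x p2 - a * ln 2) = C - a * ln 2"
      using AE_equil
    proof eventually_elim
      case (elim x)
      then have x: "x \<in> S2" "q x \<le> 0" by (auto simp: droplet_def)
      then show ?case using h_in[OF x] qp by auto
    qed
  qed
qed

theorem motherbody_exists:
  assumes V: "line_equilibrium V = \<mu>0"
    and D: "D = measure_support (sphere_equilibrium (add_measure (scale_measure (ennreal a) (return sphere_borel p1))
     (scale_measure (ennreal a) (return sphere_borel p2))))"
  shows "has_motherbody a V D"
proof -
  interpret m0: prob_space \<mu>0 by (rule p0)
  note [measurable_cong] = s0
  have sp0: "space \<mu>0 = UNIV" using sets_eq_imp_space_eq[OF s0] by simp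
  have D: "D = droplet" unfolding D sphere_equilibrium_eq by (rule support_equil)
  obtain C where C: "\<And>x. x \<in> S2 \<Longrightarrow> (1 + 2 * a) * dpot x = C - h x" using droplet_potential by blast
  define \<nu> where "\<nu> = distr \<mu>0 sphere_borel line_to_sphere"
  define \<sigma>' where "\<sigma>' = scale_measure (ennreal (1 / (2 * a))) \<nu>"
  have lm: "line_to_sphere \<in> \<mu>0 \<rightarrow>\<^sub>M sphere_borel" by measurable
  interpret n: prob_space \<nu> unfolding \<nu>_def by (rule m0.prob_space_distr[OF lm])
  have sn: "sets \<nu> = sets sphere_borel" and spn: "space \<nu> = S2" by (simp_all add: \<nu>_def)
  have ss: "sets \<sigma>' = sets sphere_borel" and sps: "space \<sigma>' = S2"
    by (simp_all add: \<sigma>'_def sn space_scale_measure spn)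
  define c where "c = 1 / (1 + 2 * a)"
  have c0: "0 < c" using a by (simp add: c_def)
  have sc: "scale_measure (ennreal (2 * a / (1 + 2 * a))) \<sigma>' = density \<nu> (\<lambda>_. ennreal c)"
    unfolding \<sigma>'_def scale_scale_measure scale_measure_eq_density[symmetric] c_def using a
    by (simp add: ennreal_mult[symmetric])
  have nun: "integrable \<nu> (\<lambda>y. skern x y)" "(\<integral>y. skern x y \<partial>\<nu>) = u x" "AE y in \<nu>. x \<noteq> y" if x: "x \<in> S2" for x
  proof -
    have [measurable]: "(\<lambda>y. skern x y) \<in> borel_measurable sphere_borel" by measurable
    show "integrable \<nu> (\<lambda>y. skern x y)" unfolding \<nu>_def
      by (subst integrable_distr_eq[OF lm]) (use nu(2)[OF x] in auto)
    show "(\<integral>y. skern x y \<partial>\<nu>) = u x" unfolding \<nu>_def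
      by (subst integral_distr[OF lm]) (use nu(3)[OF x] in auto)
    have "{y \<in> space sphere_borel. x \<noteq> y} = (- {x}) \<inter> S2" by auto
    also have "\<dots> \<in> sets sphere_borel"
      by (rule open_sphere_borel) (simp add: open_Compl)
    finally show "AE y in \<nu>. x \<noteq> y" unfolding \<nu>_def
      by (subst AE_distr_iff[OF lm]) (use nu(1)[OF x] in auto)
  qed
  have pot: "log_potential (scale_measure (ennreal (2 * a / (1 + 2 * a))) \<sigma>') x = ereal (c * u x - ln 2 / 2 * c)"
    if x: "x \<in> S2" for x
  proof -
    have "emeasure (density \<nu> (\<lambda>_. ennreal c)) S2 = ennreal c"
      using n.emeasure_space_1 spn sets.top[of \<nu>] by (simp add: emeasure_density_const)
    then have m: "measure (density \<nu> (\<lambda>_. ennreal c)) S2 = c" using c0 by (simp add: measure_def)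
    have "log_potential (density \<nu> (\<lambda>_. ennreal c)) x =
        ereal ((\<integral>y. skern x y \<partial>density \<nu> (\<lambda>_. ennreal c)) - ln 2 / 2 * measure (density \<nu> (\<lambda>_. ennreal c)) S2)"
    proof (rule log_potential_eq[OF _ _ x])
      show "finite_measure (density \<nu> (\<lambda>_. ennreal c))"
        by (rule finite_measureI) (simp add: spn \<open>emeasure (density \<nu> (\<lambda>_. ennreal c)) S2 = ennreal c\<close>)
      show "AE y in density \<nu> (\<lambda>_. ennreal c). x \<noteq> y"
        by (subst AE_density) (use nun(3)[OF x] in \<open>auto elim: eventually_mono\<close>)
      show "integrable (density \<nu> (\<lambda>_. ennreal c)) (\<lambda>y. skern x y)"
        using c0 nun(1)[OF x] by (subst integrable_density) auto
    qed (simp add: sn)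
    moreover have "(\<integral>y. skern x y \<partial>density \<nu> (\<lambda>_. ennreal c)) = c * u x"
      using c0 nun(1,2)[OF x] by (subst integral_density) auto
    ultimately show ?thesis unfolding sc m by simp
  qed
  have dp: "dpot x = c * (C - h x)" if "x \<in> S2" for x
    using C[OF that] a by (simp add: c_def field_simps)
  have ldp: "log_potential (restrict_measure surface_measure D) x = ereal (c * (C - h x) - ln 2 / 2 * c)" if "x \<in> S2" for x
    unfolding D log_potential_droplet[OF that] dp[OF that] by (simp add: c_def)
  show ?thesis
    unfolding has_motherbody_def
  \<comment> \<open>Both measures have mass c, so their shifts by ln 2 / 2 agree. The potentials
    compared are c * (C - h) and c * u; off the droplet h = c0 - u leaves this constant, and on it
    \<open>W\<close> bounds C - h by u + (C - c0).\<close>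
  proof (intro exI[of _ \<sigma>'] exI[of _ "c * (C - c0)"] conjI ballI)
    show "sets \<sigma>' = sets sphere_borel" by (rule ss)
    show "emeasure \<sigma>' (space \<sigma>') = ennreal (1 / (2 * a))"
      using n.emeasure_space_1 by (simp add: \<sigma>'_def space_scale_measure)
    show "\<sigma>' = scale_measure (ennreal (1 / (2 * a)))
                  (distr (line_equilibrium V) sphere_borel
                     (\<lambda>x. stereographic_inv (Some (complex_of_real x))))"
      unfolding V stereographic_inv_real \<sigma>'_def \<nu>_def ..
    show "measure_support \<sigma>' \<subseteq> {x \<in> S2. stereographic x \<in> insert None (Some ` \<real>)}"
    proof
      fix x assume "x \<in> measure_support \<sigma>'"
      then have S: "x \<in> S2" and pos: "\<And>U. open U \<Longrightarrow> x \<in> U \<Longrightarrow> emeasure \<sigma>' (U \<inter> S2) > 0"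
        by (auto simp: measure_support_def sps)
      define U :: "(real ^ 3) set" where "U = {y. y $ 2 \<noteq> 0}"
      have U: "open U" unfolding U_def by (intro open_Collect_neq continuous_intros)
      have mU: "U \<inter> S2 \<in> sets sphere_borel"
        by (rule open_sphere_borel) (rule U)
      have "line_to_sphere -` (U \<inter> S2) \<inter> space \<mu>0 = {}" by (auto simp: U_def line_to_sphere_nth)
      then have "emeasure \<sigma>' (U \<inter> S2) = 0"
        unfolding \<sigma>'_def \<nu>_def by (simp add: emeasure_distr[OF lm mU])
      then have "x $ 2 = 0" using pos[OF U] by (auto simp: U_def)
      with S stereographic_real_iff show "x \<in> {x \<in> S2. stereographic x \<in> insert None (Some ` \<real>)}" by blast
    qed
    fix x assume "x \<in> S2 - D"
    then have x: "x \<in> S2" "\<not> q x \<le> 0" by (auto simp: D droplet_def)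
    then have hx: "h x = c0 - u x" using h_out[of x] by simp
    show "log_potential (restrict_measure surface_measure D) x =
        log_potential (scale_measure (ennreal (2 * a / (1 + 2 * a))) \<sigma>') x + ereal (c * (C - c0))"
      unfolding ldp[OF x(1)] pot[OF x(1)] hx by (simp add: algebra_simps)
  next
    fix x assume "x \<in> D"
    then have x: "x \<in> S2" "q x \<le> 0" by (auto simp: D droplet_def)
    then have "h x = a * skern x p1 + a * skern x p2" using h_in[of x] by simp
    moreover have "x \<noteq> p1" "x \<noteq> p2" using x qp by auto
    ultimately have "C - h x \<le> u x + (C - c0)" using W[OF x(1)] by simp
    then have "c * (C - h x) \<le> c * (u x + (C - c0))" using c0 by (intro mult_left_mono) auto
    then show "log_potential (restrict_measure surface_measure D) x \<le>
        log_potential (scale_measure (ennreal (2 * a / (1 + 2 * a))) \<sigma>') x + ereal (c * (C - c0))"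
      unfolding ldp[OF x(1)] pot[OF x(1)] by (simp add: algebra_simps)
  qed
qed

end

section \<open>Complements of two caps\<close>

text \<open>An orbit not contained in the zero set meets it finitely often, so the average of its
  indicator over almost every orbit is 0, and by invariance so is its measure.\<close>

lemma AE_nonzero_of_orbits:
  assumes qc: "continuous_on UNIV q" and qt: "\<And>x. trig2 (\<lambda>t. q (rot i t x))"
    and nz: "AE x in sphere_prob. \<exists>t. q (rot i t x) \<noteq> 0"
  shows "AE x in sphere_prob. q x \<noteq> 0"
proof -
  have [measurable]: "q \<in> borel_measurable borel" using qc by (rule borel_measurable_continuous_onI)
  define Z where "Z = {x. q x = 0}"
  have Z[measurable]: "Z \<in> sets borel" unfolding Z_def by measurable
  have "(\<integral>x. indicator Z x \<partial>sphere_prob) = (0 :: real)"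
  proof (rule rotation_average_zero[where B = 1 and i = i])
    show "AE x in sphere_prob. ((\<lambda>t. indicator Z (rot i t x)) has_integral (0 :: real)) {0..2 * pi}"
      using nz
    proof eventually_elim
      case (elim x)
      then obtain t0 where "q (rot i t0 x) \<noteq> 0" by blast
      then have "finite {t \<in> {0..2 * pi}. q (rot i t x) = 0}"
        by (rule trig2_zeros[OF qt])
      then have "negligible {t \<in> {0..2 * pi}. q (rot i t x) = 0}" by (rule negligible_finite)
      then show ?case
        by (rule has_integral_spike[OF _ _ has_integral_0]) (auto simp: Z_def)
    qed
  qed auto
  then have "measure sphere_prob Z = 0" by simp
  then have "emeasure sphere_prob Z = 0" by (simp add: sphere_prob.emeasure_eq_measure)
  then show ?thesis by (intro AE_I[of _ _ Z]) (auto simp: Z_def)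
qed

lemma AE_finite_orbit_zeros:
  assumes qt: "\<And>x. trig2 (\<lambda>t. q (rot i t x))" and q0: "AE x in sphere_prob. q x \<noteq> 0"
  shows "AE x in sphere_prob. finite {t \<in> {0..2 * pi}. q (rot i t x) = 0}"
  using q0
proof eventually_elim
  case (elim x)
  show ?case by (rule trig2_zeros[OF qt, where ?t0.0 = 0]) (use elim in simp)
qed

lemma trig2_add: "trig2 f \<Longrightarrow> trig2 g \<Longrightarrow> trig2 (\<lambda>t. f t + g t)"
proof -
  assume "trig2 f" "trig2 g"
  then obtain a0 a1 a2 a3 a4 b0 b1 b2 b3 b4 where
    "\<And>t. f t = a0 + a1 * cos t + a2 * sin t + a3 * (cos t)\<^sup>2 + a4 * (cos t * sin t)"
    "\<And>t. g t = b0 + b1 * cos t + b2 * sin t + b3 * (cos t)\<^sup>2 + b4 * (cos t * sin t)"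
    unfolding trig2_def by blast
  then have "\<forall>t. f t + g t = (a0 + b0) + (a1 + b1) * cos t + (a2 + b2) * sin t + (a3 + b3) * (cos t)\<^sup>2 + (a4 + b4) * (cos t * sin t)"
    by (simp add: distrib_right)
  then show ?thesis unfolding trig2_def by blast
qed

lemma trig2_cmult: "trig2 f \<Longrightarrow> trig2 (\<lambda>t. k * f t)"
proof -
  assume "trig2 f"
  then obtain a0 a1 a2 a3 a4 where
    "\<And>t. f t = a0 + a1 * cos t + a2 * sin t + a3 * (cos t)\<^sup>2 + a4 * (cos t * sin t)"
    unfolding trig2_def by blast
  then have "\<forall>t. k * f t = (k * a0) + (k * a1) * cos t + (k * a2) * sin t + (k * a3) * (cos t)\<^sup>2 + (k * a4) * (cos t * sin t)"
    by (simp add: distrib_left mult.assoc)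
  then show ?thesis unfolding trig2_def by blast
qed

text \<open>Coordinates of an orbit are affine in \<open>cos t\<close> and \<open>sin t\<close>, so a quadratic polynomial restricts to
  a trigonometric polynomial of degree two.\<close>

definition trig1 :: "(real \<Rightarrow> real) \<Rightarrow> bool" where
  "trig1 F \<longleftrightarrow> (\<exists>a0 a1 a2. \<forall>t. F t = a0 + a1 * cos t + a2 * sin t)"

lemma trig1_rot: "trig1 (\<lambda>t. rot i t x $ j)"
proof -
  have "j = 1 \<or> j = 2 \<or> j = 3" by (rule exhaust_3)
  moreover have "trig1 (\<lambda>t. rot i t x $ 1)" "trig1 (\<lambda>t. rot i t x $ 2)" "trig1 (\<lambda>t. rot i t x $ 3)"
  proof -
    have c: "trig1 (\<lambda>t. c)" for c unfolding trig1_def by (rule exI[of _ c], rule exI[of _ 0], rule exI[of _ 0]) simp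
    have l: "trig1 (\<lambda>t. cos t * u - sin t * v)" "trig1 (\<lambda>t. cos t * u + sin t * v)" "trig1 (\<lambda>t. sin t * v + cos t * u)" for u v
      unfolding trig1_def
      by (rule exI[of _ 0], rule exI[of _ u], rule exI[of _ "- v"], simp,
          (rule exI[of _ 0], rule exI[of _ u], rule exI[of _ v], simp)+)
    show "trig1 (\<lambda>t. rot i t x $ 1)" "trig1 (\<lambda>t. rot i t x $ 2)" "trig1 (\<lambda>t. rot i t x $ 3)"
      by (cases "i = 1"; cases "i = 2"; simp add: rot_defs c l)+
  qed
  ultimately show ?thesis by auto
qed

lemma trig1_trig2: "trig1 f \<Longrightarrow> trig2 f"
proof -
  assume "trig1 f"
  then obtain a0 a1 a2 where "\<And>t. f t = a0 + a1 * cos t + a2 * sin t" unfolding trig1_def by blast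
  then have "\<forall>t. f t = a0 + a1 * cos t + a2 * sin t + 0 * (cos t)\<^sup>2 + 0 * (cos t * sin t)" by simp
  then show ?thesis unfolding trig2_def by blast
qed

lemma trig1_mult: "trig1 f \<Longrightarrow> trig1 g \<Longrightarrow> trig2 (\<lambda>t. f t * g t)"
proof -
  assume "trig1 f" "trig1 g"
  then obtain a0 a1 a2 b0 b1 b2 where f: "\<And>t. f t = a0 + a1 * cos t + a2 * sin t"
    and g: "\<And>t. g t = b0 + b1 * cos t + b2 * sin t" unfolding trig1_def by blast
  have "\<forall>t. f t * g t = (a0 * b0 + a2 * b2) + (a0 * b1 + a1 * b0) * cos t + (a0 * b2 + a2 * b0) * sin t
      + (a1 * b1 - a2 * b2) * (cos t)\<^sup>2 + (a1 * b2 + a2 * b1) * (cos t * sin t)"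
  proof
    fix t :: real
    have "sin t * sin t = 1 - (cos t)\<^sup>2" by (simp add: power2_eq_square[symmetric] sin_squared_eq)
    then have "a2 * b2 * (sin t * sin t) = a2 * b2 * (1 - (cos t)\<^sup>2)" by simp
    then show "f t * g t = (a0 * b0 + a2 * b2) + (a0 * b1 + a1 * b0) * cos t + (a0 * b2 + a2 * b0) * sin t
      + (a1 * b1 - a2 * b2) * (cos t)\<^sup>2 + (a1 * b2 + a2 * b1) * (cos t * sin t)"
      unfolding f g by (simp add: algebra_simps power2_eq_square)
  qed
  then show ?thesis unfolding trig2_def by blast
qed

lemma trig2_inner: "trig2 (\<lambda>t. rot i t x \<bullet> p)"
  unfolding inner_3 mult.commute[of _ "p $ _"]
  by (intro trig2_add trig2_cmult trig1_trig2 trig1_rot)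

context piecewise_rot_C2
begin

lemma continuous_h:
  assumes cont: "continuous_on (S2 \<inter> {x. q x \<le> 0}) HA" "continuous_on (S2 \<inter> {x. q x \<ge> 0}) HB"
  shows "continuous_on S2 h"
proof -
  have cl: "closed (S2 \<inter> {x. q x \<le> 0})" "closed (S2 \<inter> {x. q x \<ge> 0})"
    by (rule closed_Int[OF closed_sphere closed_Collect_le[OF qc continuous_on_const]],
        rule closed_Int[OF closed_sphere closed_Collect_le[OF continuous_on_const qc]])
  have "continuous_on ((S2 \<inter> {x. q x \<le> 0}) \<union> (S2 \<inter> {x. q x \<ge> 0})) (\<lambda>x. if q x \<le> 0 then HA x else HB x)"
  proof (rule continuous_on_cases[OF cl cont])
    show "\<forall>x. x \<in> S2 \<inter> {x. q x \<le> 0} \<and> \<not> q x \<le> 0 \<or> x \<in> S2 \<inter> {x. 0 \<le> q x} \<and> q x \<le> 0 \<longrightarrow> HA x = HB x"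
      using AB by (metis (no_types, lifting) IntE mem_Collect_eq order_antisym)
  qed
  moreover have "(S2 \<inter> {x. q x \<le> 0}) \<union> (S2 \<inter> {x. q x \<ge> 0}) = S2" by (rule set_eqI) (use linear in blast)
  ultimately show ?thesis by (simp add: h_def[abs_def])
qed

end

lemma rot_C2_at_cmult_add:
  assumes "rot_C2_at H H1 H2 x"
  shows "rot_C2_at (\<lambda>x. c + k * H x) (\<lambda>i x. k * H1 i x) (\<lambda>i x. k * H2 i x) x"
  using assms unfolding rot_C2_at_def by (auto intro!: derivative_eq_intros)

lemma rot_C2_at_add:
  assumes "rot_C2_at F F1 F2 x" "rot_C2_at G G1 G2 x"
  shows "rot_C2_at (\<lambda>x. F x + G x) (\<lambda>i x. F1 i x + G1 i x) (\<lambda>i x. F2 i x + G2 i x) x"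
  using assms unfolding rot_C2_at_def by (auto intro!: derivative_eq_intros)

lemma continuous_on_skern:
  "(\<And>x. x \<in> S \<Longrightarrow> x \<bullet> y \<noteq> 1) \<Longrightarrow> continuous_on S (\<lambda>x. skern x y)"
  unfolding skern_def by (intro continuous_intros) auto

lemma kern2_sum_half:
  assumes "x \<in> S2" "y \<in> S2" "x \<bullet> y \<noteq> 1"
  shows "(\<Sum>i\<in>UNIV. kern2 1 y i x) = 1 / 2"
  using kern2_sum[OF assms] by simp

text \<open>The measure on the line is the image under s of a density w on the circle of angles. The
  potential is required on the whole sphere, not only on the great circle, because the mother body
  identity is tested there.\<close>

locale circle_pushforward =
  fixes w s :: "real \<Rightarrow> real" and u :: "real ^ 3 \<Rightarrow> real"
  assumes w[measurable]: "w \<in> borel_measurable borel" and s[measurable]: "s \<in> borel_measurable borel"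
    and w0: "\<And>t. 0 \<le> w t" and w1: "integrable circ w" "(\<integral>t. w t \<partial>circ) = 1"
    and pot: "\<And>x. x \<in> S2 \<Longrightarrow> AE t in circ. x \<noteq> line_to_sphere (s t)"
      "\<And>x. x \<in> S2 \<Longrightarrow> integrable circ (\<lambda>t. w t * skern x (line_to_sphere (s t)))"
      "\<And>x. x \<in> S2 \<Longrightarrow> (\<integral>t. w t * skern x (line_to_sphere (s t)) \<partial>circ) = u x"
begin

definition \<mu> :: "real measure" where
  "\<mu> = distr (density circ (\<lambda>t. ennreal (w t))) borel s"

lemma sets_\<mu> [simp, measurable_cong]: "sets \<mu> = sets borel" and space_\<mu> [simp]: "space \<mu> = UNIV"
  by (simp_all add: \<mu>_def)

lemma prob_space_\<mu>: "prob_space \<mu>"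
proof -
  have "emeasure (density circ (\<lambda>t. ennreal (w t))) UNIV = ennreal (\<integral>t. w t \<partial>circ)"
    by (subst emeasure_density) (use w0 w1 in \<open>auto simp: nn_integral_eq_integral\<close>)
  then have "prob_space (density circ (\<lambda>t. ennreal (w t)))"
    by (intro prob_spaceI) (simp add: w1)
  then show ?thesis unfolding \<mu>_def by (rule prob_space.prob_space_distr) simp
qed

lemma AE_\<mu>: "(AE t in circ. P (s t)) \<Longrightarrow> {x. P x} \<in> sets borel \<Longrightarrow> AE x in \<mu>. P x"
  unfolding \<mu>_def
  by (subst AE_distr_iff) (auto simp: AE_density elim: eventually_mono)

lemma potential_\<mu>:
  assumes x: "x \<in> S2"
  shows "AE y in \<mu>. x \<noteq> line_to_sphere y" "integrable \<mu> (\<lambda>y. skern x (line_to_sphere y))"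
    "(\<integral>y. skern x (line_to_sphere y) \<partial>\<mu>) = u x"
proof -
  show "AE y in \<mu>. x \<noteq> line_to_sphere y"
  proof (rule AE_\<mu>[OF pot(1)[OF x]])
    have "Measurable.pred borel (\<lambda>y. x \<noteq> line_to_sphere y)" by measurable
    then show "{y. x \<noteq> line_to_sphere y} \<in> sets borel" by (simp add: pred_def)
  qed
  show "integrable \<mu> (\<lambda>y. skern x (line_to_sphere y))" unfolding \<mu>_def
    by (subst integrable_distr_eq) (use pot(2)[OF x] w0 in \<open>auto simp: integrable_density\<close>)
  show "(\<integral>y. skern x (line_to_sphere y) \<partial>\<mu>) = u x" unfolding \<mu>_def
    by (subst integral_distr) (use pot(3)[OF x] w0 in \<open>auto simp: integral_density\<close>)
qed

lemma line_equilibrium_\<mu>: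
  assumes V: "V \<in> borel_measurable borel"
    and Vt: "\<And>x. \<bar>V x - ln (1 + x\<^sup>2) / 2\<bar> \<le> C"
    and ub: "\<And>x. \<bar>u (line_to_sphere x)\<bar> \<le> B"
    and F: "\<And>x. F \<le> u (line_to_sphere x) + (V x - ln (1 + x\<^sup>2) / 2)"
      "AE t in circ. u (line_to_sphere (s t)) + (V (s t) - ln (1 + (s t)\<^sup>2) / 2) = F"
  shows "line_equilibrium V = \<mu>"
proof (rule line_equilibrium_eqI[where u = "\<lambda>x. u (line_to_sphere x)" and B = B and C = C and F = F])
  note [measurable] = V
  interpret m: prob_space \<mu> by (rule prob_space_\<mu>)
  \<comment> \<open>Measurability of u along the line is obtained from its integral representation,
    since u is abstract in this locale.\<close>
  have "(\<lambda>p. skern (line_to_sphere (fst p)) (line_to_sphere (snd p))) \<in> borel_measurable (borel \<Otimes>\<^sub>M \<mu>)"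
    by measurable
  then have "(\<lambda>(x, y). skern (line_to_sphere x) (line_to_sphere y)) \<in> borel_measurable (borel \<Otimes>\<^sub>M \<mu>)"
    by (simp add: case_prod_beta')
  then have "(\<lambda>x. \<integral>y. skern (line_to_sphere x) (line_to_sphere y) \<partial>\<mu>) \<in> borel_measurable borel"
    by (rule m.borel_measurable_lebesgue_integral)
  then show um: "(\<lambda>x. u (line_to_sphere x)) \<in> borel_measurable borel"
    by (simp add: potential_\<mu>(3)[OF line_to_sphere_S2])
  note [measurable] = um
  show "AE x in \<mu>. u (line_to_sphere x) + (V x - ln (1 + x\<^sup>2) / 2) = F"
    by (rule AE_\<mu>[OF F(2)]) measurable
  fix x
  show "AE y in \<mu>. x \<noteq> y"
    using potential_\<mu>(1)[OF line_to_sphere_S2, of x] by eventually_elim auto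
qed (use V Vt ub F prob_space_\<mu> potential_\<mu>[OF line_to_sphere_S2] in \<open>simp_all\<close>)

end

text \<open>The quotient of x^2 + d by 1 + x^2 is a weighted mean of 1 and d.\<close>

lemma ln_quotient_bound:
  fixes x d :: real
  assumes d: "0 < d"
  shows "\<bar>ln (x\<^sup>2 + d) - ln (1 + x\<^sup>2)\<bar> \<le> \<bar>ln d\<bar>"
proof -
  have p: "0 < x\<^sup>2 + d" using d by (simp add: add_nonneg_pos)
  have e: "ln (x\<^sup>2 + d) - ln (1 + x\<^sup>2) = ln ((x\<^sup>2 + d) / (1 + x\<^sup>2))" using p by (simp add: ln_div)
  show ?thesis
  proof (cases "1 \<le> d")
    case True
    have "x\<^sup>2 * 1 \<le> x\<^sup>2 * d" using True by (intro mult_left_mono) auto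
    then have "1 \<le> (x\<^sup>2 + d) / (1 + x\<^sup>2)" "(x\<^sup>2 + d) / (1 + x\<^sup>2) \<le> d"
      using True by (simp_all add: field_simps)
    moreover have "0 < (x\<^sup>2 + d) / (1 + x\<^sup>2)" using p by simp
    ultimately have "0 \<le> ln ((x\<^sup>2 + d) / (1 + x\<^sup>2))" "ln ((x\<^sup>2 + d) / (1 + x\<^sup>2)) \<le> ln d"
      by (simp, intro ln_mono)
    then show ?thesis unfolding e by simp
  next
    case False
    have "x\<^sup>2 * d \<le> x\<^sup>2 * 1" using False by (intro mult_left_mono) auto
    then have q: "d \<le> (x\<^sup>2 + d) / (1 + x\<^sup>2)" "(x\<^sup>2 + d) / (1 + x\<^sup>2) \<le> 1"
      using False by (simp_all add: field_simps)
    have "0 < (x\<^sup>2 + d) / (1 + x\<^sup>2)" using p by simp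
    then have "ln ((x\<^sup>2 + d) / (1 + x\<^sup>2)) \<le> 0" "ln d \<le> ln ((x\<^sup>2 + d) / (1 + x\<^sup>2))"
      using q d by (simp, intro ln_mono)
    then show ?thesis unfolding e by simp
  qed
qed

definition ext_field :: "real \<Rightarrow> real \<Rightarrow> real \<Rightarrow> real" where
  "ext_field a b x = (1 + a) / 2 * ln (x\<^sup>2 + 1 / b\<^sup>2) - a / 2 * ln (x\<^sup>2 + b\<^sup>2)"

lemma ext_field_measurable [measurable]: "ext_field a b \<in> borel_measurable borel"
  unfolding ext_field_def[abs_def] by measurable

lemma ext_field_reduced:
  "ext_field a b x - ln (1 + x\<^sup>2) / 2 =
     (1 + a) / 2 * (ln (x\<^sup>2 + 1 / b\<^sup>2) - ln (1 + x\<^sup>2)) - a / 2 * (ln (x\<^sup>2 + b\<^sup>2) - ln (1 + x\<^sup>2))"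
  by (simp add: ext_field_def field_simps)

lemma ext_field_bound:
  assumes "0 < b" "0 < a"
  shows "\<bar>ext_field a b x - ln (1 + x\<^sup>2) / 2\<bar> \<le> (1 + a) / 2 * \<bar>ln (1 / b\<^sup>2)\<bar> + a / 2 * \<bar>ln (b\<^sup>2)\<bar>"
proof -
  have "\<bar>(1 + a) / 2 * (ln (x\<^sup>2 + 1 / b\<^sup>2) - ln (1 + x\<^sup>2))\<bar> \<le> (1 + a) / 2 * \<bar>ln (1 / b\<^sup>2)\<bar>"
    unfolding abs_mult using assms ln_quotient_bound[of "1 / b\<^sup>2" x] by (intro mult_mono) auto
  moreover have "\<bar>a / 2 * (ln (x\<^sup>2 + b\<^sup>2) - ln (1 + x\<^sup>2))\<bar> \<le> a / 2 * \<bar>ln (b\<^sup>2)\<bar>"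
    unfolding abs_mult using assms ln_quotient_bound[of "b\<^sup>2" x] by (intro mult_mono) auto
  ultimately show ?thesis unfolding ext_field_reduced by linarith
qed

text \<open>For one charge a at p the droplet is the complement of the cap
  \<open>x \<bullet> p > r\<close>, and in the cap h continues as minus the potential of mass 1 + a
  at the antipode. The constant c matches the values on the boundary circle; matching the
  derivatives means a / (1 - r) = (1 + a) / (1 + r), which determines r.\<close>

lemma single_cap:
  fixes p :: "real ^ 3"
  assumes p: "p \<in> S2" "p $ 1 = 0" and a: "0 < a"
  defines "r \<equiv> 1 / (1 + 2 * a)"
  defines "c \<equiv> - (a / 2) * ln (1 - r) - (1 + a) / 2 * ln (1 + r)"
  defines "h \<equiv> \<lambda>x. if x \<bullet> p - r \<le> 0 then a * skern x p else c - (1 + a) * skern x (- p)"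
  defines "lap \<equiv> \<lambda>x. if x \<bullet> p - r \<le> 0 then a / 2 else - (1 + a) / 2"
  shows "h \<in> borel_measurable borel" "\<exists>K. \<forall>x\<in>S2. \<bar>h x\<bar> \<le> K"
    "\<And>y. y \<in> S2 \<Longrightarrow> (\<integral>x. skern x y * lap x \<partial>sphere_prob) = (\<integral>x. h x \<partial>sphere_prob) / 2 - h y / 2"
    "(\<integral>x. lap x \<partial>sphere_prob) = 0"
proof -
  have r: "0 < r" "r < 1" using a by (auto simp: r_def field_simps)
  have rr: "a / (1 - r) = (1 + a) / (1 + r)"
  proof -
    have "r * (1 + 2 * a) = 1" using a by (simp add: r_def)
    then have "a * (1 + r) = (1 + a) * (1 - r)" by (simp add: algebra_simps)
    then show ?thesis using r by (simp add: frac_eq_eq)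
  qed
  have mp: "- p \<in> S2" using p by simp
  define q where "q x = x \<bullet> p - r" for x :: "real ^ 3"
  have qc: "continuous_on UNIV q" unfolding q_def by (intro continuous_intros)
  have qt: "trig2 (\<lambda>t. q (rot i t x))" for i x
    unfolding q_def using trig2_add[OF trig2_inner trig2_const[of "- r"]] by simp
  have q0: "AE x in sphere_prob. q x \<noteq> 0"
  proof (rule AE_nonzero_of_orbits[where i = 1, OF qc qt], rule AE_I2)
    fix x
    \<comment> \<open>A half turn about the first axis, which is orthogonal to p, changes the sign
      of \<open>x \<bullet> p\<close>; q cannot vanish at both points because r > 0.\<close>
    show "\<exists>t. q (rot 1 t x) \<noteq> 0"
    proof (rule ccontr)
      assume "\<not> ?thesis"
      then have "q (rot 1 0 x) = 0" "q (rot 1 pi x) = 0" by blast+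
      then show False using r p(2) by (simp add: q_def rot_defs inner_3)
    qed
  qed
  define HA HB where "HA x = 0 + a * kern 1 p x" and "HB x = c + - (1 + a) * kern 1 (- p) x" for x
  define HA1 HB1 where "HA1 i x = a * kern1 1 p i x" and "HB1 i x = - (1 + a) * kern1 1 (- p) i x" for i x
  define HA2 HB2 where "HA2 i x = a * kern2 1 p i x" and "HB2 i x = - (1 + a) * kern2 1 (- p) i x" for i x
  define M where "M = max (\<bar>ln (1 - r)\<bar> + ln 3) (1 / (1 - r) + 1 / (1 - r)\<^sup>2)"
  have M0: "0 \<le> M" unfolding M_def by (simp add: le_max_iff_disj)
  define K where "K = (1 + a) * M + \<bar>c\<bar>"
  have dA: "1 - r \<le> 1 - x \<bullet> p" if "q x \<le> 0" for x using that by (simp add: q_def)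
  have dB: "1 - r \<le> 1 - x \<bullet> (- p)" if "q x \<ge> 0" for x using that r by (simp add: q_def)
  have bA: "\<bar>kern 1 p x\<bar> \<le> M" "\<bar>kern2 1 p i x\<bar> \<le> M" if "x \<in> S2" "q x \<le> 0" for x i
    using kern_bounds(1)[OF that(1) p(1) _ dA[OF that(2)]] kern_bounds(2)[OF that(1) p(1) _ dA[OF that(2)], of i] r
    unfolding M_def by auto
  have bB: "\<bar>kern 1 (- p) x\<bar> \<le> M" "\<bar>kern2 1 (- p) i x\<bar> \<le> M" if "x \<in> S2" "q x \<ge> 0" for x i
    using kern_bounds(1)[OF that(1) mp _ dB[OF that(2)]] kern_bounds(2)[OF that(1) mp _ dB[OF that(2)], of i] r
    unfolding M_def by auto
  have mult: "\<bar>k * v\<bar> \<le> (1 + a) * M" if "\<bar>k\<bar> \<le> 1 + a" "\<bar>v\<bar> \<le> M" for k v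
    unfolding abs_mult using that a M0 by (intro mult_mono) auto
  interpret P: piecewise_rot_C2 q HA HB HA1 HA2 HB1 HB2 K
  proof
    show "continuous_on UNIV q" "AE x in sphere_prob. finite {t \<in> {0..2 * pi}. q (rot i t x) = 0}" for i
      by (fact qc, rule AE_finite_orbit_zeros[OF qt q0])
    show "rot_C2_at HA HA1 HA2 x" if "x \<in> S2" "q x \<le> 0" for x
      unfolding HA_def[abs_def] HA1_def[abs_def] HA2_def[abs_def]
      by (rule rot_C2_at_cmult_add, rule kern_C2) (use dA[OF that(2)] r in simp)
    show "rot_C2_at HB HB1 HB2 x" if "x \<in> S2" "q x \<ge> 0" for x
      unfolding HB_def[abs_def] HB1_def[abs_def] HB2_def[abs_def]
      by (rule rot_C2_at_cmult_add, rule kern_C2) (use dB[OF that(2)] r in simp)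
    show "HA x = HB x \<and> HA1 i x = HB1 i x" if "x \<in> S2" "q x = 0" for x i
    proof
      have xp: "x \<bullet> p = r" using that by (simp add: q_def)
      show "HA x = HB x" by (simp add: HA_def HB_def kern_def xp c_def field_simps)
      have "HA1 i x = (rotgen i x \<bullet> p) / 2 * (a / (1 - r))"
        unfolding HA1_def kern1_def xp
        by (simp only: times_divide_eq_right times_divide_eq_left divide_divide_eq_left mult_ac)
      also have "\<dots> = HB1 i x"
        unfolding rr HB1_def kern1_def inner_minus_right xp
        by (simp only: times_divide_eq_right times_divide_eq_left divide_divide_eq_left minus_divide_left[symmetric]
            mult_minus_left mult_minus_right minus_minus diff_minus_eq_add mult_ac)
      finally show "HA1 i x = HB1 i x" .
    qed
    show "HA \<in> borel_measurable borel" "HB \<in> borel_measurable borel" "HA2 i \<in> borel_measurable borel" "HB2 i \<in> borel_measurable borel" for i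
      unfolding HA_def[abs_def] HB_def[abs_def] HA2_def[abs_def] HB2_def[abs_def] by measurable
    show "\<bar>HA x\<bar> \<le> K" "\<bar>HA2 i x\<bar> \<le> K" if "x \<in> S2" "q x \<le> 0" for x i
    proof -
      have "\<bar>a\<bar> \<le> 1 + a" using a by simp
      from mult[OF this bA(1)[OF that]] mult[OF this bA(2)[OF that, of i]]
      show "\<bar>HA x\<bar> \<le> K" "\<bar>HA2 i x\<bar> \<le> K"
        unfolding HA_def HA2_def K_def add_0 using abs_ge_zero[of c] by linarith+
    qed
    show "\<bar>HB x\<bar> \<le> K" "\<bar>HB2 i x\<bar> \<le> K" if "x \<in> S2" "q x \<ge> 0" for x i
    proof -
      have "\<bar>- (1 + a)\<bar> \<le> 1 + a" using a by simp
      from mult[OF this bB(1)[OF that]] mult[OF this bB(2)[OF that, of i]]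
      show "\<bar>HB x\<bar> \<le> K" "\<bar>HB2 i x\<bar> \<le> K"
        unfolding HB_def HB2_def K_def
        using abs_ge_zero[of c] abs_triangle_ineq[of c "- (1 + a) * kern 1 (- p) x"] by linarith+
    qed
  qed
  have hP: "P.h = h"
    by (rule ext) (simp add: P.h_def h_def HA_def HB_def q_def kern_1 algebra_simps)
  have lapP: "P.lap x = lap x" if "x \<in> S2" for x
  proof (cases "q x \<le> 0")
    case True
    have "x \<bullet> p \<noteq> 1" using dA[OF True] r by auto
    then have "(\<Sum>i\<in>UNIV. HA2 i x) = a / 2"
      unfolding HA2_def sum_distrib_left[symmetric] using kern2_sum_half[OF that p(1)] by simp
    then show ?thesis using True by (simp add: P.lap_def lap_def q_def)
  next
    case False
    have "x \<bullet> (- p) \<noteq> 1" using dB[of x] r False by auto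
    then have "(\<Sum>i\<in>UNIV. HB2 i x) = - (1 + a) * (1 / 2)"
      unfolding HB2_def sum_distrib_left[symmetric] using kern2_sum_half[OF that mp] by simp
    then show ?thesis using False by (simp add: P.lap_def lap_def q_def)
  qed
  have hc: "continuous_on S2 P.h"
  proof (rule P.continuous_h)
    show "continuous_on (S2 \<inter> {x. q x \<le> 0}) HA"
      unfolding HA_def kern_1 by (intro continuous_intros continuous_on_skern) (use dA r in force)
    show "continuous_on (S2 \<inter> {x. q x \<ge> 0}) HB"
      unfolding HB_def kern_1 by (intro continuous_intros continuous_on_skern) (use dB r in force)
  qed
  have lm: "lap \<in> borel_measurable borel" unfolding lap_def by measurable
  show "h \<in> borel_measurable borel" using P.h_measurable unfolding hP .
  show "\<exists>K. \<forall>x\<in>S2. \<bar>h x\<bar> \<le> K" using P.h_bound unfolding hP by blast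
  show "(\<integral>x. skern x y * lap x \<partial>sphere_prob) = (\<integral>x. h x \<partial>sphere_prob) / 2 - h y / 2" if y: "y \<in> S2" for y
    unfolding hP[symmetric] P.green_potential[OF y hc, symmetric]
    by (rule integral_cong_AE) (use AE_sphere_prob lapP lm in \<open>auto elim!: eventually_mono\<close>)
  show "(\<integral>x. lap x \<partial>sphere_prob) = 0"
    unfolding P.green_mass[symmetric]
    by (rule integral_cong_AE) (use AE_sphere_prob lapP lm in \<open>auto elim!: eventually_mono\<close>)
qed

lemma one_plus_ne_zero: "norm (z :: complex) < 1 \<Longrightarrow> 1 + z \<noteq> 0"
proof
  assume "norm z < 1" "1 + z = 0"
  then have "z = - 1" by (simp add: add_eq_0_iff)
  with \<open>norm z < 1\<close> show False by simp
qed

lemma path_enters_open: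
  fixes f :: "real \<Rightarrow> real ^ 3"
  assumes "isCont f 0" "f 0 = x" "open U" "x \<in> U"
  shows "\<exists>d>0. \<forall>e. 0 < e \<longrightarrow> e < d \<longrightarrow> f e \<in> U"
proof -
  have "\<forall>\<^sub>F e in at 0. f e \<in> U"
    using assms by (auto simp: isCont_def intro: topological_tendstoD)
  then obtain d where "d > 0" "\<And>e. e \<noteq> 0 \<Longrightarrow> dist e 0 < d \<Longrightarrow> f e \<in> U"
    unfolding eventually_at by auto
  then show ?thesis by (intro exI[of _ d]) auto
qed

lemma isCont_vec3: "isCont f t \<Longrightarrow> isCont g t \<Longrightarrow> isCont h t \<Longrightarrow> isCont (\<lambda>e. vec3 (f e) (g e) (h e)) t"
proof -
  assume fgh: "isCont f t" "isCont g t" "isCont h t"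
  show "isCont (\<lambda>e. vec3 (f e) (g e) (h e)) t"
    unfolding isCont_def
  proof (rule vec_tendstoI)
    fix i :: 3
    show "((\<lambda>e. vec3 (f e) (g e) (h e) $ i) \<longlongrightarrow> vec3 (f t) (g t) (h t) $ i) (at t)"
      using exhaust_3[of i] fgh[unfolded isCont_def] by (elim disjE) (simp_all only: vec3_nth)
  qed
qed

section \<open>Poles, and potentials of weights on the great circle\<close>

definition cap_pole :: "real \<Rightarrow> real ^ 3" where
  "cap_pole b = vec3 0 (2 * b / (1 + b\<^sup>2)) ((b\<^sup>2 - 1) / (1 + b\<^sup>2))"

lemma stereographic_cap_pole:
  assumes "x \<in> S2" "stereographic x = Some (\<i> * of_real b)"
  shows "x = cap_pole b"
proof -
  have n: "x $ 3 \<noteq> 1" using assms(2) by (auto simp: stereographic_def)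
  define d where "d = 1 - x $ 3"
  have d: "d \<noteq> 0" "x $ 3 = 1 - d" using n by (auto simp: d_def)
  have "(of_real (x $ 1) + \<i> * of_real (x $ 2)) / of_real d = (\<i> * of_real b :: complex)"
    using assms(2) n by (simp add: stereographic_def d_def)
  then have "of_real (x $ 1) + \<i> * of_real (x $ 2) = (\<i> * of_real (b * d) :: complex)"
    using d by (simp add: field_simps)
  then have 12: "x $ 1 = 0" "x $ 2 = b * d" by (simp_all add: complex_eq_iff)
  have "(b * d)\<^sup>2 + (1 - d)\<^sup>2 = 1" using assms(1) unfolding mem_S2_iff 12 d(2) by simp
  then have "d * ((1 + b\<^sup>2) * d - 2) = 0" by (simp add: power2_eq_square algebra_simps)
  then have "(1 + b\<^sup>2) * d = 2" using d(1) by simp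
  then have dd: "d = 2 / (1 + b\<^sup>2)" by (simp add: field_simps)
  have "1 - 2 / (1 + b\<^sup>2) = (b\<^sup>2 - 1) / (1 + b\<^sup>2)" by (simp add: field_simps)
  then show ?thesis unfolding vec3_eq_iff cap_pole_def vec3_nth 12 d(2) dd by simp
qed

lemma cap_pole_S2: "cap_pole b \<in> S2"
proof -
  have "(2 * b)\<^sup>2 + (b\<^sup>2 - 1)\<^sup>2 = (1 + b\<^sup>2)\<^sup>2" by (simp add: power2_eq_square algebra_simps)
  then have "((2 * b)\<^sup>2 + (b\<^sup>2 - 1)\<^sup>2) / (1 + b\<^sup>2)\<^sup>2 = 1" by simp
  then show ?thesis unfolding mem_S2_iff cap_pole_def vec3_nth by (simp add: power_divide add_divide_distrib)
qed

text \<open>Half-angle formulas: t is the angle from the north pole along the great circle that is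
  the image of the real line.\<close>

lemma line_to_sphere_cot:
  assumes "sin (t / 2) \<noteq> 0"
  shows "line_to_sphere (cot (t / 2)) = vec3 (sin t) 0 (cos t)"
proof -
  define s c where "s = sin (t / 2)" and "c = cos (t / 2)"
  have s: "s \<noteq> 0" using assms by (simp add: s_def)
  have sc: "c\<^sup>2 = 1 - s\<^sup>2" by (simp add: s_def c_def cos_squared_eq)
  have st: "sin t = 2 * s * c" "cos t = c\<^sup>2 - s\<^sup>2"
    using sin_double[of "t / 2"] cos_double[of "t / 2"] by (simp_all add: s_def c_def)
  have "1 + (c / s)\<^sup>2 = 1 / s\<^sup>2" using s by (simp add: power_divide sc field_simps)
  then have "2 * (c / s) / (1 + (c / s)\<^sup>2) = 2 * s * c" "((c / s)\<^sup>2 - 1) / (1 + (c / s)\<^sup>2) = c\<^sup>2 - s\<^sup>2"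
    using s by (simp_all add: power_divide field_simps power2_eq_square)
  then show ?thesis unfolding vec3_eq_iff line_to_sphere_nth vec3_nth st cot_def s_def[symmetric] c_def[symmetric] by simp
qed

lemma AE_sin_half: "AE t in circ. sin (t / 2) \<noteq> 0"
proof (rule AE_circ_finite, rule finite_subset)
  show "{t \<in> {0..2 * pi}. \<not> sin (t / 2) \<noteq> 0} \<subseteq> {0, 2 * pi}"
  proof
    fix t assume t: "t \<in> {t \<in> {0..2 * pi}. \<not> sin (t / 2) \<noteq> 0}"
    show "t \<in> {0, 2 * pi}"
    proof (rule ccontr)
      assume "t \<notin> {0, 2 * pi}"
      then have "0 < t / 2" "t / 2 < pi" using t by auto
      then have "0 < sin (t / 2)" by (rule sin_gt_zero)
      then show False using t by simp
    qed
  qed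
qed simp

text \<open>The point \<zeta> is the stereographic image of x from that pole of the second axis
  which lies on the other side of the great circle. This projection fixes the great circle as the
  unit circle, and chords become planar distances up to a conformal factor.\<close>

lemma great_circle_kernel:
  assumes x: "x \<in> S2"
  defines "\<zeta> \<equiv> Complex (x $ 3 / (1 + \<bar>x $ 2\<bar>)) (x $ 1 / (1 + \<bar>x $ 2\<bar>))"
  shows "norm \<zeta> \<le> 1"
    and "1 - x \<bullet> vec3 (sin t) 0 (cos t) = (1 + \<bar>x $ 2\<bar>) / 2 * (norm (cis t - \<zeta>))\<^sup>2"
    and "(1 + \<bar>x $ 2\<bar>) * (norm (1 + of_real q * \<zeta>))\<^sup>2 = 1 + q\<^sup>2 + \<bar>x $ 2\<bar> * (1 - q\<^sup>2) + 2 * q * x $ 3"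
proof -
  define k where "k = 1 + \<bar>x $ 2\<bar>"
  have k: "0 < k" "k \<noteq> 0" by (auto simp: k_def)
  have S: "(x $ 1)\<^sup>2 + (x $ 3)\<^sup>2 = k * (2 - k)"
    using x unfolding mem_S2_iff k_def by (simp add: algebra_simps power2_eq_square)
  have z: "(norm \<zeta>)\<^sup>2 = (2 - k) / k"
  proof -
    have "(norm \<zeta>)\<^sup>2 = ((x $ 1)\<^sup>2 + (x $ 3)\<^sup>2) / k\<^sup>2"
      by (simp add: \<zeta>_def cmod_power2 k_def[symmetric] power_divide add_divide_distrib)
    also have "\<dots> = (2 - k) / k" unfolding S using k by (simp add: power2_eq_square)
    finally show ?thesis .
  qed
  have "(2 - k) / k \<le> 1" using k by (simp add: k_def)
  then show "norm \<zeta> \<le> 1" using z by (metis norm_ge_zero power2_le_imp_le one_power2 zero_le_one)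
  have "(norm (cis t - \<zeta>))\<^sup>2 = (norm \<zeta>)\<^sup>2 + 1 - 2 * (cos t * (x $ 3 / k) + sin t * (x $ 1 / k))"
  proof -
    have "(norm (cis t - \<zeta>))\<^sup>2 = (cos t - x $ 3 / k)\<^sup>2 + (sin t - x $ 1 / k)\<^sup>2"
      by (simp add: \<zeta>_def cmod_power2 k_def[symmetric])
    also have "\<dots> = ((cos t)\<^sup>2 + (sin t)\<^sup>2) + ((x $ 3 / k)\<^sup>2 + (x $ 1 / k)\<^sup>2) - 2 * (cos t * (x $ 3 / k) + sin t * (x $ 1 / k))"
      by (simp add: power2_eq_square algebra_simps)
    also have "(x $ 3 / k)\<^sup>2 + (x $ 1 / k)\<^sup>2 = (norm \<zeta>)\<^sup>2"
      by (simp add: \<zeta>_def cmod_power2 k_def[symmetric])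
    finally show ?thesis by simp
  qed
  then have "(norm (cis t - \<zeta>))\<^sup>2 = (2 - 2 * (cos t * x $ 3 + sin t * x $ 1)) / k"
    unfolding z using k by (simp add: field_simps)
  then show "1 - x \<bullet> vec3 (sin t) 0 (cos t) = (1 + \<bar>x $ 2\<bar>) / 2 * (norm (cis t - \<zeta>))\<^sup>2"
    unfolding k_def[symmetric] using k by (simp add: inner_3 field_simps)
  have "(norm (1 + of_real q * \<zeta>))\<^sup>2 = (1 + q * (x $ 3 / k))\<^sup>2 + (q * (x $ 1 / k))\<^sup>2"
    by (simp add: \<zeta>_def cmod_power2 k_def[symmetric])
  also have "\<dots> = 1 + 2 * q * x $ 3 / k + q\<^sup>2 * ((x $ 3 / k)\<^sup>2 + (x $ 1 / k)\<^sup>2)"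
    by (simp add: power2_eq_square algebra_simps)
  also have "(x $ 3 / k)\<^sup>2 + (x $ 1 / k)\<^sup>2 = (norm \<zeta>)\<^sup>2"
    by (simp add: \<zeta>_def cmod_power2 k_def[symmetric])
  finally have N: "(norm (1 + of_real q * \<zeta>))\<^sup>2 = 1 + 2 * q * x $ 3 / k + q\<^sup>2 * ((2 - k) / k)"
    unfolding z .
  have "k * (2 * q * x $ 3 / k) = 2 * q * x $ 3" "k * (q\<^sup>2 * ((2 - k) / k)) = q\<^sup>2 * (2 - k)"
    using k by simp_all
  then have "k * (norm (1 + of_real q * \<zeta>))\<^sup>2 = k + 2 * q * x $ 3 + q\<^sup>2 * (2 - k)"
    unfolding N distrib_left by simp
  then show "(1 + \<bar>x $ 2\<bar>) * (norm (1 + of_real q * \<zeta>))\<^sup>2 = 1 + q\<^sup>2 + \<bar>x $ 2\<bar> * (1 - q\<^sup>2) + 2 * q * x $ 3"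
    unfolding k_def by (simp add: algebra_simps)
qed

text \<open>The fractions in q are coordinates of a unit vector. So on each side of the great circle
  the potential agrees, up to a constant, with that of a unit charge on the opposite side: the
  Poisson weight sweeps a point charge onto the circle.\<close>

lemma great_circle_potential:
  assumes x: "x \<in> S2" and q: "\<bar>q\<bar> < 1"
  shows "AE t in circ. x \<noteq> line_to_sphere (cot (t / 2))"
    "integrable circ (\<lambda>t. poiss q t * skern x (line_to_sphere (cot (t / 2))))"
    "(\<integral>t. poiss q t * skern x (line_to_sphere (cot (t / 2))) \<partial>circ) =
      - ln ((1 + q\<^sup>2) / 2 * (1 + \<bar>x $ 2\<bar> * ((1 - q\<^sup>2) / (1 + q\<^sup>2)) + x $ 3 * (2 * q / (1 + q\<^sup>2)))) / 2"
proof -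
  define \<zeta> where "\<zeta> = Complex (x $ 3 / (1 + \<bar>x $ 2\<bar>)) (x $ 1 / (1 + \<bar>x $ 2\<bar>))"
  note g = great_circle_kernel[OF x, folded \<zeta>_def]
  note P = log_poisson[OF g(1) q]
  have k: "0 < 1 + \<bar>x $ 2\<bar>" by auto
  have eq: "AE t in circ. skern x (line_to_sphere (cot (t / 2))) = - ln ((1 + \<bar>x $ 2\<bar>) / 2) / 2 - ln (norm (cis t - \<zeta>))"
    using P(1) AE_sin_half
  proof eventually_elim
    case (elim t)
    have "ln ((1 + \<bar>x $ 2\<bar>) / 2 * (norm (cis t - \<zeta>))\<^sup>2) = ln ((1 + \<bar>x $ 2\<bar>) / 2) + 2 * ln (norm (cis t - \<zeta>))"
      using k elim(1) ln_realpow[of "norm (cis t - \<zeta>)" 2] by (subst ln_mult_pos) auto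
    then show ?case unfolding skern_def line_to_sphere_cot[OF elim(2)] g(2) by simp
  qed
  show "AE t in circ. x \<noteq> line_to_sphere (cot (t / 2))"
    using P(1) AE_sin_half
  proof eventually_elim
    case (elim t)
    have "1 - x \<bullet> vec3 (sin t) 0 (cos t) \<noteq> 0" unfolding g(2) using k elim(1) by auto
    then show ?case unfolding line_to_sphere_cot[OF elim(2)] using x by (auto simp: norm_eq_1)
  qed
  have cotm[measurable]: "(\<lambda>t :: real. cot (t / 2)) \<in> borel_measurable borel"
    unfolding cot_def by measurable
  have i: "integrable circ (\<lambda>t. - ln ((1 + \<bar>x $ 2\<bar>) / 2) / 2 * poiss q t - poiss q t * ln (norm (cis t - \<zeta>)))"
    by (intro Bochner_Integration.integrable_diff integrable_mult_right poiss_integral(1)[OF q] P(2))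
  have eq': "AE t in circ. - ln ((1 + \<bar>x $ 2\<bar>) / 2) / 2 * poiss q t - poiss q t * ln (norm (cis t - \<zeta>)) =
      poiss q t * skern x (line_to_sphere (cot (t / 2)))"
    using eq
  proof eventually_elim
    case (elim t)
    show ?case unfolding elim by (simp add: right_diff_distrib)
  qed
  show "integrable circ (\<lambda>t. poiss q t * skern x (line_to_sphere (cot (t / 2))))"
    by (rule integrable_cong_AE_imp[OF i]) (use eq' in \<open>auto elim: eventually_mono\<close>)
  have "(\<integral>t. poiss q t * skern x (line_to_sphere (cot (t / 2))) \<partial>circ) =
      (\<integral>t. - ln ((1 + \<bar>x $ 2\<bar>) / 2) / 2 * poiss q t - poiss q t * ln (norm (cis t - \<zeta>)) \<partial>circ)"
  proof (rule integral_cong_AE)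
    show "AE t in circ. poiss q t * skern x (line_to_sphere (cot (t / 2))) =
        - ln ((1 + \<bar>x $ 2\<bar>) / 2) / 2 * poiss q t - poiss q t * ln (norm (cis t - \<zeta>))"
      using eq' by eventually_elim (rule sym)
    show "(\<lambda>t. - ln ((1 + \<bar>x $ 2\<bar>) / 2) / 2 * poiss q t - poiss q t * ln (norm (cis t - \<zeta>))) \<in> borel_measurable circ"
      by (rule borel_measurable_integrable[OF i])
  qed measurable
  also have "\<dots> = - ln ((1 + \<bar>x $ 2\<bar>) / 2) / 2 - ln (norm (1 + of_real q * \<zeta>))"
    using poiss_integral[OF q] P(2,3) by simp
  also have "\<dots> = - ln ((1 + \<bar>x $ 2\<bar>) / 2 * (norm (1 + of_real q * \<zeta>))\<^sup>2) / 2"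
  proof -
    have "norm (of_real q * \<zeta>) < 1"
      unfolding norm_mult norm_of_real using q mult_left_mono[OF g(1), of "\<bar>q\<bar>"] by simp
    then have "1 + of_real q * \<zeta> \<noteq> 0" using one_plus_ne_zero by blast
    then show ?thesis
      using k ln_realpow[of "norm (1 + of_real q * \<zeta>)" 2] by (subst ln_mult_pos) auto
  qed
  also have "(1 + \<bar>x $ 2\<bar>) / 2 * (norm (1 + of_real q * \<zeta>))\<^sup>2 =
      (1 + q\<^sup>2) / 2 * (1 + \<bar>x $ 2\<bar> * ((1 - q\<^sup>2) / (1 + q\<^sup>2)) + x $ 3 * (2 * q / (1 + q\<^sup>2)))"
  proof -
    have "(1 + q\<^sup>2) * (1 + \<bar>x $ 2\<bar> * ((1 - q\<^sup>2) / (1 + q\<^sup>2)) + x $ 3 * (2 * q / (1 + q\<^sup>2))) =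
        1 + q\<^sup>2 + \<bar>x $ 2\<bar> * (1 - q\<^sup>2) + 2 * q * x $ 3"
      by (simp add: distrib_left)
    then show ?thesis unfolding g(3)[symmetric] by simp
  qed
  finally show "(\<integral>t. poiss q t * skern x (line_to_sphere (cot (t / 2))) \<partial>circ) =
      - ln ((1 + q\<^sup>2) / 2 * (1 + \<bar>x $ 2\<bar> * ((1 - q\<^sup>2) / (1 + q\<^sup>2)) + x $ 3 * (2 * q / (1 + q\<^sup>2)))) / 2" .
qed

lemma frac_le_cross: "0 < Q \<Longrightarrow> 0 < P \<Longrightarrow> X * Q \<le> Y * P \<Longrightarrow> X / P \<le> Y / (Q :: real)"
  by (simp add: field_simps)

text \<open>The charges are treated one at a time and superposed. This includes the tangent case,
  where the great circle carrying the measure touches both caps at the north pole and has no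
  positive distance from them.\<close>

lemma caps_case:
  assumes b: "1 \<le> b" and a: "0 < a" and ab: "a * b\<^sup>2 \<le> 1 + a"
  shows "has_motherbody a (ext_field a b) (measure_support (sphere_equilibrium
    (add_measure (scale_measure (ennreal a) (return sphere_borel (cap_pole b)))
      (scale_measure (ennreal a) (return sphere_borel (cap_pole (- b)))))))"
proof -
  \<comment> \<open>Chosen so that (1 - k^2) / (1 + k^2) and 2 * k / (1 + k^2) are the coordinates
    \<beta> and \<delta> of the pole; the swept-out potentials then depend on inner products with
    the poles.\<close>
  define k where "k = (b - 1) / (b + 1)"
  define \<beta> \<delta> G r where "\<beta> = 2 * b / (1 + b\<^sup>2)" and "\<delta> = (b\<^sup>2 - 1) / (1 + b\<^sup>2)" and "G = (1 + k\<^sup>2) / 2"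
    and "r = 1 / (1 + 2 * a)"
  have b0: "0 < b" and b2: "1 \<le> b\<^sup>2" using b by (auto simp: one_le_power)
  have kb: "\<bar>k\<bar> < 1" "0 \<le> k" using b by (auto simp: k_def abs_less_iff field_simps)
  have G0: "0 < G" by (simp add: G_def)
  have k2: "1 + k\<^sup>2 = 2 * (1 + b\<^sup>2) / (b + 1)\<^sup>2" "1 - k\<^sup>2 = 4 * b / (b + 1)\<^sup>2" "2 * k = 2 * (b\<^sup>2 - 1) / (b + 1)\<^sup>2"
  proof -
    define e where "e = b + 1"
    have e: "e \<noteq> 0" "b = e - 1" "k = (e - 2) / e" using b0 by (auto simp: e_def k_def)
    show "1 + k\<^sup>2 = 2 * (1 + b\<^sup>2) / (b + 1)\<^sup>2" "1 - k\<^sup>2 = 4 * b / (b + 1)\<^sup>2" "2 * k = 2 * (b\<^sup>2 - 1) / (b + 1)\<^sup>2"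
      unfolding e(3) unfolding e(2) using e(1)
      by (simp add: power2_eq_square, simp add: field_simps)+
  qed
  have bd: "(1 - k\<^sup>2) / (1 + k\<^sup>2) = \<beta>" "2 * k / (1 + k\<^sup>2) = \<delta>"
  proof -
    have 1: "X / d / (Y / d) = X / Y" if "d \<noteq> 0" for X Y d :: real using that by simp
    have 2: "2 * X / (2 * Y) = X / Y" for X Y :: real by simp
    have d: "(b + 1)\<^sup>2 \<noteq> 0" using b0 by simp
    have "4 * b = 2 * (2 * b)" by simp
    then show "(1 - k\<^sup>2) / (1 + k\<^sup>2) = \<beta>" "2 * k / (1 + k\<^sup>2) = \<delta>"
      unfolding k2 \<beta>_def \<delta>_def 1[OF d] by (simp_all only: 2)
  qed
  have \<beta>: "0 < \<beta>" using b0 by (simp add: \<beta>_def)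
  have \<delta>: "0 \<le> \<delta>" "\<delta> < 1" using b2 by (auto simp: \<delta>_def field_simps)
  have r: "0 < r" "r < 1" using a by (auto simp: r_def field_simps)
  \<comment> \<open>The hypothesis \<open>ab\<close> in geometric form: the two open caps do not
    overlap.\<close>
  have \<delta>r: "\<delta> \<le> r"
  proof -
    have "(b\<^sup>2 - 1) * (1 + 2 * a) \<le> 1 * (1 + b\<^sup>2)" using ab by (simp add: algebra_simps)
    then show ?thesis unfolding \<delta>_def r_def using a by (simp add: frac_le_eq divide_le_0_iff field_simps)
  qed
  define p1 p2 where "p1 = cap_pole b" and "p2 = cap_pole (- b)"
  have p: "p1 \<in> S2" "p2 \<in> S2" by (simp_all only: p1_def p2_def cap_pole_S2)
  have p_1: "p1 $ 1 = 0" "p2 $ 1 = 0" by (simp_all add: p1_def p2_def cap_pole_def)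
  have xp: "x \<bullet> p1 = \<beta> * x $ 2 + \<delta> * x $ 3" "x \<bullet> p2 = - \<beta> * x $ 2 + \<delta> * x $ 3" for x
    by (simp_all add: p1_def p2_def cap_pole_def inner_3 \<beta>_def \<delta>_def mult.commute)
  \<comment> \<open>M and N are the larger and the smaller inner product of x with the two poles;
    written with the absolute value of the second coordinate they are visibly continuous.\<close>
  define M where "M x = \<beta> * \<bar>x $ 2\<bar> + \<delta> * x $ 3" for x :: "real ^ 3"
  define N where "N x = - \<beta> * \<bar>x $ 2\<bar> + \<delta> * x $ 3" for x :: "real ^ 3"
  have MN: "M x = x \<bullet> p1 \<and> N x = x \<bullet> p2 \<or> M x = x \<bullet> p2 \<and> N x = x \<bullet> p1" for x
    unfolding M_def N_def xp by (cases "0 \<le> x $ 2") auto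
  have NM: "N x \<le> M x" for x using \<beta> by (simp add: M_def N_def)
  have ip: "\<bar>x \<bullet> p1\<bar> \<le> 1" "\<bar>x \<bullet> p2\<bar> \<le> 1" if "x \<in> S2" for x
    using abs_inner_S2[OF that] p by auto
  have x3: "\<bar>x $ 3\<bar> \<le> 1" if "x \<in> S2" for x :: "real ^ 3"
    using component_le_norm_cart[of x 3] that by simp
  have dx3: "\<bar>\<delta> * x $ 3\<bar> \<le> \<delta>" if "x \<in> S2" for x
    unfolding abs_mult using \<delta>(1) mult_left_mono[OF x3[OF that], of "\<bar>\<delta>\<bar>"] by simp
  have Mp: "1 - \<delta> \<le> 1 + M x" "1 - \<delta> \<le> 1 - N x" if "x \<in> S2" for x
  proof -
    have "0 \<le> \<beta> * \<bar>x $ 2\<bar>" using \<beta> by simp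
    then show "1 - \<delta> \<le> 1 + M x" "1 - \<delta> \<le> 1 - N x" using dx3[OF that] unfolding M_def N_def by (simp_all add: abs_le_iff)
  qed
  \<comment> \<open>Up to constants, the potential of mass 1 + a at the antipode of the nearer pole
    and of mass - a at the farther pole, both swept onto the great circle.\<close>
  define U where "U x = - (1 + a) / 2 * ln (G * (1 + M x)) + a / 2 * ln (G * (1 - N x))" for x
  define w where "w t = (1 + a) * poiss k t - a * poiss (- k) t" for t
  have kb': "\<bar>- k\<bar> < 1" using kb by simp
  note Pk = great_circle_potential[OF _ kb(1)] and Pmk = great_circle_potential[OF _ kb']
  have Gm: "(1 + (- k)\<^sup>2) / 2 = G" "(1 - (- k)\<^sup>2) / (1 + (- k)\<^sup>2) = \<beta>" "2 * - k / (1 + (- k)\<^sup>2) = - \<delta>"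
    using bd by (simp_all add: G_def)
  interpret c: circle_pushforward w "\<lambda>t. cot (t / 2)" U
  proof
    show "w \<in> borel_measurable borel" unfolding w_def[abs_def] by measurable
    show "(\<lambda>t :: real. cot (t / 2)) \<in> borel_measurable borel" unfolding cot_def by measurable
    show "0 \<le> w t" for t
    proof -
      have "\<delta> * (1 + 2 * a) \<le> 1" using \<delta>r a by (simp add: r_def field_simps)
      then have "2 * k * (1 + 2 * a) \<le> 1 + k\<^sup>2" unfolding bd(2)[symmetric] by (simp add: field_simps add_pos_nonneg)
      moreover have "2 * k * (1 + 2 * a) * cos t \<le> 2 * k * (1 + 2 * a) * 1"
        using kb a by (intro mult_left_mono) auto
      ultimately have "a * (1 + k\<^sup>2 + 2 * k * cos t) \<le> (1 + a) * (1 + k\<^sup>2 - 2 * k * cos t)"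
        by (simp add: algebra_simps)
      then have *: "(1 - k\<^sup>2) * (a * (1 + k\<^sup>2 + 2 * k * cos t)) \<le> (1 - k\<^sup>2) * ((1 + a) * (1 + k\<^sup>2 - 2 * k * cos t))"
        using kb by (intro mult_left_mono) (auto simp: abs_square_le_1 less_imp_le)
      have "0 < 1 + k\<^sup>2 + 2 * k * cos t" "0 < 1 + k\<^sup>2 - 2 * k * cos t"
        using poiss_denom(2)[OF kb(1), of t] poiss_denom(2)[OF kb', of t] by simp_all
      then have "(a * (1 - k\<^sup>2)) / (1 + k\<^sup>2 - 2 * k * cos t) \<le> ((1 + a) * (1 - k\<^sup>2)) / (1 + k\<^sup>2 + 2 * k * cos t)"
        by (rule frac_le_cross) (use * in \<open>simp only: mult_ac\<close>)
      then show ?thesis by (simp add: w_def poiss_def)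
    qed
    show "integrable circ w" "(\<integral>t. w t \<partial>circ) = 1"
      using poiss_integral[OF kb(1)] poiss_integral[OF kb'] by (simp_all add: w_def[abs_def])
    fix x :: "real ^ 3" assume x: "x \<in> S2"
    show "AE t in circ. x \<noteq> line_to_sphere (cot (t / 2))" by (rule Pk(1)[OF x])
    have eq: "w t * skern x (line_to_sphere (cot (t / 2))) =
        (1 + a) * (poiss k t * skern x (line_to_sphere (cot (t / 2)))) - a * (poiss (- k) t * skern x (line_to_sphere (cot (t / 2))))" for t
      by (simp add: w_def algebra_simps)
    show "integrable circ (\<lambda>t. w t * skern x (line_to_sphere (cot (t / 2))))"
      unfolding eq by (intro Bochner_Integration.integrable_diff integrable_mult_right Pk(2)[OF x] Pmk(2)[OF x])
    have "(\<integral>t. w t * skern x (line_to_sphere (cot (t / 2))) \<partial>circ) =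
        (1 + a) * (- ln (G * (1 + \<bar>x $ 2\<bar> * \<beta> + x $ 3 * \<delta>)) / 2) - a * (- ln (G * (1 + \<bar>x $ 2\<bar> * \<beta> + x $ 3 * - \<delta>)) / 2)"
      unfolding eq
      by (subst Bochner_Integration.integral_diff[OF integrable_mult_right[OF Pk(2)[OF x]] integrable_mult_right[OF Pmk(2)[OF x]]])
         (simp only: integral_mult_right_zero Pk(3)[OF x] Pmk(3)[OF x] bd Gm G_def)
    also have "\<dots> = U x"
    proof -
      have 1: "1 + \<bar>x $ 2\<bar> * \<beta> + x $ 3 * \<delta> = 1 + M x" "1 + \<bar>x $ 2\<bar> * \<beta> + x $ 3 * - \<delta> = 1 - N x"
        unfolding M_def N_def by (simp_all add: mult.commute)
      have 2: "(1 + a) * (- L / 2) - a * (- L' / 2) = - (1 + a) / 2 * L + a / 2 * L'" for L L' :: real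
        by (simp add: field_simps)
      show ?thesis unfolding U_def 1 2 ..
    qed
    finally show "(\<integral>t. w t * skern x (line_to_sphere (cot (t / 2))) \<partial>circ) = U x" .
  qed
  define F where "F = - ln G / 2 - (1 + a) / 2 * ln (2 * b\<^sup>2 / (1 + b\<^sup>2)) + a / 2 * ln (2 / (1 + b\<^sup>2))"
  \<comment> \<open>On the great circle 1 + M and 1 - N are constant multiples of the two quotients
    in \<open>ext_field_reduced\<close>. The Frostman sum is therefore constant on the whole line,
    as it must be for a measure with full support.\<close>
  have UF: "U (line_to_sphere x) + (ext_field a b x - ln (1 + x\<^sup>2) / 2) = F" for x
  proof -
    have P: "(1 + b\<^sup>2) * (1 + x\<^sup>2) \<noteq> 0" by (simp add: add_nonneg_eq_0_iff)
    define Y where "Y = \<delta> * ((x\<^sup>2 - 1) / (1 + x\<^sup>2))"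
    have "Y = (b\<^sup>2 - 1) * (x\<^sup>2 - 1) / ((1 + b\<^sup>2) * (1 + x\<^sup>2))" by (simp add: Y_def \<delta>_def)
    then have Y: "(1 + b\<^sup>2) * (1 + x\<^sup>2) * Y = (b\<^sup>2 - 1) * (x\<^sup>2 - 1)" using P by simp
    have MY: "M (line_to_sphere x) = Y" "N (line_to_sphere x) = Y"
      by (simp_all add: M_def N_def line_to_sphere_nth Y_def)
    have bx: "b\<^sup>2 * (x\<^sup>2 + 1 / b\<^sup>2) = b\<^sup>2 * x\<^sup>2 + 1" using b0 by (simp add: distrib_left)
    have "(1 + b\<^sup>2) * (1 + x\<^sup>2) * (1 + M (line_to_sphere x)) = 2 * (b\<^sup>2 * (x\<^sup>2 + 1 / b\<^sup>2))"
      "(1 + b\<^sup>2) * (1 + x\<^sup>2) * (1 - N (line_to_sphere x)) = 2 * (x\<^sup>2 + b\<^sup>2)"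
      unfolding MY bx distrib_left[of "(1 + b\<^sup>2) * (1 + x\<^sup>2)"] right_diff_distrib[of "(1 + b\<^sup>2) * (1 + x\<^sup>2)"] Y
      by (simp_all add: algebra_simps)
    then have 1: "1 + M (line_to_sphere x) = 2 * b\<^sup>2 / (1 + b\<^sup>2) * ((x\<^sup>2 + 1 / b\<^sup>2) / (1 + x\<^sup>2))"
      and 2: "1 - N (line_to_sphere x) = 2 / (1 + b\<^sup>2) * ((x\<^sup>2 + b\<^sup>2) / (1 + x\<^sup>2))"
      unfolding times_divide_times_eq mult.assoc[of 2, symmetric] using P by (simp_all only: eq_divide_eq if_False if_True not_False_eq_True mult_ac)
    have p1: "0 < x\<^sup>2 + 1 / b\<^sup>2" "0 < x\<^sup>2 + b\<^sup>2" using b0 by (auto intro: add_nonneg_pos)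
    have l1: "ln (G * (1 + M (line_to_sphere x))) = ln G + ln (2 * b\<^sup>2 / (1 + b\<^sup>2)) + (ln (x\<^sup>2 + 1 / b\<^sup>2) - ln (1 + x\<^sup>2))"
      unfolding 1 using G0 b0 p1 by (subst ln_mult_pos, simp, simp, subst ln_mult_pos, simp, simp, subst ln_div) auto
    have l2: "ln (G * (1 - N (line_to_sphere x))) = ln G + ln (2 / (1 + b\<^sup>2)) + (ln (x\<^sup>2 + b\<^sup>2) - ln (1 + x\<^sup>2))"
      unfolding 2 using G0 b0 p1 by (subst ln_mult_pos, simp, simp, subst ln_mult_pos, simp, simp, subst ln_div) auto
    show ?thesis unfolding U_def l1 l2 ext_field_reduced F_def by (simp add: field_simps)
  qed
  define C where "C = (1 + a) / 2 * \<bar>ln (1 / b\<^sup>2)\<bar> + a / 2 * \<bar>ln (b\<^sup>2)\<bar>"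
  have line: "line_equilibrium (ext_field a b) = c.\<mu>"
  proof (rule c.line_equilibrium_\<mu>[where F = F])
    show Vt: "\<bar>ext_field a b x - ln (1 + x\<^sup>2) / 2\<bar> \<le> C" for x
      unfolding C_def by (rule ext_field_bound[OF b0 a])
    show "\<bar>U (line_to_sphere x)\<bar> \<le> \<bar>F\<bar> + C" for x
      using UF[of x] Vt[of x] by linarith
    show "F \<le> U (line_to_sphere x) + (ext_field a b x - ln (1 + x\<^sup>2) / 2)" for x by (simp add: UF)
    show "AE t in circ. U (line_to_sphere (cot (t / 2))) + (ext_field a b (cot (t / 2)) - ln (1 + (cot (t / 2))\<^sup>2) / 2) = F"
      by (simp add: UF)
  qed measurable
  define d where "d = - (a / 2) * ln (1 - r) - (1 + a) / 2 * ln (1 + r)"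
  define h where "h p x = (if x \<bullet> p - r \<le> 0 then a * skern x p else d - (1 + a) * skern x (- p))" for p x :: "real ^ 3"
  define l where "l p x = (if x \<bullet> p - r \<le> 0 then a / 2 else - (1 + a) / 2)" for p x :: "real ^ 3"
  note cap1 = single_cap[OF p(1) p_1(1) a, folded r_def, folded d_def, folded h_def l_def]
  note cap2 = single_cap[OF p(2) p_1(2) a, folded r_def, folded d_def, folded h_def l_def]
  define q where "q x = M x - r" for x
  have q_le: "q x \<le> 0 \<longleftrightarrow> x \<bullet> p1 - r \<le> 0 \<and> x \<bullet> p2 - r \<le> 0" for x
    using MN[of x] NM[of x] unfolding q_def by auto
  have not_both: "\<not> (0 < x \<bullet> p1 - r \<and> 0 < x \<bullet> p2 - r)" if "x \<in> S2" for x
    using dx3[OF that] \<delta>r unfolding xp by (auto simp: abs_le_iff)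
  \<comment> \<open>Outside both caps the Laplacians add up to a / 2 + a / 2 = a; inside one cap, to
    a / 2 - (1 + a) / 2 = - 1 / 2. No point lies in both.\<close>
  have lap: "l p1 x + l p2 x = - 1 / 2 + (1 / 2 + a) * indicator (S2 \<inter> {x. q x \<le> 0}) x" if "x \<in> S2" for x
    using that not_both[OF that] q_le[of x] by (auto simp: l_def indicator_def field_simps)
  have lm[measurable]: "l p \<in> borel_measurable borel" for p unfolding l_def[abs_def] by measurable
  have li: "integrable sphere_prob (l p)" for p
    by (rule sphere_prob.integrable_const_bound[where B = "1 + a"]) (use a in \<open>auto simp: l_def\<close>)
  have sli: "integrable sphere_prob (\<lambda>x. skern x y * l p x)" if "y \<in> S2" for y p
  proof (rule Bochner_Integration.integrable_bound[OF integrable_mult_left[OF skern_sphere_integrable[OF that], of "1 + a"]])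
    have "\<bar>l p x\<bar> \<le> \<bar>1 + a\<bar>" for x using a by (auto simp: l_def)
    then show "AE x in sphere_prob. norm (skern x y * l p x) \<le> norm (skern x y * (1 + a))"
      unfolding real_norm_def abs_mult by (intro AE_I2 mult_left_mono) auto
  qed measurable
  have qm[measurable]: "q \<in> borel_measurable borel"
    unfolding q_def[abs_def] M_def by measurable
  have ind_m: "(\<lambda>x. indicator (S2 \<inter> {x. q x \<le> 0}) x :: real) \<in> borel_measurable borel"
  proof (intro borel_measurable_indicator sets.Int)
    show "S2 \<in> sets borel" by (rule borel_closed[OF closed_sphere])
    show "{x. q x \<le> 0} \<in> sets borel" by measurable
  qed
  obtain K1 K2 where K: "\<And>x. x \<in> S2 \<Longrightarrow> \<bar>h p1 x\<bar> \<le> K1" "\<And>x. x \<in> S2 \<Longrightarrow> \<bar>h p2 x\<bar> \<le> K2"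
    using cap1(2) cap2(2) by blast
  \<comment> \<open>The factor G enters U with total weight (1 + a) / 2 - a / 2 = 1 / 2 of its
    logarithm, which has to be removed from the cap constant d.\<close>
  define c0 where "c0 = d - ln G / 2"
  have sk: "skern x (- p) = - ln (1 + x \<bullet> p) / 2" for x p by (simp add: skern_def)
  have lnG: "ln (G * (1 + M x)) = ln G + ln (1 + M x)" "ln (G * (1 - N x)) = ln G + ln (1 - N x)" if "x \<in> S2" for x
    using Mp[OF that] \<delta> G0 by (simp_all add: ln_mult_pos)
  interpret mb: motherbody q "\<lambda>x. h p1 x + h p2 x" a c0
    "(\<integral>x. h p1 x \<partial>sphere_prob) / 2 + (\<integral>x. h p2 x \<partial>sphere_prob) / 2" "K1 + K2" p1 p2 c.\<mu> U
  proof (rule motherbody.intro)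
    show "continuous_on UNIV q" unfolding q_def M_def by (intro continuous_intros)
    show "(\<lambda>x. h p1 x + h p2 x) \<in> borel_measurable borel" using cap1(1) cap2(1) by measurable
    show "\<bar>h p1 x + h p2 x\<bar> \<le> K1 + K2" if "x \<in> S2" for x using K[OF that] by linarith
    show "0 < a" "p1 \<in> S2" "p2 \<in> S2" by (fact a, fact p, fact p)
    have "M p1 \<ge> p1 \<bullet> p1" "M p2 \<ge> p2 \<bullet> p2" using MN[of p1] NM[of p1] MN[of p2] NM[of p2] by auto
    then show "0 < q p1" "0 < q p2" using r p by (auto simp: q_def norm_eq_1)
    show "h p1 x + h p2 x = a * skern x p1 + a * skern x p2" if "x \<in> S2" "q x \<le> 0" for x
      using that q_le[of x] by (simp add: h_def)
    show "h p1 x + h p2 x = c0 - U x" if x: "x \<in> S2" "0 < q x" for x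
    proof -
      have "0 < x \<bullet> p1 - r \<and> x \<bullet> p2 - r \<le> 0 \<and> M x = x \<bullet> p1 \<and> N x = x \<bullet> p2 \<or>
          0 < x \<bullet> p2 - r \<and> x \<bullet> p1 - r \<le> 0 \<and> M x = x \<bullet> p2 \<and> N x = x \<bullet> p1"
        using MN[of x] x(2) not_both[OF x(1)] unfolding q_def by auto
      then show ?thesis
      proof (elim disjE conjE)
        assume *: "0 < x \<bullet> p1 - r" "x \<bullet> p2 - r \<le> 0" "M x = x \<bullet> p1" "N x = x \<bullet> p2"
        show ?thesis using * unfolding U_def lnG[OF x(1)] h_def sk c0_def
          by (simp add: skern_def) (simp add: field_simps)
      next
        assume *: "0 < x \<bullet> p2 - r" "x \<bullet> p1 - r \<le> 0" "M x = x \<bullet> p2" "N x = x \<bullet> p1"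
        show ?thesis using * unfolding U_def lnG[OF x(1)] h_def sk c0_def
          by (simp add: skern_def) (simp add: field_simps)
      qed
    qed
    show "(\<integral>x. skern x y * (- 1 / 2 + (1 / 2 + a) * indicator (S2 \<inter> {x. q x \<le> 0}) x) \<partial>sphere_prob) =
        (\<integral>x. h p1 x \<partial>sphere_prob) / 2 + (\<integral>x. h p2 x \<partial>sphere_prob) / 2 - (h p1 y + h p2 y) / 2" if y: "y \<in> S2" for y
    proof -
      have "(\<integral>x. skern x y * (- 1 / 2 + (1 / 2 + a) * indicator (S2 \<inter> {x. q x \<le> 0}) x) \<partial>sphere_prob) =
          (\<integral>x. skern x y * l p1 x + skern x y * l p2 x \<partial>sphere_prob)"
      proof (rule integral_cong_AE)
        show "AE x in sphere_prob. skern x y * (- 1 / 2 + (1 / 2 + a) * indicator (S2 \<inter> {x. q x \<le> 0}) x) =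
            skern x y * l p1 x + skern x y * l p2 x"
          using AE_sphere_prob by eventually_elim (simp only: lap[symmetric] distrib_left)
      qed (use ind_m in measurable)
      also have "\<dots> = (\<integral>x. skern x y * l p1 x \<partial>sphere_prob) + (\<integral>x. skern x y * l p2 x \<partial>sphere_prob)"
        by (rule Bochner_Integration.integral_add[OF sli[OF y] sli[OF y]])
      also have "\<dots> = ((\<integral>x. h p1 x \<partial>sphere_prob) / 2 - h p1 y / 2) + ((\<integral>x. h p2 x \<partial>sphere_prob) / 2 - h p2 y / 2)"
        by (simp only: cap1(3)[OF y] cap2(3)[OF y])
      finally show ?thesis by (simp add: add_divide_distrib)
    qed
    have "(\<integral>x. - 1 / 2 + (1 / 2 + a) * indicator (S2 \<inter> {x. q x \<le> 0}) x \<partial>sphere_prob) = (\<integral>x. l p1 x + l p2 x \<partial>sphere_prob)"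
    proof (rule integral_cong_AE)
      show "AE x in sphere_prob. - 1 / 2 + (1 / 2 + a) * indicator (S2 \<inter> {x. q x \<le> 0}) x = l p1 x + l p2 x"
        using AE_sphere_prob by eventually_elim (rule lap[symmetric])
    qed (use ind_m in measurable)
    also have "\<dots> = 0" by (simp add: li cap1(4) cap2(4))
    finally show "(\<integral>x. - 1 / 2 + (1 / 2 + a) * indicator (S2 \<inter> {x. q x \<le> 0}) x \<partial>sphere_prob) = 0" .
    show "c0 \<le> U x + a * skern x p1 + a * skern x p2" if x: "x \<in> S2" "x \<noteq> p1" "x \<noteq> p2" for x
    proof -
      have "x \<bullet> p1 < 1" "x \<bullet> p2 < 1"
        using ip[OF x(1)] inner_eq_1_iff[OF x(1) p(1)] inner_eq_1_iff[OF x(1) p(2)] x by (auto simp: abs_le_iff)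
      then have M1: "M x < 1" using MN[of x] by auto
      have M2: "0 < 1 + M x" using Mp[OF x(1)] \<delta> by linarith
      have s: "a * skern x p1 + a * skern x p2 = - (a / 2) * ln (1 - M x) - (a / 2) * ln (1 - N x)"
        using MN[of x] unfolding skern_def by (auto simp: field_simps)
      \<comment> \<open>As a function of M, \<open>(1 + a) * ln (1 + M) + a * ln (1 - M)\<close> is
        concave with maximum at r: the tangent bounds of both logarithms at r are added, and by
        \<open>rr\<close> their slopes cancel.\<close>
      have 1: "ln (1 + M x) - ln (1 + r) \<le> (M x - r) / (1 + r)"
        using ln_le_minus_one[of "(1 + M x) / (1 + r)"] M2 r by (simp add: ln_div field_simps)
      have 2: "ln (1 - M x) - ln (1 - r) \<le> (r - M x) / (1 - r)"
        using ln_le_minus_one[of "(1 - M x) / (1 - r)"] M1 r by (simp add: ln_div field_simps)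
      have rr: "(1 + a) / (1 + r) = a / (1 - r)"
      proof -
        have "r * (1 + 2 * a) = 1" using a by (simp add: r_def)
        then have "a * (1 + r) = (1 + a) * (1 - r)" by (simp add: algebra_simps)
        then show ?thesis using r by (simp add: frac_eq_eq)
      qed
      have "(1 + a) / 2 * (ln (1 + M x) - ln (1 + r)) + a / 2 * (ln (1 - M x) - ln (1 - r)) \<le>
          (1 + a) / 2 * ((M x - r) / (1 + r)) + a / 2 * ((r - M x) / (1 - r))"
        using 1 2 a by (intro add_mono mult_left_mono) auto
      also have "\<dots> = (M x - r) / 2 * ((1 + a) / (1 + r)) - (M x - r) / 2 * (a / (1 - r))"
        by (simp add: diff_divide_distrib algebra_simps)
      also have "\<dots> = 0" unfolding rr by simp
      finally show ?thesis
        unfolding add.assoc s U_def lnG[OF x(1)] c0_def d_def by (simp add: field_simps)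
    qed
    show "\<exists>y\<in>T \<inter> S2. q y < 0" if x: "x \<in> S2" "q x \<le> 0" and T: "open T" "x \<in> T" for x T
    proof (cases "q x < 0")
      case True
      then show ?thesis using x T by blast
    next
      case False
      then have Mr: "\<beta> * \<bar>x $ 2\<bar> + \<delta> * x $ 3 = r" using x by (auto simp: q_def M_def)
      have S: "(x $ 1)\<^sup>2 + (x $ 2)\<^sup>2 + (x $ 3)\<^sup>2 = 1" using x(1) by (simp only: mem_S2_iff)
      show ?thesis
      \<comment> \<open>A boundary point off the great circle is moved at fixed height towards it,
        which lowers M; the sign \<epsilon> keeps the first coordinate on the right side. On the
        great circle the boundary equation forces \<delta> = r and x is the north pole, where the
        caps touch, so the motion goes along the great circle.\<close>
      proof (cases "x $ 2 = 0")
        case False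
        define \<epsilon> where "\<epsilon> = (if x $ 1 < 0 then - 1 else 1 :: real)"
        define f where "f e = vec3 (\<epsilon> * sqrt (1 - (x $ 3)\<^sup>2 - ((1 - e) * x $ 2)\<^sup>2)) ((1 - e) * x $ 2) (x $ 3)" for e
        have sq: "1 - (x $ 3)\<^sup>2 - (x $ 2)\<^sup>2 = (x $ 1)\<^sup>2" using S by simp
        have f0: "f 0 = x" unfolding f_def vec3_eq_iff \<epsilon>_def by (simp add: sq)
        have "isCont f 0" unfolding f_def by (intro isCont_vec3 continuous_intros)
        from path_enters_open[OF this f0 T] obtain e0 where e0: "0 < e0" "\<And>e. 0 < e \<Longrightarrow> e < e0 \<Longrightarrow> f e \<in> T" by blast
        define e where "e = min (e0 / 2) (1 / 2)"
        have e: "0 < e" "e < e0" "e < 1" using e0(1) by (auto simp: e_def)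
        have le: "((1 - e) * x $ 2)\<^sup>2 \<le> (x $ 2)\<^sup>2"
          unfolding power_mult_distrib using e by (intro mult_left_le_one_le) (auto simp: power_le_one)
        have "0 \<le> 1 - (x $ 3)\<^sup>2 - ((1 - e) * x $ 2)\<^sup>2" using le S zero_le_power2[of "x $ 1"] by linarith
        then have "f e \<in> S2"
          unfolding mem_S2_iff f_def vec3_nth power_mult_distrib[of \<epsilon>]
          by (simp only: real_sqrt_pow2) (simp add: \<epsilon>_def)
        moreover have "q (f e) < 0"
        proof -
          have "\<beta> * ((1 - e) * \<bar>x $ 2\<bar>) < \<beta> * (1 * \<bar>x $ 2\<bar>)" using \<beta> e False by (intro mult_strict_left_mono mult_strict_right_mono) auto
          then show ?thesis using Mr e by (simp add: q_def M_def f_def abs_mult)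
        qed
        ultimately show ?thesis using e0(2)[OF e(1,2)] by blast
      next
        case True
        have "x $ 3 \<le> 1" using x3[OF x(1)] by simp
        have dr: "\<delta> * x $ 3 = r" using Mr True by simp
        have "\<delta> * x $ 3 \<le> \<delta> * 1" using \<delta>(1) \<open>x $ 3 \<le> 1\<close> by (intro mult_left_mono)
        then have \<delta>e: "\<delta> = r" using dr \<delta>r by simp
        then have x31: "x $ 3 = 1" using dr r by simp
        then have x1: "x $ 1 = 0" using S True by simp
        define f where "f e = vec3 (sin e) 0 (cos e)" for e
        have f0: "f 0 = x" unfolding f_def vec3_eq_iff using True x31 x1 by simp
        have "isCont f 0" unfolding f_def by (intro isCont_vec3 continuous_intros)
        from path_enters_open[OF this f0 T] obtain e0 where e0: "0 < e0" "\<And>e. 0 < e \<Longrightarrow> e < e0 \<Longrightarrow> f e \<in> T" by blast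
        define e where "e = min (e0 / 2) 1"
        have e: "0 < e" "e < e0" "e \<le> 1" using e0(1) by (auto simp: e_def)
        have "f e \<in> S2" unfolding mem_S2_iff f_def vec3_nth by simp
        moreover have "q (f e) < 0"
        proof -
          have "cos e < cos 0" using e pi_gt3 by (intro cos_monotone_0_pi) auto
          then show ?thesis using r \<delta>e by (simp add: q_def M_def f_def)
        qed
        ultimately show ?thesis using e0(2)[OF e(1,2)] by blast
      qed
    qed
    show "sets c.\<mu> = sets borel" "prob_space c.\<mu>" by (simp_all add: c.prob_space_\<mu>)
    show "AE s in c.\<mu>. x \<noteq> line_to_sphere s" "integrable c.\<mu> (\<lambda>s. skern x (line_to_sphere s))"
      "(\<integral>s. skern x (line_to_sphere s) \<partial>c.\<mu>) = U x" if "x \<in> S2" for x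
      by (rule c.potential_\<mu>[OF that])+
  qed
  show ?thesis
    by (rule mb.motherbody_exists[OF line]) (simp only: p1_def p2_def)
qed

section \<open>Potentials of measures on arcs\<close>

lemma circ_integral_continuous:
  assumes "continuous_on UNIV f"
  shows "integrable circ f" "(\<integral>t. f t \<partial>circ) = integral {0..2 * pi} f / (2 * pi :: real)"
proof -
  have c: "continuous_on {0..2 * pi} f" by (rule continuous_on_subset[OF assms]) simp
  note * = circ_integral[OF c borel_measurable_continuous_onI[OF assms] integrable_integral[OF integrable_continuous_real[OF c]]]
  show "integrable circ f" "(\<integral>t. f t \<partial>circ) = integral {0..2 * pi} f / (2 * pi)" by (fact *)+
qed

lemma circ_leibniz:
  fixes f f' :: "real \<Rightarrow> real \<Rightarrow> real"
  assumes e: "0 < e"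
    and d: "\<And>\<tau> t. \<bar>\<tau>\<bar> < e \<Longrightarrow> ((\<lambda>\<tau>. f \<tau> t) has_real_derivative f' \<tau> t) (at \<tau>)"
    and c: "\<And>\<tau>. \<bar>\<tau>\<bar> < e \<Longrightarrow> continuous_on UNIV (f \<tau>)"
    and c': "continuous_on ({- e<..<e} \<times> UNIV) (\<lambda>(\<tau>, t). f' \<tau> t)"
  shows "((\<lambda>\<tau>. \<integral>t. f \<tau> t \<partial>circ) has_real_derivative (\<integral>t. f' 0 t \<partial>circ)) (at 0)"
proof -
  have "((\<lambda>\<tau>. integral (cbox 0 (2 * pi)) (f \<tau>)) has_real_derivative integral (cbox 0 (2 * pi)) (f' 0)) (at 0 within {- e<..<e})"
  proof (rule leibniz_rule_field_derivative)
    show "((\<lambda>\<tau>. f \<tau> t) has_real_derivative f' \<tau> t) (at \<tau> within {- e<..<e})" if "\<tau> \<in> {- e<..<e}" for \<tau> t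
      by (rule has_field_derivative_at_within[OF d]) (use that in auto)
    show "f \<tau> integrable_on cbox 0 (2 * pi)" if "\<tau> \<in> {- e<..<e}" for \<tau>
      by (rule integrable_continuous, rule continuous_on_subset[OF c]) (use that in auto)
    show "continuous_on ({- e<..<e} \<times> cbox 0 (2 * pi)) (\<lambda>(\<tau>, t). f' \<tau> t)"
      by (rule continuous_on_subset[OF c']) auto
  qed (use e in auto)
  then have D: "((\<lambda>\<tau>. integral {0..2 * pi} (f \<tau>)) has_real_derivative integral {0..2 * pi} (f' 0)) (at 0)"
    using at_within_open[of 0 "{- e<..<e}"] e by simp
  have c0: "continuous_on UNIV (f' 0)"
  proof -
    have "continuous_on UNIV (\<lambda>t. case (0, t) of (\<tau>, t) \<Rightarrow> f' \<tau> t)"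
      by (rule continuous_on_compose2[OF c']) (use e in \<open>auto intro!: continuous_intros\<close>)
    then show ?thesis by simp
  qed
  have "((\<lambda>\<tau>. integral {0..2 * pi} (f \<tau>) / (2 * pi)) has_real_derivative integral {0..2 * pi} (f' 0) / (2 * pi)) (at 0)"
    by (rule DERIV_cdivide[OF D])
  then show ?thesis
    unfolding circ_integral_continuous(2)[OF c0]
  proof (rule has_field_derivative_transform_within_open)
    show "open {- e<..<e}" "0 \<in> {- e<..<e}" using e by auto
    show "integral {0..2 * pi} (f \<tau>) / (2 * pi) = (\<integral>t. f \<tau> t \<partial>circ)" if "\<tau> \<in> {- e<..<e}" for \<tau>
      by (rule circ_integral_continuous(2)[symmetric], rule c) (use that in auto)
  qed
qed

lemma continuous_on_rotgen: "continuous_on S f \<Longrightarrow> continuous_on S (\<lambda>x. rotgen i (f x))"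
proof -
  assume f: "continuous_on S f"
  have "continuous_on UNIV (rotgen i)"
    by (rule continuous_on_vec3) (auto simp: rotgen_def intro!: continuous_intros)
  from continuous_on_compose2[OF this f] show ?thesis by simp
qed

lemma continuous_on_rot': "continuous_on S f \<Longrightarrow> continuous_on S (\<lambda>x. rot i (f x) y)"
proof -
  assume f: "continuous_on S f"
  have "continuous_on S (\<lambda>x. (f x, y))" by (intro continuous_intros f)
  from continuous_on_compose2[OF continuous_on_rot[of i] this] show ?thesis by simp
qed

text \<open>Orbits on the unit sphere have speed at most 1. Hence a positive lower bound for 1 - x
  \<bullet> y survives small rotations.\<close>

lemma rot_inner_lipschitz:
  assumes x: "x \<in> S2" and y: "y \<in> S2"
  shows "\<bar>rot i t x \<bullet> y - x \<bullet> y\<bar> \<le> \<bar>t\<bar>"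
proof -
  have "norm (rot i t x \<bullet> y - rot i 0 x \<bullet> y) \<le> 1 * norm (t - 0)"
  proof (rule field_differentiable_bound[where S = UNIV and f' = "\<lambda>t. rotgen i (rot i t x) \<bullet> y"])
    fix t :: real
    have "rot i t x \<in> S2" using x by simp
    then have "norm (rotgen i (rot i t x)) \<le> 1" using norm_rotgen_le[of i "rot i t x"] by simp
    then show "norm (rotgen i (rot i t x) \<bullet> y) \<le> 1"
      using Cauchy_Schwarz_ineq2[of "rotgen i (rot i t x)" y] y by simp
  qed (auto simp: rot_inner_deriv)
  then show ?thesis by simp
qed

text \<open>Potentials written as integrals over the circle. Away from the curve y they are
  differentiated under the integral sign, which gives their rotation derivatives without a closed
  formula.\<close>

locale arc_potential =
  fixes w :: "real \<Rightarrow> real" and y :: "real \<Rightarrow> real ^ 3"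
  assumes wc: "continuous_on UNIV w" and yc: "continuous_on UNIV y" and yS: "\<And>t. y t \<in> S2"
begin

lemma [measurable]: "w \<in> borel_measurable borel" "y \<in> borel_measurable borel"
  by (fact borel_measurable_continuous_onI[OF wc] borel_measurable_continuous_onI[OF yc])+

definition pot :: "real ^ 3 \<Rightarrow> real" where
  "pot x = (\<integral>t. w t * skern x (y t) \<partial>circ)"

definition pot1 :: "3 \<Rightarrow> real ^ 3 \<Rightarrow> real" where
  "pot1 i x = (\<integral>t. w t * kern1 1 (y t) i x \<partial>circ)"

definition pot2 :: "3 \<Rightarrow> real ^ 3 \<Rightarrow> real" where
  "pot2 i x = (\<integral>t. w t * kern2 1 (y t) i x \<partial>circ)"

lemma pot_measurable [measurable]: "pot \<in> borel_measurable borel" "pot2 i \<in> borel_measurable borel"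
proof -
  have "(\<lambda>p. w (snd p) * skern (fst p) (y (snd p))) \<in> borel_measurable (borel \<Otimes>\<^sub>M circ)"
    unfolding skern_def by measurable
  then have "(\<lambda>(x, t). w t * skern x (y t)) \<in> borel_measurable (borel \<Otimes>\<^sub>M circ)"
    by (simp add: case_prod_beta')
  then show "pot \<in> borel_measurable borel"
    unfolding pot_def[abs_def] by (rule circ.borel_measurable_lebesgue_integral)
  have "(\<lambda>p. w (snd p) * kern2 1 (y (snd p)) i (fst p)) \<in> borel_measurable (borel \<Otimes>\<^sub>M circ)"
    unfolding kern2_def by measurable
  then have "(\<lambda>(x, t). w t * kern2 1 (y t) i x) \<in> borel_measurable (borel \<Otimes>\<^sub>M circ)"
    by (simp add: case_prod_beta')
  then show "pot2 i \<in> borel_measurable borel"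
    unfolding pot2_def[abs_def] by (rule circ.borel_measurable_lebesgue_integral)
qed

lemma kern_continuous:
  assumes d: "0 < d" "\<And>\<tau> t. \<tau> \<in> T \<Longrightarrow> d \<le> 1 - f \<tau> \<bullet> y t" and f: "continuous_on T f"
  shows "continuous_on (T \<times> UNIV) (\<lambda>(\<tau>, t). w t * kern 1 (y t) (f \<tau>))"
    "continuous_on (T \<times> UNIV) (\<lambda>(\<tau>, t). w t * kern1 1 (y t) i (f \<tau>))"
    "continuous_on (T \<times> UNIV) (\<lambda>(\<tau>, t). w t * kern2 1 (y t) i (f \<tau>))"
proof -
  have ws: "continuous_on (T \<times> UNIV) (\<lambda>p. w (snd p))" "continuous_on (T \<times> UNIV) (\<lambda>p. y (snd p))"
    by (rule continuous_on_compose2[OF wc] continuous_on_compose2[OF yc]; auto intro!: continuous_intros)+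
  have fs: "continuous_on (T \<times> (UNIV :: real set)) (\<lambda>p. f (fst p))"
    by (rule continuous_on_compose2[OF f]) (auto intro!: continuous_intros)
  have pos: "0 < 1 - f (fst p) \<bullet> y (snd p)" if "p \<in> T \<times> UNIV" for p
    using d(1) d(2)[of "fst p" "snd p"] that by (auto simp: mem_Times_iff)
  have nz: "1 - f (fst p) \<bullet> y (snd p) \<noteq> 0" "(1 - f (fst p) \<bullet> y (snd p))\<^sup>2 \<noteq> 0" if "p \<in> T \<times> UNIV" for p
    using pos[OF that] by simp_all
  note intros = continuous_intros ws fs continuous_on_rotgen
  show "continuous_on (T \<times> UNIV) (\<lambda>(\<tau>, t). w t * kern 1 (y t) (f \<tau>))"
    unfolding case_prod_beta' kern_def by (intro intros ballI; (erule nz | erule pos | simp))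
  show "continuous_on (T \<times> UNIV) (\<lambda>(\<tau>, t). w t * kern1 1 (y t) i (f \<tau>))"
    unfolding case_prod_beta' kern1_def by (intro intros ballI; (erule nz | simp))
  show "continuous_on (T \<times> UNIV) (\<lambda>(\<tau>, t). w t * kern2 1 (y t) i (f \<tau>))"
    unfolding case_prod_beta' kern2_def by (intro intros ballI; (erule nz | simp))
qed

lemma kern_continuous_at:
  assumes d: "0 < d" "\<And>t. d \<le> 1 - x \<bullet> y t"
  shows "continuous_on UNIV (\<lambda>t. w t * kern 1 (y t) x)" "continuous_on UNIV (\<lambda>t. w t * kern1 1 (y t) i x)"
    "continuous_on UNIV (\<lambda>t. w t * kern2 1 (y t) i x)"
proof -
  have p: "continuous_on UNIV (\<lambda>t. (0 :: real, t :: real))" by (intro continuous_intros)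
  note k = kern_continuous[OF d(1), where T = "{0}" and f = "\<lambda>_. x", OF _ continuous_on_const]
  show "continuous_on UNIV (\<lambda>t. w t * kern 1 (y t) x)" "continuous_on UNIV (\<lambda>t. w t * kern1 1 (y t) i x)"
    "continuous_on UNIV (\<lambda>t. w t * kern2 1 (y t) i x)"
    using continuous_on_compose2[OF k(1) p] continuous_on_compose2[OF k(2)[where i = i] p]
      continuous_on_compose2[OF k(3)[where i = i] p] d(2) by auto
qed

lemma pot_C2:
  assumes x: "x \<in> S2" and d: "0 < d" "\<And>t. d \<le> 1 - x \<bullet> y t"
  shows "rot_C2_at pot pot1 pot2 x"
  unfolding rot_C2_at_def
proof (intro allI conjI)
  fix i
  \<comment> \<open>Angles below d / 2 use up at most half of the gap, so one lower bound holds
    along the whole piece of the orbit.\<close>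
  have far: "d / 2 \<le> 1 - rot i \<tau> x \<bullet> y t" if "\<bar>\<tau>\<bar> < d / 2" for \<tau> t
    using rot_inner_lipschitz[OF x yS, of i \<tau> t] d(2)[of t] that by (auto simp: abs_le_iff)
  have d2: "0 < d / 2" using d by simp
  have C2: "rot_C2_at (kern 1 (y t)) (kern1 1 (y t)) (kern2 1 (y t)) (rot i \<tau> x)" if "\<bar>\<tau>\<bar> < d / 2" for \<tau> t
    by (rule kern_C2) (use far[OF that, of t] d in auto)
  have fr: "continuous_on {- (d / 2)<..<d / 2} (\<lambda>\<tau>. rot i \<tau> x)"
    by (intro continuous_on_rot' continuous_intros)
  have far': "d / 2 \<le> 1 - rot i \<tau> x \<bullet> y t" if "\<tau> \<in> {- (d / 2)<..<d / 2}" for \<tau> t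
    by (rule far) (use that in auto)
  note K = kern_continuous[OF d2, OF far' fr]
  have "((\<lambda>\<tau>. \<integral>t. w t * kern 1 (y t) (rot i \<tau> x) \<partial>circ) has_real_derivative
      (\<integral>t. w t * kern1 1 (y t) i (rot i 0 x) \<partial>circ)) (at 0)"
  proof (rule circ_leibniz[OF d2])
    show "((\<lambda>\<tau>. w t * kern 1 (y t) (rot i \<tau> x)) has_real_derivative w t * kern1 1 (y t) i (rot i \<tau> x)) (at \<tau>)"
      if "\<bar>\<tau>\<bar> < d / 2" for \<tau> t
      by (rule DERIV_cmult[OF rot_C2_atD(1)[OF C2[OF that]]])
    show "continuous_on UNIV (\<lambda>t. w t * kern 1 (y t) (rot i \<tau> x))" if "\<bar>\<tau>\<bar> < d / 2" for \<tau>
      by (rule kern_continuous_at(1)[OF d2 far[OF that]])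
  qed (rule K(2))
  then show "((\<lambda>t. pot (rot i t x)) has_real_derivative pot1 i x) (at 0)"
    by (simp add: pot_def pot1_def kern_1)
  have "((\<lambda>\<tau>. \<integral>t. w t * kern1 1 (y t) i (rot i \<tau> x) \<partial>circ) has_real_derivative
      (\<integral>t. w t * kern2 1 (y t) i (rot i 0 x) \<partial>circ)) (at 0)"
  proof (rule circ_leibniz[OF d2])
    show "((\<lambda>\<tau>. w t * kern1 1 (y t) i (rot i \<tau> x)) has_real_derivative w t * kern2 1 (y t) i (rot i \<tau> x)) (at \<tau>)"
      if "\<bar>\<tau>\<bar> < d / 2" for \<tau> t
      by (rule DERIV_cmult[OF rot_C2_atD(2)[OF C2[OF that]]])
    show "continuous_on UNIV (\<lambda>t. w t * kern1 1 (y t) i (rot i \<tau> x))" if "\<bar>\<tau>\<bar> < d / 2" for \<tau>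
      by (rule kern_continuous_at(2)[OF d2 far[OF that]])
  qed (rule K(3))
  then show "((\<lambda>t. pot1 i (rot i t x)) has_real_derivative pot2 i x) (at 0)"
    by (simp add: pot1_def pot2_def)
qed

lemma pot_continuous:
  assumes d: "0 < d" "\<And>x t. x \<in> T \<Longrightarrow> d \<le> 1 - x \<bullet> y t"
  shows "continuous_on T pot"
proof -
  have "continuous_on (T \<times> UNIV) (\<lambda>(x, t). w t * kern 1 (y t) x)"
    by (rule kern_continuous(1)[OF d continuous_on_id])
  then have "continuous_on (T \<times> cbox 0 (2 * pi)) (\<lambda>(x, t). w t * kern 1 (y t) x)"
    by (rule continuous_on_subset) auto
  then have "continuous_on T (\<lambda>x. integral (cbox 0 (2 * pi)) (\<lambda>t. w t * kern 1 (y t) x))"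
    by (rule integral_continuous_on_param)
  then have "continuous_on T (\<lambda>x. integral {0..2 * pi} (\<lambda>t. w t * kern 1 (y t) x) / (2 * pi))"
    by (intro continuous_intros) auto
  moreover have "pot x = integral {0..2 * pi} (\<lambda>t. w t * kern 1 (y t) x) / (2 * pi)" if "x \<in> T" for x
    unfolding pot_def kern_1[symmetric]
    by (rule circ_integral_continuous(2), rule kern_continuous_at(1)[OF d(1)], rule d(2)[OF that])
  ultimately show ?thesis by (simp cong: continuous_on_cong)
qed

lemma pot_bounds:
  assumes w0: "\<And>t. 0 \<le> w t" and w1: "(\<integral>t. w t \<partial>circ) = 1"
    and x: "x \<in> S2" and d: "0 < d" "\<And>t. d \<le> 1 - x \<bullet> y t"
  shows "\<bar>pot x\<bar> \<le> \<bar>ln d\<bar> + ln 3" "\<bar>pot2 i x\<bar> \<le> 1 / d + 1 / d\<^sup>2"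
proof -
  have wi: "integrable circ w" by (rule circ_integral_continuous(1)[OF wc])
  have bound: "\<bar>\<integral>t. w t * f t \<partial>circ\<bar> \<le> B" if f: "\<And>t. \<bar>f t\<bar> \<le> B" and i: "integrable circ (\<lambda>t. w t * f t)" for f B
  proof -
    have "\<bar>\<integral>t. w t * f t \<partial>circ\<bar> \<le> (\<integral>t. \<bar>w t * f t\<bar> \<partial>circ)" by (rule integral_abs_bound)
    also have "\<dots> \<le> (\<integral>t. w t * B \<partial>circ)"
    proof (rule integral_mono)
      show "\<bar>w t * f t\<bar> \<le> w t * B" for t
        unfolding abs_mult using w0[of t] f[of t] by (intro mult_mono) auto
    qed (use i wi in auto)
    finally show ?thesis using w1 by simp
  qed
  note ki = kern_continuous_at[OF d, THEN circ_integral_continuous(1)]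
  show "\<bar>pot x\<bar> \<le> \<bar>ln d\<bar> + ln 3"
    unfolding pot_def kern_1[symmetric]
    by (rule bound[OF kern_bounds(1)[OF x yS d(1) d(2)] ki(1)]) auto
  show "\<bar>pot2 i x\<bar> \<le> 1 / d + 1 / d\<^sup>2"
    unfolding pot2_def
    by (rule bound[OF kern_bounds(2)[OF x yS d(1) d(2)] ki(3)]) auto
qed

lemma pot2_sum:
  assumes w1: "(\<integral>t. w t \<partial>circ) = 1" and x: "x \<in> S2" and d: "0 < d" "\<And>t. d \<le> 1 - x \<bullet> y t"
  shows "(\<Sum>i\<in>UNIV. pot2 i x) = 1 / 2"
proof -
  note ki = kern_continuous_at(3)[OF d, THEN circ_integral_continuous(1)]
  have "(\<Sum>i\<in>UNIV. pot2 i x) = (\<integral>t. (\<Sum>i\<in>UNIV. w t * kern2 1 (y t) i x) \<partial>circ)"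
    unfolding pot2_def by (rule Bochner_Integration.integral_sum[symmetric]) (rule ki)
  also have "\<dots> = (\<integral>t. w t * (1 / 2) \<partial>circ)"
  proof (rule Bochner_Integration.integral_cong[OF refl])
    fix t
    have "x \<bullet> y t \<noteq> 1" using d(1) d(2)[of t] by auto
    then show "(\<Sum>i\<in>UNIV. w t * kern2 1 (y t) i x) = w t * (1 / 2)"
      unfolding sum_distrib_left[symmetric] using kern2_sum_half[OF x yS] by simp
  qed
  also have "\<dots> = 1 / 2" using w1 by simp
  finally show ?thesis .
qed

end

lemma sphere_separation:
  assumes "compact A" "compact B" "A \<subseteq> S2" "B \<subseteq> S2" "A \<inter> B = {}"
  shows "\<exists>d>0. \<forall>x\<in>A. \<forall>y\<in>B. d \<le> 1 - x \<bullet> y"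
proof -
  obtain d where d: "0 < d" "\<And>x y. x \<in> A \<Longrightarrow> y \<in> B \<Longrightarrow> d \<le> dist x y"
    using separate_compact_closed[OF assms(1) compact_imp_closed[OF assms(2)] assms(5)] by auto
  have "d\<^sup>2 / 2 \<le> 1 - x \<bullet> y" if "x \<in> A" "y \<in> B" for x y
  proof -
    have "d\<^sup>2 \<le> (norm (x - y))\<^sup>2" using d(2)[OF that] d(1) by (intro power_mono) (auto simp: dist_norm)
    also have "\<dots> = x \<bullet> x + y \<bullet> y - 2 * (x \<bullet> y)"
      by (simp add: power2_norm_eq_inner inner_diff inner_commute)
    also have "\<dots> = 2 - 2 * (x \<bullet> y)"
      using subsetD[OF assms(3) that(1)] subsetD[OF assms(4) that(2)] by (simp add: norm_eq_1)
    finally show ?thesis by simp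
  qed
  then show ?thesis using d(1) by (intro exI[of _ "d\<^sup>2 / 2"]) auto
qed

text \<open>On the boundary of the droplet the obstacle function \<open>u + U - c0\<close> vanishes and has a minimum there,
  so both functions glued along the boundary have the same first derivatives.\<close>

theorem arc_motherbody:
  fixes q :: "real ^ 3 \<Rightarrow> real"
  assumes cp: "circle_pushforward w s u" and wc: "continuous_on UNIV w" and sc: "continuous_on UNIV s"
    and sb: "\<And>t. \<bar>s t\<bar> \<le> c" and qneg: "\<And>v. \<bar>v\<bar> \<le> c \<Longrightarrow> q (line_to_sphere v) < 0"
    and qc: "continuous_on UNIV q"
    and qf: "\<And>i. AE x in sphere_prob. finite {t \<in> {0..2 * pi}. q (rot i t x) = 0}"
    and a: "0 < a" and p: "p1 \<in> S2" "p2 \<in> S2" and qp: "0 < q p1" "0 < q p2"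
    and W: "\<And>x. x \<in> S2 \<Longrightarrow> x \<noteq> p1 \<Longrightarrow> x \<noteq> p2 \<Longrightarrow> c0 \<le> u x + a * skern x p1 + a * skern x p2"
    and W0: "\<And>x. x \<in> S2 \<Longrightarrow> q x = 0 \<Longrightarrow> u x + a * skern x p1 + a * skern x p2 = c0"
    and dense: "\<And>x U. x \<in> S2 \<Longrightarrow> q x \<le> 0 \<Longrightarrow> open U \<Longrightarrow> x \<in> U \<Longrightarrow> \<exists>y\<in>U \<inter> S2. q y < 0"
    and line: "line_equilibrium V = circle_pushforward.\<mu> w s"
  shows "has_motherbody a V (measure_support (sphere_equilibrium
    (add_measure (scale_measure (ennreal a) (return sphere_borel p1)) (scale_measure (ennreal a) (return sphere_borel p2)))))"
proof -
  interpret c: circle_pushforward w s u by (rule cp)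
  have lsc: "continuous_on S (\<lambda>t. line_to_sphere (f t))" if "continuous_on S f" for S and f :: "real \<Rightarrow> real"
    by (rule continuous_on_compose2[OF continuous_on_line_to_sphere that]) auto
  interpret A: arc_potential w "\<lambda>t. line_to_sphere (s t)"
    by unfold_locales (rule wc, rule lsc[OF sc], rule line_to_sphere_S2)
  have u: "u x = A.pot x" if "x \<in> S2" for x unfolding A.pot_def by (rule c.pot(3)[OF that, symmetric])
  have qn: "compact (S2 \<inter> {x. q x \<ge> 0})" "compact (S2 \<inter> {x. q x \<le> 0})"
    by (rule compact_Int_closed[OF compact_sphere closed_Collect_le[OF continuous_on_const qc]],
        rule compact_Int_closed[OF compact_sphere closed_Collect_le[OF qc continuous_on_const]])
  \<comment> \<open>The arc carrying the measure lies strictly inside the droplet, so it is compact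
    and disjoint from \<open>q \<ge> 0\<close>. A single d then bounds all kernels used outside the
    droplet.\<close>
  obtain d where d: "0 < d" "\<And>x t. x \<in> S2 \<Longrightarrow> 0 \<le> q x \<Longrightarrow> d \<le> 1 - x \<bullet> line_to_sphere (s t)"
  proof -
    have "compact (line_to_sphere ` {- c..c})"
      by (rule compact_continuous_image[OF lsc[OF continuous_on_id] compact_Icc])
    moreover have "line_to_sphere ` {- c..c} \<subseteq> S2" using line_to_sphere_S2 by blast
    moreover have "S2 \<inter> {x. q x \<ge> 0} \<inter> line_to_sphere ` {- c..c} = {}"
    proof -
      have "\<not> 0 \<le> q (line_to_sphere v)" if "v \<in> {- c..c}" for v using qneg[of v] that by (simp add: abs_le_iff)
      then show ?thesis by blast
    qed
    ultimately obtain d where "0 < d" "\<forall>x\<in>S2 \<inter> {x. q x \<ge> 0}. \<forall>y\<in>line_to_sphere ` {- c..c}. d \<le> 1 - x \<bullet> y"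
      using sphere_separation[OF qn(1)] by blast
    moreover have "line_to_sphere (s t) \<in> line_to_sphere ` {- c..c}" for t
      using sb[of t] by (intro imageI) (simp add: abs_le_iff)
    ultimately show thesis by (intro that[of d]) blast+
  qed
  obtain e where e: "0 < e" "\<And>x. x \<in> S2 \<Longrightarrow> q x \<le> 0 \<Longrightarrow> e \<le> 1 - x \<bullet> p1" "\<And>x. x \<in> S2 \<Longrightarrow> q x \<le> 0 \<Longrightarrow> e \<le> 1 - x \<bullet> p2"
  proof -
    have "S2 \<inter> {x. q x \<le> 0} \<inter> {p1, p2} = {}" using qp by fastforce
    then obtain e where "0 < e" "\<forall>x\<in>S2 \<inter> {x. q x \<le> 0}. \<forall>y\<in>{p1, p2}. e \<le> 1 - x \<bullet> y"
      using sphere_separation[OF qn(2) finite_imp_compact[of "{p1, p2}"]] p by blast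
    then show thesis by (intro that[of e]) blast+
  qed
  define HA HB where "HA x = (0 + a * kern 1 p1 x) + (0 + a * kern 1 p2 x)" and "HB x = c0 + - 1 * A.pot x" for x
  define HA1 HB1 where "HA1 i x = a * kern1 1 p1 i x + a * kern1 1 p2 i x" and "HB1 i x = - 1 * A.pot1 i x" for i x
  define HA2 HB2 where "HA2 i x = a * kern2 1 p1 i x + a * kern2 1 p2 i x" and "HB2 i x = - 1 * A.pot2 i x" for i x
  define Md where "Md d = max (\<bar>ln d\<bar> + ln 3) (1 / d + 1 / d\<^sup>2)" for d :: real
  define K where "K = 2 * a * Md e + Md d + \<bar>c0\<bar>"
  have Md0: "0 \<le> Md d" for d unfolding Md_def by (simp add: le_max_iff_disj)
  have K: "2 * a * Md e \<le> K" "\<bar>c0\<bar> + Md d \<le> K" using a Md0[of d] Md0[of e] by (auto simp: K_def)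
  have bk: "\<bar>kern 1 p x\<bar> \<le> Md e" "\<bar>kern2 1 p i x\<bar> \<le> Md e" if "x \<in> S2" "p \<in> S2" "e \<le> 1 - x \<bullet> p" for x p i
    using kern_bounds(1)[OF that(1,2) e(1) that(3)] kern_bounds(2)[OF that(1,2) e(1) that(3), of i] unfolding Md_def by auto
  have two: "\<bar>a * v + a * v'\<bar> \<le> K" if "\<bar>v\<bar> \<le> Md e" "\<bar>v'\<bar> \<le> Md e" for v v'
  proof -
    have "\<bar>a * v\<bar> \<le> a * Md e" "\<bar>a * v'\<bar> \<le> a * Md e" unfolding abs_mult using a that by (auto intro: mult_left_mono)
    then show ?thesis using K(1) by linarith
  qed
  have CA: "rot_C2_at HA HA1 HA2 x" if "x \<bullet> p1 < 1" "x \<bullet> p2 < 1" for x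
    unfolding HA_def[abs_def] HA1_def[abs_def] HA2_def[abs_def]
    by (intro rot_C2_at_add rot_C2_at_cmult_add kern_C2 that)
  have CB: "rot_C2_at HB HB1 HB2 x" if "x \<in> S2" "0 \<le> q x" for x
    unfolding HB_def[abs_def] HB1_def[abs_def] HB2_def[abs_def]
    by (rule rot_C2_at_cmult_add, rule A.pot_C2[OF that(1) d(1)], rule d(2)[OF that])
  have HAB: "HA x - HB x = u x + a * skern x p1 + a * skern x p2 - c0" if "x \<in> S2" for x
    unfolding HA_def HB_def u[OF that] kern_1 by simp
  interpret P: piecewise_rot_C2 q HA HB HA1 HA2 HB1 HB2 K
  proof
    show "continuous_on UNIV q" by (rule qc)
    show "AE x in sphere_prob. finite {t \<in> {0..2 * pi}. q (rot i t x) = 0}" for i by (rule qf)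
    show "rot_C2_at HA HA1 HA2 x" if "x \<in> S2" "q x \<le> 0" for x
      using e(2)[OF that] e(3)[OF that] e(1) by (intro CA) auto
    show "rot_C2_at HB HB1 HB2 x" if "x \<in> S2" "0 \<le> q x" for x by (rule CB[OF that])
    show "HA x = HB x \<and> HA1 i x = HB1 i x" if x: "x \<in> S2" "q x = 0" for x i
    proof
      show 0: "HA x = HB x" using HAB[OF x(1)] W0[OF x] by simp
      have xq: "q x \<le> 0" "0 \<le> q x" using x by auto
      have D1: "((\<lambda>t. HA (rot i t x) - HB (rot i t x)) has_real_derivative HA1 i x - HB1 i x) (at 0)"
        using CA[of x] CB[OF x(1) xq(2)] e(2)[OF x(1) xq(1)] e(3)[OF x(1) xq(1)] e(1) unfolding rot_C2_at_def
        by (intro DERIV_diff) auto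
      \<comment> \<open>Up to angle e the orbit avoids the poles, where \<open>skern\<close> has the
        artificial value 0 and \<open>W\<close> says nothing.\<close>
      have D2: "\<forall>t. \<bar>0 - t\<bar> < e \<longrightarrow> HA (rot i 0 x) - HB (rot i 0 x) \<le> HA (rot i t x) - HB (rot i t x)"
      proof (intro allI impI)
        fix t assume t: "\<bar>0 - t\<bar> < e"
        have S: "rot i t x \<in> S2" using x(1) by simp
        have "rot i t x \<bullet> p1 < 1" "rot i t x \<bullet> p2 < 1"
          using rot_inner_lipschitz[OF x(1) p(1), of i t] rot_inner_lipschitz[OF x(1) p(2), of i t]
            e(2)[OF x(1) xq(1)] e(3)[OF x(1) xq(1)] t by (auto simp: abs_le_iff)
        then have "rot i t x \<noteq> p1" "rot i t x \<noteq> p2" using p by (auto simp: norm_eq_1)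
        from W[OF S this] show "HA (rot i 0 x) - HB (rot i 0 x) \<le> HA (rot i t x) - HB (rot i t x)"
          unfolding HAB[OF S] rot_0 0 by simp
      qed
      have "HA1 i x - HB1 i x = 0" by (rule DERIV_local_min[OF D1 e(1) D2])
      then show "HA1 i x = HB1 i x" by simp
    qed
    show "HA \<in> borel_measurable borel" "HB \<in> borel_measurable borel" "HA2 i \<in> borel_measurable borel" "HB2 i \<in> borel_measurable borel" for i
      unfolding HA_def[abs_def] HB_def[abs_def] HA2_def[abs_def] HB2_def[abs_def] by measurable
    show "\<bar>HA x\<bar> \<le> K" "\<bar>HA2 i x\<bar> \<le> K" if "x \<in> S2" "q x \<le> 0" for x i
      unfolding HA_def HA2_def add_0 using bk[OF that(1) p(1) e(2)[OF that]] bk[OF that(1) p(2) e(3)[OF that]]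
      by (auto intro!: two)
    show "\<bar>HB x\<bar> \<le> K" "\<bar>HB2 i x\<bar> \<le> K" if "x \<in> S2" "0 \<le> q x" for x i
    proof -
      have "\<bar>A.pot x\<bar> \<le> Md d" "\<bar>A.pot2 i x\<bar> \<le> Md d"
        using A.pot_bounds[OF c.w0 c.w1(2) that(1) d(1) d(2)[OF that]] unfolding Md_def by (auto simp: le_max_iff_disj)
      then show "\<bar>HB x\<bar> \<le> K" "\<bar>HB2 i x\<bar> \<le> K" using K(2) unfolding HB_def HB2_def by (auto simp: abs_le_iff)
    qed
  qed
  \<comment> \<open>Inside, each of the two charges contributes a / 2; outside, minus the potential
    of a probability measure contributes - 1 / 2.\<close>
  have lap: "P.lap x = - 1 / 2 + (1 / 2 + a) * indicator (S2 \<inter> {x. q x \<le> 0}) x" if x: "x \<in> S2" for x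
  proof (cases "q x \<le> 0")
    case True
    have ne: "x \<bullet> p1 \<noteq> 1" "x \<bullet> p2 \<noteq> 1" using e(1) e(2)[OF x True] e(3)[OF x True] by auto
    have "(\<Sum>i\<in>UNIV. HA2 i x) = a"
      unfolding HA2_def sum.distrib sum_distrib_left[symmetric] kern2_sum_half[OF x p(1) ne(1)] kern2_sum_half[OF x p(2) ne(2)] by simp
    then show ?thesis using True x by (simp add: P.lap_def)
  next
    case False
    then have q: "0 \<le> q x" by simp
    have "(\<Sum>i\<in>UNIV. HB2 i x) = - 1 * (1 / 2)"
      unfolding HB2_def sum_distrib_left[symmetric] A.pot2_sum[OF c.w1(2) x d(1) d(2)[OF x q]] ..
    then show ?thesis using False x by (simp add: P.lap_def)
  qed
  have hc: "continuous_on S2 P.h"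
  proof -
    have mv: "(\<lambda>x. 0 + a * kern 1 p1 x + (0 + a * kern 1 p2 x)) = (\<lambda>x. a * skern x p1 + a * skern x p2)" by (simp add: kern_1)
    have cA: "continuous_on (S2 \<inter> {x. q x \<le> 0}) HA"
      unfolding HA_def mv by (intro continuous_intros continuous_on_skern) (use e in force)+
    have cB: "continuous_on (S2 \<inter> {x. 0 \<le> q x}) HB"
    proof -
      have "continuous_on (S2 \<inter> {x. 0 \<le> q x}) A.pot"
        by (rule A.pot_continuous[OF d(1)]) (use d(2) in auto)
      then show ?thesis unfolding HB_def by (intro continuous_intros)
    qed
    show ?thesis by (rule P.continuous_h[OF cA cB])
  qed
  define ind where "ind x = (indicator (S2 \<inter> {x. q x \<le> 0}) x :: real)" for x
  have ind_m[measurable]: "ind \<in> borel_measurable borel"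
    unfolding ind_def[abs_def] by (rule borel_measurable_indicator, rule borel_closed, rule compact_imp_closed, rule qn(2))
  interpret mb: motherbody q P.h a c0 "(\<integral>x. P.h x \<partial>sphere_prob) / 2" K p1 p2 c.\<mu> u
  proof (rule motherbody.intro)
    show "continuous_on UNIV q" "P.h \<in> borel_measurable borel" by (rule qc, rule P.h_measurable)
    show "\<bar>P.h x\<bar> \<le> K" if "x \<in> S2" for x by (rule P.h_bound[OF that])
    show "0 < a" "p1 \<in> S2" "p2 \<in> S2" "0 < q p1" "0 < q p2" by (fact a, fact p, fact p, fact qp, fact qp)
    show "P.h x = a * skern x p1 + a * skern x p2" if "x \<in> S2" "q x \<le> 0" for x
      using that by (simp add: P.h_def HA_def kern_1)
    show "P.h x = c0 - u x" if "x \<in> S2" "0 < q x" for x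
      using that(2) u[OF that(1)] by (simp add: P.h_def HB_def)
    show "(\<integral>x. skern x y * (- 1 / 2 + (1 / 2 + a) * indicator (S2 \<inter> {x. q x \<le> 0}) x) \<partial>sphere_prob) =
        (\<integral>x. P.h x \<partial>sphere_prob) / 2 - P.h y / 2" if y: "y \<in> S2" for y
      unfolding P.green_potential[OF y hc, symmetric] ind_def[symmetric]
    proof (rule integral_cong_AE)
      show "AE x in sphere_prob. skern x y * (- 1 / 2 + (1 / 2 + a) * ind x) = skern x y * P.lap x"
        using AE_sphere_prob by eventually_elim (simp only: lap ind_def)
    qed measurable
    have "(\<integral>x. - 1 / 2 + (1 / 2 + a) * ind x \<partial>sphere_prob) = (\<integral>x. P.lap x \<partial>sphere_prob)"
    proof (rule integral_cong_AE)
      show "AE x in sphere_prob. - 1 / 2 + (1 / 2 + a) * ind x = P.lap x"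
        using AE_sphere_prob by eventually_elim (simp only: lap ind_def)
    qed measurable
    then show "(\<integral>x. - 1 / 2 + (1 / 2 + a) * indicator (S2 \<inter> {x. q x \<le> 0}) x \<partial>sphere_prob) = 0"
      unfolding ind_def P.green_mass .
    show "sets c.\<mu> = sets borel" "prob_space c.\<mu>" by (rule c.sets_\<mu>, rule c.prob_space_\<mu>)
    show "AE v in c.\<mu>. x \<noteq> line_to_sphere v" "integrable c.\<mu> (\<lambda>v. skern x (line_to_sphere v))"
      "(\<integral>v. skern x (line_to_sphere v) \<partial>c.\<mu>) = u x" if "x \<in> S2" for x
      by (rule c.potential_\<mu>[OF that])+
  qed (fact W, fact dense)
  show ?thesis by (rule mb.motherbody_exists[OF line refl])
qed

section \<open>Elliptic droplets\<close>

text \<open>As a function of ln (x + d), ln x is concave, because its derivative (x + d) / x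
  decreases in x. The right side is the tangent at z.\<close>

lemma ln_shift_le:
  fixes x z d :: real
  assumes "0 < x" "0 < z" "0 \<le> d"
  shows "ln x \<le> ln z + (z + d) / z * (ln (x + d) - ln (z + d))"
proof -
  define y where "y = (x + d) / (z + d)"
  have y: "0 < y" and yd: "y * (z + d) = x + d" using assms by (auto simp: y_def)
  have "ln (x / (z * y)) \<le> x / (z * y) - 1" "ln (1 / y) \<le> 1 / y - 1"
    using assms y by (intro ln_le_minus_one; simp)+
  then have 1: "ln x - ln z - ln y \<le> x / (z * y) - 1" and 2: "- ln y \<le> 1 / y - 1"
    using assms y by (simp_all add: ln_div ln_mult_pos)
  have "d / z * - ln y \<le> d / z * (1 / y - 1)" using assms 2 by (intro mult_left_mono) auto
  then have "ln x - ln z - ln y - d / z * ln y \<le> x / (z * y) - 1 + d / z * (1 / y - 1)" using 1 by simp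
  also have "\<dots> = (x + d) / (z * y) - (z + d) / z" using assms y by (simp add: field_simps)
  also have "\<dots> = 0" unfolding yd[symmetric] using assms y by simp
  finally have "ln x \<le> ln z + (z + d) / z * ln y" using assms by (simp add: field_simps)
  moreover have "ln y = ln (x + d) - ln (z + d)" using assms by (simp add: y_def ln_div)
  ultimately show ?thesis by simp
qed

text \<open>Adding d to both entries raises a weighted geometric mean by at least d. So if the mean
  of the shifted numbers is at most Z + d, that of the original ones is at most Z.\<close>

lemma weighted_geometric_mean_superadditive:
  fixes X Y Z P Q d :: real
  assumes "0 < X" "0 < Y" "0 < Z" "0 \<le> d" "0 \<le> P" "0 \<le> Q"
    and le: "P * ln (X + d) + Q * ln (Y + d) \<le> (P + Q) * ln (Z + d)"
  shows "P * ln X + Q * ln Y \<le> (P + Q) * ln Z"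
proof -
  define k where "k = (Z + d) / Z"
  have "P * ln X \<le> P * (ln Z + k * (ln (X + d) - ln (Z + d)))" "Q * ln Y \<le> Q * (ln Z + k * (ln (Y + d) - ln (Z + d)))"
    unfolding k_def using assms by (intro mult_left_mono ln_shift_le; simp)+
  then have "P * ln X + Q * ln Y \<le> (P + Q) * ln Z + k * (P * ln (X + d) + Q * ln (Y + d) - (P + Q) * ln (Z + d))"
    by (simp add: algebra_simps)
  moreover have "0 \<le> k" using assms by (simp add: k_def)
  then have "k * (P * ln (X + d) + Q * ln (Y + d) - (P + Q) * ln (Z + d)) \<le> 0"
    using le by (intro mult_nonneg_nonpos) auto
  ultimately show ?thesis by simp
qed

text \<open>In the coordinate \<open>\<zeta>\<close> given by \<open>z\<^sup>2 * \<zeta> = g * (1 + \<zeta>)\<^sup>2\<close> and \<open>norm \<zeta> \<le> 1\<close>, the equilibrium measure on the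
  line has the density \<open>(1 + a) * poiss (m\<^sup>2) t - a * poiss (n\<^sup>2) t\<close> on the unit circle, and the droplet is
  \<open>norm \<zeta> \<ge> n / m\<close>. The constants \<open>a\<close>, \<open>b\<close>, \<open>g\<close> are rational functions of \<open>m\<close> and \<open>n\<close> up to square roots.\<close>

locale ellipse =
  fixes m n :: real
  assumes n0: "0 < n" and nm: "n < m" and m1: "m < 1"
begin

text \<open>P and Q are 1 + a and a multiplied by the common denominator 2 * (m^2 - n^2); e is the
  factor with e * g = m * n.\<close>

definition "P = (1 + m\<^sup>2) * (1 - n\<^sup>2)"
definition "Q = (1 - m\<^sup>2) * (1 + n\<^sup>2)"
definition "e = (1 - m\<^sup>2) * (1 - n\<^sup>2)"

lemma m0: "0 < m" and n1: "n < 1" and nm2: "n\<^sup>2 < m\<^sup>2" and m2: "m\<^sup>2 < 1" and n2: "n\<^sup>2 < 1"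
  using n0 nm m1 by (auto intro: power_strict_mono simp: abs_square_less_1)

lemma pos: "0 < P" "0 < Q" "0 < e" "0 < 1 - m\<^sup>2 * n\<^sup>2"
proof -
  have "m\<^sup>2 * n\<^sup>2 < 1 * 1" using m2 n2 n0 m0 by (intro mult_strict_mono) auto
  then show "0 < 1 - m\<^sup>2 * n\<^sup>2" by simp
  show "0 < P" "0 < Q" "0 < e" unfolding P_def Q_def e_def using m2 n2
    by (auto intro!: mult_pos_pos add_pos_nonneg)
qed

lemma PQ: "P + Q = 2 * (1 - m\<^sup>2 * n\<^sup>2)" "P - Q = 2 * (m\<^sup>2 - n\<^sup>2)"
  by (simp_all add: P_def Q_def algebra_simps)

text \<open>The obstacle function u + U - c0 at positive real \<zeta> = r, multiplied by 4 * (m^2 -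
  n^2) and up to an additive constant.\<close>

definition "F r = (P + Q) * ln (e * r + m * n * (1 + r)\<^sup>2) - 2 * P * ln (1 + m\<^sup>2 * r) - 2 * Q * ln (r + n\<^sup>2)"

text \<open>Over the common denominator the numerator collapses to a positive constant times (m * r
  - n) * (1 - r). The sign changes only at n / m and at 1, so n / m is the minimum on the unit
  interval.\<close>

lemma F_deriv:
  assumes r: "0 < r"
  shows "(F has_real_derivative 2 * (m - n) * e * (1 - m\<^sup>2 * n\<^sup>2) * ((m * r - n) * (1 - r)) /
    ((e * r + m * n * (1 + r)\<^sup>2) * (1 + m\<^sup>2 * r) * (r + n\<^sup>2))) (at r)"
proof -
  define E3 E1 E2 where "E3 = e * r + m * n * (1 + r)\<^sup>2" and "E1 = 1 + m\<^sup>2 * r" and "E2 = r + n\<^sup>2"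
  have p: "0 < E3" "0 < E1" "0 < E2" unfolding E3_def E1_def E2_def using r pos m0 n0 by (auto intro!: add_pos_pos mult_pos_pos)
  have "(F has_real_derivative (P + Q) * ((e + 2 * m * n * (1 + r)) / E3) - 2 * P * (m\<^sup>2 / E1) - 2 * Q * (1 / E2)) (at r)"
  proof -
    have d: "((\<lambda>r. e * r + m * n * (1 + r)\<^sup>2) has_real_derivative e + 2 * m * n * (1 + r)) (at r)"
      "((\<lambda>r. 1 + m\<^sup>2 * r) has_real_derivative m\<^sup>2) (at r)" "((\<lambda>r. r + n\<^sup>2) has_real_derivative 1) (at r)"
      by (auto intro!: derivative_eq_intros simp: algebra_simps)
    note l = DERIV_chain2[OF DERIV_ln_divide]
    have "((\<lambda>r. (P + Q) * ln (e * r + m * n * (1 + r)\<^sup>2) - 2 * P * ln (1 + m\<^sup>2 * r) - 2 * Q * ln (r + n\<^sup>2)) has_real_derivative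
        (P + Q) * (1 / E3 * (e + 2 * m * n * (1 + r))) - 2 * P * (1 / E1 * m\<^sup>2) - 2 * Q * (1 / E2 * 1)) (at r)"
      unfolding E3_def E1_def E2_def
      by (intro DERIV_diff DERIV_cmult l d p[unfolded E3_def E1_def E2_def])
    then show ?thesis unfolding F_def[abs_def] by simp
  qed
  moreover have "(P + Q) * ((e + 2 * m * n * (1 + r)) / E3) - 2 * P * (m\<^sup>2 / E1) - 2 * Q * (1 / E2) =
      ((P + Q) * (e + 2 * m * n * (1 + r)) * E1 * E2 - 2 * P * m\<^sup>2 * E3 * E2 - 2 * Q * E3 * E1) / (E3 * E1 * E2)"
    using p by (simp add: diff_divide_distrib)
  moreover have "(P + Q) * (e + 2 * m * n * (1 + r)) * E1 * E2 - 2 * P * m\<^sup>2 * E3 * E2 - 2 * Q * E3 * E1 =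
      2 * (m - n) * e * (1 - m\<^sup>2 * n\<^sup>2) * ((m * r - n) * (1 - r))"
    unfolding PQ unfolding P_def Q_def E3_def E1_def E2_def e_def by algebra
  ultimately show ?thesis unfolding E3_def E1_def E2_def by simp
qed

lemma F_min:
  assumes r: "0 < r" "r \<le> 1"
  shows "F (n / m) \<le> F r"
proof -
  have r0: "0 < n / m" "n / m < 1" using n0 m0 nm by auto
  have s: "0 < 2 * (m - n) * e * (1 - m\<^sup>2 * n\<^sup>2)" using nm pos by simp
  have d: "0 < (e * r + m * n * (1 + r)\<^sup>2) * (1 + m\<^sup>2 * r) * (r + n\<^sup>2)" if "0 < r" for r
    using that pos m0 n0 by (intro mult_pos_pos add_pos_nonneg) auto
  show ?thesis
  proof (cases "n / m \<le> r")
    case True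
    show ?thesis
    proof (rule DERIV_nonneg_imp_nondecreasing[OF True])
      fix v assume v: "n / m \<le> v" "v \<le> r"
      then have v0: "0 < v" using r0 by linarith
      have "n \<le> m * v" using v(1) m0 by (simp add: pos_divide_le_eq mult.commute)
      then have "0 \<le> (m * v - n) * (1 - v)" using v r by simp
      then show "\<exists>y. (F has_real_derivative y) (at v) \<and> 0 \<le> y"
        using F_deriv[OF v0] divide_nonneg_pos[OF mult_nonneg_nonneg[OF less_imp_le[OF s]] d[OF v0]] by blast
    qed
  next
    case False
    then have le: "r \<le> n / m" by simp
    show ?thesis
    proof (rule DERIV_nonpos_imp_nonincreasing[OF le])
      fix v assume v: "r \<le> v" "v \<le> n / m"
      then have v0: "0 < v" using r by linarith
      have "m * v \<le> n" using v(2) m0 by (simp add: pos_le_divide_eq mult.commute)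
      moreover have "v \<le> 1" using v r0 by linarith
      ultimately have "(m * v - n) * (1 - v) \<le> 0" by (simp add: mult_nonpos_nonneg)
      then show "\<exists>y. (F has_real_derivative y) (at v) \<and> y \<le> 0"
        using F_deriv[OF v0] divide_nonpos_pos[OF mult_nonneg_nonpos[OF less_imp_le[OF s]] d[OF v0]] by blast
    qed
  qed
qed

text \<open>For fixed modulus r each of the three expressions is a multiple of \<alpha> + C, with C
  the cosine of the argument of \<zeta>. Passing to C = 1 thus adds the same amount 1 - C to all
  three, which is what superadditivity can handle.\<close>

lemma E_factor:
  assumes r: "0 < r"
  defines "\<alpha>1 \<equiv> (1 + (m\<^sup>2 * r)\<^sup>2) / (2 * m\<^sup>2 * r)" and "\<alpha>2 \<equiv> (r\<^sup>2 + (n\<^sup>2)\<^sup>2) / (2 * n\<^sup>2 * r)"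
    and "\<alpha>3 \<equiv> (e * r + m * n * (1 + r\<^sup>2)) / (2 * m * n * r)"
  shows "1 + (m\<^sup>2 * r)\<^sup>2 + 2 * m\<^sup>2 * r * C = 2 * m\<^sup>2 * r * (\<alpha>1 + C)"
    "r\<^sup>2 + (n\<^sup>2)\<^sup>2 + 2 * n\<^sup>2 * r * C = 2 * n\<^sup>2 * r * (\<alpha>2 + C)"
    "e * r + m * n * (1 + r\<^sup>2 + 2 * r * C) = 2 * m * n * r * (\<alpha>3 + C)"
proof -
  have c: "X + k * C = k * (X / k + C)" if "k \<noteq> 0" for X k :: real using that by (simp add: distrib_left)
  have k: "2 * m\<^sup>2 * r \<noteq> 0" "2 * n\<^sup>2 * r \<noteq> 0" "2 * m * n * r \<noteq> 0" using assms m0 n0 by auto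
  have "e * r + m * n * (1 + r\<^sup>2 + 2 * r * C) = (e * r + m * n * (1 + r\<^sup>2)) + 2 * m * n * r * C" by (simp add: algebra_simps)
  then show "1 + (m\<^sup>2 * r)\<^sup>2 + 2 * m\<^sup>2 * r * C = 2 * m\<^sup>2 * r * (\<alpha>1 + C)"
    "r\<^sup>2 + (n\<^sup>2)\<^sup>2 + 2 * n\<^sup>2 * r * C = 2 * n\<^sup>2 * r * (\<alpha>2 + C)"
    "e * r + m * n * (1 + r\<^sup>2 + 2 * r * C) = 2 * m * n * r * (\<alpha>3 + C)"
    unfolding \<alpha>1_def \<alpha>2_def \<alpha>3_def by (simp_all only: c[OF k(1)] c[OF k(2)] c[OF k(3)])
qed

text \<open>At r = n / m the three shifts coincide. This is why the obstacle function is constant on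
  that circle, whatever the argument of \<zeta>.\<close>

lemma E_factor_eq:
  "(1 + (m\<^sup>2 * (n / m))\<^sup>2) / (2 * m\<^sup>2 * (n / m)) = (1 + (m * n)\<^sup>2) / (2 * (m * n))"
  "((n / m)\<^sup>2 + (n\<^sup>2)\<^sup>2) / (2 * n\<^sup>2 * (n / m)) = (1 + (m * n)\<^sup>2) / (2 * (m * n))"
  "(e * (n / m) + m * n * (1 + (n / m)\<^sup>2)) / (2 * m * n * (n / m)) = (1 + (m * n)\<^sup>2) / (2 * (m * n))"
proof -
  have "m\<^sup>2 * (n / m) = m * n" "2 * m\<^sup>2 * (n / m) = 2 * (m * n)" using m0 by (simp_all add: power2_eq_square)
  then show "(1 + (m\<^sup>2 * (n / m))\<^sup>2) / (2 * m\<^sup>2 * (n / m)) = (1 + (m * n)\<^sup>2) / (2 * (m * n))" by (simp only:)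
  have c: "k * x / (k * y) = x / y" if "k \<noteq> 0" for k x y :: real using that by simp
  have k: "n\<^sup>2 / m\<^sup>2 \<noteq> 0" "n / m \<noteq> 0" using m0 n0 by auto
  have "(n / m)\<^sup>2 + (n\<^sup>2)\<^sup>2 = n\<^sup>2 / m\<^sup>2 * (1 + (m * n)\<^sup>2)" "2 * n\<^sup>2 * (n / m) = n\<^sup>2 / m\<^sup>2 * (2 * (m * n))"
    using m0 n0 by (simp_all add: field_simps power2_eq_square)
  then show "((n / m)\<^sup>2 + (n\<^sup>2)\<^sup>2) / (2 * n\<^sup>2 * (n / m)) = (1 + (m * n)\<^sup>2) / (2 * (m * n))"
    by (simp only: c[OF k(1)])
  have "e * (n / m) + m * n * (1 + (n / m)\<^sup>2) = n / m * (1 + (m * n)\<^sup>2)" "2 * m * n * (n / m) = n / m * (2 * (m * n))"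
    unfolding e_def using m0 n0 by (simp_all add: field_simps power2_eq_square)
  then show "(e * (n / m) + m * n * (1 + (n / m)\<^sup>2)) / (2 * m * n * (n / m)) = (1 + (m * n)\<^sup>2) / (2 * (m * n))"
    by (simp only: c[OF k(2)])
qed

text \<open>The logarithms of 2 and r cancel because the weights P + Q, - P, - Q sum to 0; those of
  m and n leave exactly the term with P - Q.\<close>

lemma ln_coeff:
  assumes r: "0 < r" and X: "0 < X" "0 < Y" "0 < Z"
  shows "(P + Q) * ln (2 * m * n * r * Z) + (P - Q) * (ln m - ln n) - P * ln (2 * m\<^sup>2 * r * X) - Q * ln (2 * n\<^sup>2 * r * Y) =
    (P + Q) * ln Z - P * ln X - Q * ln Y"
proof -
  have 1: "ln (2 * m * n * r * Z) = ln 2 + ln m + ln n + ln r + ln Z"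
    "ln (2 * m\<^sup>2 * r * X) = ln 2 + 2 * ln m + ln r + ln X" "ln (2 * n\<^sup>2 * r * Y) = ln 2 + 2 * ln n + ln r + ln Y"
    using r X m0 n0 by (simp_all add: ln_mult_pos ln_realpow)
  show ?thesis unfolding 1 by (simp add: algebra_simps)
qed

text \<open>E1 and E2 are the squared moduli of 1 + m^2 * \<zeta> and \<zeta> + n^2, and E3 is e * r
  * (1 + \<bar>z\<bar>^2), in terms of the modulus r of \<zeta> and the cosine C of its argument.
  Positivity of E2 excludes \<zeta> = - n^2, the position of the two charges.\<close>

lemma obstacle:
  fixes r C :: real
  assumes r: "0 < r" "r \<le> 1" and C: "\<bar>C\<bar> \<le> 1"
  defines "E1 \<equiv> 1 + (m\<^sup>2 * r)\<^sup>2 + 2 * m\<^sup>2 * r * C" and "E2 \<equiv> r\<^sup>2 + (n\<^sup>2)\<^sup>2 + 2 * n\<^sup>2 * r * C"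
    and "E3 \<equiv> e * r + m * n * (1 + r\<^sup>2 + 2 * r * C)"
  assumes E2: "0 < E2"
  shows "P * ln E1 + Q * ln E2 \<le> (P + Q) * ln E3 + (P - Q) * (ln m - ln n)"
    "r = n / m \<Longrightarrow> P * ln E1 + Q * ln E2 = (P + Q) * ln E3 + (P - Q) * (ln m - ln n)"
    "0 < E1" "0 < E3"
proof -
  note f = E_factor[OF r(1)]
  define \<alpha>1 \<alpha>2 \<alpha>3 where "\<alpha>1 = (1 + (m\<^sup>2 * r)\<^sup>2) / (2 * m\<^sup>2 * r)" and "\<alpha>2 = (r\<^sup>2 + (n\<^sup>2)\<^sup>2) / (2 * n\<^sup>2 * r)"
    and "\<alpha>3 = (e * r + m * n * (1 + r\<^sup>2)) / (2 * m * n * r)"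
  note f = f[folded \<alpha>1_def \<alpha>2_def \<alpha>3_def]
  have k: "0 < 2 * m\<^sup>2 * r" "0 < 2 * n\<^sup>2 * r" "0 < 2 * m * n * r" using r m0 n0 by auto
  have C1: "0 \<le> 1 + C" "0 \<le> 1 - C" using C by (auto simp: abs_le_iff)
  have "m\<^sup>2 * r < 1 * 1" using m2 r m0 by (intro mult_less_le_imp_less) auto
  then have "0 < (1 - m\<^sup>2 * r)\<^sup>2" by simp
  moreover have "0 \<le> 2 * m\<^sup>2 * r * (1 + C)" using k(1) C1 by simp
  ultimately show p1: "0 < E1" unfolding E1_def by (simp add: power2_diff algebra_simps)
  have "0 \<le> (1 - r)\<^sup>2" "0 \<le> 2 * r * (1 + C)" using C1 r by auto
  then have "0 \<le> 1 + r\<^sup>2 + 2 * r * C" by (simp add: power2_diff algebra_simps)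
  moreover have "0 < e * r" using pos r by simp
  ultimately show p3: "0 < E3" unfolding E3_def using m0 n0 by (intro add_pos_nonneg mult_nonneg_nonneg) auto
  have X: "0 < \<alpha>1 + C" "0 < \<alpha>2 + C" "0 < \<alpha>3 + C"
    using p1 p3 E2 unfolding E1_def E2_def E3_def f
    by (blast intro: zero_less_mult_pos[OF _ k(1)] zero_less_mult_pos[OF _ k(2)] zero_less_mult_pos[OF _ k(3)])+
  have L: "(P + Q) * ln E3 + (P - Q) * (ln m - ln n) - P * ln E1 - Q * ln E2 =
      (P + Q) * ln (\<alpha>3 + C) - P * ln (\<alpha>1 + C) - Q * ln (\<alpha>2 + C)"
    unfolding E1_def E2_def E3_def f by (rule ln_coeff[OF r(1) X])
  have eq0: "\<alpha>1 = \<alpha>3 \<and> \<alpha>2 = \<alpha>3" if "r = n / m"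
    unfolding \<alpha>1_def \<alpha>2_def \<alpha>3_def that using E_factor_eq by auto
  show "P * ln E1 + Q * ln E2 = (P + Q) * ln E3 + (P - Q) * (ln m - ln n)" if "r = n / m"
    using L eq0[OF that] by (simp add: algebra_simps)
  \<comment> \<open>Superadditivity reduces the inequality to \<open>C = 1\<close>, that is, to positive real \<open>\<zeta>\<close>.\<close>
  have "P * ln (\<alpha>1 + C) + Q * ln (\<alpha>2 + C) \<le> (P + Q) * ln (\<alpha>3 + C)"
  proof (rule weighted_geometric_mean_superadditive[where d = "1 - C"])
    define L1 where "L1 r = (P + Q) * ln (e * r + m * n * (1 + r)\<^sup>2) - P * ln ((1 + m\<^sup>2 * r)\<^sup>2) - Q * ln ((r + n\<^sup>2)\<^sup>2)" for r
    have FL: "L1 v = F v" if "0 < v" for v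
      unfolding L1_def F_def using that m0 n0 by (simp add: ln_realpow add_pos_pos)
    have sq: "1 + (m\<^sup>2 * v)\<^sup>2 + 2 * m\<^sup>2 * v * 1 = (1 + m\<^sup>2 * v)\<^sup>2" "v\<^sup>2 + (n\<^sup>2)\<^sup>2 + 2 * n\<^sup>2 * v * 1 = (v + n\<^sup>2)\<^sup>2"
      "1 + v\<^sup>2 + 2 * v * 1 = (1 + v)\<^sup>2" for v
      by (simp_all add: power2_sum)
    define A1 A2 A3 where "A1 v = (1 + (m\<^sup>2 * v)\<^sup>2) / (2 * m\<^sup>2 * v)" and "A2 v = (v\<^sup>2 + (n\<^sup>2)\<^sup>2) / (2 * n\<^sup>2 * v)"
      and "A3 v = (e * v + m * n * (1 + v\<^sup>2)) / (2 * m * n * v)" for v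
    have FA: "F v + (P - Q) * (ln m - ln n) = (P + Q) * ln (A3 v + 1) - P * ln (A1 v + 1) - Q * ln (A2 v + 1)" if v: "0 < v" for v
    proof -
      note fv = E_factor[OF v, folded A1_def A2_def A3_def, of 1, unfolded sq]
      have "0 < A1 v + 1" "0 < A2 v + 1" "0 < A3 v + 1"
        unfolding A1_def A2_def A3_def using v m0 n0 pos by (auto intro!: add_nonneg_pos divide_nonneg_pos add_nonneg_nonneg)
      from ln_coeff[OF v this] show ?thesis unfolding FL[OF v, symmetric] L1_def fv by simp
    qed
    have r0: "0 < n / m" using n0 m0 by simp
    have "A1 (n / m) = A3 (n / m)" "A2 (n / m) = A3 (n / m)"
      using E_factor_eq unfolding A1_def A2_def A3_def by auto
    then have "F (n / m) + (P - Q) * (ln m - ln n) = 0" unfolding FA[OF r0] by (simp add: algebra_simps)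
    then have "0 \<le> F r + (P - Q) * (ln m - ln n)" using F_min[OF r] by simp
    then have "P * ln (A1 r + 1) + Q * ln (A2 r + 1) \<le> (P + Q) * ln (A3 r + 1)" unfolding FA[OF r(1)] by simp
    then show "P * ln (\<alpha>1 + C + (1 - C)) + Q * ln (\<alpha>2 + C + (1 - C)) \<le> (P + Q) * ln (\<alpha>3 + C + (1 - C))"
      by (simp add: A1_def A2_def A3_def \<alpha>1_def \<alpha>2_def \<alpha>3_def)
  qed (use X C1 pos in auto)
  then show "P * ln E1 + Q * ln E2 \<le> (P + Q) * ln E3 + (P - Q) * (ln m - ln n)" using L by simp
qed

end

section \<open>The plane as the sphere without its north pole\<close>

definition plane_to_sphere :: "complex \<Rightarrow> real ^ 3" where
  "plane_to_sphere z = vec3 (2 * Re z / (1 + (norm z)\<^sup>2)) (2 * Im z / (1 + (norm z)\<^sup>2)) (((norm z)\<^sup>2 - 1) / (1 + (norm z)\<^sup>2))"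

lemma plane_to_sphere_of_real: "plane_to_sphere (of_real x) = line_to_sphere x"
  unfolding vec3_eq_iff plane_to_sphere_def vec3_nth line_to_sphere_nth by simp

lemma plane_to_sphere_cap_pole: "plane_to_sphere (\<i> * of_real b) = cap_pole b"
  unfolding vec3_eq_iff plane_to_sphere_def vec3_nth cap_pole_def by (simp add: norm_mult)

lemma plane_to_sphere_inner:
  "1 - plane_to_sphere z \<bullet> plane_to_sphere z' = 2 * (norm (z - z'))\<^sup>2 / ((1 + (norm z)\<^sup>2) * (1 + (norm z')\<^sup>2))"
proof -
  define Z Z' where "Z = 1 + (norm z)\<^sup>2" and "Z' = 1 + (norm z')\<^sup>2"
  have p: "Z \<noteq> 0" "Z' \<noteq> 0" by (simp_all add: Z_def Z'_def)
  have e: "(norm z)\<^sup>2 - 1 = Z - 2" "(norm z')\<^sup>2 - 1 = Z' - 2" by (simp_all add: Z_def Z'_def)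
  have "plane_to_sphere z \<bullet> plane_to_sphere z' = (4 * Re z * Re z' + 4 * Im z * Im z' + (Z - 2) * (Z' - 2)) / (Z * Z')"
    unfolding plane_to_sphere_def inner_3 vec3_nth e Z_def[symmetric] Z'_def[symmetric]
    by (simp add: add_divide_distrib)
  also have "1 - \<dots> = (Z * Z' - (4 * Re z * Re z' + 4 * Im z * Im z' + (Z - 2) * (Z' - 2))) / (Z * Z')"
    using p by (simp add: diff_divide_distrib)
  also have "Z * Z' - (4 * Re z * Re z' + 4 * Im z * Im z' + (Z - 2) * (Z' - 2)) = 2 * (norm (z - z'))\<^sup>2"
    unfolding Z_def Z'_def cmod_power2 minus_complex.sel by (simp add: power2_eq_square algebra_simps)
  finally show ?thesis unfolding Z_def Z'_def .
qed

lemma plane_to_sphere_S2: "plane_to_sphere z \<in> S2"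
  using plane_to_sphere_inner[of z z] by (simp add: norm_eq_1)

lemma plane_to_sphere_nth3: "1 - plane_to_sphere z $ 3 = 2 / (1 + (norm z)\<^sup>2)"
  unfolding plane_to_sphere_def vec3_nth by (simp add: field_simps)

lemma sphere_cases:
  assumes x: "x \<in> S2" "x \<noteq> vec3 0 0 1"
  obtains z where "x = plane_to_sphere z"
proof -
  define d where "d = 1 - x $ 3"
  have S: "(x $ 1)\<^sup>2 + (x $ 2)\<^sup>2 = d * (2 - d)"
    using x(1) unfolding mem_S2_iff d_def by (simp add: power2_eq_square algebra_simps)
  have d: "d \<noteq> 0"
  proof
    assume "d = 0"
    then have "(x $ 1)\<^sup>2 + (x $ 2)\<^sup>2 = 0" "x $ 3 = 1" using S by (simp_all add: d_def)
    then show False using x(2) by (simp add: vec3_eq_iff sum_power2_eq_zero_iff)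
  qed
  define z where "z = Complex (x $ 1 / d) (x $ 2 / d)"
  have "(norm z)\<^sup>2 = ((x $ 1)\<^sup>2 + (x $ 2)\<^sup>2) / d\<^sup>2"
    by (simp add: z_def cmod_power2 power_divide add_divide_distrib)
  also have "\<dots> = 2 / d - 1" unfolding S using d by (simp add: power2_eq_square diff_divide_distrib)
  finally have n: "(norm z)\<^sup>2 = 2 / d - 1" .
  have "(2 / d - 1 - 1) / (2 / d) = 1 - d" using d by (simp add: field_simps)
  then have "x = plane_to_sphere z"
    unfolding vec3_eq_iff plane_to_sphere_def vec3_nth n using d by (simp add: z_def) (simp add: d_def)
  then show thesis by (rule that)
qed

lemma skern_plane:
  assumes "z \<noteq> z'"
  shows "skern (plane_to_sphere z) (plane_to_sphere z') =
    (ln (1 + (norm z)\<^sup>2) + ln (1 + (norm z')\<^sup>2) - ln 2) / 2 - ln (norm (z - z'))"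
proof -
  have p: "0 < 1 + (norm z)\<^sup>2" "0 < 1 + (norm z')\<^sup>2" "0 < norm (z - z')" using assms by simp_all
  have "ln (2 * (norm (z - z'))\<^sup>2 / ((1 + (norm z)\<^sup>2) * (1 + (norm z')\<^sup>2))) =
      ln (2 * (norm (z - z'))\<^sup>2) - ln ((1 + (norm z)\<^sup>2) * (1 + (norm z')\<^sup>2))"
    using p by (subst ln_div) auto
  also have "\<dots> = ln 2 + 2 * ln (norm (z - z')) - (ln (1 + (norm z)\<^sup>2) + ln (1 + (norm z')\<^sup>2))"
    using p ln_realpow[of "norm (z - z')" 2] by (subst ln_mult_pos, simp, simp, subst ln_mult_pos) simp_all
  finally show ?thesis unfolding skern_def plane_to_sphere_inner by simp
qed

text \<open>This symmetry pairs the parameters of opposite points s t and - s t of the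
  interval.\<close>

lemma circ_reflect: "distr circ borel (\<lambda>t. 2 * pi - t) = circ"
proof (rule measure_eqI)
  fix A assume "A \<in> sets (distr circ borel (\<lambda>t. 2 * pi - t))"
  then have A[measurable]: "A \<in> sets borel" by simp
  define T where "T t = 2 * pi - t" for t :: real
  have T[measurable]: "T \<in> borel_measurable borel" unfolding T_def by measurable
  have L: "distr lborel borel T = lborel"
    using lborel_real_affine[of "- 1" "2 * pi"] by (simp add: T_def[abs_def] density_1)
  have "emeasure (distr circ borel T) A = emeasure circ (T -` A)" by (subst emeasure_distr) auto
  also have "T -` A \<in> sets lborel" using measurable_sets[OF T A] by simp
  then have "emeasure circ (T -` A) = emeasure lborel ({0..2 * pi} \<inter> T -` A) / emeasure lborel {0..2 * pi}"
    unfolding circ_def by (subst emeasure_uniform_measure) auto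
  also have "{0..2 * pi} \<inter> T -` A = T -` ({0..2 * pi} \<inter> A)" by (auto simp: T_def)
  also have "emeasure lborel (T -` ({0..2 * pi} \<inter> A)) = emeasure (distr lborel borel T) ({0..2 * pi} \<inter> A)"
    by (subst emeasure_distr) auto
  also have "\<dots> / emeasure lborel {0..2 * pi} = emeasure circ A"
    unfolding L circ_def by (subst emeasure_uniform_measure) auto
  finally show "emeasure (distr circ borel (\<lambda>t. 2 * pi - t)) A = emeasure circ A" unfolding T_def .
qed simp

lemma circ_integral_reflect:
  fixes f :: "real \<Rightarrow> real"
  assumes [measurable]: "f \<in> borel_measurable borel" and i: "integrable circ f"
  shows "integrable circ (\<lambda>t. f (2 * pi - t))" "(\<integral>t. f (2 * pi - t) \<partial>circ) = (\<integral>t. f t \<partial>circ)"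
proof -
  have "integrable (distr circ borel (\<lambda>t. 2 * pi - t)) f" unfolding circ_reflect by (rule i)
  then show "integrable circ (\<lambda>t. f (2 * pi - t))" by (subst (asm) integrable_distr_eq) auto
  have "(\<integral>t. f t \<partial>distr circ borel (\<lambda>t. 2 * pi - t)) = (\<integral>t. f (2 * pi - t) \<partial>circ)"
    by (rule integral_distr) auto
  then show "(\<integral>t. f (2 * pi - t) \<partial>circ) = (\<integral>t. f t \<partial>circ)" unfolding circ_reflect by simp
qed

text \<open>After division by \<zeta> the equation prescribes \<zeta> + 1 / \<zeta>; its two roots
  are inverse to each other, so one of them lies in the closed disc.\<close>

lemma joukowski_inverse:
  fixes v :: complex and g :: real
  assumes g: "0 < g"
  obtains \<zeta> where "\<zeta> \<noteq> 0" "norm \<zeta> \<le> 1" "v * \<zeta> = of_real g * (1 + \<zeta>)\<^sup>2"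
proof -
  define k where "k = (v - 2 * of_real g) / (2 * of_real g)"
  have v: "v = of_real g * (2 * k + 2)" using g by (simp add: k_def field_simps)
  define \<xi> where "\<xi> = k + csqrt (k\<^sup>2 - 1)"
  have "(\<xi> - k)\<^sup>2 = k\<^sup>2 - 1" by (simp add: \<xi>_def)
  then have x: "\<xi>\<^sup>2 + 1 = 2 * k * \<xi>" by (simp add: power2_eq_square algebra_simps)
  have x0: "\<xi> \<noteq> 0" using x by auto
  have sol: "v * \<zeta> = of_real g * (1 + \<zeta>)\<^sup>2" if "\<zeta>\<^sup>2 + 1 = 2 * k * \<zeta>" for \<zeta>
  proof -
    have "of_real g * (1 + \<zeta>)\<^sup>2 = of_real g * ((\<zeta>\<^sup>2 + 1) + 2 * \<zeta>)" by (simp add: power2_eq_square algebra_simps)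
    then show ?thesis unfolding that v by (simp add: algebra_simps)
  qed
  show thesis
  proof (cases "norm \<xi> \<le> 1")
    case True
    then show thesis using that[OF x0 _ sol[OF x]] by simp
  next
    case False
    have "(1 / \<xi>)\<^sup>2 + 1 = (\<xi>\<^sup>2 + 1) / \<xi>\<^sup>2" using x0 by (simp add: power_divide add_divide_distrib)
    also have "\<dots> = 2 * k * (1 / \<xi>)" unfolding x using x0 by (simp add: power2_eq_square)
    finally have "(1 / \<xi>)\<^sup>2 + 1 = 2 * k * (1 / \<xi>)" .
    from that[OF _ _ sol[OF this]] False x0 show thesis by (simp add: norm_divide divide_le_eq_1)
  qed
qed

section \<open>The equilibrium measure on an interval and its potential\<close>

context ellipse
begin

definition "a = Q / (2 * (m\<^sup>2 - n\<^sup>2))"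
definition "g = m * n / e"
definition "b = sqrt (m * (1 - n\<^sup>2) / (n * (1 - m\<^sup>2)))"
text \<open>The values run through the interval with end points \<plusminus> 2 * sqrt g, and (s t)^2
  * \<zeta> = g * (1 + \<zeta>)^2 at \<zeta> = cis t: the support corresponds to the unit circle of
  the coordinate.\<close>

definition "s t = 2 * sqrt g * cos (t / 2)" for t :: real
definition "w t = (1 + a) * poiss (m\<^sup>2) t - a * poiss (n\<^sup>2) t"
definition "u x = (\<integral>t. w t * skern x (line_to_sphere (s t)) \<partial>circ)"

lemma a1: "1 + a = P / (2 * (m\<^sup>2 - n\<^sup>2))" and a0: "0 < a" and g0: "0 < g" and b2: "b\<^sup>2 = m * (1 - n\<^sup>2) / (n * (1 - m\<^sup>2))"
  and b0: "0 < b"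
proof -
  have "P = Q + 2 * (m\<^sup>2 - n\<^sup>2)" using PQ by simp
  then show "1 + a = P / (2 * (m\<^sup>2 - n\<^sup>2))" using nm2 by (simp add: a_def add_divide_distrib)
  show "0 < a" "0 < g" unfolding a_def g_def using nm2 pos m0 n0 by simp_all
  have p: "0 < m * (1 - n\<^sup>2) / (n * (1 - m\<^sup>2))" using m0 n0 n2 m2 by simp
  then show "b\<^sup>2 = m * (1 - n\<^sup>2) / (n * (1 - m\<^sup>2))" "0 < b" by (simp_all add: b_def)
qed

lemma mn_abs: "\<bar>m\<^sup>2\<bar> < 1" "\<bar>n\<^sup>2\<bar> < 1"
  using m2 n2 by auto

text \<open>The choice of a makes the numerator a multiple of 1 - X. For X = cos t this gives a
  nonnegative density vanishing at the parameters of the end points of the interval; for X \<ge> 1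
  it gives the opposite sign, which controls the potential beyond the end points.\<close>

lemma weight_identity:
  assumes "1 + (m\<^sup>2)\<^sup>2 + 2 * m\<^sup>2 * X \<noteq> 0" "1 + (n\<^sup>2)\<^sup>2 + 2 * n\<^sup>2 * X \<noteq> 0"
  shows "(1 + a) * ((1 - (m\<^sup>2)\<^sup>2) / (1 + (m\<^sup>2)\<^sup>2 + 2 * m\<^sup>2 * X)) - a * ((1 - (n\<^sup>2)\<^sup>2) / (1 + (n\<^sup>2)\<^sup>2 + 2 * n\<^sup>2 * X)) =
    e * (1 - m\<^sup>2 * n\<^sup>2) * (1 - X) / ((1 + (m\<^sup>2)\<^sup>2 + 2 * m\<^sup>2 * X) * (1 + (n\<^sup>2)\<^sup>2 + 2 * n\<^sup>2 * X))"
proof -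
  define D1 D2 \<Delta> where "D1 = 1 + (m\<^sup>2)\<^sup>2 + 2 * m\<^sup>2 * X" and "D2 = 1 + (n\<^sup>2)\<^sup>2 + 2 * n\<^sup>2 * X" and "\<Delta> = 2 * (m\<^sup>2 - n\<^sup>2)"
  have nz: "D1 \<noteq> 0" "D2 \<noteq> 0" "\<Delta> \<noteq> 0" using assms nm2 by (auto simp: D1_def D2_def \<Delta>_def)
  have "P / \<Delta> * ((1 - (m\<^sup>2)\<^sup>2) / D1) - Q / \<Delta> * ((1 - (n\<^sup>2)\<^sup>2) / D2) = (P * (1 - (m\<^sup>2)\<^sup>2) * D2 - Q * (1 - (n\<^sup>2)\<^sup>2) * D1) / (\<Delta> * (D1 * D2))"
  proof -
    have "p / \<Delta> * (A / D1) - q / \<Delta> * (B / D2) = (p * A * D2 - q * B * D1) / (\<Delta> * (D1 * D2))" for p q A B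
      using nz by (simp add: diff_divide_distrib)
    then show ?thesis .
  qed
  also have "P * (1 - (m\<^sup>2)\<^sup>2) * D2 - Q * (1 - (n\<^sup>2)\<^sup>2) * D1 = \<Delta> * (e * (1 - m\<^sup>2 * n\<^sup>2) * (1 - X))"
    unfolding P_def Q_def D1_def D2_def \<Delta>_def e_def by algebra
  also have "\<dots> / (\<Delta> * (D1 * D2)) = e * (1 - m\<^sup>2 * n\<^sup>2) * (1 - X) / (D1 * D2)" using nz by simp
  finally show ?thesis unfolding a1 unfolding a_def D1_def D2_def \<Delta>_def .
qed

lemma w_nonneg: "0 \<le> w t"
proof -
  note p = poiss_denom(2)[OF mn_abs(1), of t] poiss_denom(2)[OF mn_abs(2), of t]
  have "w t = e * (1 - m\<^sup>2 * n\<^sup>2) * (1 - cos t) / ((1 + (m\<^sup>2)\<^sup>2 + 2 * m\<^sup>2 * cos t) * (1 + (n\<^sup>2)\<^sup>2 + 2 * n\<^sup>2 * cos t))"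
    unfolding w_def poiss_def by (rule weight_identity) (use p in auto)
  moreover have "0 \<le> e * (1 - m\<^sup>2 * n\<^sup>2) * (1 - cos t)" using pos by (intro mult_nonneg_nonneg) auto
  ultimately show ?thesis using p by simp
qed

lemma w_continuous: "continuous_on UNIV w"
  unfolding w_def by (intro continuous_intros continuous_poiss mn_abs)

lemma s_continuous: "continuous_on UNIV s"
  unfolding s_def by (intro continuous_intros) auto

lemma ws_measurable [measurable]: "w \<in> borel_measurable borel" "s \<in> borel_measurable borel"
  by (fact borel_measurable_continuous_onI[OF w_continuous] borel_measurable_continuous_onI[OF s_continuous])+

lemma w_integral: "integrable circ w" "(\<integral>t. w t \<partial>circ) = 1"
  using poiss_integral[OF mn_abs(1)] poiss_integral[OF mn_abs(2)] by (simp_all add: w_def[abs_def])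

lemma s_square: "(s t)\<^sup>2 = g * (2 + 2 * cos t)"
proof -
  have c: "2 + 2 * cos t = 4 * (cos (t / 2))\<^sup>2" using cos_double_cos[of "t / 2"] by simp
  show ?thesis unfolding c s_def using g0 by (simp add: power_mult_distrib)
qed

lemma s_reflect: "s (2 * pi - t) = - s t" "w (2 * pi - t) = w t"
  by (simp_all add: s_def w_def poiss_even diff_divide_distrib cos_diff)

definition "c1 = (\<integral>t. w t * ln (1 + (s t)\<^sup>2) \<partial>circ)"

lemma c1_integrable: "integrable circ (\<lambda>t. w t * ln (1 + (s t)\<^sup>2))"
proof (rule circ_integral_continuous(1))
  have "1 + (s t)\<^sup>2 \<noteq> 0" for t by simp
  then show "continuous_on UNIV (\<lambda>t. w t * ln (1 + (s t)\<^sup>2))"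
    by (intro continuous_intros w_continuous s_continuous) auto
qed

text \<open>Since (s t)^2 and z^2 arise from the same map, their difference vanishes exactly when
  \<zeta> is cis t or its conjugate, and it factors accordingly.\<close>

lemma joukowski_norm:
  assumes z: "z\<^sup>2 * \<zeta> = of_real g * (1 + \<zeta>)\<^sup>2"
  shows "norm \<zeta> * (norm (z - of_real (s t)) * norm (z - of_real (- s t))) = g * (norm (cis t - \<zeta>) * norm (cis t - cnj \<zeta>))"
proof -
  have E0: "(z - of_real (s t)) * (z - of_real (- s t)) = z\<^sup>2 - of_real ((s t)\<^sup>2)" by (simp add: power2_eq_square algebra_simps)
  have "\<zeta> * ((z - of_real (s t)) * (z - of_real (- s t))) = of_real g * (1 + \<zeta>)\<^sup>2 - \<zeta> * of_real (g * (2 + 2 * cos t))"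
    unfolding E0 s_square z[symmetric] by (simp add: algebra_simps)
  also have "\<dots> = of_real g * ((cis t - \<zeta>) * (cis (- t) - \<zeta>))"
  proof -
    have c: "cis t * cis (- t) = 1" by (simp add: cis_mult)
    have c2: "cis t + cis (- t) = of_real (2 * cos t)" by (simp add: complex_eq_iff)
    have "(cis t - \<zeta>) * (cis (- t) - \<zeta>) = cis t * cis (- t) - (cis t + cis (- t)) * \<zeta> + \<zeta>\<^sup>2"
      by (simp add: power2_eq_square algebra_simps)
    also have "\<dots> = 1 - of_real (2 * cos t) * \<zeta> + \<zeta>\<^sup>2" unfolding c c2 ..
    finally have F: "(cis t - \<zeta>) * (cis (- t) - \<zeta>) = 1 - of_real (2 * cos t) * \<zeta> + \<zeta>\<^sup>2" .
    show ?thesis unfolding F by (simp add: power2_eq_square algebra_simps)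
  qed
  finally have E: "\<zeta> * ((z - of_real (s t)) * (z - of_real (- s t))) = of_real g * ((cis t - \<zeta>) * (cis (- t) - \<zeta>))" .
  have "norm (\<zeta> * ((z - of_real (s t)) * (z - of_real (- s t)))) = norm (of_real g * ((cis t - \<zeta>) * (cis (- t) - \<zeta>)))"
    by (simp only: E)
  then have "norm \<zeta> * (norm (z - of_real (s t)) * norm (z - of_real (- s t))) = g * (norm (cis t - \<zeta>) * norm (cis (- t) - \<zeta>))"
    unfolding norm_mult norm_of_real abs_of_pos[OF g0] .
  moreover have "cis (- t) - \<zeta> = cnj (cis t - cnj \<zeta>)" by (simp add: cis_cnj)
  ultimately show ?thesis by (simp only: complex_mod_cnj)
qed

text \<open>The coordinate controls only the product of the distances from z to s t and to - s t. So
  the closed formula is for the sum of the integrand at t and at 2 * pi - t, and reflection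
  invariance halves its integral.\<close>

lemma potential_plane:
  assumes \<zeta>: "\<zeta> \<noteq> 0" "norm \<zeta> \<le> 1" and z: "z\<^sup>2 * \<zeta> = of_real g * (1 + \<zeta>)\<^sup>2"
  shows "AE t in circ. plane_to_sphere z \<noteq> line_to_sphere (s t)"
    "integrable circ (\<lambda>t. w t * skern (plane_to_sphere z) (line_to_sphere (s t)))"
    "u (plane_to_sphere z) = (c1 - ln 2 - ln g + ln (1 + (norm z)\<^sup>2) + ln (norm \<zeta>)) / 2 -
       (1 + a) * ln (norm (1 + of_real (m\<^sup>2) * \<zeta>)) + a * ln (norm (1 + of_real (n\<^sup>2) * \<zeta>))"
proof -
  have \<zeta>': "norm (cnj \<zeta>) \<le> 1" using \<zeta> by simp
  note L = log_poisson[OF \<zeta>(2) mn_abs(1)] log_poisson[OF \<zeta>(2) mn_abs(2)] log_poisson[OF \<zeta>' mn_abs(1)] log_poisson[OF \<zeta>' mn_abs(2)]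
  have nc: "norm (1 + of_real q * cnj \<zeta>) = norm (1 + of_real q * \<zeta>)" for q
  proof -
    have "1 + of_real q * cnj \<zeta> = cnj (1 + of_real q * \<zeta>)" by simp
    then show ?thesis by (simp only: complex_mod_cnj)
  qed
  note L = L[unfolded nc]
  define \<Lambda> where "\<Lambda> = (1 + a) * ln (norm (1 + of_real (m\<^sup>2) * \<zeta>)) - a * ln (norm (1 + of_real (n\<^sup>2) * \<zeta>))"
  have wl: "integrable circ (\<lambda>t. w t * ln (norm (cis t - \<zeta>)))" "(\<integral>t. w t * ln (norm (cis t - \<zeta>)) \<partial>circ) = \<Lambda>"
    "integrable circ (\<lambda>t. w t * ln (norm (cis t - cnj \<zeta>)))" "(\<integral>t. w t * ln (norm (cis t - cnj \<zeta>)) \<partial>circ) = \<Lambda>"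
    using L unfolding w_def left_diff_distrib mult.assoc \<Lambda>_def by simp_all
  define \<Phi> where "\<Phi> t = (ln (1 + (norm z)\<^sup>2) - ln 2 - ln g + ln (norm \<zeta>)) * w t + w t * ln (1 + (s t)\<^sup>2)
      - w t * ln (norm (cis t - \<zeta>)) - w t * ln (norm (cis t - cnj \<zeta>))" for t
  have \<Phi>: "integrable circ \<Phi>" "(\<integral>t. \<Phi> t \<partial>circ) = (ln (1 + (norm z)\<^sup>2) - ln 2 - ln g + ln (norm \<zeta>)) + c1 - \<Lambda> - \<Lambda>"
    unfolding \<Phi>_def[abs_def] using wl w_integral c1_integrable by (simp_all add: c1_def)
  define f where "f t = w t * skern (plane_to_sphere z) (line_to_sphere (s t))" for t
  have f_meas[measurable]: "f \<in> borel_measurable borel" unfolding f_def[abs_def] skern_def by measurable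
  have nz: "AE t in circ. cis t \<noteq> \<zeta> \<and> cis t \<noteq> cnj \<zeta>"
    using L(1) L(7) by eventually_elim simp
  have zs: "z \<noteq> of_real (s t) \<and> z \<noteq> of_real (- s t)" if t: "cis t \<noteq> \<zeta> \<and> cis t \<noteq> cnj \<zeta>" for t
  proof -
    have "g * (norm (cis t - \<zeta>) * norm (cis t - cnj \<zeta>)) \<noteq> 0" using t g0 by simp
    then show ?thesis unfolding joukowski_norm[OF z, symmetric] by auto
  qed
  have sum: "f t + f (2 * pi - t) = \<Phi> t" if t: "cis t \<noteq> \<zeta> \<and> cis t \<noteq> cnj \<zeta>" for t
  proof -
    note zt = zs[OF t]
    have l3: "ln (A * (B * C)) = ln A + (ln B + ln C)" if "0 < A" "0 < B" "0 < C" for A B C :: real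
      using that by (simp add: ln_mult_pos)
    have pz: "0 < norm \<zeta>" "0 < norm (z - of_real (s t))" "0 < norm (z - of_real (- s t))"
      "0 < norm (cis t - \<zeta>)" "0 < norm (cis t - cnj \<zeta>)"
      using \<zeta>(1) zt t by (simp_all only: zero_less_norm_iff right_minus_eq not_False_eq_True)
    have "ln (norm \<zeta>) + (ln (norm (z - of_real (s t))) + ln (norm (z - of_real (- s t)))) =
        ln (norm \<zeta> * (norm (z - of_real (s t)) * norm (z - of_real (- s t))))"
      by (rule l3[OF pz(1-3), symmetric])
    also have "\<dots> = ln g + (ln (norm (cis t - \<zeta>)) + ln (norm (cis t - cnj \<zeta>)))"
      unfolding joukowski_norm[OF z] by (rule l3[OF g0 pz(4,5)])
    finally have l: "ln (norm (z - of_real (s t))) + ln (norm (z - of_real (- s t))) =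
        ln g - ln (norm \<zeta>) + (ln (norm (cis t - \<zeta>)) + ln (norm (cis t - cnj \<zeta>)))" by simp
    have k1: "skern (plane_to_sphere z) (line_to_sphere (s t)) = (ln (1 + (norm z)\<^sup>2) + ln (1 + (s t)\<^sup>2) - ln 2) / 2 - ln (norm (z - of_real (s t)))"
      unfolding plane_to_sphere_of_real[symmetric] by (subst skern_plane) (use zt in auto)
    have k2: "skern (plane_to_sphere z) (line_to_sphere (- s t)) = (ln (1 + (norm z)\<^sup>2) + ln (1 + (s t)\<^sup>2) - ln 2) / 2 - ln (norm (z - of_real (- s t)))"
      unfolding plane_to_sphere_of_real[symmetric] by (subst skern_plane) (use zt in auto)
    have "f t + f (2 * pi - t) = w t * (ln (1 + (norm z)\<^sup>2) + ln (1 + (s t)\<^sup>2) - ln 2 -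
        (ln (norm (z - of_real (s t))) + ln (norm (z - of_real (- s t)))))"
      unfolding f_def s_reflect k1 k2 by (simp add: algebra_simps)
    then show ?thesis unfolding l \<Phi>_def by (simp add: algebra_simps)
  qed
  show "AE t in circ. plane_to_sphere z \<noteq> line_to_sphere (s t)"
    using nz
  proof eventually_elim
    case (elim t)
    have "0 < (norm (z - of_real (s t)))\<^sup>2" using zs[OF elim] by simp
    moreover have "0 < (1 + (norm z)\<^sup>2) * (1 + (norm (of_real (s t) :: complex))\<^sup>2)" by (intro mult_pos_pos) (auto intro: add_pos_nonneg)
    ultimately have "0 < 1 - plane_to_sphere z \<bullet> line_to_sphere (s t)"
      unfolding plane_to_sphere_of_real[symmetric] plane_to_sphere_inner by simp
    then show ?case using plane_to_sphere_S2[of z] by (auto simp: norm_eq_1)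
  qed
  \<comment> \<open>Applied at the reflected parameter, this lower bound turns the formula for the
    sum into an integrable majorant of f alone.\<close>
  have lb: "- (w t * ln 2) \<le> f t" for t
  proof -
    have "0 \<le> ln (2 :: real)" by simp
    then have "w t * (- ln 2) \<le> w t * skern (plane_to_sphere z) (line_to_sphere (s t))"
      using skern_ge[OF plane_to_sphere_S2 line_to_sphere_S2, of z "s t"] w_nonneg[of t] by (intro mult_left_mono) linarith+
    then show ?thesis unfolding f_def by simp
  qed
  have fi: "integrable circ f"
  proof (rule Bochner_Integration.integrable_bound)
    show "integrable circ (\<lambda>t. \<bar>\<Phi> t\<bar> + w t * ln 2)" using \<Phi>(1) w_integral(1) by simp
    show "AE t in circ. norm (f t) \<le> norm (\<bar>\<Phi> t\<bar> + w t * ln 2)"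
      using nz
    proof eventually_elim
      case (elim t)
      have "0 \<le> w t * ln 2" using w_nonneg[of t] by simp
      moreover have "f t + f (2 * pi - t) \<le> \<bar>\<Phi> t\<bar>" using sum[OF elim] by simp
      moreover have "- (w t * ln 2) \<le> f (2 * pi - t)" using lb[of "2 * pi - t"] unfolding s_reflect .
      ultimately have "f t \<le> \<bar>\<Phi> t\<bar> + w t * ln 2" "- f t \<le> \<bar>\<Phi> t\<bar> + w t * ln 2"
        using lb[of t] by (linarith, linarith)
      then have "\<bar>f t\<bar> \<le> \<bar>\<Phi> t\<bar> + w t * ln 2" by (rule abs_leI)
      then show ?case unfolding real_norm_def by (rule order_trans[OF _ abs_ge_self])
    qed
  qed simp
  then show "integrable circ (\<lambda>t. w t * skern (plane_to_sphere z) (line_to_sphere (s t)))" by (simp add: f_def[abs_def])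
  have "2 * (\<integral>t. f t \<partial>circ) = (\<integral>t. f t + f (2 * pi - t) \<partial>circ)"
    using circ_integral_reflect[OF f_meas fi] fi by simp
  also have "\<dots> = (\<integral>t. \<Phi> t \<partial>circ)"
  proof (rule integral_cong_AE)
    show "AE t in circ. f t + f (2 * pi - t) = \<Phi> t" using nz by eventually_elim (rule sum)
    show "\<Phi> \<in> borel_measurable circ" using \<Phi>(1) by (rule borel_measurable_integrable)
  qed measurable
  finally have "2 * u (plane_to_sphere z) = (ln (1 + (norm z)\<^sup>2) - ln 2 - ln g + ln (norm \<zeta>)) + c1 - \<Lambda> - \<Lambda>"
    unfolding \<Phi>(2) u_def f_def .
  then show "u (plane_to_sphere z) = (c1 - ln 2 - ln g + ln (1 + (norm z)\<^sup>2) + ln (norm \<zeta>)) / 2 -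
       (1 + a) * ln (norm (1 + of_real (m\<^sup>2) * \<zeta>)) + a * ln (norm (1 + of_real (n\<^sup>2) * \<zeta>))"
    unfolding \<Lambda>_def by (simp add: field_simps)
qed

text \<open>The north pole has no coordinate \<zeta>, so only integrability is recorded here; the
  obstacle inequality reaches it by continuity.\<close>

lemma potential_pole:
  "AE t in circ. vec3 0 0 1 \<noteq> line_to_sphere (s t)" "integrable circ (\<lambda>t. w t * skern (vec3 0 0 1) (line_to_sphere (s t)))"
proof -
  have l: "1 - vec3 0 0 1 \<bullet> line_to_sphere v = 2 / (1 + v\<^sup>2)" for v
    unfolding inner_3 vec3_nth line_to_sphere_nth by (simp add: field_simps)
  have "vec3 0 0 1 \<noteq> line_to_sphere v" for v
  proof
    assume A: "vec3 0 0 1 = line_to_sphere v"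
    have "vec3 0 0 1 $ 3 = line_to_sphere v $ 3" by (simp only: A)
    then show False unfolding vec3_nth line_to_sphere_nth by (simp add: eq_divide_eq)
  qed
  then show "AE t in circ. vec3 0 0 1 \<noteq> line_to_sphere (s t)" by simp
  show "integrable circ (\<lambda>t. w t * skern (vec3 0 0 1) (line_to_sphere (s t)))"
    unfolding skern_def l
  proof (rule circ_integral_continuous(1))
    have "1 + (s t)\<^sup>2 \<noteq> 0" "2 / (1 + (s t)\<^sup>2) \<noteq> 0" for t by simp_all
    then show "continuous_on UNIV (\<lambda>t. w t * (- ln (2 / (1 + (s t)\<^sup>2)) / 2))"
      by (intro continuous_intros w_continuous s_continuous) auto
  qed
qed

sublocale cp: circle_pushforward w s u
proof
  show "0 \<le> w t" for t by (rule w_nonneg)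
  show "integrable circ w" "(\<integral>t. w t \<partial>circ) = 1" by (fact w_integral)+
  show "(\<integral>t. w t * skern x (line_to_sphere (s t)) \<partial>circ) = u x" if "x \<in> S2" for x by (simp add: u_def)
  fix x :: "real ^ 3" assume x: "x \<in> S2"
  have "(AE t in circ. x \<noteq> line_to_sphere (s t)) \<and> integrable circ (\<lambda>t. w t * skern x (line_to_sphere (s t)))"
  proof (cases "x = vec3 0 0 1")
    case True
    show ?thesis unfolding True by (intro conjI potential_pole)
  next
    case False
    obtain z where z: "x = plane_to_sphere z" by (rule sphere_cases[OF x False])
    obtain \<zeta> where "\<zeta> \<noteq> 0" "norm \<zeta> \<le> 1" "z\<^sup>2 * \<zeta> = of_real g * (1 + \<zeta>)\<^sup>2" by (rule joukowski_inverse[OF g0])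
    from potential_plane(1,2)[OF this] show ?thesis unfolding z by (rule conjI)
  qed
  then show "AE t in circ. x \<noteq> line_to_sphere (s t)" "integrable circ (\<lambda>t. w t * skern x (line_to_sphere (s t)))" by blast+
qed measurable

end

section \<open>The obstacle function, and the Frostman condition on the line\<close>

context ellipse
begin

lemma norm_one_plus: "(norm (1 + of_real q * \<zeta>))\<^sup>2 = 1 + (q * norm \<zeta>)\<^sup>2 + 2 * q * Re \<zeta>"
  and norm_plus: "(norm (\<zeta> + of_real q))\<^sup>2 = (norm \<zeta>)\<^sup>2 + q\<^sup>2 + 2 * q * Re \<zeta>"
  unfolding power_mult_distrib cmod_power2 by (simp_all add: power2_eq_square algebra_simps)

lemma eg: "e * g = m * n"
  using pos by (simp add: g_def)

lemma b2_g: "b\<^sup>2 = g / n\<^sup>2 * (1 - n\<^sup>2)\<^sup>2" "1 / b\<^sup>2 = g / m\<^sup>2 * (1 - m\<^sup>2)\<^sup>2"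
proof -
  define M N where "M = 1 - m\<^sup>2" and "N = 1 - n\<^sup>2"
  have nz: "M \<noteq> 0" "N \<noteq> 0" "m \<noteq> 0" "n \<noteq> 0" using m2 n2 m0 n0 by (auto simp: M_def N_def)
  show "b\<^sup>2 = g / n\<^sup>2 * (1 - n\<^sup>2)\<^sup>2" "1 / b\<^sup>2 = g / m\<^sup>2 * (1 - m\<^sup>2)\<^sup>2"
    unfolding b2 g_def e_def M_def[symmetric] N_def[symmetric] using nz by (simp_all add: power2_eq_square)
qed

text \<open>The value v = - k has the coordinates - q and - 1 / q, so v + k splits into these two
  factors. The shifts b^2 and 1 / b^2 of the external field belong to q = n^2 and q = m^2.\<close>

lemma joukowski_shift:
  fixes v \<zeta> :: complex
  assumes z: "v * \<zeta> = of_real g * (1 + \<zeta>)\<^sup>2" and q: "q \<noteq> 0" and k: "k = g / q * (1 - q)\<^sup>2"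
  shows "(v + of_real k) * \<zeta> = of_real (g / q) * ((\<zeta> + of_real q) * (1 + of_real q * \<zeta>))"
proof -
  have 1: "g = g / q * q" using q by simp
  have "(v + of_real k) * \<zeta> = of_real (g / q * q) * (1 + \<zeta>)\<^sup>2 + of_real k * \<zeta>"
    using z q by (simp add: distrib_right)
  also have "\<dots> = of_real (g / q) * (of_real q * (1 + \<zeta>)\<^sup>2 + (1 - of_real q)\<^sup>2 * \<zeta>)"
    unfolding k by (simp add: distrib_left mult.assoc del: times_divide_eq_left of_real_divide)
  also have "of_real q * (1 + \<zeta>)\<^sup>2 + (1 - of_real q)\<^sup>2 * \<zeta> = (\<zeta> + of_real q) * (1 + of_real q * \<zeta>)"
    by (simp add: power2_eq_square algebra_simps)
  finally show ?thesis .
qed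

lemma ln_shift:
  fixes v \<zeta> :: complex
  assumes z: "v * \<zeta> = of_real g * (1 + \<zeta>)\<^sup>2" and q: "0 < q" "q < 1" and k: "k = g / q * (1 - q)\<^sup>2"
    and \<zeta>: "\<zeta> \<noteq> 0" "norm \<zeta> \<le> 1" and nz: "v + of_real k \<noteq> 0"
  shows "ln (norm (v + of_real k)) = ln (g / q) + ln (norm (\<zeta> + of_real q)) + ln (norm (1 + of_real q * \<zeta>)) - ln (norm \<zeta>)"
    "\<zeta> + of_real q \<noteq> 0" "1 + of_real q * \<zeta> \<noteq> 0"
proof -
  have q0: "q \<noteq> 0" using q by simp
  note J = joukowski_shift[OF z q0 k]
  have "(v + of_real k) * \<zeta> \<noteq> 0" using nz \<zeta> by simp
  then show n: "\<zeta> + of_real q \<noteq> 0" "1 + of_real q * \<zeta> \<noteq> 0" unfolding J by auto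
  have gq: "0 < g / q" using g0 q by simp
  have "ln (norm (v + of_real k)) + ln (norm \<zeta>) = ln (norm ((v + of_real k) * \<zeta>))"
    unfolding norm_mult using nz \<zeta> by (subst ln_mult_pos) auto
  also have "\<dots> = ln (g / q) + (ln (norm (\<zeta> + of_real q)) + ln (norm (1 + of_real q * \<zeta>)))"
  proof -
    have l3: "ln (A * (B * C)) = ln A + (ln B + ln C)" if "0 < A" "0 < B" "0 < C" for A B C :: real
      using that by (simp add: ln_mult_pos)
    have "0 < norm (\<zeta> + of_real q)" "0 < norm (1 + of_real q * \<zeta>)" using n by (simp_all only: zero_less_norm_iff not_False_eq_True)
    from l3[OF gq this] show ?thesis unfolding J norm_mult norm_of_real abs_of_pos[OF gq] .
  qed
  finally show "ln (norm (v + of_real k)) = ln (g / q) + ln (norm (\<zeta> + of_real q)) + ln (norm (1 + of_real q * \<zeta>)) - ln (norm \<zeta>)" by simp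
qed

lemma mn_sq: "0 < m\<^sup>2" "0 < n\<^sup>2"
  using m0 n0 by simp_all

definition "K0 = (c1 - ln 2 - ln g) / 2 + a * (ln (1 + b\<^sup>2) - ln 2 - ln (g / n\<^sup>2)) - (1 / 2 + a) * ln e"
text \<open>The value of the potential u plus that of the two charges where \<zeta> has modulus n /
  m. The integral \<open>c1\<close> inside \<open>K0\<close> stays unevaluated, as only differences
  matter.\<close>

definition "c0 = K0 - (P - Q) * (ln m - ln n) / (4 * (m\<^sup>2 - n\<^sup>2))"

lemma poles: "cap_pole b = plane_to_sphere (\<i> * of_real b)" "cap_pole (- b) = plane_to_sphere (- \<i> * of_real b)"
  using plane_to_sphere_cap_pole[of b] plane_to_sphere_cap_pole[of "- b"] by simp_all

lemma obstacle_plane: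
  assumes x: "plane_to_sphere z \<noteq> cap_pole b" "plane_to_sphere z \<noteq> cap_pole (- b)"
    and \<zeta>: "\<zeta> \<noteq> 0" "norm \<zeta> \<le> 1" and z: "z\<^sup>2 * \<zeta> = of_real g * (1 + \<zeta>)\<^sup>2"
  defines "x \<equiv> plane_to_sphere z"
  shows "c0 \<le> u x + a * skern x (cap_pole b) + a * skern x (cap_pole (- b))"
    "norm \<zeta> = n / m \<Longrightarrow> u x + a * skern x (cap_pole b) + a * skern x (cap_pole (- b)) = c0"
proof -
  define r C where "r = norm \<zeta>" and "C = Re \<zeta> / r"
  have r: "0 < r" "r \<le> 1" using \<zeta> by (auto simp: r_def)
  have rC: "Re \<zeta> = r * C" using r by (simp add: C_def)
  have C: "\<bar>C\<bar> \<le> 1" using abs_Re_le_cmod[of \<zeta>] r by (simp add: C_def r_def[symmetric] abs_divide)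
  define E1 E2 E3 where "E1 = 1 + (m\<^sup>2 * r)\<^sup>2 + 2 * m\<^sup>2 * r * C" and "E2 = r\<^sup>2 + (n\<^sup>2)\<^sup>2 + 2 * n\<^sup>2 * r * C"
    and "E3 = e * r + m * n * (1 + r\<^sup>2 + 2 * r * C)"
  have e1: "(norm (1 + of_real (m\<^sup>2) * \<zeta>))\<^sup>2 = E1" and e2: "(norm (\<zeta> + of_real (n\<^sup>2)))\<^sup>2 = E2"
    unfolding norm_one_plus norm_plus rC E1_def E2_def r_def by simp_all
  have zb: "z \<noteq> \<i> * of_real b" "z \<noteq> - \<i> * of_real b" using x unfolding poles by auto
  have f: "z\<^sup>2 + of_real (b\<^sup>2) = (z - \<i> * of_real b) * (z - (- \<i> * of_real b))"
    by (simp add: power2_eq_square algebra_simps)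
  have "z\<^sup>2 + of_real (b\<^sup>2) \<noteq> 0" unfolding f mult_eq_0_iff right_minus_eq using zb by blast
  note l = ln_shift[OF z mn_sq(2) n2 b2_g(1) \<zeta> this]
  have E2: "0 < E2" unfolding e2[symmetric] using l(2) by simp
  note O = obstacle[OF r C, folded E1_def E2_def E3_def, OF E2]
  have e3: "e * (norm \<zeta> * (1 + (norm z)\<^sup>2)) = E3"
  proof -
    have "norm (z\<^sup>2 * \<zeta>) = norm (of_real g * (1 + \<zeta>)\<^sup>2)" by (simp only: z)
    then have "(norm z)\<^sup>2 * norm \<zeta> = g * (norm (1 + of_real 1 * \<zeta>))\<^sup>2" using g0 by (simp add: norm_mult norm_power)
    also have "\<dots> = g * (1 + r\<^sup>2 + 2 * r * C)" unfolding norm_one_plus rC by (simp add: r_def)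
    finally have "e * (norm \<zeta> * (1 + (norm z)\<^sup>2)) = e * r + e * g * (1 + r\<^sup>2 + 2 * r * C)"
      by (simp add: r_def algebra_simps)
    then show ?thesis unfolding eg E3_def .
  qed
  have le3: "ln (1 + (norm z)\<^sup>2) + ln (norm \<zeta>) = ln E3 - ln e"
  proof -
    have "0 < 1 + (norm z)\<^sup>2" by simp
    then show ?thesis unfolding e3[symmetric] using pos r by (simp add: ln_mult_pos r_def)
  qed
  have le1: "ln (norm (1 + of_real (m\<^sup>2) * \<zeta>)) = ln E1 / 2"
  proof -
    have "0 < norm (1 + of_real (m\<^sup>2) * \<zeta>)" using O(3) unfolding e1[symmetric] by (simp add: zero_less_power2)
    then show ?thesis unfolding e1[symmetric] by (simp add: ln_realpow)
  qed
  have le2: "ln (norm (\<zeta> + of_real (n\<^sup>2))) = ln E2 / 2"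
  proof -
    have "0 < norm (\<zeta> + of_real (n\<^sup>2))" using l(2) by (simp only: zero_less_norm_iff not_False_eq_True)
    then show ?thesis unfolding e2[symmetric] by (simp add: ln_realpow)
  qed
  have nb: "(norm (\<i> * of_real b :: complex))\<^sup>2 = b\<^sup>2" "(norm (- \<i> * of_real b :: complex))\<^sup>2 = b\<^sup>2"
    by (simp_all add: norm_mult)
  have "ln (norm (z - \<i> * of_real b)) + ln (norm (z - (- \<i> * of_real b))) = ln (norm (z\<^sup>2 + of_real (b\<^sup>2)))"
  proof -
    have "0 < norm (z - \<i> * of_real b)" "0 < norm (z - (- \<i> * of_real b))" using zb
      by (simp_all only: zero_less_norm_iff right_minus_eq not_False_eq_True)
    then show ?thesis unfolding f norm_mult by (simp only: ln_mult_pos)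
  qed
  then have S: "skern x (cap_pole b) + skern x (cap_pole (- b)) = ln (1 + (norm z)\<^sup>2) + ln (1 + b\<^sup>2) - ln 2 -
      (ln (g / n\<^sup>2) + ln E2 / 2 + ln (norm (1 + of_real (n\<^sup>2) * \<zeta>)) - ln (norm \<zeta>))"
    unfolding x_def poles skern_plane[OF zb(1)] skern_plane[OF zb(2)] nb l(1) le2 by simp
  have d: "0 < m\<^sup>2 - n\<^sup>2" using nm2 by simp
  have ad: "(1 + a) / 2 = P / (4 * (m\<^sup>2 - n\<^sup>2))" "a / 2 = Q / (4 * (m\<^sup>2 - n\<^sup>2))" "1 / 2 + a = (P + Q) / (4 * (m\<^sup>2 - n\<^sup>2))"
  proof -
    show 1: "(1 + a) / 2 = P / (4 * (m\<^sup>2 - n\<^sup>2))" and 2: "a / 2 = Q / (4 * (m\<^sup>2 - n\<^sup>2))"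
      unfolding a1 unfolding a_def by simp_all
    have "1 / 2 + a = (1 + a) / 2 + a / 2" by (simp add: field_simps)
    then show "1 / 2 + a = (P + Q) / (4 * (m\<^sup>2 - n\<^sup>2))" unfolding 1 2 by (simp only: add_divide_distrib)
  qed
  have "u x + a * skern x (cap_pole b) + a * skern x (cap_pole (- b)) = u x + a * (skern x (cap_pole b) + skern x (cap_pole (- b)))"
    by (simp add: algebra_simps)
  also have "\<dots> = K0 + (1 / 2 + a) * (ln (1 + (norm z)\<^sup>2) + ln (norm \<zeta>) + ln e) - (1 + a) / 2 * ln E1 - a / 2 * ln E2"
    unfolding S unfolding x_def potential_plane(3)[OF \<zeta> z] le1 K0_def by (simp add: field_simps)
  also have "\<dots> = c0 + ((P + Q) * ln E3 + (P - Q) * (ln m - ln n) - P * ln E1 - Q * ln E2) / (4 * (m\<^sup>2 - n\<^sup>2))"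
  proof -
    define D where "D = 4 * (m\<^sup>2 - n\<^sup>2)"
    show ?thesis unfolding le3 c0_def ad D_def[symmetric] by (simp add: add_divide_distrib diff_divide_distrib distrib_right)
  qed
  finally have W: "u x + a * skern x (cap_pole b) + a * skern x (cap_pole (- b)) =
      c0 + ((P + Q) * ln E3 + (P - Q) * (ln m - ln n) - P * ln E1 - Q * ln E2) / (4 * (m\<^sup>2 - n\<^sup>2))" .
  show "c0 \<le> u x + a * skern x (cap_pole b) + a * skern x (cap_pole (- b))"
    unfolding W using O(1) d by simp
  show "u x + a * skern x (cap_pole b) + a * skern x (cap_pole (- b)) = c0" if "norm \<zeta> = n / m"
    unfolding W using O(2) that by (simp add: r_def)
qed

text \<open>Twice the excess of the Frostman sum on the line over its value F0 on the support, as a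
  function of the coordinate.\<close>

definition psi :: "complex \<Rightarrow> real" where
  "psi \<zeta> = (1 + a) * (ln (norm (\<zeta> + of_real (m\<^sup>2))) - ln (norm (1 + of_real (m\<^sup>2) * \<zeta>)))
  - a * (ln (norm (\<zeta> + of_real (n\<^sup>2))) - ln (norm (1 + of_real (n\<^sup>2) * \<zeta>)))"

lemma psi_unit: "norm \<zeta> = 1 \<Longrightarrow> psi \<zeta> = 0"
proof -
  assume "norm \<zeta> = 1"
  then have E: "(norm (\<zeta> + of_real q))\<^sup>2 = (norm (1 + of_real q * \<zeta>))\<^sup>2" for q unfolding norm_one_plus norm_plus by simp
  have E': "norm (\<zeta> + of_real q) = norm (1 + of_real q * \<zeta>)" for q
    by (rule power2_eq_imp_eq[OF E norm_ge_zero norm_ge_zero])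
  show ?thesis unfolding psi_def E' by simp
qed

text \<open>The derivative in v is 1 / v times the expression of \<open>weight_identity\<close> with
  X = (v + 1 / v) / 2 \<ge> 1, hence nonpositive, and the function vanishes at v = 1.\<close>

lemma psi_real:
  assumes v: "0 < v" "v \<le> 1"
  shows "0 \<le> psi (of_real v)" "psi (of_real v) \<le> a * (ln 2 - ln (n\<^sup>2))"
proof -
  define f where "f v = (1 + a) * (ln (v + m\<^sup>2) - ln (1 + m\<^sup>2 * v)) - a * (ln (v + n\<^sup>2) - ln (1 + n\<^sup>2 * v))" for v
  have p: "0 < v + m\<^sup>2" "0 < 1 + m\<^sup>2 * v" "0 < v + n\<^sup>2" "0 < 1 + n\<^sup>2 * v" if "0 < v" for v
    using that by (auto intro!: add_pos_nonneg)
  have pf: "psi (of_real v) = f v"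
  proof -
    have "norm (of_real v + of_real q :: complex) = v + q" "norm (1 + of_real q * of_real v :: complex) = 1 + q * v" if "0 < q" for q
    proof -
      have "norm (of_real (v + q) :: complex) = v + q" "norm (of_real (1 + q * v) :: complex) = 1 + q * v"
        unfolding norm_of_real using v that by (simp_all add: add_pos_pos)
      then show "norm (of_real v + of_real q :: complex) = v + q" "norm (1 + of_real q * of_real v :: complex) = 1 + q * v" by simp_all
    qed
    from this[OF mn_sq(1)] this[OF mn_sq(2)] show ?thesis unfolding psi_def f_def by (simp only:)
  qed
  have "f 1 \<le> f v"
  proof (rule DERIV_nonpos_imp_nonincreasing[OF v(2)])
    fix y assume "v \<le> y" "y \<le> 1"
    then have y: "0 < y" "y \<le> 1" using v by auto
    \<comment> \<open>The hyperbolic counterpart of the cosine: it satisfies 2 * y * X = 1 + y^2, so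
      the denominators of the Poisson kernels reappear.\<close>
    define X where "X = (1 + y\<^sup>2) / (2 * y)"
    have X: "1 \<le> X"
    proof -
      have "0 \<le> (1 - y)\<^sup>2" by simp
      then have "2 * y \<le> 1 + y\<^sup>2" by (simp add: power2_diff)
      then show ?thesis using y by (simp add: X_def)
    qed
    have D: "(y + q) * (1 + q * y) = y * (1 + q\<^sup>2 + 2 * q * X)" for q
    proof -
      have yX: "2 * y * X = 1 + y\<^sup>2" using y by (simp add: X_def)
      have "y * (1 + q\<^sup>2 + 2 * q * X) = y * (1 + q\<^sup>2) + q * (2 * y * X)" by (simp add: algebra_simps)
      then show ?thesis unfolding yX by (simp add: power2_eq_square algebra_simps)
    qed
    have Dp: "0 < 1 + q\<^sup>2 + 2 * q * X" if "0 < q" for q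
      using that X by (intro add_pos_pos) (auto intro: add_pos_nonneg)
    have d: "((\<lambda>v. ln (v + q) - ln (1 + q * v)) has_real_derivative (1 - q\<^sup>2) / (1 + q\<^sup>2 + 2 * q * X) / y) (at y)" if q: "0 < q" for q
    proof -
      have pq: "0 < y + q" "0 < 1 + q * y" using y q by (auto intro: add_pos_pos)
      have "((\<lambda>v. ln (v + q) - ln (1 + q * v)) has_real_derivative 1 / (y + q) * 1 - 1 / (1 + q * y) * q) (at y)"
        by (intro DERIV_diff DERIV_chain2[OF DERIV_ln_divide] pq) (auto intro!: derivative_eq_intros)
      moreover have "1 / (y + q) * 1 - 1 / (1 + q * y) * q = ((1 + q * y) - q * (y + q)) / ((y + q) * (1 + q * y))"
        using pq by (simp add: diff_divide_distrib)
      moreover have "(1 + q * y) - q * (y + q) = 1 - q\<^sup>2" by (simp add: power2_eq_square algebra_simps)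
      ultimately show ?thesis unfolding D by (simp add: mult.commute)
    qed
    define G where "G q = (1 - q\<^sup>2) / (1 + q\<^sup>2 + 2 * q * X)" for q
    have "(f has_real_derivative (1 + a) * (G (m\<^sup>2) / y) - a * (G (n\<^sup>2) / y)) (at y)"
      unfolding f_def[abs_def] G_def by (intro DERIV_diff DERIV_cmult d mn_sq)
    moreover have "(1 + a) * (G (m\<^sup>2) / y) - a * (G (n\<^sup>2) / y) \<le> 0"
    proof -
      have "(1 + a) * G (m\<^sup>2) - a * G (n\<^sup>2) = e * (1 - m\<^sup>2 * n\<^sup>2) * (1 - X) / ((1 + (m\<^sup>2)\<^sup>2 + 2 * m\<^sup>2 * X) * (1 + (n\<^sup>2)\<^sup>2 + 2 * n\<^sup>2 * X))"
        unfolding G_def by (rule weight_identity) (use Dp[OF mn_sq(1)] Dp[OF mn_sq(2)] in auto)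
      also have "\<dots> \<le> 0"
        using pos X Dp[OF mn_sq(1)] Dp[OF mn_sq(2)] by (intro divide_nonpos_pos mult_nonneg_nonpos mult_pos_pos) auto
      finally have "((1 + a) * G (m\<^sup>2) - a * G (n\<^sup>2)) / y \<le> 0" using y by (intro divide_nonpos_pos)
      then show ?thesis by (simp add: diff_divide_distrib)
    qed
    ultimately show "\<exists>d. (f has_real_derivative d) (at y) \<and> d \<le> 0" by blast
  qed
  moreover have "f 1 = 0" by (simp add: f_def add.commute)
  ultimately show "0 \<le> psi (of_real v)" unfolding pf by simp
  have "v + m\<^sup>2 \<le> 1 + m\<^sup>2 * v"
  proof -
    have "0 \<le> (1 - v) * (1 - m\<^sup>2)" using v m2 by (intro mult_nonneg_nonneg) auto
    then show ?thesis by (simp add: algebra_simps)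
  qed
  then have "ln (v + m\<^sup>2) \<le> ln (1 + m\<^sup>2 * v)" using p[OF v(1)] by (intro ln_mono) auto
  then have 1: "(1 + a) * (ln (v + m\<^sup>2) - ln (1 + m\<^sup>2 * v)) \<le> 0" using a0 by (intro mult_nonneg_nonpos) auto
  have "n\<^sup>2 * v \<le> 1 * 1" using n2 v by (intro mult_mono) auto
  then have "ln (1 + n\<^sup>2 * v) \<le> ln 2" using p[OF v(1)] by (intro ln_mono) auto
  moreover have "ln (n\<^sup>2) \<le> ln (v + n\<^sup>2)" using v mn_sq by (intro ln_mono) auto
  ultimately have "a * (ln (1 + n\<^sup>2 * v) - ln (v + n\<^sup>2)) \<le> a * (ln 2 - ln (n\<^sup>2))" using a0 by (intro mult_left_mono) auto
  moreover have "f v = (1 + a) * (ln (v + m\<^sup>2) - ln (1 + m\<^sup>2 * v)) + a * (ln (1 + n\<^sup>2 * v) - ln (v + n\<^sup>2))"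
    by (simp add: f_def algebra_simps)
  ultimately show "psi (of_real v) \<le> a * (ln 2 - ln (n\<^sup>2))" unfolding pf using 1 by simp
qed

text \<open>For a real point, \<zeta> + 1 / \<zeta> is real, so \<zeta> is unimodular or real. In
  the second case it is positive because x^2 is, and x lies beyond the end points of the
  support.\<close>

lemma joukowski_real:
  fixes \<zeta> :: complex
  assumes \<zeta>: "\<zeta> \<noteq> 0" "norm \<zeta> \<le> 1" and z: "(of_real x)\<^sup>2 * \<zeta> = of_real g * (1 + \<zeta>)\<^sup>2"
  shows "norm \<zeta> = 1 \<or> (\<exists>v. 0 < v \<and> v < 1 \<and> \<zeta> = of_real v \<and> 4 * g < x\<^sup>2)"
proof (cases "norm \<zeta> = 1")
  case False
  define r where "r = norm \<zeta>"
  have r: "0 < r" "r < 1" using \<zeta> False by (auto simp: r_def)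
  have zz: "\<zeta> * cnj \<zeta> = of_real (r\<^sup>2)" unfolding r_def by (rule complex_norm_square[symmetric])
  have "(of_real x)\<^sup>2 * \<zeta> * cnj \<zeta> = of_real g * (1 + \<zeta>)\<^sup>2 * cnj \<zeta>" by (simp only: z)
  also have "\<dots> = of_real g * (cnj \<zeta> + 2 * (\<zeta> * cnj \<zeta>) + \<zeta> * (\<zeta> * cnj \<zeta>))" by (simp add: power2_eq_square algebra_simps)
  finally have "of_real (x\<^sup>2 * r\<^sup>2) = of_real g * (cnj \<zeta> + 2 * of_real (r\<^sup>2) + \<zeta> * of_real (r\<^sup>2))"
    unfolding zz mult.assoc by simp
  then have "Im (of_real (x\<^sup>2 * r\<^sup>2)) = Im (of_real g * (cnj \<zeta> + 2 * of_real (r\<^sup>2) + \<zeta> * of_real (r\<^sup>2)))" by (simp only:)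
  then have "0 = g * (Im \<zeta> * (r\<^sup>2 - 1))" by (simp add: algebra_simps)
  moreover have "r\<^sup>2 < 1" using r by (simp add: abs_square_less_1)
  ultimately have "Im \<zeta> = 0" using g0 by simp
  then have "\<zeta> = of_real (Re \<zeta>)" by (simp add: complex_eq_iff)
  then obtain v where v: "\<zeta> = of_real v" by blast
  have "\<bar>v\<bar> < 1" using r(2) unfolding r_def v norm_of_real .
  have "of_real (x\<^sup>2 * v) = (of_real (g * (1 + v)\<^sup>2) :: complex)" using z unfolding v by simp
  then have eq: "x\<^sup>2 * v = g * (1 + v)\<^sup>2" by (simp only: of_real_eq_iff)
  have "0 < g * (1 + v)\<^sup>2" using g0 \<open>\<bar>v\<bar> < 1\<close> by simp
  then have "0 < x\<^sup>2 * v" unfolding eq .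
  then have v0: "0 < v" by (simp add: zero_less_mult_iff)
  have "0 < g * (1 - v)\<^sup>2" using g0 \<open>\<bar>v\<bar> < 1\<close> by simp
  then have "4 * g * v < x\<^sup>2 * v" unfolding eq by (simp add: power2_eq_square algebra_simps)
  then have "4 * g < x\<^sup>2" using v0 by simp
  then show ?thesis using v v0 \<open>\<bar>v\<bar> < 1\<close> by auto
qed simp

definition "F0 = (c1 - ln 2 - ln g) / 2 + (1 + a) / 2 * ln (g / m\<^sup>2) - a / 2 * ln (g / n\<^sup>2)"

text \<open>The sum equals F0 + psi \<zeta> / 2. The upper bound yields the boundedness of u on the
  line that \<open>line_equilibrium_\<mu>\<close> asks for.\<close>

lemma frostman_line:
  "F0 \<le> u (line_to_sphere x) + (ext_field a b x - ln (1 + x\<^sup>2) / 2)"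
  "u (line_to_sphere x) + (ext_field a b x - ln (1 + x\<^sup>2) / 2) \<le> F0 + a * (ln 2 - ln (n\<^sup>2)) / 2"
  "x\<^sup>2 \<le> 4 * g \<Longrightarrow> u (line_to_sphere x) + (ext_field a b x - ln (1 + x\<^sup>2) / 2) = F0"
proof -
  obtain \<zeta> :: complex where \<zeta>: "\<zeta> \<noteq> 0" "norm \<zeta> \<le> 1" and z: "(of_real x)\<^sup>2 * \<zeta> = of_real g * (1 + \<zeta>)\<^sup>2"
    by (rule joukowski_inverse[OF g0])
  have p: "0 < x\<^sup>2 + b\<^sup>2" "0 < x\<^sup>2 + 1 / b\<^sup>2" using b0 by (auto intro: add_nonneg_pos)
  have nx: "(of_real x)\<^sup>2 + of_real k = (of_real (x\<^sup>2 + k) :: complex)" for k by simp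
  have nz: "(of_real x)\<^sup>2 + of_real (b\<^sup>2) \<noteq> (0 :: complex)" "(of_real x)\<^sup>2 + of_real (1 / b\<^sup>2) \<noteq> (0 :: complex)"
    unfolding nx of_real_eq_0_iff using p by auto
  note l1 = ln_shift(1)[OF z mn_sq(1) m2 b2_g(2) \<zeta> nz(2)] and l2 = ln_shift(1)[OF z mn_sq(2) n2 b2_g(1) \<zeta> nz(1)]
  note l1 = l1[unfolded nx norm_of_real abs_of_pos[OF p(2)]] and l2 = l2[unfolded nx norm_of_real abs_of_pos[OF p(1)]]
  have nx2: "(norm (of_real x :: complex))\<^sup>2 = x\<^sup>2" by simp
  have eq: "u (line_to_sphere x) + (ext_field a b x - ln (1 + x\<^sup>2) / 2) = F0 + psi \<zeta> / 2"
    unfolding plane_to_sphere_of_real[symmetric] potential_plane(3)[OF \<zeta> z] nx2 ext_field_def l1 l2 F0_def psi_def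
    by (simp add: field_simps)
  have B: "0 \<le> a * (ln 2 - ln (n\<^sup>2))" using a0 n2 mn_sq by (intro mult_nonneg_nonneg) (auto intro!: ln_mono)
  from joukowski_real[OF \<zeta> z] have ps: "0 \<le> psi \<zeta> \<and> psi \<zeta> \<le> a * (ln 2 - ln (n\<^sup>2)) \<and> (x\<^sup>2 \<le> 4 * g \<longrightarrow> psi \<zeta> = 0)"
  proof (elim disjE exE conjE)
    assume "norm \<zeta> = 1"
    then show ?thesis using psi_unit B by simp
  next
    fix v assume "0 < v" "v < 1" "\<zeta> = of_real v" "4 * g < x\<^sup>2"
    then show ?thesis using psi_real[of v] by simp
  qed
  then show "F0 \<le> u (line_to_sphere x) + (ext_field a b x - ln (1 + x\<^sup>2) / 2)"
    "u (line_to_sphere x) + (ext_field a b x - ln (1 + x\<^sup>2) / 2) \<le> F0 + a * (ln 2 - ln (n\<^sup>2)) / 2"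
    "x\<^sup>2 \<le> 4 * g \<Longrightarrow> u (line_to_sphere x) + (ext_field a b x - ln (1 + x\<^sup>2) / 2) = F0"
    unfolding eq by auto
qed

lemma s_bound: "(s t)\<^sup>2 \<le> 4 * g" "\<bar>s t\<bar> \<le> 2 * sqrt g"
proof -
  have "g * (2 + 2 * cos t) \<le> g * 4" using g0 by (intro mult_left_mono) auto
  then show "(s t)\<^sup>2 \<le> 4 * g" unfolding s_square by simp
  have "2 * sqrt g * \<bar>cos (t / 2)\<bar> \<le> 2 * sqrt g * 1" using g0 by (intro mult_left_mono) auto
  then show "\<bar>s t\<bar> \<le> 2 * sqrt g" unfolding s_def abs_mult using g0 by simp
qed

lemma line_equilibrium: "line_equilibrium (ext_field a b) = cp.\<mu>"
proof -
  define C where "C = (1 + a) / 2 * \<bar>ln (1 / b\<^sup>2)\<bar> + a / 2 * \<bar>ln (b\<^sup>2)\<bar>"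
  show ?thesis
  proof (rule cp.line_equilibrium_\<mu>[where F = F0])
    show V: "\<bar>ext_field a b x - ln (1 + x\<^sup>2) / 2\<bar> \<le> C" for x
      unfolding C_def by (rule ext_field_bound[OF b0 a0])
    show "\<bar>u (line_to_sphere x)\<bar> \<le> \<bar>F0\<bar> + C + \<bar>a * (ln 2 - ln (n\<^sup>2)) / 2\<bar>" for x
      using frostman_line(1,2)[of x] V[of x] by linarith
    show "F0 \<le> u (line_to_sphere x) + (ext_field a b x - ln (1 + x\<^sup>2) / 2)" for x by (rule frostman_line)
    show "AE t in circ. u (line_to_sphere (s t)) + (ext_field a b (s t) - ln (1 + (s t)\<^sup>2) / 2) = F0"
      by (rule AE_I2, rule frostman_line(3), rule s_bound)
  qed measurable
qed

end

section \<open>The ellipse as a region on the sphere\<close>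

context ellipse
begin

text \<open>The homogenised equation of the ellipse with - (1 - x $ 3)^2 multiplied out, bracketed
  as sums and products of coordinates so that the rules for \<open>trig1\<close> and
  \<open>trig2\<close> match it syntactically.\<close>

definition "q0 x = e / (m + n)\<^sup>2 * (x $ 1 * x $ 1) + (e / (m - n)\<^sup>2 * (x $ 2 * x $ 2) + ((- 1) * (x $ 3 * x $ 3) + (2 * x $ 3 + (- 1))))"
  for x :: "real ^ 3"
text \<open>Height below 1 - 1 / R means squared norm below 2 * R - 1 in the plane, which exceeds
  the squared major semi-axis (m + n)^2 / e. The cut thus removes the north pole and nothing of the
  ellipse.\<close>

definition "R = 1 + (m + n)\<^sup>2 / e"

text \<open>The quadratic cone \<open>q0\<close> over the ellipse in the plane also vanishes at the north pole; the maximum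
  removes this point from the droplet.\<close>

definition "q x = max (q0 x) (x $ 3 + (1 / R - 1))" for x :: "real ^ 3"

definition "ell z = e * (Re z)\<^sup>2 / (m + n)\<^sup>2 + e * (Im z)\<^sup>2 / (m - n)\<^sup>2 - 1"

lemma R: "1 < R" and mn_ne: "0 < (m + n)\<^sup>2" "0 < (m - n)\<^sup>2"
proof -
  show "0 < (m + n)\<^sup>2" "0 < (m - n)\<^sup>2" using n0 m0 nm by auto
  then show "1 < R" using pos by (simp add: R_def)
qed

lemma q0_plane: "q0 (plane_to_sphere z) = 4 / (1 + (norm z)\<^sup>2)\<^sup>2 * ell z"
proof -
  define Z where "Z = 1 + (norm z)\<^sup>2"
  have Z: "Z \<noteq> 0" by (simp add: Z_def)
  have n3: "((norm z)\<^sup>2 - 1) / Z = 1 - 2 / Z"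
  proof -
    have zz: "(norm z)\<^sup>2 - 1 = Z - 2" by (simp add: Z_def)
    show ?thesis unfolding zz using Z by (simp add: diff_divide_distrib)
  qed
  define \<alpha> \<beta> where "\<alpha> = e / (m + n)\<^sup>2" and "\<beta> = e / (m - n)\<^sup>2"
  have "q0 (plane_to_sphere z) = \<alpha> * (2 * Re z / Z * (2 * Re z / Z)) + (\<beta> * (2 * Im z / Z * (2 * Im z / Z)) - (2 / Z)\<^sup>2)"
    unfolding q0_def plane_to_sphere_def vec3_nth Z_def[symmetric] n3 \<alpha>_def[symmetric] \<beta>_def[symmetric]
    by (simp add: power2_eq_square algebra_simps)
  also have "\<dots> = 4 / Z\<^sup>2 * (\<alpha> * (Re z)\<^sup>2 + \<beta> * (Im z)\<^sup>2 - 1)"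
    by (simp add: power2_eq_square distrib_left right_diff_distrib mult.left_commute)
  also have "\<alpha> * (Re z)\<^sup>2 + \<beta> * (Im z)\<^sup>2 - 1 = ell z" by (simp add: \<alpha>_def \<beta>_def ell_def)
  finally show ?thesis unfolding Z_def .
qed

lemma ell_bound: "ell z \<le> 0 \<Longrightarrow> (norm z)\<^sup>2 < 2 * R - 1"
proof -
  assume "ell z \<le> 0"
  moreover have "e * (Im z)\<^sup>2 / (m + n)\<^sup>2 \<le> e * (Im z)\<^sup>2 / (m - n)\<^sup>2"
    using pos mn_ne m0 n0 by (intro divide_left_mono mult_nonneg_nonneg mult_pos_pos) (auto simp: power2_eq_square algebra_simps)
  ultimately have "e * (norm z)\<^sup>2 / (m + n)\<^sup>2 \<le> 1"
    unfolding ell_def cmod_power2 by (simp add: distrib_left add_divide_distrib)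
  then have "e * (norm z)\<^sup>2 \<le> (m + n)\<^sup>2" using mn_ne by (simp add: divide_le_eq)
  then have "(norm z)\<^sup>2 \<le> (m + n)\<^sup>2 / e" using pos by (simp add: pos_le_divide_eq mult.commute)
  then show ?thesis using R by (simp add: R_def)
qed

lemma q_plane: "q (plane_to_sphere z) \<le> 0 \<longleftrightarrow> ell z \<le> 0" "q (plane_to_sphere z) < 0 \<longleftrightarrow> ell z < 0"
  "q (plane_to_sphere z) = 0 \<Longrightarrow> ell z = 0" "0 < ell z \<Longrightarrow> 0 < q (plane_to_sphere z)"
proof -
  have k: "0 < 4 / (1 + (norm z)\<^sup>2)\<^sup>2" by (simp add: add_pos_nonneg zero_less_power)
  have c: "plane_to_sphere z $ 3 + (1 / R - 1) < 0" if "ell z \<le> 0"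
  proof -
    have "1 / R < 2 / (1 + (norm z)\<^sup>2)" using ell_bound[OF that] R by (simp add: divide_less_eq pos_less_divide_eq add_pos_nonneg)
    then show ?thesis using plane_to_sphere_nth3[of z] by simp
  qed
  have s: "q0 (plane_to_sphere z) \<le> 0 \<longleftrightarrow> ell z \<le> 0" "q0 (plane_to_sphere z) < 0 \<longleftrightarrow> ell z < 0"
    "q0 (plane_to_sphere z) = 0 \<longleftrightarrow> ell z = 0"
  proof -
    have "(k * E \<le> 0 \<longleftrightarrow> E \<le> 0) \<and> (k * E < 0 \<longleftrightarrow> E < 0) \<and> (k * E = 0 \<longleftrightarrow> E = 0)" if "0 < k" for k E :: real
      using that by (auto simp: mult_le_0_iff mult_less_0_iff)
    from this[OF k, of "ell z"] show "q0 (plane_to_sphere z) \<le> 0 \<longleftrightarrow> ell z \<le> 0" "q0 (plane_to_sphere z) < 0 \<longleftrightarrow> ell z < 0"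
      "q0 (plane_to_sphere z) = 0 \<longleftrightarrow> ell z = 0" unfolding q0_plane by blast+
  qed
  show 1: "q (plane_to_sphere z) \<le> 0 \<longleftrightarrow> ell z \<le> 0" and "q (plane_to_sphere z) < 0 \<longleftrightarrow> ell z < 0"
    using c s by (auto simp: q_def)
  show "ell z = 0" if "q (plane_to_sphere z) = 0"
  proof -
    have "ell z \<le> 0" using that 1 by simp
    from c[OF this] that have "q0 (plane_to_sphere z) = 0" by (auto simp: q_def max_def split: if_splits)
    then show ?thesis using s by simp
  qed
  show "0 < ell z \<Longrightarrow> 0 < q (plane_to_sphere z)" using 1 by simp
qed

lemma q_north: "0 < q (vec3 0 0 1)"
  using R by (simp add: q_def less_max_iff_disj)

text \<open>Circles around 0 in the coordinate \<zeta> become ellipses in the plane. The factors m *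
  r - n and n * r - m show that the circles of radius n / m and m / n give the boundary, and only
  the former lies in the unit disc.\<close>

lemma ell_joukowski:
  assumes \<zeta>: "\<zeta> \<noteq> 0" and z: "z\<^sup>2 * \<zeta> = of_real g * (1 + \<zeta>)\<^sup>2"
  defines "r \<equiv> norm \<zeta>"
  shows "2 * r * ell z = (m * r - n) * (n * r - m) * ((1 + Re \<zeta> / r) / (m + n)\<^sup>2 + (1 - Re \<zeta> / r) / (m - n)\<^sup>2)"
proof -
  define C where "C = Re \<zeta> / r"
  have r: "0 < r" using \<zeta> by (simp add: r_def)
  have rC: "Re \<zeta> = r * C" using r by (simp add: C_def)
  have zz: "\<zeta> * cnj \<zeta> = of_real (r\<^sup>2)" unfolding r_def by (rule complex_norm_square[symmetric])
  have "norm (z\<^sup>2 * \<zeta>) = norm (of_real g * (1 + \<zeta>)\<^sup>2)" by (simp only: z)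
  then have "(norm z)\<^sup>2 * r = g * (norm (1 + of_real 1 * \<zeta>))\<^sup>2" using g0 by (simp add: norm_mult norm_power r_def)
  also have "\<dots> = g * (1 + r\<^sup>2 + 2 * r * C)" unfolding norm_one_plus rC by (simp add: r_def)
  finally have N: "((Re z)\<^sup>2 + (Im z)\<^sup>2) * r = g * (1 + r\<^sup>2 + 2 * r * C)" unfolding cmod_power2 .
  have "z\<^sup>2 * (\<zeta> * cnj \<zeta>) = of_real g * (1 + \<zeta>)\<^sup>2 * cnj \<zeta>" unfolding mult.assoc[symmetric] z ..
  also have "\<dots> = of_real g * (cnj \<zeta> + 2 * (\<zeta> * cnj \<zeta>) + \<zeta> * (\<zeta> * cnj \<zeta>))" by (simp add: power2_eq_square algebra_simps)
  finally have "Re (z\<^sup>2 * of_real (r\<^sup>2)) = Re (of_real g * (cnj \<zeta> + 2 * of_real (r\<^sup>2) + \<zeta> * of_real (r\<^sup>2)))"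
    unfolding zz by (simp only:)
  then have "((Re z)\<^sup>2 - (Im z)\<^sup>2) * r\<^sup>2 = g * (r * C + 2 * r\<^sup>2 + r * C * r\<^sup>2)"
    by (simp add: power2_eq_square rC)
  also have "\<dots> = g * (C + 2 * r + C * r\<^sup>2) * r" by (simp add: power2_eq_square algebra_simps)
  finally have "((Re z)\<^sup>2 - (Im z)\<^sup>2) * r * r = g * (C + 2 * r + C * r\<^sup>2) * r" by (simp add: power2_eq_square mult.assoc)
  then have D: "((Re z)\<^sup>2 - (Im z)\<^sup>2) * r = g * (C + 2 * r + C * r\<^sup>2)" using r by simp
  \<comment> \<open>\<open>N\<close> is the modulus of z^2 and \<open>D\<close> its real part; their
    sum and difference isolate the squares of the two coordinates.\<close>
  have X: "2 * r * (Re z)\<^sup>2 = g * ((1 + r)\<^sup>2 * (1 + C))" and Y: "2 * r * (Im z)\<^sup>2 = g * ((1 - r)\<^sup>2 * (1 - C))"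
    using N D by algebra+
  have "2 * r * ell z = e * (2 * r * (Re z)\<^sup>2) / (m + n)\<^sup>2 + e * (2 * r * (Im z)\<^sup>2) / (m - n)\<^sup>2 - 2 * r"
    by (simp add: ell_def algebra_simps)
  also have "\<dots> = (e * g) * ((1 + r)\<^sup>2 * (1 + C)) / (m + n)\<^sup>2 + (e * g) * ((1 - r)\<^sup>2 * (1 - C)) / (m - n)\<^sup>2 - 2 * r"
    unfolding X Y by (simp add: mult.assoc)
  also have "\<dots> = (m * n * (1 + r)\<^sup>2 - r * (m + n)\<^sup>2) * (1 + C) / (m + n)\<^sup>2 + (m * n * (1 - r)\<^sup>2 - r * (m - n)\<^sup>2) * (1 - C) / (m - n)\<^sup>2"
  proof -
    have c: "(A - r * E) * v / E = A * v / E - r * v" if "E \<noteq> 0" for A E v :: real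
      using that by (simp add: left_diff_distrib diff_divide_distrib)
    have nz: "(m + n)\<^sup>2 \<noteq> 0" "(m - n)\<^sup>2 \<noteq> 0" using mn_ne by auto
    show ?thesis unfolding c[OF nz(1)] c[OF nz(2)] eg by (simp add: algebra_simps)
  qed
  also have "m * n * (1 + r)\<^sup>2 - r * (m + n)\<^sup>2 = (m * r - n) * (n * r - m)" by (simp add: power2_eq_square algebra_simps)
  also have "m * n * (1 - r)\<^sup>2 - r * (m - n)\<^sup>2 = (m * r - n) * (n * r - m)" by (simp add: power2_eq_square algebra_simps)
  finally show ?thesis unfolding C_def by (simp add: distrib_left)
qed

lemma boundary_norm:
  assumes \<zeta>: "\<zeta> \<noteq> 0" "norm \<zeta> \<le> 1" and z: "z\<^sup>2 * \<zeta> = of_real g * (1 + \<zeta>)\<^sup>2" and "ell z = 0"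
  shows "norm \<zeta> = n / m"
proof -
  define r C where "r = norm \<zeta>" and "C = Re \<zeta> / r"
  have r: "0 < r" "r \<le> 1" using \<zeta> by (auto simp: r_def)
  have C: "\<bar>C\<bar> \<le> 1" using abs_Re_le_cmod[of \<zeta>] r by (simp add: C_def r_def[symmetric] abs_divide)
  have "0 < (1 + C) / (m + n)\<^sup>2 + (1 - C) / (m - n)\<^sup>2"
  proof (cases "C = 1")
    case True
    then show ?thesis using mn_ne by simp
  next
    case False
    then have "0 < 1 - C" "0 \<le> 1 + C" using C by auto
    then show ?thesis using mn_ne by (intro add_nonneg_pos divide_nonneg_pos divide_pos_pos) auto
  qed
  moreover have "n * r \<le> n * 1" using r n0 by (intro mult_left_mono) auto
  then have "n * r - m \<noteq> 0" using nm by simp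
  moreover have "0 = (m * r - n) * (n * r - m) * ((1 + C) / (m + n)\<^sup>2 + (1 - C) / (m - n)\<^sup>2)"
    using ell_joukowski[OF \<zeta>(1) z] assms(4) by (simp add: r_def C_def)
  ultimately have "m * r - n = 0" by auto
  then show ?thesis using m0 unfolding r_def by (simp add: eq_divide_eq mult.commute)
qed

text \<open>The squared semi-axes are (m + n)^2 / e and (m - n)^2 / e, with difference 4 * g. So the
  support of the measure is the segment between the foci, strictly inside the ellipse.\<close>

lemma q_line: "\<bar>v\<bar> \<le> 2 * sqrt g \<Longrightarrow> q (line_to_sphere v) < 0"
proof -
  assume "\<bar>v\<bar> \<le> 2 * sqrt g"
  then have "\<bar>v\<bar>\<^sup>2 \<le> (2 * sqrt g)\<^sup>2" by (intro power_mono) auto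
  then have "v\<^sup>2 \<le> 4 * g" using g0 by (simp add: power_mult_distrib)
  then have "e * v\<^sup>2 \<le> e * (4 * g)" using pos by (intro mult_left_mono) auto
  also have "\<dots> = 4 * (m * n)" using eg by (simp add: algebra_simps)
  also have "\<dots> < (m + n)\<^sup>2" using mn_ne(2) by (simp add: power2_eq_square algebra_simps)
  finally have "ell (of_real v) < 0" using mn_ne by (simp add: ell_def)
  then show ?thesis using q_plane(2)[of "of_real v"] by (simp add: plane_to_sphere_of_real)
qed

lemma q_poles: "0 < q (cap_pole b)" "0 < q (cap_pole (- b))"
proof -
  have 1: "(m - n) < 1 - n\<^sup>2"
  proof -
    have "n\<^sup>2 \<le> n * 1" unfolding power2_eq_square using n0 n1 by (intro mult_left_mono) auto
    then show ?thesis using m1 by simp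
  qed
  have "e * b\<^sup>2 = m / n * (1 - n\<^sup>2)\<^sup>2"
    using m2 n0 unfolding b2 e_def by (simp add: power2_eq_square)
  also have "\<dots> > 1 * (m - n)\<^sup>2"
  proof (rule mult_strict_mono)
    show "1 < m / n" using n0 nm by simp
    show "(m - n)\<^sup>2 < (1 - n\<^sup>2)\<^sup>2" using 1 nm by (intro power_strict_mono) auto
  qed (use n0 nm in auto)
  finally have "1 < e * b\<^sup>2 / (m - n)\<^sup>2" using mn_ne by simp
  then have "0 < ell (\<i> * of_real b)" "0 < ell (- \<i> * of_real b)" by (simp_all add: ell_def)
  then show "0 < q (cap_pole b)" "0 < q (cap_pole (- b))" unfolding poles by (auto intro: q_plane(4))
qed

lemma q_continuous: "continuous_on UNIV q"
  unfolding q_def q0_def by (intro continuous_intros)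

lemma q_orbit_zeros: "AE x in sphere_prob. finite {t \<in> {0..2 * pi}. q (rot i t x) = 0}"
proof -
  have t2: "trig2 (\<lambda>t. q0 (rot i t x))" "trig2 (\<lambda>t. rot i t x $ 3 + (1 / R - 1))" for i x
    unfolding q0_def by (intro trig2_add trig2_cmult trig1_mult trig1_rot trig2_const trig1_trig2)+
  have e1: "AE x in sphere_prob. x \<noteq> vec3 1 0 0 \<and> x \<noteq> vec3 (- 1) 0 0"
  proof -
    have "AE x in sphere_prob. x \<noteq> y" for y
      by (rule AE_I[where N = "{y}"]) (auto simp: sphere_prob_point)
    then show ?thesis by (simp add: eventually_conj_iff)
  qed
  have "AE x in sphere_prob. q0 x \<noteq> 0"
  proof (rule AE_nonzero_of_orbits[where i = 1])
    show "continuous_on UNIV q0" unfolding q0_def by (intro continuous_intros)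
    show "trig2 (\<lambda>t. q0 (rot 1 t x))" for x by (rule t2)
    show "AE x in sphere_prob. \<exists>t. q0 (rot 1 t x) \<noteq> 0"
      using AE_sphere_prob e1
    proof eventually_elim
      case (elim x)
      show ?case
      proof (rule ccontr)
        assume "\<not> ?thesis"
        \<comment> \<open>Opposite points of an orbit about the first axis share all squares, so q0
          differs there only by four times the height. The angles 0 and pi / 2 thus isolate the
          third and the second coordinate.\<close>
        then have z: "q0 (rot 1 0 x) = 0" "q0 (rot 1 pi x) = 0" "q0 (rot 1 (pi / 2) x) = 0" "q0 (rot 1 (- (pi / 2)) x) = 0" by blast+
        have "q0 (rot 1 0 x) - q0 (rot 1 pi x) = 4 * x $ 3"
          unfolding q0_def rot_defs by simp
        moreover have "q0 (rot 1 (pi / 2) x) - q0 (rot 1 (- (pi / 2)) x) = 4 * x $ 2"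
          unfolding q0_def rot_defs by simp
        ultimately have 23: "x $ 2 = 0" "x $ 3 = 0" unfolding z by simp_all
        then have "(x $ 1)\<^sup>2 = 1" using elim(1) unfolding mem_S2_iff by simp
        then have "x $ 1 = 1 \<or> x $ 1 = - 1" by (simp add: power2_eq_1_iff)
        then show False using elim(2) 23 by (auto simp: vec3_eq_iff)
      qed
    qed
  qed
  from AE_finite_orbit_zeros[OF t2(1) this]
  have 1: "AE x in sphere_prob. finite {t \<in> {0..2 * pi}. q0 (rot i t x) = 0}" .
  have "AE x in sphere_prob. x $ 3 + (1 / R - 1) \<noteq> 0"
  proof (rule AE_nonzero_of_orbits[where i = 1])
    show "continuous_on UNIV (\<lambda>x :: real ^ 3. x $ 3 + (1 / R - 1))" by (intro continuous_intros)
    show "trig2 (\<lambda>t. rot 1 t x $ 3 + (1 / R - 1))" for x by (rule t2)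
    show "AE x in sphere_prob. \<exists>t. rot 1 t x $ 3 + (1 / R - 1) \<noteq> 0"
    proof (rule AE_I2, rule ccontr)
      fix x assume "\<not> (\<exists>t. rot 1 t x $ 3 + (1 / R - 1) \<noteq> 0)"
      then have "rot 1 0 x $ 3 + (1 / R - 1) = 0" "rot 1 pi x $ 3 + (1 / R - 1) = 0" by blast+
      then have "x $ 3 + (1 / R - 1) = 0" "- x $ 3 + (1 / R - 1) = 0" by (simp_all add: rot_defs)
      then have "1 / R = 1" by simp
      then show False using R by simp
    qed
  qed
  from AE_finite_orbit_zeros[where q = "\<lambda>x. x $ 3 + (1 / R - 1)", OF t2(2) this]
  have 2: "AE x in sphere_prob. finite {t \<in> {0..2 * pi}. rot i t x $ 3 + (1 / R - 1) = 0}" .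
  show ?thesis
    using 1 2
  proof eventually_elim
    case (elim x)
    show ?case
      by (rule finite_subset[OF _ finite_UnI[OF elim]]) (auto simp: q_def max_def split: if_splits)
  qed
qed

text \<open>Contracting towards the centre of the ellipse moves boundary points strictly
  inside.\<close>

lemma q_dense:
  assumes x: "x \<in> S2" "q x \<le> 0" and U: "open U" "x \<in> U"
  shows "\<exists>y\<in>U \<inter> S2. q y < 0"
proof -
  have "x \<noteq> vec3 0 0 1" using x q_north by auto
  from sphere_cases[OF x(1) this] obtain z where z: "x = plane_to_sphere z" by blast
  have ell: "ell z \<le> 0" using x unfolding z q_plane by simp
  define f where "f \<epsilon> = plane_to_sphere (of_real (1 - \<epsilon>) * z)" for \<epsilon> :: real
  have fc: "isCont f 0" unfolding f_def plane_to_sphere_def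
    by (intro isCont_vec3 continuous_intros) (simp_all add: add_nonneg_eq_0_iff)
  have f0: "f 0 = x" by (simp add: f_def z)
  obtain d where d: "0 < d" "\<And>\<epsilon>. 0 < \<epsilon> \<Longrightarrow> \<epsilon> < d \<Longrightarrow> f \<epsilon> \<in> U" using path_enters_open[OF fc f0 U] by blast
  define \<epsilon> where "\<epsilon> = min (d / 2) (1 / 2)"
  have \<epsilon>: "0 < \<epsilon>" "\<epsilon> < d" "\<epsilon> < 1" using d by (auto simp: \<epsilon>_def)
  have "ell (of_real (1 - \<epsilon>) * z) = (1 - \<epsilon>)\<^sup>2 * (ell z + 1) - 1"
    by (simp add: ell_def power_mult_distrib distrib_left mult.left_commute)
  moreover have "(1 - \<epsilon>)\<^sup>2 * (ell z + 1) \<le> (1 - \<epsilon>)\<^sup>2 * 1" using ell by (intro mult_left_mono) auto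
  moreover have "(1 - \<epsilon>)\<^sup>2 < 1" using \<epsilon> by (simp add: abs_square_less_1)
  ultimately have "ell (of_real (1 - \<epsilon>) * z) < 0" by linarith
  then have "q (f \<epsilon>) < 0" unfolding f_def q_plane .
  then show ?thesis using d(2)[OF \<epsilon>(1,2)] plane_to_sphere_S2 unfolding f_def by blast
qed

lemma obstacle_sphere:
  assumes x: "x \<in> S2" "x \<noteq> vec3 0 0 1" "x \<noteq> cap_pole b" "x \<noteq> cap_pole (- b)"
  shows "c0 \<le> u x + a * skern x (cap_pole b) + a * skern x (cap_pole (- b))"
    "q x = 0 \<Longrightarrow> u x + a * skern x (cap_pole b) + a * skern x (cap_pole (- b)) = c0"
proof -
  obtain z where z: "x = plane_to_sphere z" by (rule sphere_cases[OF x(1,2)])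
  obtain \<zeta> where \<zeta>: "\<zeta> \<noteq> 0" "norm \<zeta> \<le> 1" "z\<^sup>2 * \<zeta> = of_real g * (1 + \<zeta>)\<^sup>2"
    by (rule joukowski_inverse[OF g0])
  note O = obstacle_plane[OF x(3,4)[unfolded z] \<zeta>]
  show "c0 \<le> u x + a * skern x (cap_pole b) + a * skern x (cap_pole (- b))" unfolding z by (rule O(1))
  show "u x + a * skern x (cap_pole b) + a * skern x (cap_pole (- b)) = c0" if "q x = 0"
    unfolding z by (rule O(2), rule boundary_norm[OF \<zeta>], rule q_plane(3)) (use that z in simp)
qed

text \<open>The inequality holds at the rotated points near the north pole and passes to the limit:
  the potential of the arc is continuous there because the arc is bounded in the plane, and the
  charges lie elsewhere.\<close>

lemma obstacle_north:
  defines "N \<equiv> vec3 0 0 1"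
  shows "c0 \<le> u N + a * skern N (cap_pole b) + a * skern N (cap_pole (- b))"
proof -
  interpret A: arc_potential w "\<lambda>t. line_to_sphere (s t)"
    by unfold_locales (rule w_continuous,
      rule continuous_on_compose2[OF continuous_on_line_to_sphere s_continuous], simp, rule line_to_sphere_S2)
  have N: "N \<in> S2" unfolding N_def mem_S2_iff vec3_nth by simp
  have u: "u x = A.pot x" for x by (simp add: u_def A.pot_def)
  have Np: "N \<bullet> cap_pole b < 1" "N \<bullet> cap_pole (- b) < 1"
    using b0 unfolding N_def inner_3 cap_pole_def vec3_nth by (simp_all add: divide_less_eq add_pos_nonneg)
  define \<eta> where "\<eta> = min (min (1 - N \<bullet> cap_pole b) (1 - N \<bullet> cap_pole (- b))) 1"
  have \<eta>: "0 < \<eta>" "\<eta> \<le> 1 - N \<bullet> cap_pole b" "\<eta> \<le> 1 - N \<bullet> cap_pole (- b)" "\<eta> \<le> 1"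
    using Np by (auto simp: \<eta>_def)
  have far: "2 / (1 + 4 * g) \<le> 1 - N \<bullet> line_to_sphere (s t)" for t
  proof -
    have l: "1 - N \<bullet> line_to_sphere (s t) = 2 / (1 + (s t)\<^sup>2)"
      unfolding N_def inner_3 vec3_nth line_to_sphere_nth by (simp add: field_simps)
    show ?thesis unfolding l using s_bound(1)[of t] g0 by (intro frac_le) auto
  qed
  define f where "f t = u (rot 1 t N) + a * kern 1 (cap_pole b) (rot 1 t N) + a * kern 1 (cap_pole (- b)) (rot 1 t N)" for t
  have "0 < 2 / (1 + 4 * g)" using g0 by simp
  from A.pot_C2[OF N this far] have i1: "isCont (\<lambda>t. A.pot (rot 1 t N)) 0"
    unfolding rot_C2_at_def by (blast intro: DERIV_isCont)
  have i2: "isCont (\<lambda>t. kern 1 p (rot 1 t N)) 0" if "N \<bullet> p < 1" for p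
    using kern_C2[OF that] unfolding rot_C2_at_def by (blast intro: DERIV_isCont)
  have "isCont f 0" unfolding f_def u
    by (intro isCont_add isCont_mult continuous_const i1 i2[OF Np(1)] i2[OF Np(2)])
  then have "(f \<longlongrightarrow> f 0) (at_right 0)" unfolding isCont_def by (rule filterlim_mono[OF _ order_refl at_le]) simp
  moreover have "eventually (\<lambda>t. c0 \<le> f t) (at_right 0)"
    unfolding eventually_at_right_field
  proof (intro exI[of _ \<eta>] conjI allI impI)
    show "0 < \<eta>" by (rule \<eta>)
    fix t :: real assume t: "0 < t" "t < \<eta>"
    have S: "rot 1 t N \<in> S2" using N by simp
    have "rot 1 t N \<bullet> cap_pole b < 1" "rot 1 t N \<bullet> cap_pole (- b) < 1"
      using rot_inner_lipschitz[OF N cap_pole_S2, of 1 t b] rot_inner_lipschitz[OF N cap_pole_S2, of 1 t "- b"] \<eta> t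
      by (auto simp: abs_le_iff)
    then have ne: "rot 1 t N \<noteq> cap_pole b" "rot 1 t N \<noteq> cap_pole (- b)"
      using cap_pole_S2[of b] cap_pole_S2[of "- b"] by (auto simp: norm_eq_1)
    have "sin t \<noteq> 0" using sin_gt_zero[of t] t \<eta> pi_gt3 by auto
    then have "rot 1 t N \<noteq> vec3 0 0 1" by (simp add: N_def rot_defs vec3_eq_iff)
    from obstacle_sphere(1)[OF S this ne] show "c0 \<le> f t" unfolding f_def kern_1 .
  qed
  ultimately have "c0 \<le> f 0" by (intro tendsto_lowerbound) auto
  then show ?thesis by (simp add: f_def kern_1)
qed

theorem motherbody_ellipse:
  "has_motherbody a (ext_field a b) (measure_support (sphere_equilibrium
    (add_measure (scale_measure (ennreal a) (return sphere_borel (cap_pole b)))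
      (scale_measure (ennreal a) (return sphere_borel (cap_pole (- b)))))))"
proof (rule arc_motherbody[where w = w and s = s and u = u and q = q and c = "2 * sqrt g" and ?c0.0 = c0])
  show "circle_pushforward w s u" by (rule cp.circle_pushforward_axioms)
  show "continuous_on UNIV w" "continuous_on UNIV s" "continuous_on UNIV q"
    by (rule w_continuous, rule s_continuous, rule q_continuous)
  show "\<bar>s t\<bar> \<le> 2 * sqrt g" for t by (rule s_bound)
  show "q (line_to_sphere v) < 0" if "\<bar>v\<bar> \<le> 2 * sqrt g" for v by (rule q_line[OF that])
  show "AE x in sphere_prob. finite {t \<in> {0..2 * pi}. q (rot i t x) = 0}" for i by (rule q_orbit_zeros)
  show "0 < a" "cap_pole b \<in> S2" "cap_pole (- b) \<in> S2" "0 < q (cap_pole b)" "0 < q (cap_pole (- b))"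
    by (rule a0, rule cap_pole_S2, rule cap_pole_S2, rule q_poles, rule q_poles)
  show "c0 \<le> u x + a * skern x (cap_pole b) + a * skern x (cap_pole (- b))"
    if "x \<in> S2" "x \<noteq> cap_pole b" "x \<noteq> cap_pole (- b)" for x
    using obstacle_sphere(1)[OF that(1) _ that(2,3)] obstacle_north by (cases "x = vec3 0 0 1") auto
  show "u x + a * skern x (cap_pole b) + a * skern x (cap_pole (- b)) = c0" if "x \<in> S2" "q x = 0" for x
    using that q_poles q_north by (intro obstacle_sphere(2)) auto
  show "\<exists>y\<in>U \<inter> S2. q y < 0" if "x \<in> S2" "q x \<le> 0" "open U" "x \<in> U" for x U by (rule q_dense[OF that])
  show "line_equilibrium (ext_field a b) = circle_pushforward.\<mu> w s" by (rule line_equilibrium)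
qed

end

text \<open>Put A1 = (1 + m^2) / (1 - m^2) and A2 = (1 + n^2) / (1 - n^2). The equations to be
  solved become a = A2 / (A1 - A2) and b^4 = (A1^2 - 1) / (A2^2 - 1). The former gives A1 = (1 + a)
  * L and A2 = a * L, the latter determines L; the condition on a and b makes T positive and A2
  greater than 1.\<close>

lemma ellipse_parameters:
  fixes a b :: real
  assumes b: "1 \<le> b" and a: "0 < a" and ab: "1 + a < a * b\<^sup>2"
  obtains m n where "ellipse m n" "ellipse.a m n = a" "ellipse.b m n = b"
proof -
  define T where "T = (a * b\<^sup>2)\<^sup>2 - (1 + a)\<^sup>2"
  have "(1 + a)\<^sup>2 < (a * b\<^sup>2)\<^sup>2" using ab a by (intro power_strict_mono) auto
  then have T: "0 < T" by (simp add: T_def)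
  have "a * 1 < a * b\<^sup>2" using ab by simp
  then have b1: "1 < b\<^sup>2" using a by (simp only: mult_less_cancel_left_pos)
  then have b4: "0 < (b\<^sup>2)\<^sup>2 - 1" using power_strict_mono[of 1 "b\<^sup>2" 2] by simp
  define L where "L = sqrt (((b\<^sup>2)\<^sup>2 - 1) / T)"
  have L0: "0 < L" using b4 T by (simp add: L_def)
  have L2: "L\<^sup>2 * T = (b\<^sup>2)\<^sup>2 - 1" using b4 T by (simp add: L_def)
  define A1 A2 where "A1 = (1 + a) * L" and "A2 = a * L"
  have S: "((1 + a)\<^sup>2 - a\<^sup>2) / T > 0" using a T by (simp add: power2_eq_square algebra_simps)
  have "A2\<^sup>2 * T = a\<^sup>2 * ((b\<^sup>2)\<^sup>2 - 1)" "A1\<^sup>2 * T = (1 + a)\<^sup>2 * ((b\<^sup>2)\<^sup>2 - 1)"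
    unfolding A1_def A2_def L2[symmetric] by (simp_all add: power_mult_distrib)
  then have "(A2\<^sup>2 - 1) * T = (1 + a)\<^sup>2 - a\<^sup>2" "(A1\<^sup>2 - 1) * T = (b\<^sup>2)\<^sup>2 * ((1 + a)\<^sup>2 - a\<^sup>2)"
    unfolding left_diff_distrib T_def power_mult_distrib by (simp_all add: algebra_simps)
  then have A: "A2\<^sup>2 - 1 = ((1 + a)\<^sup>2 - a\<^sup>2) / T" "A1\<^sup>2 - 1 = (b\<^sup>2)\<^sup>2 * (((1 + a)\<^sup>2 - a\<^sup>2) / T)"
    using T by (simp_all add: eq_divide_eq)
  have A0: "0 < A2" "A2 < A1" using a L0 by (auto simp: A1_def A2_def)
  have "1 < A2\<^sup>2" using A(1) S by simp
  then have A21: "1 < A2" using A0(1) by (intro power2_less_imp_less[of 1 A2]) auto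
  define q1 q2 where "q1 = (A1 - 1) / (A1 + 1)" and "q2 = (A2 - 1) / (A2 + 1)"
  have q: "0 < q2" "q2 < q1" "q1 < 1"
    using A0 A21 by (simp_all add: q1_def q2_def frac_less_eq divide_less_0_iff field_simps)
  define m n where "m = sqrt q1" and "n = sqrt q2"
  have mn2: "m\<^sup>2 = q1" "n\<^sup>2 = q2" using q by (simp_all add: m_def n_def)
  have E: "ellipse m n" by unfold_locales (use q in \<open>simp_all add: m_def n_def\<close>)
  interpret el: ellipse m n by (rule E)
  have d: "A1 + 1 \<noteq> 0" "A2 + 1 \<noteq> 0" using A0 A21 by auto
  have f: "1 - q1 = 2 / (A1 + 1)" "1 - q2 = 2 / (A2 + 1)" "1 + q2 = 2 * A2 / (A2 + 1)"
    using d by (simp_all add: q1_def q2_def field_simps)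
  have "q1 - q2 = (1 - q2) - (1 - q1)" by simp
  also have "\<dots> = 2 * (A1 - A2) / ((A1 + 1) * (A2 + 1))" unfolding f using d by (simp add: field_simps)
  finally have q12: "q1 - q2 = 2 * (A1 - A2) / ((A1 + 1) * (A2 + 1))" .
  have "ellipse.a m n = (4 * A2 / ((A1 + 1) * (A2 + 1))) / (4 * (A1 - A2) / ((A1 + 1) * (A2 + 1)))"
    unfolding el.a_def el.Q_def mn2 f q12 by simp
  also have "\<dots> = A2 / (A1 - A2)"
  proof -
    have c: "4 * X / K / (4 * Y / K) = X / Y" if "K \<noteq> 0" for X Y K :: real using that by simp
    show ?thesis by (rule c) (use d in simp)
  qed
  also have "A1 - A2 = L" by (simp add: A1_def A2_def algebra_simps)
  also have "A2 / L = a" using L0 by (simp add: A2_def)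
  finally have 1: "ellipse.a m n = a" .
  define v where "v = m * (1 - q2) / (n * (1 - q1))"
  have v0: "0 \<le> v" using q by (simp add: v_def m_def n_def)
  have "v\<^sup>2 = q1 * (1 - q2)\<^sup>2 / (q2 * (1 - q1)\<^sup>2)" by (simp add: v_def power_mult_distrib power_divide mn2)
  also have "\<dots> = (A1\<^sup>2 - 1) / (A2\<^sup>2 - 1)"
  proof -
    have g: "q1 * (A1 + 1) = A1 - 1" "q2 * (A2 + 1) = A2 - 1" using d by (simp_all add: q1_def q2_def)
    have sq: "A1\<^sup>2 - 1 = q1 * (A1 + 1)\<^sup>2" "A2\<^sup>2 - 1 = q2 * (A2 + 1)\<^sup>2"
      using g by algebra+
    show ?thesis unfolding sq f using d q by (simp add: power_divide)
  qed
  also have "\<dots> = (b\<^sup>2)\<^sup>2" unfolding A by (rule nonzero_mult_div_cancel_right) (use S in linarith)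
  finally have "v\<^sup>2 = (b\<^sup>2)\<^sup>2" .
  then have "v = b\<^sup>2" by (rule power2_eq_imp_eq[OF _ v0]) simp
  then have 2: "ellipse.b m n = b" unfolding el.b_def mn2 v_def[symmetric] using b by simp
  show thesis by (rule that[OF E 1 2])
qed

theorem theorem1p2:
  fixes a b :: real
    and p1 p2 :: "real ^ 3"
    and \<sigma> :: "(real ^ 3) measure"
    and D :: "(real ^ 3) set"
    and V :: "real \<Rightarrow> real"
  assumes "b \<ge> 1" and "a > 0"
    and "p1 \<in> S2" and "stereographic p1 = Some (\<i> * of_real b)"
    and "p2 \<in> S2" and "stereographic p2 = Some (- \<i> * of_real b)"
    and "\<sigma> = add_measure (scale_measure (ennreal a) (return sphere_borel p1))
                         (scale_measure (ennreal a) (return sphere_borel p2))"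
    and "D = measure_support (sphere_equilibrium \<sigma>)"
    and "V = (\<lambda>x. (1 + a) / 2 * ln (x\<^sup>2 + 1 / b\<^sup>2) - a / 2 * ln (x\<^sup>2 + b\<^sup>2))"
  shows "\<exists>\<sigma>'. sets \<sigma>' = sets sphere_borel \<and>
           measure_support \<sigma>' \<subseteq> {x \<in> S2. stereographic x \<in> insert None (Some ` \<real>)} \<and>
           emeasure \<sigma>' (space \<sigma>') = ennreal (1 / (2 * a)) \<and>
           (\<exists>m :: real.
              (\<forall>x \<in> S2 - D. log_potential (restrict_measure surface_measure D) x =
                 log_potential (scale_measure (ennreal (2 * a / (1 + 2 * a))) \<sigma>') x + ereal m) \<and>
              (\<forall>x \<in> D. log_potential (restrict_measure surface_measure D) x \<le>
                 log_potential (scale_measure (ennreal (2 * a / (1 + 2 * a))) \<sigma>') x + ereal m)) \<and>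
           \<sigma>' = scale_measure (ennreal (1 / (2 * a)))
                  (distr (line_equilibrium V) sphere_borel
                     (\<lambda>x. stereographic_inv (Some (complex_of_real x))))"
proof -
  have p: "p1 = cap_pole b" "p2 = cap_pole (- b)"
    using assms(3-6) by (auto intro!: stereographic_cap_pole)
  have V: "V = ext_field a b" unfolding assms(9) ext_field_def[abs_def] ..
  have "has_motherbody a (ext_field a b) D"
  \<comment> \<open>The caps of area a / (1 + 2 * a) around the two charges have disjoint interiors
    exactly in the first case.\<close>
  proof (cases "a * b\<^sup>2 \<le> 1 + a")
    case True
    show ?thesis unfolding assms(7,8) p by (rule caps_case[OF assms(1,2) True])
  next
    case False
    then have "1 + a < a * b\<^sup>2" by simp
    then obtain m n where E: "ellipse m n" "ellipse.a m n = a" "ellipse.b m n = b"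
      by (rule ellipse_parameters[OF assms(1,2)])
    show ?thesis unfolding assms(7,8) p by (rule ellipse.motherbody_ellipse[OF E(1), unfolded E(2,3)])
  qed
  then show ?thesis unfolding has_motherbody_def V .
qed

end
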